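(* Let $\Sigma$ be a compact connected oriented surface of genus $g\ge1$ with boundary a circle $C$. Let $A_1=\{[p\mu]:p\in\mathbb R\}$, $A_2=\{[q\lambda],[\mu/2+q\lambda]:q\in\mathbb R\}$ in $M$, $U_1=M\setminus A_2$, $U_2=M\setminus A_1$, $A=A_1\cup A_2$, and let $\Theta_A$ be the flat section of $L_M\to A$ equal to $1$ at the origin. The restriction of $(Z_k(\Sigma\times S^1),\ k\in\mathbb N^* )$ to $U_1$ is a Lagrangian state with associated data $(A_1\setminus A_2,\Theta_A,\sigma_1,g)$, where $$\sigma_1(p\mu)\equiv i\sqrt2\,\pi^g[\sin(2\pi p)]^{-2g+1}(dp)^{1/2},\qquad p\in\mathbb R.$$ The restriction of $(Z_k(\Sigma\times S^1),\ k\in\mathbb N^* )$ to $U_2$ is a Lagrangian state with associated data $(A_2\setminus A_1,\Theta_A,\sigma_2,3g-\tfrac32)$, where $$\sigma_2(q\lambda)\equiv e^{i\pi/4}\bigl(\tfrac\pi2\bigr)^{1/2}P_{g,0}(2q)\,(dq)^{1/2},\qquad q\in(0,1),$$ and $\sigma_2(q\lambda+\tfrac12\mu)=-\sigma_2(q\lambda)$. Here $\equiv$ means equality up to sign, and $(dp)^{1/2}$ (resp. $(dq)^{1/2}$) denotes a vector of $\delta$ whose square restricts to the one-form $dp$ on $A_1$ (resp. $dq$ on $A_2$), $p,q$ being the linear coordinates dual to $(\mu,\lambda)$.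
   Context: Quantization of the torus. $E=H_1(C\times S^1,\mathbb R)$ with $\omega=4\pi$ times the intersection product, $R=H_1(C\times S^1,\mathbb Z)$, $\mu=[C]$, $\lambda=[S^1]$, so $\omega(\mu,\lambda)=4\pi$. $L_E=E\times\mathbb C$ is the trivial Hermitian line bundle with connection $d+\frac1i\alpha$, $\alpha_x(y)=\frac12\omega(x,y)$. The Heisenberg group $E\times U(1)$, with product $(x,u).(y,v)=(x+y,uve^{i\omega(x,y)/2})$, acts on $L_E$ by the same formula. $M=E/R$, $L_M=L_E/(R\times\{1\})$, with induced symplectic form, metric and connection. For $x\in\frac1{2k}R$ the action of $(x,1)$ on $L_E^k$ descends to $L_M^k$, and $T_x^*$ denotes the pull-back of sections of $L_M^k$ by it. $j$ is a linear complex structure on $E$ compatible with $\omega$. $(\delta,\varphi)$ is a half-form line: $\delta$ a complex line and $\varphi:\delta^{\otimes2}\to K_j=\{\alpha\in E^*\otimes\mathbb C:\alpha(j\cdot)=i\alpha\}$ an isomorphism; $K_j$ has scalar product $(\alpha,\beta)=i\alpha\wedge\bar\beta/\omega$ and $\delta$ the one making $\varphi$ unitary. $\delta_M=M\times\delta$, $\mathcal H_k=H^0(M,L_M^k\otimes\delta_M)$ (dimension $2k$), with scalar product obtained by integrating against $\omega$. $(\Psi_\ell)_{\ell\in\mathbb Z/2k\mathbb Z}$ is the orthonormal basis of $\mathcal H_k$ with $T^*_{\mu/2k}\Psi_\ell=e^{i\pi\ell/k}\Psi_\ell$, $T^*_{\lambda/2k}\Psi_\ell=\Psi_{\ell+1}$,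 $\Psi_0(0)\in\mathbb R_{>0}\,\sigma_0^k\otimes\Omega_\mu$, where $\sigma_0\in L_{M,[0]}$ corresponds to $1\in L_{E,0}=\mathbb C$ and $\Omega_\mu\in\delta$ satisfies $\varphi(\Omega_\mu^2)(\mu)=1$. The state. The Hermitian space $V_k(C\times S^1)$ of $\mathrm{SU}(2)$ Chern–Simons TQFT at level $k-2$, with Verlinde basis $e_1,\dots,e_{k-1}$ associated to $(\mu,\lambda)$, is embedded in $\mathcal H_k$ by $e_\ell\mapsto2^{-1/2}(\Psi_\ell-\Psi_{-\ell})$. The TQFT vector of $\Sigma\times S^1$ is then $$Z_k(\Sigma\times S^1)=\frac1{\sqrt2}\sum_{\ell=1}^{k-1}N_\ell^{g,k}(\Psi_\ell-\Psi_{-\ell}),$$ where $N_\ell^{g,k}=\sum_{m=1}^{k-1}S_{m,1}^{1-2g}S_{m,\ell}$, $S_{m,p}=(2/k)^{1/2}\sin(\pi mp/k)$. $P_{g,0}$ is the unique polynomial for which there exist polynomials $P_{g,1},\dots,P_{g,g-1}$ with $N_\ell^{g,k}=(\frac k{2\pi})^{3g-2}\sum_{m=0}^{g-1}k^{-2m}P_{g,m}(\ell/k)$ for all $k\ge1$ and all odd $\ell$ with $1\le\ell\le k-1$. Lagrangian states. A family $\xi=(\xi_k\in\mathcal H_k)_{k}$ is admissible if $\|\xi_k\|\le Ck^{N'}$ for some $C,N'$. $x\notin\mathrm{MS}(\xi)$ iff there are a neighborhood $V$ of $x$ and constants $C_n$ with $|\xi_k|\le C_nk^{-n}$ on $V$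 for all $n,k$. Let $U\subset M$ be open, $\Gamma$ a one-dimensional submanifold of $U$, $\Theta$ a flat section of $L_M\to\Gamma$ of constant norm $1$, $\sigma$ a section of $\delta_M\to\Gamma$, $N\in\mathbb R$. The restriction of the admissible family $\xi$ to $U$ is a Lagrangian state with associated data $(\Gamma,\Theta,\sigma,N)$ if $\mathrm{MS}(\xi)\cap U\subset\Gamma$ and every $x_0\in\Gamma$ has an open neighborhood $V$ on which, uniformly, $\xi_k(x)=(\frac k{2\pi})^{1/4+N}F^k(x)f(x,k)+O(k^{-\infty})$, where $F$ is a section of $L_M\to V$ with $F=\Theta$ on $\Gamma\cap V$, $|F|<1$ off $\Gamma$, $\bar\partial F\equiv0$ modulo a section vanishing to infinite order along $\Gamma$, and $f(\cdot,k)\in\mathcal C^\infty(V,\delta_M)$ has an asymptotic expansion $f_0+k^{-1}f_1+\cdots$ with smooth coefficients and $f_0=\sigma$ on $\Gamma\cap V$. Squares of elements of $\delta$ are viewed as linear forms on $E$ via $\varphi$ and restricted to tangent lines of $\Gamma$. *)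

theory Defs
  imports "HOL-Analysis.Analysis" "HOL-Computational_Algebra.Polynomial"
begin

text \<open>The plane \<open>E = H\<^sub>1(C \<times> S\<^sup>1, \<real>)\<close> is written in the basis \<open>(\<mu>, \<lambda>)\<close>:
  the pair \<open>(p, q)\<close> stands for \<open>p \<mu> + q \<lambda>\<close>.\<close>

type_synonym plane = "real \<times> real"

definition mu :: plane where "mu = (1, 0)"

definition lam :: plane where "lam = (0, 1)"

definition omega :: "plane \<Rightarrow> plane \<Rightarrow> real" where
  "omega x y = 4 * pi * (fst x * snd y - snd x * fst y)"

definition alpha :: "plane \<Rightarrow> plane \<Rightarrow> real" where
  "alpha x y = omega x y / 2"

definition lattice :: "plane set" where
  "lattice = \<int> \<times> \<int>"

text \<open>Everything over the torus \<open>M = E/R\<close> is written on the cover \<open>E\<close>. A subset of \<open>M\<close> is its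
  \<open>R\<close>-invariant preimage in \<open>E\<close>. A section over \<open>V\<close> of \<open>L\<^sub>M\<^sup>k \<otimes> (M \<times> \<delta>)\<close>, where
  \<open>L\<^sub>M = (E \<times> \<complex>)/(R \<times> {1})\<close>, is a function on the preimage of \<open>V\<close> whose graph is invariant
  under the action \<open>x.(y, v) = (x + y, e\<^bsup>i k \<omega>(x,y)/2\<^esup> v)\<close> of \<open>R\<close>. Its values outside the
  preimage of \<open>V\<close> are irrelevant. The argument \<open>sc\<close> is the complex scalar multiplication of
  the fibre: sections of \<open>L\<^sub>M\<^sup>k\<close> are obtained with \<open>sc = (*)\<close>, sections of
  \<open>\<delta>\<^sub>M = M \<times> \<delta>\<close> with \<open>k = 0\<close>. As \<open>L\<^sub>M\<close> has the trivial metric on the cover, the pointwise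
  norm of a section is the norm of its value.\<close>

definition saturated :: "plane set \<Rightarrow> bool" where
  "saturated V \<longleftrightarrow> (\<forall>r\<in>lattice. \<forall>y\<in>V. r + y \<in> V)"

definition saturation :: "plane set \<Rightarrow> plane set" where
  "saturation S = {r + y |r y. r \<in> lattice \<and> y \<in> S}"

definition open_M :: "plane set \<Rightarrow> bool" where
  "open_M V \<longleftrightarrow> open V \<and> saturated V"

definition is_section ::
    "(complex \<Rightarrow> 'd \<Rightarrow> 'd) \<Rightarrow> nat \<Rightarrow> plane set \<Rightarrow> (plane \<Rightarrow> 'd) \<Rightarrow> bool" where
  "is_section sc k V s \<longleftrightarrow>
     (\<forall>r\<in>lattice. \<forall>y\<in>V. s (r + y) = sc (cis (real k * omega r y / 2)) (s y))"

primrec iter_deriv ::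
    "'a::real_normed_vector list \<Rightarrow> ('a \<Rightarrow> 'b::real_normed_vector) \<Rightarrow> 'a \<Rightarrow> 'b" where
  "iter_deriv [] f = f"
| "iter_deriv (v # vs) f = (\<lambda>x. frechet_derivative (iter_deriv vs f) (at x) v)"

text \<open>Meant for open \<open>S\<close>: all iterated directional derivatives exist and are differentiable.\<close>

definition smooth_on :: "'a::real_normed_vector set \<Rightarrow> ('a \<Rightarrow> 'b::real_normed_vector) \<Rightarrow> bool" where
  "smooth_on S f \<longleftrightarrow> (\<forall>vs. \<forall>x\<in>S. iter_deriv vs f differentiable (at x))"

definition vanishes_inf_order ::
    "'a::real_normed_vector set \<Rightarrow> ('a \<Rightarrow> 'b::real_normed_vector) \<Rightarrow> bool" where
  "vanishes_inf_order S f \<longleftrightarrow> (\<forall>vs. \<forall>x\<in>S. iter_deriv vs f x = 0)"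

text \<open>\<open>f(\<cdot>, k) = c\<^sub>0 + k\<^sup>-\<^sup>1 c\<^sub>1 + \<dots>\<close> in the topology of \<open>C\<^sup>\<infinity>(V)\<close>, that is,
  uniformly on compact subsets together with all derivatives.\<close>

definition asymp_expansion ::
    "'a::real_normed_vector set \<Rightarrow> (nat \<Rightarrow> 'a \<Rightarrow> 'b::real_normed_vector) \<Rightarrow> (nat \<Rightarrow> 'a \<Rightarrow> 'b) \<Rightarrow> bool" where
  "asymp_expansion V f c \<longleftrightarrow>
     (\<forall>n vs K. compact K \<and> K \<subseteq> V \<longrightarrow>
        (\<exists>C. \<forall>k\<ge>1. \<forall>x\<in>K.
           norm (iter_deriv vs (\<lambda>y. f k y - (\<Sum>l<n. (1 / real k ^ l) *\<^sub>R c l y)) x) \<le> C / real k ^ n))"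

text \<open>The covariant derivative induced on \<open>L\<^sup>k \<otimes> \<delta>\<^sub>M\<close> by \<open>d + \<alpha>/i\<close> on \<open>L\<close> and by \<open>d\<close> on
  the trivial bundle \<open>\<delta>\<^sub>M\<close>.\<close>

definition nabla ::
    "(complex \<Rightarrow> 'd::real_normed_vector \<Rightarrow> 'd) \<Rightarrow> nat \<Rightarrow> (plane \<Rightarrow> 'd) \<Rightarrow> plane \<Rightarrow> plane \<Rightarrow> 'd" where
  "nabla sc k s x v =
     frechet_derivative s (at x) v + sc (of_nat k / \<i> * of_real (alpha x v)) (s x)"

definition dbar ::
    "(plane \<Rightarrow> plane) \<Rightarrow> (complex \<Rightarrow> 'd::real_normed_vector \<Rightarrow> 'd) \<Rightarrow> nat \<Rightarrow> (plane \<Rightarrow> 'd) \<Rightarrow> plane \<Rightarrow> plane \<Rightarrow> 'd" where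
  "dbar j sc k s x v = (1 / 2) *\<^sub>R (nabla sc k s x v + sc \<i> (nabla sc k s x (j v)))"

definition compatible_complex_structure :: "(plane \<Rightarrow> plane) \<Rightarrow> bool" where
  "compatible_complex_structure j \<longleftrightarrow>
     linear j \<and> (\<forall>x. j (j x) = - x) \<and> (\<forall>x y. omega (j x) (j y) = omega x y) \<and>
     (\<forall>x. x \<noteq> 0 \<longrightarrow> omega x (j x) > 0)"

definition canonical_line :: "(plane \<Rightarrow> plane) \<Rightarrow> (plane \<Rightarrow> complex) set" where
  "canonical_line j = {a. linear a \<and> (\<forall>v. a (j v) = \<i> * a v)}"

text \<open>The scalar product \<open>i a \<and> \<bar>b / \<omega>\<close>; both 2-forms are evaluated at \<open>(\<mu>, \<lambda>)\<close>.\<close>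

definition canonical_inner :: "(plane \<Rightarrow> complex) \<Rightarrow> (plane \<Rightarrow> complex) \<Rightarrow> complex" where
  "canonical_inner a b = \<i> * (a mu * cnj (b lam) - a lam * cnj (b mu)) / of_real (omega mu lam)"

text \<open>A half-form line: the complex line \<open>\<delta>\<close> is the type \<open>'d\<close> with complex scalar
  multiplication \<open>sc\<close>. The isomorphism \<open>\<phi> : \<delta>\<^sup>\<otimes>\<^sup>2 \<rightarrow> K\<^sub>j\<close> is given through the universal
  property of the tensor product as a bilinear map; since \<open>\<delta>\<close> is a line, every element of
  \<open>\<delta>\<^sup>\<otimes>\<^sup>2\<close> is a pure tensor, which vanishes only if one of its factors does, so the last two
  conditions on \<open>\<phi>\<close> are surjectivity and injectivity. The Hermitian product \<open>herm\<close> (linear in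
  its first argument) is the one making \<open>\<phi>\<close> unitary, and the norm of the type \<open>'d\<close> is its norm.\<close>

definition half_form_line ::
    "(plane \<Rightarrow> plane) \<Rightarrow> (complex \<Rightarrow> 'd::real_normed_vector \<Rightarrow> 'd) \<Rightarrow>
     ('d \<Rightarrow> 'd \<Rightarrow> plane \<Rightarrow> complex) \<Rightarrow> ('d \<Rightarrow> 'd \<Rightarrow> complex) \<Rightarrow> bool" where
  "half_form_line j sc \<phi> herm \<longleftrightarrow>
     vector_space sc \<and> (\<forall>r u. sc (of_real r) u = r *\<^sub>R u) \<and>
     vector_space.dim sc (UNIV :: 'd set) = 1 \<and>
     (\<forall>u u' v x. \<phi> (u + u') v x = \<phi> u v x + \<phi> u' v x) \<and>
     (\<forall>u v v' x. \<phi> u (v + v') x = \<phi> u v x + \<phi> u v' x) \<and>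
     (\<forall>c u v x. \<phi> (sc c u) v x = c * \<phi> u v x) \<and>
     (\<forall>c u v x. \<phi> u (sc c v) x = c * \<phi> u v x) \<and>
     {\<phi> u v |u v. True} = canonical_line j \<and>
     (\<forall>u v. (\<forall>x. \<phi> u v x = 0) \<longrightarrow> u = 0 \<or> v = 0) \<and>
     (\<forall>u u' v. herm (u + u') v = herm u v + herm u' v) \<and>
     (\<forall>c u v. herm (sc c u) v = c * herm u v) \<and>
     (\<forall>u v. herm v u = cnj (herm u v)) \<and>
     (\<forall>u u' v v'. canonical_inner (\<phi> u u') (\<phi> v v') = herm u v * herm u' v') \<and>
     (\<forall>u. herm u u = of_real (norm u ^ 2))"

definition quantum_space ::
    "(plane \<Rightarrow> plane) \<Rightarrow> (complex \<Rightarrow> 'd::real_normed_vector \<Rightarrow> 'd) \<Rightarrow> nat \<Rightarrow> (plane \<Rightarrow> 'd) set" where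
  "quantum_space j sc k =
     {s. is_section sc k UNIV s \<and> smooth_on UNIV s \<and> (\<forall>x v. dbar j sc k s x v = 0)}"

text \<open>Integration against \<open>\<omega>\<close> over the fundamental domain \<open>{p \<mu> + q \<lambda>. 0 \<le> p, q \<le> 1}\<close>, where
  \<open>\<omega> = \<omega>(\<mu>,\<lambda>) dp dq\<close>.\<close>

definition quantum_inner ::
    "('d \<Rightarrow> 'd \<Rightarrow> complex) \<Rightarrow> (plane \<Rightarrow> 'd) \<Rightarrow> (plane \<Rightarrow> 'd) \<Rightarrow> complex" where
  "quantum_inner herm s t =
     of_real (omega mu lam) * integral (cbox (0, 0) (1, 1)) (\<lambda>x. herm (s x) (t x))"

definition quantum_norm :: "('d \<Rightarrow> 'd \<Rightarrow> complex) \<Rightarrow> (plane \<Rightarrow> 'd) \<Rightarrow> real" where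
  "quantum_norm herm s = sqrt (Re (quantum_inner herm s s))"

text \<open>Pull-back of a section of \<open>L\<^sup>k\<close> by the action \<open>(y, v) \<mapsto> (x + y, e\<^bsup>i k \<omega>(x,y)/2\<^esup> v)\<close>.\<close>

definition pull_back ::
    "(complex \<Rightarrow> 'd \<Rightarrow> 'd) \<Rightarrow> nat \<Rightarrow> plane \<Rightarrow> (plane \<Rightarrow> 'd) \<Rightarrow> plane \<Rightarrow> 'd" where
  "pull_back sc k x s = (\<lambda>y. sc (cis (- (real k * omega x y / 2))) (s (x + y)))"

text \<open>The basis \<open>(\<Psi>\<^sub>l)\<close>, with \<open>l \<in> \<int>/2k\<int>\<close> encoded by periodicity in an integer index. The unit
  vector \<open>\<sigma>\<^sub>0\<close> at the origin is \<open>1\<close> on the cover, so it does not show in the last condition.\<close>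

definition quantum_basis ::
    "(plane \<Rightarrow> plane) \<Rightarrow> (complex \<Rightarrow> 'd::real_normed_vector \<Rightarrow> 'd) \<Rightarrow> ('d \<Rightarrow> 'd \<Rightarrow> complex) \<Rightarrow>
     'd \<Rightarrow> nat \<Rightarrow> (int \<Rightarrow> plane \<Rightarrow> 'd) \<Rightarrow> bool" where
  "quantum_basis j sc herm Om k \<Psi> \<longleftrightarrow>
     (\<forall>l. \<Psi> (l + 2 * int k) = \<Psi> l) \<and>
     (\<forall>l. \<Psi> l \<in> quantum_space j sc k) \<and>
     (\<forall>l\<in>{0..<2 * int k}. \<forall>m\<in>{0..<2 * int k}.
        quantum_inner herm (\<Psi> l) (\<Psi> m) = (if l = m then 1 else 0)) \<and>
     (\<forall>s\<in>quantum_space j sc k. \<exists>c. \<forall>x. s x = (\<Sum>l\<in>{0..<2 * int k}. sc (c l) (\<Psi> l x))) \<and>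
     (\<forall>l x. pull_back sc k ((1 / (2 * real k)) *\<^sub>R mu) (\<Psi> l) x = sc (cis (pi * of_int l / real k)) (\<Psi> l x)) \<and>
     (\<forall>l. pull_back sc k ((1 / (2 * real k)) *\<^sub>R lam) (\<Psi> l) = \<Psi> (l + 1)) \<and>
     (\<exists>r>0. \<Psi> 0 0 = r *\<^sub>R Om)"

definition S_coeff :: "nat \<Rightarrow> nat \<Rightarrow> nat \<Rightarrow> real" where
  "S_coeff k m p = sqrt (2 / real k) * sin (pi * real m * real p / real k)"

definition N_coeff :: "nat \<Rightarrow> nat \<Rightarrow> nat \<Rightarrow> real" where
  "N_coeff g k l = (\<Sum>m\<in>{1..<k}. S_coeff k m 1 powi (1 - 2 * int g) * S_coeff k m l)"

text \<open>The surface enters only through its genus \<open>g\<close>.\<close>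

definition Z_state :: "(nat \<Rightarrow> int \<Rightarrow> plane \<Rightarrow> 'd::real_vector) \<Rightarrow> nat \<Rightarrow> nat \<Rightarrow> plane \<Rightarrow> 'd" where
  "Z_state \<Psi> g k = (\<lambda>x. (1 / sqrt 2) *\<^sub>R
     (\<Sum>l\<in>{1..<k}. N_coeff g k l *\<^sub>R (\<Psi> k (int l) x - \<Psi> k (- int l) x)))"

definition is_leading_polynomial :: "nat \<Rightarrow> real poly \<Rightarrow> bool" where
  "is_leading_polynomial g P0 \<longleftrightarrow>
     (\<exists>P :: nat \<Rightarrow> real poly. P 0 = P0 \<and>
        (\<forall>k\<ge>1. \<forall>l. odd l \<and> 1 \<le> l \<and> l \<le> k - 1 \<longrightarrow>
           N_coeff g k l = (real k / (2 * pi)) ^ (3 * g - 2) *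
             (\<Sum>m<g. poly (P m) (real l / real k) / real k ^ (2 * m))))"

definition admissible ::
    "(plane \<Rightarrow> plane) \<Rightarrow> (complex \<Rightarrow> 'd::real_normed_vector \<Rightarrow> 'd) \<Rightarrow> ('d \<Rightarrow> 'd \<Rightarrow> complex) \<Rightarrow>
     (nat \<Rightarrow> plane \<Rightarrow> 'd) \<Rightarrow> bool" where
  "admissible j sc herm \<xi> \<longleftrightarrow>
     (\<forall>k\<ge>1. \<xi> k \<in> quantum_space j sc k) \<and>
     (\<exists>C N'. \<forall>k\<ge>1. quantum_norm herm (\<xi> k) \<le> C * real k powr N')"

definition microsupport :: "(nat \<Rightarrow> plane \<Rightarrow> 'd::real_normed_vector) \<Rightarrow> plane set" where
  "microsupport \<xi> =
     - {x. \<exists>V. open_M V \<and> x \<in> V \<and> (\<forall>n::nat. \<exists>C. \<forall>k\<ge>1. \<forall>y\<in>V. norm (\<xi> k y) \<le> C / real k ^ n)}"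

definition submanifold_1d :: "plane set \<Rightarrow> plane set \<Rightarrow> bool" where
  "submanifold_1d U \<Gamma> \<longleftrightarrow>
     \<Gamma> \<subseteq> U \<and> saturated \<Gamma> \<and>
     (\<forall>x\<in>\<Gamma>. \<exists>W (\<rho> :: plane \<Rightarrow> real). open W \<and> x \<in> W \<and> W \<subseteq> U \<and> smooth_on W \<rho> \<and>
        (\<forall>y\<in>W. \<exists>v. frechet_derivative \<rho> (at y) v \<noteq> 0) \<and> \<Gamma> \<inter> W = {y \<in> W. \<rho> y = 0})"

text \<open>Flatness of a section \<open>\<Theta>\<close> of \<open>L\<^sub>M \<rightarrow> \<Gamma>\<close> for the connection \<open>d + \<alpha>/i\<close> is tested along curves
  in \<open>\<Gamma>\<close>; this also makes sense on the union \<open>A\<close> of crossing curves.\<close>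

definition flat_section :: "plane set \<Rightarrow> (plane \<Rightarrow> complex) \<Rightarrow> bool" where
  "flat_section \<Gamma> \<Theta> \<longleftrightarrow>
     is_section (*) 1 \<Gamma> \<Theta> \<and> continuous_on \<Gamma> \<Theta> \<and>
     (\<forall>\<gamma> t v. eventually (\<lambda>s. \<gamma> s \<in> \<Gamma>) (nhds t) \<and> (\<gamma> has_vector_derivative v) (at t) \<longrightarrow>
        ((\<lambda>s. \<Theta> (\<gamma> s)) has_vector_derivative - (1 / \<i> * of_real (alpha (\<gamma> t) v) * \<Theta> (\<gamma> t))) (at t))"

definition lagrangian_state ::
    "(plane \<Rightarrow> plane) \<Rightarrow> (complex \<Rightarrow> 'd::real_normed_vector \<Rightarrow> 'd) \<Rightarrow> ('d \<Rightarrow> 'd \<Rightarrow> complex) \<Rightarrow>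
     plane set \<Rightarrow> (nat \<Rightarrow> plane \<Rightarrow> 'd) \<Rightarrow>
     plane set \<Rightarrow> (plane \<Rightarrow> complex) \<Rightarrow> (plane \<Rightarrow> 'd) \<Rightarrow> real \<Rightarrow> bool" where
  "lagrangian_state j sc herm U \<xi> \<Gamma> \<Theta> \<sigma> N \<longleftrightarrow>
     admissible j sc herm \<xi> \<and> open_M U \<and> submanifold_1d U \<Gamma> \<and>
     flat_section \<Gamma> \<Theta> \<and> (\<forall>x\<in>\<Gamma>. norm (\<Theta> x) = 1) \<and> is_section sc 0 \<Gamma> \<sigma> \<and>
     microsupport \<xi> \<inter> U \<subseteq> \<Gamma> \<and>
     (\<forall>x0\<in>\<Gamma>. \<exists>V F f c.
        open_M V \<and> x0 \<in> V \<and> V \<subseteq> U \<and>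
        is_section (*) 1 V F \<and> smooth_on V F \<and>
        (\<forall>x\<in>\<Gamma> \<inter> V. F x = \<Theta> x) \<and> (\<forall>x\<in>V - \<Gamma>. norm (F x) < 1) \<and>
        (\<forall>v. vanishes_inf_order (\<Gamma> \<inter> V) (\<lambda>x. dbar j (*) 1 F x v)) \<and>
        (\<forall>k\<ge>1. is_section sc 0 V (f k) \<and> smooth_on V (f k)) \<and>
        (\<forall>l. is_section sc 0 V (c l) \<and> smooth_on V (c l)) \<and>
        asymp_expansion V f c \<and> (\<forall>x\<in>\<Gamma> \<inter> V. c 0 x = \<sigma> x) \<and>
        (\<forall>n. \<exists>C. \<forall>k\<ge>1. \<forall>x\<in>V.
           norm (\<xi> k x - ((real k / (2 * pi)) powr (1 / 4 + N)) *\<^sub>R sc (F x ^ k) (f k x)) \<le> C / real k ^ n))"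

definition A1 :: "plane set" where
  "A1 = saturation {p *\<^sub>R mu |p. True}"

definition A2 :: "plane set" where
  "A2 = saturation ({q *\<^sub>R lam |q. True} \<union> {(1 / 2) *\<^sub>R mu + q *\<^sub>R lam |q. True})"

text \<open>\<open>w\<close> is a vector \<open>(dt)\<^sup>1\<^sup>/\<^sup>2\<close> of \<open>\<delta>\<close> for the linear coordinate \<open>t\<close> on the line \<open>\<real> e\<close>:
  its square restricts there to \<open>dt\<close>.\<close>

definition sqrt_coordinate_form :: "('d \<Rightarrow> 'd \<Rightarrow> plane \<Rightarrow> complex) \<Rightarrow> plane \<Rightarrow> 'd \<Rightarrow> bool" where
  "sqrt_coordinate_form \<phi> e w \<longleftrightarrow> (\<forall>t. \<phi> w w (t *\<^sub>R e) = of_real t)"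

end

theory Submission
 imports Defs "HOL-Complex_Analysis.Complex_Analysis"
begin

text \<open>On the cover the basis sections are theta series, so up to a phase that tends to 1 rapidly the
  state is an explicit Gaussian sum over \<open>n\<close> with the Verlinde numbers as weights. A sum of Gaussians
  with weights \<open>w(n/2k)\<close>, \<open>w\<close> holomorphic near the centre, is expanded by replacing \<open>w\<close> with its
  Taylor polynomial and applying Poisson summation to the moments: only one term of the dual sum
  survives, and the heat operator acting on \<open>w\<close> produces the expansion in powers of \<open>1/k\<close>.
  Near \<open>A\<^sub>2\<close> this applies directly, since for odd \<open>n\<close> the Verlinde number is a polynomial in \<open>n/k\<close>;
  the restriction to odd \<open>n\<close> is responsible for the second component of \<open>A\<^sub>2\<close>. Near \<open>A\<^sub>1\<close> the
  Verlinde numbers are first written as a Fourier sum, and Poisson summation turns the state into a Gaussian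
  sum for the inverted modulus with weights \<open>sin(\<pi> n/k)\<^sup>1\<^sup>-\<^sup>2\<^sup>g\<close>. In both cases the Gaussian factor is the
  \<open>k\<close>-th power of a holomorphic section of norm at most 1 that restricts to the flat section, and
  the amplitudes are holomorphic in the complex coordinate.\<close>

section \<open>Gaussian sums and Poisson summation\<close>

text \<open>The difficulty is uniformity: the state must be controlled on a full neighbourhood of
  the curve, where the Gaussian factor has any size between 1 and exponentially small, so an
  expansion along the curve alone does not suffice. The weight is expanded at the real centre
  \<open>-Q\<close> of the sum, but after Poisson summation its Taylor polynomial is evaluated at
  the complex point \<open>-Q - P/\<tau>\<close> and compared with the weight itself there; the
  discrepancy is a power of \<open>P\<close>, which the surviving Gaussian converts into a power of
  \<open>1/k\<close>. That point is a multiple of the complex coordinate, whence the holomorphic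
  amplitudes. A second obstacle: the polynomials are known to represent Verlinde numbers only for
  \<open>l < k\<close>, while the theta series sees a whole period \<open>0 < n < 2k\<close>. The
  missing antisymmetry about \<open>l = k\<close> is extracted from finite differences, which lower
  the genus down to 0. Finally, \<open>exp(i pi/4)\<close> appears because Poisson summation
  produces \<open>1/csqrt(-i modulus)\<close>, whereas a half-form of \<open>dq\<close> has as
  coefficient a square root of \<open>1/modulus\<close>.\<close>

abbreviation "tpi \<equiv> 2 * complex_of_real pi*\<i>"

abbreviation "mtpi \<equiv> - 2 * complex_of_real pi*\<i>"

abbreviation "pt k n \<equiv> real_of_int n/(2*real k)"

abbreviation "kp k \<equiv> real k/(2*pi)"

section \<open>Majorants for Gaussian series, uniform in the translation\<close>

lemma summable_on_int_inverse_square: "(\<lambda>n::int. 1/(1 + (real_of_int n)^2)) summable_on UNIV" proof -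
 have s: "summable (\<lambda>n::nat. 1/(1 + (real n)^2))" proof (rule summable_comparison_test'[OF inverse_power_summable[of 2]])
  fix n :: nat assume "n \<ge> 1"
  then show "norm (1/(1 + (real n)^2)) \<le> inverse (real n^2)" by (simp add: field_simps add_pos_nonneg)
 qed simp
 have a: "(\<lambda>n::nat. 1/(1 + (real n)^2)) summable_on UNIV" using s by (intro summable_nonneg_imp_summable_on) auto
 have b1: "(\<lambda>n::int. 1/(1 + (real_of_int n)^2)) summable_on (range int)" using a by (subst summable_on_reindex) (auto simp: o_def inj_on_def)
 have b2: "(\<lambda>n::int. 1/(1 + (real_of_int n)^2)) summable_on (range (\<lambda>n. - int n))"
  using a by (subst summable_on_reindex) (auto simp: o_def inj_on_def)
 have "UNIV = range int \<union> range (\<lambda>n. - int n)" by (metis (no_types, lifting) UNIV_eq_I UnI1 UnI2 int_cases2 rangeI)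
 then show ?thesis using summable_on_union[OF b1 b2] by simp
qed

lemma shifted_inverse_square_le:
 assumes "0 \<le> y" "y \<le> (1::real)" shows "1/(1 + (y + real_of_int n)^2) \<le> 4/(1 + (real_of_int n)^2)" proof -
 have "1 + (real_of_int n)^2 \<le> 4*(1 + (y + real_of_int n)^2)" proof -
  define m where "m = real_of_int n"
  have "4*(1 + (y+m)^2) - (1 + m^2) = 3*(m + 4*y/3)^2 + 3 - 4*y^2/3" by (simp add: power2_eq_square field_simps)
  moreover have "y^2 \<le> 1" using assms by (simp add: power_le_one)
  moreover have "(m + 4*y/3)^2 \<ge> 0" by simp
  ultimately show ?thesis unfolding m_def by linarith
 qed
 then show ?thesis by (simp add: field_simps add_pos_nonneg)
qed

text \<open>The sum is 1-periodic in \<open>y\<close>, so only \<open>0 <= y <= 1\<close> matters,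
  and there one fixed series dominates. The constant makes the estimates of theta sums uniform in
  the position.\<close>

lemma infsum_shifted_inverse_square:
 obtains K where "K > 0" "\<And>y. (\<lambda>n::int. 1/(1 + (y + real_of_int n)^2)) summable_on UNIV"
  "\<And>y. (\<Sum>\<^sub>\<infinity>n::int. 1/(1 + (y + real_of_int n)^2)) \<le> K" proof -
 define S where "S = (\<lambda>y. (\<Sum>\<^sub>\<infinity>n::int. 1/(1 + (y + real_of_int n)^2)))"
 define K where "K = (\<Sum>\<^sub>\<infinity>n::int. 4*(1/(1 + (real_of_int n)^2)))"
 have s4: "(\<lambda>n::int. 4*(1/(1 + (real_of_int n)^2))) summable_on UNIV" by (intro summable_on_cmult_right summable_on_int_inverse_square)
 have summ0: "(\<lambda>n::int. 1/(1 + (y + real_of_int n)^2)) summable_on UNIV" if "0 \<le> y" "y \<le> 1" for y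
  by (rule summable_on_comparison_test[OF s4]) (use shifted_inverse_square_le[OF that] in auto)
 have bd0: "S y \<le> K" if "0 \<le> y" "y \<le> 1" for y unfolding S_def K_def
  by (rule infsum_mono[OF summ0[OF that] s4]) (use shifted_inverse_square_le[OF that] in auto)
 have bij: "bij_betw (\<lambda>n. n + \<lfloor>y\<rfloor>) UNIV (UNIV::int set)" for y :: real
  by (rule bij_betwI[where g="\<lambda>n. n - \<lfloor>y\<rfloor>"]) auto
 have eq: "(\<lambda>n::int. 1/(1 + (y + real_of_int n)^2)) = (\<lambda>n. (\<lambda>n. 1/(1 + (frac y + real_of_int n)^2)) (n + \<lfloor>y\<rfloor>))" for y
  by (simp add: frac_def algebra_simps)
 have fr: "0 \<le> frac y" "frac y \<le> 1" for y :: real using frac_lt_1[of y] by (auto simp: less_imp_le)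
 have summ: "(\<lambda>n::int. 1/(1 + (y + real_of_int n)^2)) summable_on UNIV" for y
  unfolding eq by (subst summable_on_reindex_bij_betw[OF bij]) (rule summ0[OF fr])
 have bd: "S y \<le> K" for y proof -
  have "S y = S (frac y)" unfolding S_def eq[of y] by (rule infsum_reindex_bij_betw[OF bij])
  then show ?thesis using bd0[OF fr] by simp
 qed
 have "K \<ge> 0" unfolding K_def by (intro infsum_nonneg) auto
 then show ?thesis using that[of "K+1"] summ bd unfolding S_def by (smt (verit, best))
qed

text \<open>Half of the quadratic exponent absorbs the linear one by completing a square; the other
  half beats \<open>1 + x^2\<close> because \<open>exp t >= 1 + t\<close>.\<close>

lemma exp_neg_square_le:
 assumes "c > (0::real)" shows "exp (- c*x^2 + R*\<bar>x\<bar>) \<le> (exp (R^2/(2*c)) * max 1 (2/c))/(1 + x^2)" proof -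
 have sq: "0 \<le> (c*\<bar>x\<bar> - R)^2" by simp
 have "2*c*(R*\<bar>x\<bar>) \<le> c^2*x^2 + R^2" using sq by (simp add: power2_diff power_mult_distrib algebra_simps)
 then have "R*\<bar>x\<bar> \<le> (c^2*x^2 + R^2)/(2*c)" using assms by (simp add: field_simps)
 also have "... = (c/2)*x^2 + R^2/(2*c)" using assms by (simp add: field_simps power2_eq_square)
 finally have "- c*x^2 + R*\<bar>x\<bar> \<le> - (c/2*x^2) + R^2/(2*c)" by simp
 then have 1: "exp (- c*x^2 + R*\<bar>x\<bar>) \<le> exp (R^2/(2*c))*exp (- (c/2*x^2))" by (simp add: exp_add[symmetric] add.commute)
 have "1 + x^2 \<le> max 1 (2/c)*(1 + c/2*x^2)" proof -
  have "1 \<le> max 1 (2/c)" "x^2 \<le> max 1 (2/c)*(c/2*x^2)" proof -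
   have "1 \<le> max 1 (2/c)*(c/2)" using mult_right_mono[of "2/c" "max 1 (2/c)" "c/2"] assms by simp
   then show "x^2 \<le> max 1 (2/c)*(c/2*x^2)" using mult_right_mono[of 1 "max 1 (2/c)*(c/2)" "x^2"] by (simp add: mult.assoc)
  qed simp
  then show ?thesis unfolding distrib_left by linarith
 qed
 also have "1 + c/2*x^2 \<le> exp (c/2*x^2)" by (rule exp_ge_add_one_self)
 finally have "1 + x^2 \<le> max 1 (2/c)*exp (c/2*x^2)" by (simp add: mult_left_mono)
 then have 2: "exp (- (c/2*x^2)) \<le> max 1 (2/c)/(1+x^2)" by (simp add: exp_minus field_simps add_pos_nonneg)
 show ?thesis using 1 mult_left_mono[OF 2, of "exp (R^2/(2*c))"] by simp
qed

lemma summable_on_gaussian: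
 assumes "c > (0::real)" shows "(\<lambda>n::int. exp (- c*(real_of_int n)^2 + R*\<bar>real_of_int n\<bar>)) summable_on UNIV"
proof (rule summable_on_comparison_test)
 show "(\<lambda>n::int. (exp (R^2/(2*c)) * max 1 (2/c))*(1/(1 + (real_of_int n)^2))) summable_on UNIV"
  by (intro summable_on_cmult_right summable_on_int_inverse_square)
qed (use exp_neg_square_le[OF assms] in auto)

text \<open>Chernoff's argument: dividing \<open>f - f 0\<close> by \<open>e\<^bsup>2\<pi>iz\<^esup> - 1\<close> makes the Fourier sums telescope.\<close>

lemma fourier_sum_at_0:
 fixes f :: "complex => complex"
 assumes f: "f holomorphic_on UNIV"
 defines "a \<equiv> \<lambda>m::int. integral {-1/2..1/2::real} (\<lambda>x. f (of_real x)*exp (mtpi * of_int m * of_real x))"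
 shows "(\<lambda>N. \<Sum>m\<in>{-int N..int N}. a m) \<longlonglongrightarrow> f 0" proof -
 \<comment> \<open>The strip contains the interval of integration, and 0 is the only integer in it.
   So \<open>h - 1\<close> has no other zero there and the quotient \<open>E\<close> below is
   holomorphic.\<close>
 define S where "S = {z::complex. \<bar>Re z\<bar> < 1}"
 have S_eq: "S = {z. Re z < 1} \<inter> {z. Re z > -1}" unfolding S_def by auto
 have S: "open S" unfolding S_eq by (intro open_Int open_halfspace_Re_lt open_halfspace_Re_gt)
 define A where "A = (\<lambda>z. if z = 0 then deriv f 0 else (f z - f 0)/(z - 0))"
 define h where "h = (\<lambda>z::complex. exp (tpi*z))"
 define B where "B = (\<lambda>z. if z = 0 then deriv h 0 else (h z - h 0)/(z - 0))"
 have hh: "h holomorphic_on UNIV" unfolding h_def by (intro holomorphic_intros)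
 have A: "A holomorphic_on UNIV" unfolding A_def by (rule pole_lemma_open[OF f]) simp
 have B: "B holomorphic_on UNIV" unfolding B_def by (rule pole_lemma_open[OF hh]) simp
 have dh: "deriv h 0 = tpi" unfolding h_def by (rule DERIV_imp_deriv) (auto intro!: derivative_eq_intros)
 have B0: "B z \<noteq> 0" if "z \<in> S" for z proof (cases "z = 0")
  case True then show ?thesis by (simp add: B_def dh)
 next
  case False
  have "h z \<noteq> 1" proof
   assume "h z = 1"
   then obtain n :: int where n: "Re (tpi*z) = 0" "Im (tpi*z) = of_int (2*n)*pi" unfolding h_def exp_eq_1 by auto
   then have z: "Im z = 0" "Re z = n" by auto
   then have "\<bar>real_of_int n\<bar> < 1" using that by (simp add: S_def)
   then have "n = 0" by linarith
   with z have "z = 0" by (simp add: complex_eq_iff)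
   with False show False by simp
  qed
  then show ?thesis using False by (simp add: B_def h_def)
 qed
 define E where "E = (\<lambda>z. A z/B z)"
 have E: "E holomorphic_on S" unfolding E_def
  by (intro holomorphic_on_divide holomorphic_on_subset[OF A] holomorphic_on_subset[OF B]) (use B0 in auto)
 have fE: "f z = f 0 + E z*(h z - 1)" if "z \<in> S" for z proof (cases "z = 0")
  case True then show ?thesis by (simp add: h_def)
 next
  case False
  have "h z - 1 = z*B z" using False by (simp add: B_def h_def)
  moreover have "f z - f 0 = z * A z" using False by (simp add: A_def)
  moreover have "E z*B z = A z" using B0[OF that] by (simp add: E_def)
  ultimately show ?thesis by (metis (no_types, opaque_lifting) add.commute diff_add_cancel mult.left_commute)
 qed
 have inS: "of_real x \<in> S" if "x \<in> {-1/2..1/2}" for x :: real using that by (auto simp: S_def)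
 define e where "e = (\<lambda>m::int. \<lambda>x::real. exp (mtpi * of_int m * of_real x) :: complex)"
 define c where "c = (\<lambda>m::int. integral {-1/2..1/2::real} (\<lambda>x. E (of_real x)*e m x))"
 have contE: "continuous_on {-1/2..1/2::real} (\<lambda>x. E (of_real x))"
  by (rule continuous_on_compose2[OF holomorphic_on_imp_continuous_on[OF E]]) (use inS in \<open>auto intro!: continuous_intros\<close>)
 have conte: "continuous_on X (e m)" for m X unfolding e_def by (intro continuous_intros)
 have intE: "(\<lambda>x. E (of_real x)*e m x) integrable_on {-1/2..1/2::real}" for m
  by (intro integrable_continuous_real continuous_intros contE conte)
 have ge: "(e m has_integral (if m = 0 then 1 else 0)) {-1/2..1/2::real}" for m proof (cases "m = 0")
  case True
  show ?thesis using True has_integral_const_real[of "1::complex" "-1/2" "1/2"] by (simp add: e_def)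
 next
  case False
  define G where "G = (\<lambda>x::real. e m x/(mtpi * of_int m))"
  have "(G has_vector_derivative e m x) (at x within X)" for x X proof -
   have "((\<lambda>z. exp (mtpi * of_int m*z)/(mtpi * of_int m)) has_field_derivative
     exp (mtpi * of_int m * of_real x)) (at (of_real x))" using False by (auto intro!: derivative_eq_intros)
   then show ?thesis unfolding G_def e_def by (rule has_vector_derivative_real_field)
  qed
  then have "(e m has_integral (G (1/2) - G (-1/2))) {-1/2..1/2}" by (intro fundamental_theorem_of_calculus) auto
  moreover have "G (1/2) = G (-1/2)" proof -
   have "e m (1/2) = e m (-1/2)*exp (tpi * of_int (-m))" unfolding e_def exp_add[symmetric] by (rule arg_cong[where f=exp]) (simp add: field_simps)
   also have "exp (tpi * of_int (-m)) = 1" by (subst exp_eq_1) (auto intro!: exI[of _ "-m"])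
   finally show ?thesis by (simp add: G_def)
  qed
  ultimately show ?thesis using False by simp
 qed
 \<comment> \<open>Multiplication by \<open>h\<close> lowers the Fourier index by one, so each
   coefficient of \<open>f - f 0\<close> is a difference of consecutive coefficients of
   \<open>E\<close>.\<close>
 have tel: "a m = (if m = 0 then f 0 else 0) + (c (m-1) - c m)" for m proof -
  have "((\<lambda>x. f 0*e m x + (E (of_real x)*e (m-1) x - E (of_real x)*e m x)) has_integral
    (f 0*(if m = 0 then 1 else 0) + (c (m-1) - c m))) {-1/2..1/2::real}" unfolding c_def
   by (intro has_integral_add has_integral_diff has_integral_mult_right ge integrable_integral intE)
  then have "((\<lambda>x. f (of_real x)*e m x) has_integral
    (f 0*(if m = 0 then 1 else 0) + (c (m-1) - c m))) {-1/2..1/2::real}" proof (rule has_integral_eq[rotated])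
   fix x :: real assume "x \<in> {-1/2..1/2}"
   have "e (m-1) x = h (of_real x)*e m x" unfolding e_def h_def exp_add[symmetric] by (rule arg_cong[where f=exp]) (simp add: algebra_simps)
   then show "f 0*e m x + (E (of_real x)*e (m-1) x - E (of_real x)*e m x) = f (of_real x)*e m x"
    unfolding fE[OF inS[OF \<open>x \<in> _\<close>]] \<open>e (m-1) x = _\<close> by (simp only: algebra_simps) simp
  qed
  then have "a m = f 0*(if m = 0 then 1 else 0) + (c (m-1) - c m)" unfolding a_def e_def by (rule integral_unique)
  then show ?thesis by simp
 qed
 have sum: "(\<Sum>m\<in>{-int N..int N}. a m) = f 0 + (c (- int N - 1) - c (int N))" for N proof (induction N)
  case 0
  show ?case by (simp add: tel)
 next
  case (Suc N)
  have "{-int (Suc N)..int (Suc N)} = insert (-int (Suc N)) (insert (int (Suc N)) {-int N..int N})" by auto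
  moreover have e: "- int N - 1 = - 1 - int N" by simp
  ultimately show ?case using Suc.IH[unfolded e] by (simp add: tel algebra_simps)
 qed
 \<comment> \<open>One integration by parts; the decay \<open>1/|m|\<close> is all that the two end
   terms of the telescoping sum require.\<close>
 obtain M where M: "\<And>m. m \<noteq> 0 ==> norm (c m) \<le> M / \<bar>real_of_int m\<bar>" proof -
  have dE: "(E has_field_derivative deriv E z) (at z)" if "z \<in> S" for z using E S holomorphic_derivI that by blast
  have contdE: "continuous_on {-1/2..1/2::real} (\<lambda>x. deriv E (of_real x))"
   by (rule continuous_on_compose2[OF holomorphic_on_imp_continuous_on[OF holomorphic_deriv[OF E S]]])
    (use inS in \<open>auto intro!: continuous_intros\<close>)
  have "bounded ((\<lambda>x. E (of_real x)) ` {-1/2..1/2::real})" "bounded ((\<lambda>x. deriv E (of_real x)) ` {-1/2..1/2::real})"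
   by (rule compact_imp_bounded[OF compact_continuous_image[OF contE]], simp)
    (rule compact_imp_bounded[OF compact_continuous_image[OF contdE]], simp)
  then obtain M0 M1 where M0: "\<And>x. x \<in> {-1/2..1/2} ==> norm (E (of_real x)) \<le> M0"
   and M1: "\<And>x. x \<in> {-1/2..1/2} ==> norm (deriv E (of_real x)) \<le> M1" unfolding bounded_iff ball_simps by blast
  have ne: "norm (e m x) = 1" for m x unfolding e_def by (simp add: norm_exp_eq_Re)
  show ?thesis proof (rule that[of "(2 * M0 + M1)"])
   fix m :: int assume m: "m \<noteq> 0"
   define w where "w = mtpi*(of_int m :: complex)"
   have w0: "w \<noteq> 0" using m by (simp add: w_def)
   have nw: "norm w = 2*pi*\<bar>real_of_int m\<bar>" by (simp add: w_def norm_mult)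
   have "((\<lambda>x. E (of_real x)*e m x/w) has_vector_derivative (E (of_real x)*e m x + deriv E (of_real x)*e m x/w)) (at x within {-1/2..1/2})"
    if "x \<in> {-1/2..1/2}" for x proof -
    have "((\<lambda>z. E z*exp (w*z)/w) has_field_derivative
     (E (of_real x)*exp (w * of_real x) + deriv E (of_real x)*exp (w * of_real x)/w)) (at (of_real x))"
     using w0 by (auto intro!: derivative_eq_intros dE[OF inS[OF that]] simp: field_simps)
    from has_vector_derivative_real_field[OF this] show ?thesis by (simp add: e_def w_def)
   qed
   then have FTC: "((\<lambda>x. E (of_real x)*e m x + deriv E (of_real x)*e m x/w) has_integral
     (E (of_real (1/2))*e m (1/2)/w - E (of_real (-1/2))*e m (-1/2)/w)) {-1/2..1/2}" by (intro fundamental_theorem_of_calculus) auto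
   have i2: "(\<lambda>x. deriv E (of_real x)*e m x/w) integrable_on {-1/2..1/2::real}"
    using w0 by (intro integrable_continuous_real continuous_intros contdE conte) auto
   define I2 where "I2 = integral {-1/2..1/2::real} (\<lambda>x. deriv E (of_real x)*e m x/w)"
   have "c m = (E (of_real (1/2))*e m (1/2)/w - E (of_real (-1/2))*e m (-1/2)/w) - I2"
    using has_integral_diff[OF FTC integrable_integral[OF i2]] unfolding c_def I2_def by (simp add: integral_unique)
   also have "norm ... \<le> norm (E (of_real (1/2))*e m (1/2)/w) + norm (E (of_real (-1/2))*e m (-1/2)/w) + norm I2"
    by (meson add_mono norm_triangle_ineq4 order_refl order_trans)
   also have "... \<le> M0/norm w + M0/norm w + M1/norm w" proof (intro add_mono)
    show "norm (E (of_real (1/2))*e m (1/2)/w) \<le> M0/norm w"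
     unfolding norm_divide norm_mult ne using M0[of "1/2"] by (intro divide_right_mono) auto
    show "norm (E (of_real (-1/2))*e m (-1/2)/w) \<le> M0/norm w"
     unfolding norm_divide norm_mult ne using M0[of "-1/2"] by (intro divide_right_mono) auto

    have "norm I2 \<le> integral {-1/2..1/2::real} (\<lambda>x. M1/norm w)" unfolding I2_def proof (rule integral_norm_bound_integral[OF i2])
     show "norm (deriv E (of_real x)*e m x/w) \<le> M1/norm w" if "x \<in> {-1/2..1/2}" for x
      unfolding norm_divide norm_mult ne using M1[OF that] by (intro divide_right_mono) auto
    qed auto
    then show "norm I2 \<le> M1/norm w" by simp
   qed
   also have "... = (2*M0 + M1)/norm w" by (simp add: add_divide_distrib)
   also have "... \<le> (2*M0 + M1) / \<bar>real_of_int m\<bar>" proof (rule divide_left_mono)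
    have "0 \<le> M0" "0 \<le> M1" using order_trans[OF norm_ge_zero M0[of 0]] order_trans[OF norm_ge_zero M1[of 0]] by simp_all
    then show "0 \<le> 2*M0+M1" by simp
    have "1*\<bar>real_of_int m\<bar> \<le> (2*pi)*\<bar>real_of_int m\<bar>" using pi_ge_two by (intro mult_right_mono) auto
    then show "\<bar>real_of_int m\<bar> \<le> norm w" unfolding nw by simp
    show "0 < norm w*\<bar>real_of_int m\<bar>" using w0 m by simp
   qed
   finally show "norm (c m) \<le> (2 * M0 + M1) / \<bar>real_of_int m\<bar>" .
  qed
 qed
 have M0: "M \<ge> 0" using M[of 1] norm_ge_zero[of "c 1"] by (simp del: norm_ge_zero)
 have c1: "(\<lambda>N. c (int N)) \<longlonglongrightarrow> 0" proof (rule Lim_null_comparison)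
  show "eventually (\<lambda>N. norm (c (int N)) \<le> M/real N) sequentially" proof (rule eventually_mono[OF eventually_gt_at_top[of 0]])
   fix N :: nat assume "0 < N"
   then show "norm (c (int N)) \<le> M/real N" using M[of "int N"] by simp
  qed
  show "(\<lambda>N. M/real N) \<longlonglongrightarrow> 0" by (rule lim_const_over_n)
 qed
 have c2: "(\<lambda>N. c (- int N - 1)) \<longlonglongrightarrow> 0" proof (rule Lim_null_comparison)
  show "eventually (\<lambda>N. norm (c (- int N - 1)) \<le> M/real N) sequentially" using eventually_gt_at_top[of 0] proof eventually_elim
   case (elim N)
   have "norm (c (- int N - 1)) \<le> M / \<bar>real_of_int (- int N - 1)\<bar>" by (rule M) simp
   also have "... \<le> M/real N" using elim M0 by (intro divide_left_mono) auto
   finally show ?case .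
  qed
  show "(\<lambda>N. M/real N) \<longlonglongrightarrow> 0" by (rule lim_const_over_n)
 qed
 show ?thesis unfolding sum using tendsto_add[OF tendsto_const tendsto_diff[OF c2 c1], of "f 0"] by simp
qed

section \<open>The Gaussian integral with a complex parameter\<close>

lemma gaussian_primitive:
 obtains G :: "complex => complex" where "\<And>z. (G has_field_derivative exp (- a*z^2)) (at z)" proof -
 have "(\<lambda>z. exp (- a*z^2)) holomorphic_on UNIV" by (intro holomorphic_intros)
 then show ?thesis by (rule holomorphic_convex_primitive'[OF convex_UNIV open_UNIV]) (rule that, simp)
qed

text \<open>The classical evaluation of the Gaussian integral by differentiation under the integral sign;
  it also covers complex \<open>a\<close>.\<close>

lemma gaussian_primitive_square:
 assumes G: "\<And>z. (G has_field_derivative exp (- a*z^2)) (at z)" and a: "Re a > 0" shows "(G (of_real R) - G 0)^2 +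
  integral {0..1::real} (\<lambda>s. exp (- a*(of_real R)^2*(1 + (of_real s)^2))/(a*(1 + (of_real s)^2)))
  = of_real pi/(4*a)" proof -
 have a0: "a \<noteq> 0" using a by auto
 have s0: "1 + (of_real s :: complex)^2 \<noteq> 0" for s :: real proof -
  have "1 + (of_real s :: complex)^2 = of_real (1 + s^2)" by simp
  moreover have "1 + s^2 \<noteq> 0" using zero_le_power2[of s] by linarith
  ultimately show ?thesis using of_real_eq_0_iff by metis
 qed
 define \<phi> where "\<phi> = (\<lambda>z s. exp (- a*z^2*(1 + (of_real s)^2))/(a*(1 + (of_real s)^2)) :: complex)"
 define \<phi>' where "\<phi>' = (\<lambda>(z::complex) (s::real). - 2*z*exp (- a*z^2*(1 + (of_real s)^2)))"
 define H where "H = (\<lambda>z. (G z - G 0)^2 + integral (cbox 0 (1::real)) (\<phi> z))"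
 have I: "((\<lambda>z. integral (cbox 0 (1::real)) (\<phi> z)) has_field_derivative integral (cbox 0 1) (\<phi>' z)) (at z within UNIV)" for z
 proof (rule leibniz_rule_field_derivative)
  show "((\<lambda>z. \<phi> z t) has_field_derivative \<phi>' z t) (at z within UNIV)" for z t proof -
   define c where "c = a*(1 + (of_real t :: complex)^2)"
   have c0: "c \<noteq> 0" using a0 s0[of t] by (simp only: c_def mult_eq_0_iff simp_thms)
   have e: "- a*w^2*(1 + (of_real t :: complex)^2) = - (c*w^2)" for w by (simp add: c_def algebra_simps)
   have "((\<lambda>w. exp (- (c*w^2))/c) has_field_derivative (exp (- (c*z^2)) * - (c*(2*z))/c)) (at z)"
    by (rule derivative_eq_intros refl c0 | simp)+
   then show ?thesis unfolding \<phi>_def \<phi>'_def e c_def[symmetric] using c0 by (simp add: mult_ac)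
  qed
  show "\<phi> z integrable_on cbox 0 1" for z
   unfolding \<phi>_def by (intro integrable_continuous continuous_intros) (intro ballI, simp only: a0 s0 mult_eq_0_iff simp_thms)
  show "continuous_on (UNIV \<times> cbox 0 1) (\<lambda>(z, t). \<phi>' z t)" unfolding \<phi>'_def split_beta by (intro continuous_intros)
 qed auto
 have J: "integral (cbox 0 (1::real)) (\<phi>' z) = - 2*exp (- a*z^2)*(G z - G 0)" for z proof -
  have "((\<lambda>s. G (z * of_real s)) has_vector_derivative (exp (- a*(z * of_real s)^2)*z)) (at s within {0..1})" for s proof -
   have "((\<lambda>w. G (z*w)) has_field_derivative (exp (- a*(z * of_real s)^2)*z)) (at (of_real s))"
    by (rule DERIV_chain2[OF G]) (auto intro!: derivative_eq_intros)
   from has_vector_derivative_real_field[OF this] show ?thesis .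
  qed
  then have "((\<lambda>s. exp (- a*(z * of_real s)^2)*z) has_integral (G (z * of_real 1) - G (z * of_real 0))) {0..1}"
   by (intro fundamental_theorem_of_calculus) auto
  then have "((\<lambda>s. (- 2*exp (- a*z^2))*(exp (- a*(z * of_real s)^2)*z)) has_integral (- 2*exp (- a*z^2))*(G z - G 0)) {0..1}"
   by (intro has_integral_mult_right) simp
  moreover have "(- 2*exp (- a*z^2))*(exp (- a*(z * of_real s)^2)*z) = \<phi>' z s" for s proof -
   have "exp (- a*z^2*(1 + (of_real s)^2)) = exp (- a*z^2)*exp (- a*(z * of_real s)^2)"
    by (simp add: exp_add[symmetric] algebra_simps power_mult_distrib)
   then show ?thesis by (simp add: \<phi>'_def)
  qed
  ultimately show ?thesis by (simp add: integral_unique)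
 qed
 have "(H has_field_derivative 0) (at z)" for z proof -
  have "((\<lambda>z. (G z - G 0)^2) has_field_derivative (2*(G z - G 0)*exp (- a*z^2))) (at z)"
   by (rule DERIV_cong[OF DERIV_power[OF DERIV_diff[OF G DERIV_const]]]) simp
  from DERIV_add[OF this I[of z]]
  have "(H has_field_derivative (2*(G z - G 0)*exp (- a*z^2) + integral (cbox 0 1) (\<phi>' z))) (at z)" unfolding H_def .
  then show ?thesis by (rule DERIV_cong) (unfold J, simp add: algebra_simps)
 qed
 then have "\<exists>c. \<forall>z\<in>UNIV. H z = c" by (intro has_field_derivative_zero_constant) auto
 then obtain c where c: "\<And>z. H z = c" by blast
 have "integral (cbox 0 (1::real)) (\<phi> 0) = of_real pi/(4*a)" proof -
  have "((\<lambda>s. 1/(1 + s^2)) has_integral (arctan 1 - arctan 0)) {0..1::real}" by (intro fundamental_theorem_of_calculus)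
    (auto intro!: derivative_eq_intros simp: has_real_derivative_iff_has_vector_derivative[symmetric] field_simps)
  then have "((\<lambda>s. of_real (1/(1 + s^2))/a) has_integral (of_real (pi/4)/a)) {0..1::real}"
   by (intro has_integral_divide has_integral_of_real) (simp add: arctan_one)
  then show ?thesis by (intro integral_unique) (simp add: \<phi>_def mult.commute)
 qed
 then have "H 0 = of_real pi/(4*a)" by (simp add: H_def)
 then have "H (of_real R) = of_real pi/(4*a)" using c by metis
 then show ?thesis by (simp add: H_def \<phi>_def)
qed

lemma gaussian_primitive_rest_le:
 assumes a: "Re a > 0" shows "norm (integral {0..1::real} (\<lambda>s. exp (- a*(of_real R)^2*(1 + (of_real s)^2))/(a*(1 + (of_real s)^2))))
  \<le> exp (- Re a * R^2)*(pi/(4*norm a))" proof -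
 have a0: "a \<noteq> 0" using a by auto
 have n1: "norm (1 + (of_real s :: complex)^2) = 1 + s^2" for s :: real proof -
  have "1 + (of_real s :: complex)^2 = of_real (1 + s^2)" by simp
  then show ?thesis by (metis abs_of_nonneg norm_of_real add_nonneg_nonneg zero_le_one zero_le_power2)
 qed
 have s0: "1 + (of_real s :: complex)^2 \<noteq> 0" for s :: real
  using n1[of s] by (metis add_pos_nonneg norm_zero order_less_irrefl zero_le_power2 zero_less_one)
 have I: "((\<lambda>s. exp (- Re a * R^2)/norm a*(1/(1 + s^2))) has_integral exp (- Re a * R^2)/norm a*(arctan 1 - arctan 0)) {0..1::real}"
  by (intro has_integral_mult_right fundamental_theorem_of_calculus)
   (auto intro!: derivative_eq_intros simp: has_real_derivative_iff_has_vector_derivative[symmetric] field_simps)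
 have "norm (integral {0..1::real} (\<lambda>s. exp (- a*(of_real R)^2*(1 + (of_real s)^2))/(a*(1 + (of_real s)^2))))
  \<le> integral {0..1} (\<lambda>s. exp (- Re a * R^2)/norm a*(1/(1 + s^2)))" proof (rule integral_norm_bound_integral)
  show "(\<lambda>s. exp (- a*(of_real R)^2*(1 + (of_real s)^2))/(a*(1 + (of_real s)^2))) integrable_on {0..1::real}"
   by (intro integrable_continuous_real continuous_intros) (intro ballI, simp only: a0 s0 mult_eq_0_iff simp_thms)
  show "(\<lambda>s. exp (- Re a * R^2)/norm a*(1/(1 + s^2))) integrable_on {0..1::real}" using I by (rule has_integral_integrable)
  fix s :: real assume "s \<in> {0..1}"
  have "norm (exp (- a*(of_real R)^2*(1 + (of_real s)^2))) = exp (- Re a * R^2*(1 + s^2))" proof -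
   have "- a*(of_real R)^2*(1 + (of_real s)^2) = of_real (R^2*(1 + s^2))*(- a)" by (simp add: mult_ac)
   then show ?thesis unfolding norm_exp_eq_Re by (simp add: mult_ac)
  qed
  also have "... \<le> exp (- Re a * R^2)" proof -
   have "Re a * R^2*1 \<le> Re a * R^2*(1 + s^2)" using a by (intro mult_left_mono) auto
   then show ?thesis by simp
  qed
  finally have "norm (exp (- a*(of_real R)^2*(1 + (of_real s)^2))) \<le> exp (- Re a * R^2)" .
  then show "norm (exp (- a*(of_real R)^2*(1 + (of_real s)^2))/(a*(1 + (of_real s)^2))) \<le> exp (- Re a * R^2)/norm a*(1/(1 + s^2))"
   unfolding norm_divide norm_mult n1 using zero_le_power2[of s] by (simp add: divide_right_mono zero_le_mult_iff add_nonneg_nonneg)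
 qed
 also have "... = exp (- Re a * R^2)*(pi/(4*norm a))" using integral_unique[OF I] by (simp add: arctan_one)
 finally show ?thesis .
qed

text \<open>The preceding identity determines only the square of the limit. The sign follows by
  continuity: \<open>v R\<close> squares to 1 up to an error smaller than 1, hence never has zero
  real part for \<open>R > 0\<close>, and it leaves 0 in the direction of \<open>c\<close>, which
  lies in the right half plane.\<close>

lemma gaussian_primitive_limit:
 assumes G: "\<And>z. (G has_field_derivative exp (- a*z^2)) (at z)" and a: "Re a > 0"
  and lim: "(\<lambda>N. 2*(G (of_real (X N)) - G 0)) \<longlonglongrightarrow> \<kappa>" and X: "filterlim X at_top sequentially"
 shows "\<kappa> * csqrt (a/of_real pi) = 1" proof -
 define I where "I = (\<lambda>R::real. integral {0..1::real} (\<lambda>s. exp (- a*(of_real R)^2*(1 + (of_real s)^2))/(a*(1 + (of_real s)^2))))"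
 define c where "c = csqrt (a/of_real pi)"
 have a0: "a \<noteq> 0" using a by auto
 have c2: "c^2 = a/of_real pi" by (simp add: c_def)
 define v where "v = (\<lambda>R::real. 2*(G (of_real R) - G 0)*c)"
 have v2: "(v R)^2 = 1 - 4*a/of_real pi * I R" for R proof -
  have "(G (of_real R) - G 0)^2 = of_real pi/(4*a) - I R" using gaussian_primitive_square[OF G a, of R] unfolding I_def by (simp add: eq_diff_eq)
  then show ?thesis unfolding v_def power_mult_distrib c2 using a0 by (simp add: field_simps)
 qed
 have small: "norm (4*a/of_real pi * I R) \<le> exp (- Re a * R^2)" for R proof -
  have "norm (4*a/of_real pi * I R) \<le> 4*norm a/pi*(exp (- Re a * R^2)*(pi/(4*norm a)))"
   unfolding norm_mult[of "4*a/of_real pi"] using gaussian_primitive_rest_le[OF a, of R]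
   by (intro mult_mono) (auto simp: I_def norm_divide norm_mult)
  also have "... = exp (- Re a * R^2)" using a0 by simp
  finally show ?thesis .
 qed
 have Re0: "Re (v R) \<noteq> 0" if "R > 0" for R proof
  assume "Re (v R) = 0"
  then have "Re ((v R)^2) \<le> 0" by (simp add: Re_power2)
  moreover have "Re ((v R)^2) \<ge> 1 - norm (4*a/of_real pi * I R)" unfolding v2 using complex_Re_le_cmod[of "4*a/of_real pi * I R"] by simp
  moreover have "exp (- Re a * R^2) < 1" using a that by simp
  ultimately show False using small[of R] by linarith
 qed
 have contv: "continuous_on X v" for X proof -
  have "continuous_on UNIV G" using G by (meson DERIV_isCont continuous_at_imp_continuous_on)
  then have "continuous_on X (\<lambda>R. G (of_real R))" for X :: "real set" by (rule continuous_on_compose2) (auto intro!: continuous_intros)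
  then show ?thesis unfolding v_def by (intro continuous_intros)
 qed
 have "((\<lambda>z. 2*(G z - G 0)*c) has_field_derivative (2*(exp (- a*(of_real 0)^2) - 0)*c)) (at (of_real 0))"
  by (intro DERIV_cmult_right DERIV_cmult DERIV_diff G DERIV_const)
 from has_vector_derivative_real_field[OF this, of UNIV]
 have dv: "(v has_vector_derivative 2*c) (at 0)" by (simp add: v_def)
 have "((\<lambda>R. Re (v R)) has_vector_derivative Re (2*c)) (at 0)" by (rule bounded_linear.has_vector_derivative[OF bounded_linear_Re dv])
 then have dRe: "((\<lambda>R. Re (v R)) has_real_derivative 2 * Re c) (at 0)" by (simp add: has_real_derivative_iff_has_vector_derivative)
 have "Re c > 0" proof -
  have "Re c \<ge> 0" using Re_csqrt[of "a/of_real pi"] by (simp add: c_def)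
  moreover have "Re c \<noteq> 0" proof
   assume "Re c = 0"
   then have "Re (c^2) \<le> 0" by (simp add: Re_power2)
   moreover have "Re (c^2) > 0" unfolding c2 using a by (simp add: Re_divide_of_real)
   ultimately show False by simp
  qed
  ultimately show ?thesis by simp
 qed
 then have "\<exists>d>0. \<forall>h>0. h < d --> Re (v 0) < Re (v (0 + h))" using DERIV_pos_inc_right[OF dRe] by simp
 then obtain d where d: "d > 0" "\<And>h. 0 < h ==> h < d ==> 0 < Re (v h)" by (auto simp: v_def)
 have pos: "Re (v R) > 0" if "R > 0" for R proof (rule ccontr)
  assume nR: "\<not> Re (v R) > 0"
  define r where "r = min R d/2"
  have r: "0 < r" "r < d" "r < R" using that d by (auto simp: r_def)
  have "\<exists>x\<ge>r. x \<le> R \<and> Re (v x) = 0"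
   by (rule IVT2'[of "\<lambda>x. Re (v x)"]) (use r d(2)[of r] nR in \<open>auto intro!: continuous_intros contv\<close>)
  then obtain x where "r \<le> x" "Re (v x) = 0" by blast
  then show False using Re0[of x] r by simp
 qed
 have lv: "(\<lambda>N. v (X N)) \<longlonglongrightarrow> \<kappa>*c" unfolding v_def by (intro tendsto_mult lim tendsto_const)
 have ev: "eventually (\<lambda>N. 0 < X N) sequentially" using X by (simp add: filterlim_at_top_dense)
 have "0 \<le> Re (\<kappa>*c)"
  by (rule tendsto_lowerbound[OF tendsto_Re[OF lv]]) (use ev pos in \<open>auto elim!: eventually_mono intro!: less_imp_le\<close>)
 moreover have "(\<kappa>*c)^2 = 1" proof (rule LIMSEQ_unique[OF tendsto_power[OF lv]])
  have "((\<lambda>R. exp (- Re a * R^2)) \<longlongrightarrow> 0) at_top" proof (rule filterlim_compose[OF exp_at_bot])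
   have "filterlim (\<lambda>R::real. Re a * R^2) at_top at_top"
    by (intro filterlim_tendsto_pos_mult_at_top[OF tendsto_const a] filterlim_pow_at_top filterlim_ident) auto
   then show "filterlim (\<lambda>R::real. - Re a * R^2) at_bot at_top" by (simp add: filterlim_uminus_at_top)
  qed
  then have "(\<lambda>N. exp (- Re a*(X N)^2)) \<longlonglongrightarrow> 0" by (rule filterlim_compose[OF _ X])
  then have "(\<lambda>N. 4*a/of_real pi * I (X N)) \<longlonglongrightarrow> 0" by (rule Lim_null_comparison[rotated]) (use small in auto)
  from tendsto_diff[OF tendsto_const this, of 1] show "(\<lambda>N. (v (X N))^2) \<longlonglongrightarrow> 1" unfolding v2 by simp
 qed
 ultimately have "\<kappa>*c \<noteq> -1" "(\<kappa>*c = 1) \<or> (\<kappa>*c = -1)"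
  by (auto simp only: power2_eq_1_iff) (simp_all add: complex_eq_iff)
 then show ?thesis unfolding c_def[symmetric] by blast
qed

text \<open>For \<open>Re a > 0\<close> this is the integral of \<open>exp(-a x^2)\<close> over the
  real line; \<open>csqrt\<close> provides the correct branch.\<close>

definition gauss_const :: "complex => complex" where
 "gauss_const a = 1/csqrt (a/of_real pi)"

text \<open>For \<open>Re a > 0\<close> the number \<open>csqrt (a/pi)\<close> has positive real
  part, and a positive factor keeps it in the right half plane, so the branch is respected.\<close>

lemma gauss_const_scale:
 assumes "c > 0" "Re a > 0" shows "gauss_const (of_real c*a) = gauss_const a/of_real (sqrt c)" proof -
 define w where "w = of_real (sqrt c) * csqrt (a/of_real pi)"
 have "w^2 = of_real c*a/of_real pi" using assms by (simp add: w_def power_mult_distrib flip: of_real_power)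
 moreover have "csqrt (w^2) = w" proof (rule csqrt_square)
  have "Re w = sqrt c * Re (csqrt (a/of_real pi))" by (simp add: w_def)
  moreover have "Re (csqrt (a/of_real pi)) > 0" proof -
   have "Re (csqrt (a/of_real pi)) \<ge> 0" using csqrt_principal[of "a/of_real pi"] by linarith
   moreover have "Re (csqrt (a/of_real pi)) \<noteq> 0" proof
    assume "Re (csqrt (a/of_real pi)) = 0"
    then have "Re ((csqrt (a/of_real pi))^2) \<le> 0" by (simp only: Re_power2) simp
    moreover have "Re ((csqrt (a/of_real pi))^2) > 0" using assms by (simp add: Re_divide_of_real)
    ultimately show False by simp
   qed
   ultimately show ?thesis by simp
  qed
  ultimately show "0 < Re w \<or> Re w = 0 \<and> 0 \<le> Im w" using assms by simp
 qed
 ultimately have "csqrt (of_real c*a/of_real pi) = w" by simp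
 then show ?thesis by (simp add: gauss_const_def w_def)
qed

lemma uniform_limit_theta_series:
 fixes A B :: "'a::type => complex"
 assumes c: "c > 0" and b: "\<And>n z. z \<in> Y ==> norm (f n z) \<le> K*exp (- c*(real_of_int n)^2 + R*\<bar>real_of_int n\<bar>)"
 shows "uniform_limit Y (\<lambda>X y. \<Sum>n\<in>X. f n y) (\<lambda>y. \<Sum>\<^sub>\<infinity>n\<in>UNIV. f n y :: complex) (finite_subsets_at_top (UNIV :: int set))"
 by (rule Weierstrass_m_test_general[where M="\<lambda>n. K*exp (- c*(real_of_int n)^2 + R*\<bar>real_of_int n\<bar>)"])
   (use b in simp, intro summable_on_cmult_right summable_on_gaussian c)

text \<open>Unconditional sums over the integers are limits over finite sets; these intervals link
  them with symmetric partial sums, the ones that telescope.\<close>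

lemma filterlim_symmetric_intervals:
 "filterlim (\<lambda>N. {- int N..int N}) (finite_subsets_at_top UNIV) sequentially" unfolding filterlim_finite_subsets_at_top
proof (intro allI impI)
 fix X :: "int set" assume X: "finite X \<and> X \<subseteq> UNIV"
 define M where "M = nat (Max (insert 0 (abs ` X)))"
 show "\<forall>\<^sub>F N in sequentially. finite {- int N..int N} \<and> X \<subseteq> {- int N..int N} \<and> {- int N..int N} \<subseteq> UNIV"
  using eventually_ge_at_top[of M] proof eventually_elim
  case (elim N)
  have "x \<in> {- int N..int N}" if "x \<in> X" for x proof -
   have "\<bar>x\<bar> \<le> Max (insert 0 (abs ` X))" using X that by (intro Max_ge) auto
   moreover have "0 \<le> Max (insert 0 (abs ` X))" using X by (intro Max_ge) auto
   ultimately have "\<bar>x\<bar> \<le> int M" unfolding M_def by linarith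
   then show ?thesis using elim by auto
  qed
  then show ?case by auto
 qed
qed

section \<open>Poisson summation for a translated Gaussian\<close>

lemma norm_exp_shifted_le:
 fixes a z :: complex
 assumes a: "Re a > 0" and z: "norm z \<le> r"
 shows "norm (exp (- a*(of_int n + z)^2)) \<le> exp (norm a * r^2)*exp (- Re a*(real_of_int n)^2 + (2*norm a * r)*\<bar>real_of_int n\<bar>)" proof -
 have r: "r \<ge> 0" using z norm_ge_zero order_trans by blast
 have "- a*(of_int n + z)^2 = - (of_real ((real_of_int n)^2)*a) + (- (2 * of_int n*a*z) - a*z^2)" by (simp add: algebra_simps power2_eq_square)
 then have "Re (- a*(of_int n + z)^2) = - Re a*(real_of_int n)^2 + Re (- (2 * of_int n*a*z) - a*z^2)" by (simp add: mult.commute)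
 also have "Re (- (2 * of_int n*a*z) - a*z^2) \<le> norm (2 * of_int n*a*z) + norm (a*z^2)"
  by (rule order_trans[OF complex_Re_le_cmod]) (metis norm_minus_cancel norm_triangle_ineq4)
 also have "norm (2 * of_int n*a*z) \<le> (2*norm a * r)*\<bar>real_of_int n\<bar>"
  using mult_left_mono[OF z, of "2*norm a*\<bar>real_of_int n\<bar>"] by (simp add: norm_mult mult_ac)
 also have "norm (a*z^2) \<le> norm a * r^2" using z by (simp add: norm_mult norm_power mult_left_mono power_mono)
 finally show ?thesis unfolding norm_exp_eq_Re exp_add[symmetric] by simp
qed

lemma gaussian_periodization_limit:
 assumes a: "Re a > 0" shows "uniform_limit (cball 0 r) (\<lambda>X z. \<Sum>n\<in>X. exp (- a*(of_int n + z)^2))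
  (\<lambda>z. \<Sum>\<^sub>\<infinity>n\<in>UNIV. exp (- a*(of_int n + z)^2)) (finite_subsets_at_top (UNIV :: int set))"
 by (rule uniform_limit_theta_series[OF a, where K="exp (norm a * r^2)" and R="2*norm a * r"])
  (use norm_exp_shifted_le[OF a] in auto)

lemma holomorphic_gaussian_periodization:
 assumes a: "Re a > 0" shows "(\<lambda>z. \<Sum>\<^sub>\<infinity>n\<in>(UNIV :: int set). exp (- a*(of_int n + z)^2)) holomorphic_on UNIV" proof -
 have "(\<lambda>z. \<Sum>\<^sub>\<infinity>n\<in>(UNIV :: int set). exp (- a*(of_int n + z)^2)) holomorphic_on ball 0 r" for r
 by (rule holomorphic_uniform_limit[OF _ gaussian_periodization_limit[OF a]])
   (auto intro!: always_eventually continuous_intros holomorphic_intros)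
 then have "(\<lambda>z. \<Sum>\<^sub>\<infinity>n\<in>(UNIV :: int set). exp (- a*(of_int n + z)^2)) field_differentiable (at z)" for z
  by (rule holomorphic_on_imp_differentiable_at[of _ "ball 0 (norm z + 1)"]) auto
 then show ?thesis by (simp add: holomorphic_on_def)
qed

text \<open>On the segment of length \<open>|w|\<close> from \<open>X\<close> to
  \<open>X + w\<close> the integrand is Gaussian small in \<open>|X|\<close>. This plays the role of
  a contour shift.\<close>

lemma gaussian_primitive_shift:
 assumes G: "\<And>z. (G has_field_derivative exp (- a*z^2)) (at z)" and a: "Re a > 0"
  and X: "filterlim (\<lambda>N. \<bar>X N\<bar>) at_top F"
 shows "((\<lambda>N. G (of_real (X N) + w) - G (of_real (X N))) \<longlongrightarrow> 0) F" proof (rule Lim_null_comparison)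
 define B where "B = (\<lambda>x. exp (norm a*(norm w)^2 - Re a*x^2 + (2*norm a*norm w)*x)*norm w)"
 show "\<forall>\<^sub>F N in F. norm (G (of_real (X N) + w) - G (of_real (X N))) \<le> B \<bar>X N\<bar>" proof (intro always_eventually allI)
  fix N
  let ?x = "of_real (X N) :: complex"
  have "norm (G (?x + w) - G ?x) \<le> exp (norm a*(norm w)^2 - Re a*(X N)^2 + (2*norm a*norm w)*\<bar>X N\<bar>)*norm ((?x + w) - ?x)"
  proof (rule field_differentiable_bound[of "closed_segment ?x (?x + w)"])
   show "(G has_field_derivative exp (- a*z^2)) (at z within closed_segment ?x (?x + w))" for z using G by (rule has_field_derivative_at_within)
   fix z assume "z \<in> closed_segment ?x (?x + w)"
   then obtain u where u: "0 \<le> u" "u \<le> 1" "z = (1 - u) *\<^sub>R ?x + u *\<^sub>R (?x + w)" by (auto simp: in_segment)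
   define h where "h = u *\<^sub>R w"
   have zh: "z = ?x + h" using u by (simp add: h_def algebra_simps)
   have hn: "norm h \<le> norm w" using u by (simp add: h_def mult_left_le_one_le)
   have "- a*z^2 = - (of_real ((X N)^2)*a) + (- (2 * ?x*a*h) - a*h^2)" unfolding zh by (simp add: algebra_simps power2_eq_square)
   then have "Re (- a*z^2) = - Re a*(X N)^2 + Re (- (2 * ?x*a*h) - a*h^2)" by (simp add: mult.commute)
   also have "Re (- (2 * ?x*a*h) - a*h^2) \<le> norm (2 * ?x*a*h) + norm (a*h^2)"
    by (rule order_trans[OF complex_Re_le_cmod]) (metis norm_minus_cancel norm_triangle_ineq4)
   also have "norm (2 * ?x*a*h) \<le> (2*norm a*norm w)*\<bar>X N\<bar>"
    using mult_left_mono[OF hn, of "2*norm a*\<bar>X N\<bar>"] by (simp add: norm_mult mult_ac)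
   also have "norm (a*h^2) \<le> norm a*(norm w)^2" using hn by (simp add: norm_mult norm_power mult_left_mono power_mono)
   finally show "norm (exp (- a*z^2)) \<le> exp (norm a*(norm w)^2 - Re a*(X N)^2 + (2*norm a*norm w)*\<bar>X N\<bar>)"
    unfolding norm_exp_eq_Re by simp
  qed auto
  then show "norm (G (?x + w) - G ?x) \<le> B \<bar>X N\<bar>" by (simp add: B_def)
 qed
 have "(B \<longlongrightarrow> 0*norm w) at_top" unfolding B_def proof (intro tendsto_mult tendsto_const filterlim_compose[OF exp_at_bot])
  have "filterlim (\<lambda>x. x*(Re a*x - 2*norm a*norm w)) at_top at_top" using filterlim_at_top_mult_at_top[OF filterlim_ident
    filterlim_tendsto_add_at_top[OF tendsto_const[of "- (2*norm a*norm w)"] filterlim_tendsto_pos_mult_at_top[OF tendsto_const a filterlim_ident]]]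
   by simp
  then have "filterlim (\<lambda>x. - (norm a*(norm w)^2) + x*(Re a*x - 2*norm a*norm w)) at_top at_top"
   by (rule filterlim_tendsto_add_at_top[OF tendsto_const])
  then have "filterlim (\<lambda>x. - (- (norm a*(norm w)^2) + x*(Re a*x - 2*norm a*norm w))) at_bot at_top"
   unfolding filterlim_uminus_at_bot by simp
  then show "filterlim (\<lambda>x. norm a*(norm w)^2 - Re a*x^2 + 2*norm a*norm w*x) at_bot at_top" by (simp add: algebra_simps power2_eq_square)
 qed
 then show "((\<lambda>N. B \<bar>X N\<bar>) \<longlongrightarrow> 0) F" using filterlim_compose[OF _ X, of B "nhds 0"] by simp
qed

text \<open>Completing the square turns the product with the character into the Gaussian of
  \<open>n + x + w m\<close> times a constant; the integrals over unit intervals then telescope to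
  values of the primitive at two far points.\<close>

lemma gaussian_unfold:
 fixes a z :: complex and m :: int
 assumes a: "Re a > 0" and G: "\<And>z. (G has_field_derivative exp (- a*z^2)) (at z)"
 defines "f \<equiv> \<lambda>z. \<Sum>\<^sub>\<infinity>n\<in>(UNIV :: int set). exp (- a*(of_int n + z)^2)"
 defines "w \<equiv> \<lambda>m::int. of_real pi*\<i> * of_int m/a + z"
 shows "(\<lambda>N. exp (- (of_real pi)\<^sup>2*(of_int m)^2/a + tpi * of_int m*z)*(G (of_real (real N + 1/2) + w m) - G (of_real (- real N - 1/2) + w m)))
  \<longlonglongrightarrow> integral {-1/2..1/2::real} (\<lambda>x. f (of_real x + z)*exp (mtpi * of_int m * of_real x))" proof -
 have a0: "a \<noteq> 0" using a by auto
 define e where "e = (\<lambda>x::real. exp (mtpi * of_int m * of_real x) :: complex)"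
 define Q where "Q = exp (- (of_real pi)\<^sup>2*(of_int m)^2/a + tpi * of_int m*z)"
 have ne: "norm (e x) = 1" for x by (simp add: e_def norm_exp_eq_Re)
 have sub: "of_real x + z \<in> cball 0 (1 + norm z)" if "x \<in> {-1/2..1/2::real}" for x proof -
  have "\<bar>x\<bar> \<le> 1" using that by (auto simp: abs_le_iff)
  then show ?thesis using norm_triangle_ineq[of "of_real x" z] by simp
 qed
 have "uniform_limit {-1/2..1/2} (\<lambda>X x. \<Sum>n\<in>X. exp (- a*(of_int n + (of_real x + z))^2)) (\<lambda>x. f (of_real x + z)) (finite_subsets_at_top (UNIV::int set))"
 proof (rule uniform_limitI)
  fix \<epsilon> :: real assume "0 < \<epsilon>"
  from uniform_limitD[OF gaussian_periodization_limit[OF a, of "1 + norm z"] this]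
  show "\<forall>\<^sub>F X in finite_subsets_at_top UNIV. \<forall>x\<in>{-1/2..1/2}. dist (\<Sum>n\<in>X. exp (- a*(of_int n + (of_real x + z))^2)) (f (of_real x + z)) < \<epsilon>"
   by eventually_elim (use sub in \<open>auto simp: f_def\<close>)
 qed
 then have u: "uniform_limit {-1/2..1/2} (\<lambda>X x. (\<Sum>n\<in>X. exp (- a*(of_int n + (of_real x + z))^2))*e x) (\<lambda>x. f (of_real x + z)*e x) (finite_subsets_at_top (UNIV::int set))"
 proof -
  assume u: "uniform_limit {-1/2..1/2} (\<lambda>X x. \<Sum>n\<in>X. exp (- a*(of_int n + (of_real x + z))^2)) (\<lambda>x. f (of_real x + z)) (finite_subsets_at_top (UNIV::int set))"
  show ?thesis proof (rule uniform_limitI)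
   fix \<epsilon> :: real assume "0 < \<epsilon>"
   from uniform_limitD[OF u this]
   show "\<forall>\<^sub>F X in finite_subsets_at_top UNIV. \<forall>x\<in>{-1/2..1/2}. dist ((\<Sum>n\<in>X. exp (- a*(of_int n + (of_real x + z))^2))*e x) (f (of_real x + z)*e x) < \<epsilon>"
    by eventually_elim (simp add: dist_norm norm_mult ne flip: left_diff_distrib)
  qed
 qed
 obtain I J where I: "\<And>X. ((\<lambda>x. (\<Sum>n\<in>X. exp (- a*(of_int n + (of_real x + z))^2))*e x) has_integral I X) {-1/2..1/2::real}"
  and J: "((\<lambda>x. f (of_real x + z)*e x) has_integral J) {-1/2..1/2::real}" and lim: "(I \<longlongrightarrow> J) (finite_subsets_at_top (UNIV::int set))"
 proof (rule uniform_limit_integral[OF u])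
  show "continuous_on {-1/2..1/2} (\<lambda>x. (\<Sum>n\<in>X. exp (- a*(of_int n + (of_real x + z))^2))*e x)" for X
   unfolding e_def by (intro continuous_intros)
 qed auto
 have trm: "((\<lambda>x. exp (- a*(of_int n + (of_real x + z))^2)*e x) has_integral
   Q*(G (of_int n + 1/2 + w m) - G (of_int n - 1/2 + w m))) {-1/2..1/2::real}" for n proof -
  have "exp (- a*(of_int n + (of_real x + z))^2)*e x = Q*exp (- a*(of_int n + of_real x + w m)^2)" for x proof -
   \<comment> \<open>The inserted factor is 1 and replaces \<open>x\<close> by \<open>x + n\<close>
     in the character.\<close>
   have "exp (- a*(of_int n + (of_real x + z))^2)*e x = exp (- a*(of_int n + (of_real x + z))^2)*(e x*exp (tpi * of_int (- m*n)))"
    using exp_two_pi_i by (subst (2) exp_eq_1[THEN iffD2]) (auto intro!: exI[of _ "- m*n"])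
   also have "... = Q*exp (- a*(of_int n + of_real x + w m)^2)" unfolding e_def Q_def w_def exp_add[symmetric]
    by (rule arg_cong[where f=exp]) (use a0 in \<open>simp add: field_simps power2_eq_square\<close>)
   finally show ?thesis .
  qed
  moreover have "((\<lambda>x. Q*exp (- a*(of_int n + of_real x + w m)^2)) has_integral
    Q*(G (of_int n + of_real (1/2) + w m) - G (of_int n + of_real (-1/2) + w m))) {-1/2..1/2::real}"
  proof (intro has_integral_mult_right fundamental_theorem_of_calculus)
   fix x :: real
   have "((\<lambda>z. G (of_int n + z + w m)) has_field_derivative exp (- a*(of_int n + of_real x + w m)^2)*1) (at (of_real x))"
    by (rule DERIV_chain2[OF G]) (auto intro!: derivative_eq_intros)
   from has_vector_derivative_real_field[OF this]
   show "((\<lambda>x. G (of_int n + of_real x + w m)) has_vector_derivative exp (- a*(of_int n + of_real x + w m)^2)) (at x within {-1/2..1/2})"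
    by simp
  qed auto
  ultimately show ?thesis by simp
 qed
 have IX: "I X = (\<Sum>n\<in>X. Q*(G (of_int n + 1/2 + w m) - G (of_int n - 1/2 + w m)))" if "finite X" for X proof -
  have "((\<lambda>x. \<Sum>n\<in>X. exp (- a*(of_int n + (of_real x + z))^2)*e x) has_integral (\<Sum>n\<in>X. Q*(G (of_int n + 1/2 + w m) - G (of_int n - 1/2 + w m)))) {-1/2..1/2::real}"
   by (intro has_integral_sum that trm)
  then show ?thesis using I[of X] by (simp add: sum_distrib_right has_integral_unique)
 qed
 have "I {-int N..int N} = Q*(G (of_real (real N + 1/2) + w m) - G (of_real (- real N - 1/2) + w m))" for N proof -
  have "(\<Sum>n\<in>{-int N..int N}. Q*(G (of_int n + 1/2 + w m) - G (of_int n - 1/2 + w m)))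
   = Q*(G (of_real (real N + 1/2) + w m) - G (of_real (- real N - 1/2) + w m))" proof (induction N)
   case 0
   show ?case by simp
  next
   case (Suc N)
   have "{-int (Suc N)..int (Suc N)} = insert (-int (Suc N)) (insert (int (Suc N)) {-int N..int N})" by auto
   then have "(\<Sum>n\<in>{-int (Suc N)..int (Suc N)}. Q*(G (of_int n + 1/2 + w m) - G (of_int n - 1/2 + w m)))
    = Q*(G (of_int (-int (Suc N)) + 1/2 + w m) - G (of_int (-int (Suc N)) - 1/2 + w m))
    + (Q*(G (of_int (int (Suc N)) + 1/2 + w m) - G (of_int (int (Suc N)) - 1/2 + w m))
    + Q*(G (of_real (real N + 1/2) + w m) - G (of_real (- real N - 1/2) + w m)))" using Suc.IH by simp
   moreover have "of_int (-int (Suc N)) + 1/2 = (of_real (- real N - 1/2) :: complex)"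
    "of_int (int (Suc N)) - 1/2 = (of_real (real N + 1/2) :: complex)"
    "of_int (-int (Suc N)) - 1/2 = (of_real (- real (Suc N) - 1/2) :: complex)"
    "of_int (int (Suc N)) + 1/2 = (of_real (real (Suc N) + 1/2) :: complex)" by (simp_all add: complex_eq_iff)
   ultimately show ?case by (simp only: right_diff_distrib) simp
  qed
  then show ?thesis using IX[of "{-int N..int N}"] by simp
 qed
 moreover have "(\<lambda>N. I {-int N..int N}) \<longlonglongrightarrow> J" by (rule filterlim_compose[OF lim filterlim_symmetric_intervals])
 moreover have "J = integral {-1/2..1/2::real} (\<lambda>x. f (of_real x + z)*e x)" using J by (simp add: integral_unique)
 ultimately show ?thesis unfolding Q_def e_def by simp
qed

text \<open>Moving both end points back to the real axis shows that the coefficient of index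
  \<open>m\<close> is an explicit factor times the one of index 0, and the latter is the Gaussian
  integral.\<close>

lemma gaussian_fourier_coefficient:
 fixes z :: complex and m :: int
 assumes a: "Re a > 0"
 defines "f \<equiv> \<lambda>z. \<Sum>\<^sub>\<infinity>n\<in>(UNIV :: int set). exp (- a*(of_int n + z)^2)"
 shows "integral {-1/2..1/2::real} (\<lambda>x. f (of_real x + z)*exp (mtpi * of_int m * of_real x))
  = gauss_const a*exp (- (of_real pi)\<^sup>2*(of_int m)^2/a + tpi * of_int m*z)" proof -
 obtain G where G: "\<And>z. (G has_field_derivative exp (- a*z^2)) (at z)" using gaussian_primitive[of a] by blast
 have a0: "a \<noteq> 0" using a by auto
 define w where "w = (\<lambda>m::int. of_real pi*\<i> * of_int m/a + z)"
 define A where "A = (\<lambda>m::int. integral {-1/2..1/2::real} (\<lambda>x. f (of_real x + z)*exp (mtpi * of_int m * of_real x)))"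
 define X where "X = (\<lambda>N::nat. real N + 1/2)"
 have Xlim: "filterlim X at_top sequentially" unfolding X_def by (rule filterlim_at_top_mono[OF filterlim_real_sequentially]) simp
 have X1: "filterlim (\<lambda>N. \<bar>X N\<bar>) at_top sequentially" "filterlim (\<lambda>N. \<bar>- X N\<bar>) at_top sequentially"
  by (auto intro!: filterlim_at_top_mono[OF Xlim] always_eventually)
 define D where "D = (\<lambda>N. G (of_real (X N)) - G (of_real (- X N)))"
 have odd: "G (- z) - G 0 = - (G z - G 0)" for z proof -
  have "((\<lambda>z. G z + G (- z)) has_field_derivative (exp (- a*z^2) + exp (- a*(- z)^2) * - 1)) (at z within UNIV)" for z proof -
   have "((\<lambda>z. G (- z)) has_field_derivative (exp (- a*(- z)^2) * - 1)) (at z)"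
    by (rule DERIV_chain2[OF G]) (auto intro!: derivative_eq_intros)
   from DERIV_add[OF G this] show ?thesis by simp
  qed
  then have "\<exists>c. \<forall>z\<in>UNIV. G z + G (- z) = c" by (intro has_field_derivative_zero_constant) auto
  then obtain c where c: "\<forall>z\<in>UNIV. G z + G (- z) = c" by (rule exE)
  have "G z + G (- z) = G 0 + G (- 0)" using bspec[OF c UNIV_I, of z] bspec[OF c UNIV_I, of 0] by simp
  then have "G (- z) = G 0 + G 0 - G z" by (simp add: eq_diff_eq add.commute)
  then show ?thesis by simp
 qed
 have D2: "D N = 2*(G (of_real (X N)) - G 0)" for N using odd[of "of_real (X N)"] unfolding D_def by (simp add: algebra_simps)
 define q where "q = (\<lambda>m::int. exp (- (of_real pi)\<^sup>2*(of_int m)^2/a + tpi * of_int m*z))"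
 have Am: "(\<lambda>N. q m * D N) \<longlonglongrightarrow> A m" for m proof -
  have l: "(\<lambda>N. q m*(G (of_real (X N) + w m) - G (of_real (- X N) + w m))) \<longlonglongrightarrow> A m"
   using gaussian_unfold[OF a G, of m z] unfolding q_def w_def A_def f_def X_def by simp
  have "(\<lambda>N. q m*((G (of_real (X N) + w m) - G (of_real (X N))) - (G (of_real (- X N) + w m) - G (of_real (- X N))))) \<longlonglongrightarrow> q m*(0 - 0)"
   by (intro tendsto_mult tendsto_const tendsto_diff gaussian_primitive_shift[OF G a] X1)
  from tendsto_diff[OF l this] show ?thesis unfolding D_def by (simp add: algebra_simps)
 qed
 have "q 0 = 1" by (simp add: q_def)
 then have "D \<longlonglongrightarrow> A 0" using Am[of 0] by simp
 then have "A 0 * csqrt (a/of_real pi) = 1" unfolding D2 by (rule gaussian_primitive_limit[OF G a _ Xlim])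
 then have A0: "A 0 = gauss_const a" unfolding gauss_const_def by (metis div_by_0 eq_divide_imp mult_zero_right zero_neq_one)
 have Aq: "A m = gauss_const a*q m" for m proof -
  have "(\<lambda>N. q m * D N) \<longlonglongrightarrow> q m * A 0" by (intro tendsto_mult tendsto_const \<open>D \<longlonglongrightarrow> A 0\<close>)
  from LIMSEQ_unique[OF this Am] show ?thesis by (simp add: A0 mult.commute)
 qed
 show ?thesis using Aq[of m] unfolding A_def q_def .
qed

text \<open>The Fourier theorem yields only symmetric partial sums; the Gaussian decay of the dual
  terms, from \<open>Re (pi^2/a) > 0\<close>, makes the sum unconditional.\<close>

theorem gaussian_poisson:
 assumes a: "Re a > 0" shows "((\<lambda>m. gauss_const a*exp (- (of_real pi)\<^sup>2*(of_int m)^2/a + tpi * of_int m*z))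
  has_sum (\<Sum>\<^sub>\<infinity>n\<in>(UNIV :: int set). exp (- a*(of_int n + z)^2))) UNIV" proof -
 have a0: "a \<noteq> 0" using a by auto
 define f where "f = (\<lambda>z. \<Sum>\<^sub>\<infinity>n\<in>(UNIV :: int set). exp (- a*(of_int n + z)^2))"
 define A where "A = (\<lambda>m::int. integral {-1/2..1/2::real} (\<lambda>x. f (of_real x + z)*exp (mtpi * of_int m * of_real x)))"
 define q where "q = (\<lambda>m::int. exp (- (of_real pi)\<^sup>2*(of_int m)^2/a + tpi * of_int m*z))"
 have Aq: "A m = gauss_const a*q m" for m unfolding A_def q_def f_def by (rule gaussian_fourier_coefficient[OF a])
 have hol: "f holomorphic_on UNIV" unfolding f_def by (rule holomorphic_gaussian_periodization[OF a])
 have contf: "continuous_on S f" for S using holomorphic_on_imp_continuous_on[OF hol] continuous_on_subset by blast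
 define g where "g = (\<lambda>m::int. gauss_const a*exp (- (of_real pi)\<^sup>2*(of_int m)^2/a + tpi * of_int m*z))"
 have summ: "g summable_on UNIV" proof (rule abs_summable_summable[OF Infinite_Sum.abs_summable_on_comparison_test'])
  define c where "c = Re (of_real (pi^2)/a)"
  have c: "c > 0" unfolding c_def using a by (simp add: Re_divide) (intro divide_pos_pos, auto simp: sum_power2_gt_zero_iff)
  show "(\<lambda>m::int. norm (gauss_const a)*exp (- c*(real_of_int m)^2 + (2*pi*norm z)*\<bar>real_of_int m\<bar>)) summable_on UNIV"
   by (intro summable_on_cmult_right summable_on_gaussian c)
  fix m :: int
  have E: "- (of_real pi)\<^sup>2*(of_int m)^2/a = - (of_real ((real_of_int m)^2)*(of_real (pi^2)/a))" by simp
  have R: "Re (- (of_real r*y)) = - Re y * r" for r y by simp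
  have "Re (- (of_real pi)\<^sup>2*(of_int m)^2/a) = - c*(real_of_int m)^2" unfolding E R c_def ..
  moreover have "Re (tpi * of_int m*z) \<le> norm (tpi * of_int m*z)" by (rule complex_Re_le_cmod)
  moreover have "norm (tpi * of_int m*z) = (2*pi*norm z)*\<bar>real_of_int m\<bar>" by (simp add: norm_mult)
  ultimately show "norm (g m) \<le> norm (gauss_const a)*exp (- c*(real_of_int m)^2 + (2*pi*norm z)*\<bar>real_of_int m\<bar>)"
   unfolding g_def norm_mult norm_exp_eq_Re by (intro mult_left_mono) auto
 qed
 have "(\<lambda>N. \<Sum>m\<in>{-int N..int N}. A m) \<longlonglongrightarrow> f (0 + z)" unfolding A_def proof (rule fourier_sum_at_0)
  show "(\<lambda>x. f (x + z)) holomorphic_on UNIV"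
   by (rule holomorphic_on_compose_gen[OF _ hol, unfolded o_def]) (auto intro!: holomorphic_intros)
 qed
 moreover have "(\<lambda>N. \<Sum>m\<in>{-int N..int N}. A m) \<longlonglongrightarrow> infsum g UNIV"
  unfolding Aq using filterlim_compose[OF has_sum_infsum[OF summ, unfolded has_sum_def] filterlim_symmetric_intervals]
  by (simp add: g_def q_def mult_ac)
 ultimately have "f z = infsum g UNIV" using LIMSEQ_unique by fastforce
 then show ?thesis using has_sum_infsum[OF summ] unfolding g_def f_def by simp
qed

section \<open>Moments of theta sums\<close>

text \<open>The heat semigroup on polynomials: \<open>heat b p = e\<^bsup>b D\<^sup>2\<^esup> p\<close>.\<close>

definition heat :: "complex => complex poly => complex poly" where
 "heat b p = (\<Sum>i\<le>degree p. smult (b^i/fact i) ((pderiv ^^ (2*i)) p))"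

lemma higher_pderiv_eq_0: "degree p < n ==> (pderiv ^^ n) p = (0 :: complex poly)" proof (induction n arbitrary: p)
 case (Suc n)
 show ?case proof (cases "pderiv p = 0")
  case True
  have "(pderiv ^^ n) (0 :: complex poly) = 0" by (induction n) auto
  then show ?thesis using True by (simp add: funpow_Suc_right del: funpow.simps)
 next
  case False
  then have "degree p \<noteq> 0" by (simp add: pderiv_eq_0_iff)
  then have "degree (pderiv p) < n" using Suc.prems by (simp add: degree_pderiv)
  then show ?thesis using Suc.IH by (simp add: funpow_Suc_right del: funpow.simps)
 qed
qed simp

lemma smult_sum_right: "smult c (sum f A) = (\<Sum>x\<in>A. smult c (f x))" by (induction A rule: infinite_finite_induct) (auto simp: smult_add_right)

lemma pCons_0_sum: "pCons 0 (sum f A) = (\<Sum>x\<in>A. pCons 0 (f x :: complex poly))" proof -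
 have "pCons 0 (p + q) = pCons 0 p + pCons 0 q" for p q :: "complex poly" by simp
 then show ?thesis by (induction A rule: infinite_finite_induct) (simp_all del: add_pCons)
qed

lemma pderiv_sum_distrib: "pderiv (sum f A) = (\<Sum>x\<in>A. pderiv (f x :: complex poly))"
 by (induction A rule: infinite_finite_induct) (auto simp: pderiv_add)

lemma heat_eq_sum:
 assumes "degree p < N" shows "heat b p = (\<Sum>i<N. smult (b^i/fact i) ((pderiv ^^ (2*i)) p))" proof -
 have "(\<Sum>i<N. smult (b^i/fact i) ((pderiv ^^ (2*i)) p)) = (\<Sum>i\<le>degree p. smult (b^i/fact i) ((pderiv ^^ (2*i)) p))"
  using assms by (intro sum.mono_neutral_right) (auto simp: higher_pderiv_eq_0)
 then show ?thesis by (simp add: heat_def)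
qed

text \<open>Leibniz rule for multiplication by the variable. At \<open>n = 0\<close> the truncated
  index \<open>n - 1\<close> is harmless because of the factor \<open>n\<close>.\<close>

lemma higher_pderiv_pCons_0:
 "(pderiv ^^ n) (pCons 0 p) = pCons 0 ((pderiv ^^ n) p) + smult (of_nat n) ((pderiv ^^ (n - 1)) (p :: complex poly))" proof (induction n)
 case (Suc n)
 have "(pderiv ^^ Suc n) (pCons 0 p) = pderiv (pCons 0 ((pderiv ^^ n) p)) + smult (of_nat n) (pderiv ((pderiv ^^ (n - 1)) p))"
  by (simp add: Suc.IH pderiv_add pderiv_smult)
 also have "smult (of_nat n) (pderiv ((pderiv ^^ (n - 1)) p)) = smult (of_nat n) ((pderiv ^^ n) p)" by (cases n) auto
 also have "pderiv (pCons 0 ((pderiv ^^ n) p)) = pCons 0 ((pderiv ^^ Suc n) p) + (pderiv ^^ n) p" by (simp add: pderiv_pCons)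
 finally show ?case by (simp add: smult_add_left algebra_simps)
qed simp

lemma heat_add: "heat b (p + q) = heat b p + heat b q" proof -
 define N where "N = Suc (max (degree p) (degree q))"
 have "degree (p + q) < N" using degree_add_le_max[of p q] by (simp add: N_def)
 moreover have "degree p < N" "degree q < N" by (auto simp: N_def)
 ultimately show ?thesis by (simp add: heat_eq_sum[of _ N] higher_pderiv_add smult_add_right sum.distrib)
qed

lemma heat_smult: "heat b (smult c p) = smult c (heat b p)" proof -
 define N where "N = Suc (degree p)"
 have "degree (smult c p) < N" "degree p < N" using degree_smult_le[of c p] by (auto simp: N_def simp del: degree_smult_eq)
 then have "heat b (smult c p) = (\<Sum>i<N. smult c (smult (b^i/fact i) ((pderiv ^^ (2*i)) p)))"
  by (simp add: heat_eq_sum[of _ N] higher_pderiv_smult mult.commute)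
 also have "... = smult c (heat b p)" using \<open>degree p < N\<close> by (simp add: heat_eq_sum[of _ N] smult_sum_right)
 finally show ?thesis .
qed

lemma heat_const: "heat b [:a:] = [:a:]" by (simp add: heat_def)

text \<open>The commutation rule \<open>exp(b D^2) x = (x + 2 b D) exp(b D^2)\<close>.
  Differentiation in \<open>P\<close> acts on the dual theta series in exactly this form.\<close>

lemma heat_pCons_0: "heat b (pCons 0 p) = pCons 0 (heat b p) + smult (2*b) (pderiv (heat b p))" proof -
 define N where "N = Suc (Suc (degree p))"
 let ?t = "\<lambda>i. smult (b^i/fact i)"
 have d: "degree (pCons 0 p) < N" "degree p < N" "degree p < Suc (degree p)" by (auto simp: N_def degree_pCons_eq_if)
 have "heat b (pCons 0 p) = (\<Sum>i<N. ?t i (pCons 0 ((pderiv ^^ (2*i)) p))) + (\<Sum>i<N. ?t i (smult (of_nat (2*i)) ((pderiv ^^ (2*i - 1)) p)))"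
  by (simp add: heat_eq_sum[OF d(1)] higher_pderiv_pCons_0 smult_add_right sum.distrib)
 also have "(\<Sum>i<N. ?t i (pCons 0 ((pderiv ^^ (2*i)) p))) = pCons 0 (heat b p)" unfolding heat_eq_sum[OF d(2)] pCons_0_sum by simp
 also have "(\<Sum>i<N. ?t i (smult (of_nat (2*i)) ((pderiv ^^ (2*i - 1)) p)))
   = (\<Sum>i<Suc (degree p). ?t (Suc i) (smult (of_nat (2 * Suc i)) ((pderiv ^^ (2 * Suc i - 1)) p)))"
  unfolding N_def by (subst sum.lessThan_Suc_shift) simp
 also have "... = (\<Sum>i<Suc (degree p). smult (2*b) (?t i ((pderiv ^^ Suc (2*i)) p)))" proof (rule sum.cong[OF refl])
  fix i
  have "b^Suc i/fact (Suc i) * of_nat (2 * Suc i) = 2*b*(b^i/fact i)" by (simp only: fact_Suc of_nat_mult) (simp add: field_simps del: of_nat_Suc)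
  then show "?t (Suc i) (smult (of_nat (2 * Suc i)) ((pderiv ^^ (2 * Suc i - 1)) p)) = smult (2*b) (?t i ((pderiv ^^ Suc (2*i)) p))" by simp
 qed
 also have "... = smult (2*b) (pderiv (heat b p))"
  unfolding heat_eq_sum[OF d(3)] by (simp add: smult_sum_right pderiv_smult pderiv_sum_distrib del: sum.lessThan_Suc)
 finally show ?thesis .
qed

lemma heat_pCons: "heat b (pCons a p) = [:a:] + pCons 0 (heat b p) + smult (2*b) (pderiv (heat b p))" proof -
 have "pCons a p = [:a:] + pCons 0 p" by simp
 then show ?thesis by (metis heat_add heat_const heat_pCons_0 add.assoc)
qed

lemma poly_exp_bound:
 fixes p :: "complex poly" shows "\<exists>C\<ge>0. \<exists>d\<ge>0. \<forall>x. norm (poly p x) \<le> C*exp (d*norm x)" proof (induction p)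
 case 0
 show ?case by (intro exI[of _ 0]) auto
next
 case (pCons a p)
 then obtain C d where Cd: "C \<ge> 0" "d \<ge> 0" "\<And>x. norm (poly p x) \<le> C*exp (d*norm x)" by blast
 have "norm (poly (pCons a p) x) \<le> (norm a + C)*exp ((d + 1)*norm x)" for x proof -
  have "norm (poly (pCons a p) x) \<le> norm a + norm x*norm (poly p x)" by simp (metis norm_mult norm_triangle_ineq)
  also have "norm x*norm (poly p x) \<le> exp (norm x)*(C*exp (d*norm x))" proof (rule mult_mono)
   show "norm x \<le> exp (norm x)" using exp_ge_add_one_self[of "norm x"] by linarith
  qed (use Cd in auto)
  also have "... = C*exp ((d + 1)*norm x)" by (simp add: exp_add distrib_right)
  also have "norm a \<le> norm a*exp ((d + 1)*norm x)" using Cd by (simp add: mult_le_cancel_left1)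
  finally show ?thesis by (simp add: distrib_right)
 qed
 moreover have "norm a + C \<ge> 0" "d + 1 \<ge> 0" using Cd by auto
 ultimately show ?case by blast
qed

text \<open>A polynomial at a point of size \<open>O(1 + |n|)\<close> grows at most exponentially in
  \<open>|n|\<close>, which a Gaussian tolerates. The same majorant serves both sides of Poisson
  summation, uniformly for bounded parameters.\<close>

lemma theta_term_bound:
 fixes p :: "complex poly"
 shows "\<exists>K R. \<forall>n::int. \<forall>l \<mu> \<nu>. norm l \<le> L*(1 + \<bar>real_of_int n\<bar>) --> norm \<mu> \<le> M --> norm \<nu> \<le> M -->
   norm (poly p l*exp (\<gamma>*(of_int n)^2 + \<mu> * of_int n + \<nu>)) \<le> K*exp (Re \<gamma>*(real_of_int n)^2 + R*\<bar>real_of_int n\<bar>)"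
proof -
 obtain C d where Cd: "C \<ge> 0" "d \<ge> 0" "\<And>x. norm (poly p x) \<le> C*exp (d*norm x)" using poly_exp_bound by blast
 have "norm (poly p l*exp (\<gamma>*(of_int n)^2 + \<mu> * of_int n + \<nu>)) \<le> (C*exp (d * L + M))*exp (Re \<gamma>*(real_of_int n)^2 + (d * L + M)*\<bar>real_of_int n\<bar>)"
  if "norm l \<le> L*(1 + \<bar>real_of_int n\<bar>)" "norm \<mu> \<le> M" "norm \<nu> \<le> M" for n :: int and l \<mu> \<nu> proof -
  have e: "\<gamma>*(of_int n)^2 = of_real ((real_of_int n)^2)*\<gamma>" by (simp add: mult.commute)
  have "Re (\<gamma>*(of_int n)^2 + \<mu> * of_int n + \<nu>) = Re \<gamma>*(real_of_int n)^2 + Re (\<mu> * of_int n + \<nu>)" unfolding e by simp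
  also have "Re (\<mu> * of_int n + \<nu>) \<le> norm (\<mu> * of_int n) + norm \<nu>"
   using complex_Re_le_cmod norm_triangle_ineq order_trans by blast
  also have "norm (\<mu> * of_int n) \<le> M*\<bar>real_of_int n\<bar>" using that by (simp add: norm_mult mult_right_mono)
  finally have 1: "norm (exp (\<gamma>*(of_int n)^2 + \<mu> * of_int n + \<nu>)) \<le> exp (Re \<gamma>*(real_of_int n)^2 + M*\<bar>real_of_int n\<bar> + M)"
   unfolding norm_exp_eq_Re using that by simp
  have "d*norm l \<le> d*(L*(1 + \<bar>real_of_int n\<bar>))" using that Cd by (intro mult_left_mono) auto
  then have 2: "norm (poly p l) \<le> C*exp (d*(L*(1 + \<bar>real_of_int n\<bar>)))" using Cd by (intro order_trans[OF Cd(3)] mult_left_mono) auto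
  have "norm (poly p l*exp (\<gamma>*(of_int n)^2 + \<mu> * of_int n + \<nu>)) \<le> (C*exp (d*(L*(1 + \<bar>real_of_int n\<bar>))))*exp (Re \<gamma>*(real_of_int n)^2 + M*\<bar>real_of_int n\<bar> + M)"
   unfolding norm_mult using Cd by (intro mult_mono 1 2) auto
  also have "... = (C*exp (d * L + M))*exp (Re \<gamma>*(real_of_int n)^2 + (d * L + M)*\<bar>real_of_int n\<bar>)"
   by (simp add: exp_add[symmetric] mult.assoc) (simp add: algebra_simps)
  finally show ?thesis .
 qed
 then show ?thesis by blast
qed

text \<open>Weierstrass: locally uniform convergence of holomorphic functions passes to derivatives.
  The hypothesis \<open>sum\<close> is conditional because summability itself follows from the
  majorant.\<close>

lemma has_sum_deriv:
 fixes h :: "int => complex => complex"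
 assumes hol: "\<And>n. h n holomorphic_on UNIV"
  and bd: "\<And>r. \<exists>K R. \<forall>n. \<forall>P\<in>cball 0 r. norm (h n P) \<le> K*exp (- c*(real_of_int n)^2 + R*\<bar>real_of_int n\<bar>)" and c: "c > 0"
  and sum: "\<And>P. (\<lambda>n. h n P) summable_on UNIV ==> infsum (\<lambda>n. h n P) UNIV = H P"
 shows "((\<lambda>n. h n P) has_sum H P) UNIV" "((\<lambda>n. deriv (h n) P) has_sum deriv H P) UNIV" proof -
 have s: "((\<lambda>n. h n P) has_sum H P) UNIV" for P proof -
  obtain K R where KR: "\<And>n Q. Q\<in>cball 0 (norm P) ==> norm (h n Q) \<le> K*exp (- c*(real_of_int n)^2 + R*\<bar>real_of_int n\<bar>)"
   using bd[of "norm P"] by blast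
  have "(\<lambda>n::int. K*exp (- c*(real_of_int n)^2 + R*\<bar>real_of_int n\<bar>)) summable_on UNIV"
   by (intro summable_on_cmult_right summable_on_gaussian c)
  then have "(\<lambda>n. h n P) summable_on UNIV"
   by (rule abs_summable_summable[OF Infinite_Sum.abs_summable_on_comparison_test']) (use KR in auto)
  then show ?thesis using has_sum_infsum[of "\<lambda>n. h n P"] sum by metis
 qed
 then show "((\<lambda>n. h n P) has_sum H P) UNIV" .
 obtain K R where KR: "\<And>n Q. Q\<in>cball 0 (norm P + 1) ==> norm (h n Q) \<le> K*exp (- c*(real_of_int n)^2 + R*\<bar>real_of_int n\<bar>)"
  using bd[of "norm P + 1"] by blast
 have SM: "(\<lambda>n::int. K*exp (- c*(real_of_int n)^2 + R*\<bar>real_of_int n\<bar>)) summable_on UNIV"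
  by (intro summable_on_cmult_right summable_on_gaussian c)
 have "uniform_limit (ball 0 (norm P + 1)) (\<lambda>X y. \<Sum>n\<in>X. h n y) H (finite_subsets_at_top (UNIV::int set))"
  by (rule Weierstrass_m_test_general'[OF _ s SM]) (use KR in auto)
 then have "((\<lambda>X. deriv (\<lambda>y. \<Sum>n\<in>X. h n y) P) \<longlongrightarrow> deriv H P) (finite_subsets_at_top UNIV)"
  by (rule deriv_complex_uniform_limit)
   (auto intro!: always_eventually holomorphic_intros holomorphic_on_subset[OF hol])
 moreover have "deriv (\<lambda>y. \<Sum>n\<in>X. h n y) P = (\<Sum>n\<in>X. deriv (h n) P)" for X
  by (rule DERIV_imp_deriv, rule DERIV_sum) (use hol holomorphic_derivI in blast)
 ultimately show "((\<lambda>n. deriv (h n) P) has_sum deriv H P) UNIV" unfolding has_sum_def by simp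
qed

section \<open>A theta series, its Poisson dual and their moments\<close>

definition lat :: "nat => real => int => complex" where
 "lat k Q n = of_real Q + of_int n/(2 * of_nat k)"

text \<open>With \<open>x = lat k Q n\<close> this is
  \<open>exp(4 pi i k P x + 2 pi i k \<tau> x^2)\<close>; for real \<open>P\<close> its modulus is a
  Gaussian in \<open>x\<close> of width of order \<open>k^(-1/2)\<close>.\<close>

definition primal :: "complex => nat => real => int => complex => complex" where
 "primal \<tau> k Q n P = exp (4 * of_real pi*\<i> * of_nat k*P * lat k Q n + tpi * of_nat k*\<tau>*(lat k Q n)^2)"

text \<open>The term of index \<open>m\<close> is concentrated at \<open>P = -m\<close>, so only the
  index 0 matters when \<open>|P|\<close> stays below 1 by a margin.\<close>

definition dual :: "complex => nat => real => int => complex => complex" where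
 "dual \<tau> k Q m P = gauss_const (- of_real pi*\<i>*\<tau>/(2 * of_nat k)) *
   exp (mtpi * of_nat k*(P + of_int m)^2 / \<tau> - 4 * of_real pi*\<i> * of_nat k * of_int m * of_real Q)"

text \<open>Half of the complex variance of the Gaussian \<open>exp(2 pi i k \<tau> x^2)\<close>,
  which is the time that the heat operator has to run.\<close>

definition beta :: "complex => nat => complex" where
 "beta \<tau> k = \<i>/(8 * of_real pi * of_nat k*\<tau>)"

context
 fixes \<tau> :: complex and k :: nat and Q :: real
 assumes tau: "Im \<tau> > 0" and k: "k \<ge> 1"
begin

lemma tau0: "\<tau> \<noteq> 0" using tau by auto

text \<open>Completing the square in \<open>n\<close>, with the \<open>a\<close> and
  \<open>z\<close> defined below, reduces this to the Poisson formula; the dual index is reversed at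
  the end.\<close>

lemma poisson_base: "((\<lambda>m. dual \<tau> k Q m P) has_sum (\<Sum>\<^sub>\<infinity>n. primal \<tau> k Q n P)) UNIV" proof -
 define a where "a = - of_real pi*\<i>*\<tau>/(2 * of_nat k)"
 define z where "z = 2 * of_nat k*(of_real Q + P / \<tau>)"
 define E where "E = exp (mtpi * of_nat k*P^2 / \<tau>)"
 have k0: "(of_nat k :: complex) \<noteq> 0" using k by simp
 have "Re a = pi*Im \<tau>/(2*real k)" unfolding a_def by (simp add: Re_divide_of_nat)
 then have a: "Re a > 0" using tau k by simp
 then have a0: "a \<noteq> 0" by auto
 have pr: "primal \<tau> k Q n P = E*exp (- a*(of_int n + z)^2)" for n unfolding primal_def E_def exp_add[symmetric] by (rule arg_cong[where f=exp])
   (use k0 tau0 in \<open>simp add: a_def z_def lat_def field_simps power2_eq_square\<close>)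
 have "((\<lambda>m. gauss_const a*exp (- (of_real pi)\<^sup>2*(of_int m)^2/a + tpi * of_int m*z)) has_sum (\<Sum>\<^sub>\<infinity>n. exp (- a*(of_int n + z)^2))) UNIV"
  by (rule gaussian_poisson[OF a])
 then have "((\<lambda>m. E*(gauss_const a*exp (- (of_real pi)\<^sup>2*(of_int m)^2/a + tpi * of_int m*z))) has_sum E*(\<Sum>\<^sub>\<infinity>n. exp (- a*(of_int n + z)^2))) UNIV"
  by (rule has_sum_cmult_right)
 moreover have "E*(\<Sum>\<^sub>\<infinity>n. exp (- a*(of_int n + z)^2)) = (\<Sum>\<^sub>\<infinity>n. primal \<tau> k Q n P)"
  unfolding pr by (rule infsum_cmult_right'[symmetric])
 moreover have "E*(gauss_const a*exp (- (of_real pi)\<^sup>2*(of_int m)^2/a + tpi * of_int m*z)) = dual \<tau> k Q (- m) P" for m proof -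
  have pa: "(of_real pi)^2/a = tpi * of_nat k / \<tau>" using k0 tau0 by (simp add: a_def field_simps power2_eq_square)
  have "- (of_real pi)\<^sup>2*(of_int m)^2/a = - (of_int m)\<^sup>2*((of_real pi)^2/a)" by simp
  then have "E*exp (- (of_real pi)\<^sup>2*(of_int m)^2/a + tpi * of_int m*z) =
   exp (mtpi * of_nat k*(P + of_int (- m))^2 / \<tau> - 4 * of_real pi*\<i> * of_nat k * of_int (- m) * of_real Q)"
   unfolding E_def exp_add[symmetric] pa using tau0 by (intro arg_cong[where f=exp]) (simp add: z_def field_simps power2_eq_square)
  then show ?thesis unfolding dual_def a_def[symmetric] by (simp add: mult.left_commute)
 qed
 ultimately have "((\<lambda>m. dual \<tau> k Q (- m) P) has_sum (\<Sum>\<^sub>\<infinity>n. primal \<tau> k Q n P)) UNIV" by simp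
 then show ?thesis by (subst (asm) has_sum_reindex_bij_betw[where g=uminus]) (auto intro!: bij_betwI[where g=uminus])
qed

lemma primal_bound:
 "\<exists>K R. \<forall>n. \<forall>P\<in>cball 0 r. norm (poly p (lat k Q n)*primal \<tau> k Q n P) \<le> K*exp (- (pi*Im \<tau>/(2*real k))*(real_of_int n)^2 + R*\<bar>real_of_int n\<bar>)"
proof -
 have k0: "(of_nat k :: complex) \<noteq> 0" and k1: "real k \<ge> 1" using k by auto
 define \<gamma> where "\<gamma> = of_real pi*\<i>*\<tau>/(2 * of_nat k)"
 define \<mu> where "\<mu> = (\<lambda>P::complex. tpi*P + tpi*\<tau> * of_real Q)"
 define \<nu> where "\<nu> = (\<lambda>P::complex. 4 * of_real pi*\<i> * of_nat k*P * of_real Q + tpi * of_nat k*\<tau>*(of_real Q)^2)"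
 define M where "M = max (2*pi*\<bar>r\<bar> + 2*pi*norm \<tau>*\<bar>Q\<bar>) (4*pi*real k*\<bar>r\<bar>*\<bar>Q\<bar> + 2*pi*real k*norm \<tau>*Q^2)"
 have Re: "Re \<gamma> = - (pi*Im \<tau>/(2*real k))" unfolding \<gamma>_def by (simp add: Re_divide_of_nat)
 have pr: "primal \<tau> k Q n P = exp (\<gamma>*(of_int n)^2 + \<mu> P * of_int n + \<nu> P)" for n P unfolding primal_def
  by (rule arg_cong[where f=exp]) (use k0 in \<open>simp add: lat_def \<gamma>_def \<mu>_def \<nu>_def field_simps power2_eq_square\<close>)
 have m1: "norm (\<mu> P) \<le> M" if "P \<in> cball 0 r" for P proof -
  have "norm (\<mu> P) \<le> 2*pi*norm P + 2*pi*norm \<tau>*\<bar>Q\<bar>"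
   unfolding \<mu>_def by (rule order_trans[OF norm_triangle_ineq]) (simp add: norm_mult)
  also have "... \<le> 2*pi*\<bar>r\<bar> + 2*pi*norm \<tau>*\<bar>Q\<bar>" using that by simp
  finally show ?thesis by (simp add: M_def)
 qed
 have m2: "norm (\<nu> P) \<le> M" if "P \<in> cball 0 r" for P proof -
  have "norm (\<nu> P) \<le> 4*pi*real k*norm P*\<bar>Q\<bar> + 2*pi*real k*norm \<tau>*Q^2"
   unfolding \<nu>_def by (rule order_trans[OF norm_triangle_ineq]) (simp add: norm_mult norm_power)
  also have "... \<le> 4*pi*real k*\<bar>r\<bar>*\<bar>Q\<bar> + 2*pi*real k*norm \<tau>*Q^2"
   using that by (intro add_right_mono mult_right_mono mult_left_mono) auto
  finally show ?thesis by (simp add: M_def)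
 qed
 have l: "norm (lat k Q n) \<le> (\<bar>Q\<bar> + 1)*(1 + \<bar>real_of_int n\<bar>)" for n proof -
  have "norm (lat k Q n) \<le> \<bar>Q\<bar> + \<bar>real_of_int n\<bar>/(2*real k)"
   unfolding lat_def by (rule order_trans[OF norm_triangle_ineq]) (simp add: norm_divide norm_mult)
  also have "\<bar>real_of_int n\<bar>/(2*real k) \<le> \<bar>real_of_int n\<bar>/1" using k1 by (intro divide_left_mono) auto
  also have "\<bar>Q\<bar> + \<bar>real_of_int n\<bar>/1 \<le> (\<bar>Q\<bar> + 1)*(1 + \<bar>real_of_int n\<bar>)" by (simp add: algebra_simps)
  finally show ?thesis by simp
 qed
 obtain K R where "\<forall>n::int. \<forall>l \<mu> \<nu>. norm l \<le> (\<bar>Q\<bar> + 1)*(1 + \<bar>real_of_int n\<bar>) --> norm \<mu> \<le> M --> norm \<nu> \<le> M -->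
   norm (poly p l*exp (\<gamma>*(of_int n)^2 + \<mu> * of_int n + \<nu>)) \<le> K*exp (Re \<gamma>*(real_of_int n)^2 + R*\<bar>real_of_int n\<bar>)"
  using theta_term_bound by blast
 then have "\<forall>n. \<forall>P\<in>cball 0 r. norm (poly p (lat k Q n)*primal \<tau> k Q n P) \<le> K*exp (- (pi*Im \<tau>/(2*real k))*(real_of_int n)^2 + R*\<bar>real_of_int n\<bar>)"
  unfolding pr Re using l m1 m2 by blast
 then show ?thesis by blast
qed

lemma dual_bound:
 "\<exists>K R. \<forall>m. \<forall>P\<in>cball 0 r. norm (poly p (- (P + of_int m) / \<tau>)*dual \<tau> k Q m P) \<le> K*exp (- (2*pi*real k*Im \<tau>/(norm \<tau>)^2)*(real_of_int m)^2 + R*\<bar>real_of_int m\<bar>)"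
proof -
 have k0: "(of_nat k :: complex) \<noteq> 0" and k1: "real k \<ge> 1" using k by auto
 define g where "g = gauss_const (- of_real pi*\<i>*\<tau>/(2 * of_nat k))"
 define \<gamma> where "\<gamma> = mtpi * of_nat k / \<tau>"
 define \<mu> where "\<mu> = (\<lambda>P::complex. - 4 * of_real pi*\<i> * of_nat k*P / \<tau> - 4 * of_real pi*\<i> * of_nat k * of_real Q)"
 define \<nu> where "\<nu> = (\<lambda>P::complex. mtpi * of_nat k*P^2 / \<tau>)"
 define M where "M = max (4*pi*real k*\<bar>r\<bar>/norm \<tau> + 4*pi*real k*\<bar>Q\<bar>) (2*pi*real k*\<bar>r\<bar>^2/norm \<tau>)"
 have Re: "Re \<gamma> = - (2*pi*real k*Im \<tau>/(norm \<tau>)^2)" unfolding \<gamma>_def by (simp add: Re_divide cmod_power2)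
 have du: "dual \<tau> k Q m P = g*exp (\<gamma>*(of_int m)^2 + \<mu> P * of_int m + \<nu> P)" for m P unfolding dual_def g_def
  by (intro arg_cong2[where f="(*)"] arg_cong[where f=exp]) (use tau0 in \<open>simp_all add: \<gamma>_def \<mu>_def \<nu>_def field_simps power2_eq_square\<close>)
 have m1: "norm (\<mu> P) \<le> M" if "P \<in> cball 0 r" for P proof -
  have "norm (\<mu> P) \<le> 4*pi*real k*norm P/norm \<tau> + 4*pi*real k*\<bar>Q\<bar>"
   unfolding \<mu>_def by (rule order_trans[OF norm_triangle_ineq4]) (simp add: norm_mult norm_divide)
  also have "... \<le> 4*pi*real k*\<bar>r\<bar>/norm \<tau> + 4*pi*real k*\<bar>Q\<bar>"
   using that by (intro add_right_mono divide_right_mono mult_left_mono) auto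
  finally show ?thesis by (simp add: M_def)
 qed
 have m2: "norm (\<nu> P) \<le> M" if "P \<in> cball 0 r" for P proof -
  have "norm (\<nu> P) = 2*pi*real k*(norm P)^2/norm \<tau>" unfolding \<nu>_def by (simp add: norm_mult norm_divide norm_power)
  also have "... \<le> 2*pi*real k*\<bar>r\<bar>^2/norm \<tau>" using that by (intro divide_right_mono mult_left_mono power_mono) auto
  finally show ?thesis by (simp add: M_def)
 qed
 have l: "norm (- (P + of_int m) / \<tau>) \<le> ((\<bar>r\<bar> + 1)/norm \<tau>)*(1 + \<bar>real_of_int m\<bar>)" if "P \<in> cball 0 r" for P m
 proof -
  have "norm (- (P + of_int m)) \<le> norm P + \<bar>real_of_int m\<bar>"
   unfolding norm_minus_cancel using norm_triangle_ineq[of P "of_int m"] by simp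
  also have "... \<le> (\<bar>r\<bar> + 1)*(1 + \<bar>real_of_int m\<bar>)" proof -
   have "norm P \<le> \<bar>r\<bar>" using that by simp
   moreover have "0 \<le> \<bar>r\<bar>*\<bar>real_of_int m\<bar>" by simp
   moreover have "(\<bar>r\<bar> + 1)*(1 + \<bar>real_of_int m\<bar>) = \<bar>r\<bar> + \<bar>r\<bar>*\<bar>real_of_int m\<bar> + 1 + \<bar>real_of_int m\<bar>"
    by (simp add: algebra_simps)
   ultimately show ?thesis by linarith
  qed
  finally show ?thesis unfolding norm_divide by (simp add: divide_right_mono)
 qed
 obtain K R where KR: "\<forall>n::int. \<forall>l \<mu> \<nu>. norm l \<le> ((\<bar>r\<bar> + 1)/norm \<tau>)*(1 + \<bar>real_of_int n\<bar>) --> norm \<mu> \<le> M --> norm \<nu> \<le> M -->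
   norm (poly p l*exp (\<gamma>*(of_int n)^2 + \<mu> * of_int n + \<nu>)) \<le> K*exp (Re \<gamma>*(real_of_int n)^2 + R*\<bar>real_of_int n\<bar>)"
  using theta_term_bound by blast
 have "norm (poly p (- (P + of_int m) / \<tau>)*dual \<tau> k Q m P) \<le> (norm g*K)*exp (- (2*pi*real k*Im \<tau>/(norm \<tau>)^2)*(real_of_int m)^2 + R*\<bar>real_of_int m\<bar>)"
  if P: "P \<in> cball 0 r" for m P proof -
  have "norm (poly p (- (P + of_int m) / \<tau>)*dual \<tau> k Q m P) = norm g*norm (poly p (- (P + of_int m) / \<tau>)*exp (\<gamma>*(of_int m)^2 + \<mu> P * of_int m + \<nu> P))"
   unfolding du by (simp add: norm_mult)
  also have "... \<le> norm g*(K*exp (Re \<gamma>*(real_of_int m)^2 + R*\<bar>real_of_int m\<bar>))"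
   by (intro mult_left_mono KR[rule_format, OF l[OF P] m1[OF P] m2[OF P]]) simp
  finally show ?thesis unfolding Re by simp
 qed
 then show ?thesis by blast
qed

lemma decay_rates: "pi*Im \<tau>/(2*real k) > 0" "2*pi*real k*Im \<tau>/(norm \<tau>)^2 > 0" using tau k tau0 by auto

lemma primal_holomorphic: "(\<lambda>P. poly p (lat k Q n)*primal \<tau> k Q n P) holomorphic_on UNIV"
 unfolding primal_def by (intro holomorphic_intros)

lemma dual_holomorphic: "(\<lambda>P. poly p (- (P + of_int m) / \<tau>)*dual \<tau> k Q m P) holomorphic_on UNIV"
 unfolding dual_def poly_altdef by (intro holomorphic_intros) (use tau0 in auto)

lemma primal_summable: "((\<lambda>n. poly p (lat k Q n)*primal \<tau> k Q n P) has_sum (\<Sum>\<^sub>\<infinity>n. poly p (lat k Q n)*primal \<tau> k Q n P)) UNIV"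
 by (rule has_sum_deriv(1)[OF primal_holomorphic primal_bound decay_rates(1)]) simp

text \<open>Induction on the polynomial by differentiation in \<open>P\<close>. A primal term is
  multiplied by \<open>s * lat k Q n\<close>. A dual term is multiplied by \<open>s\<close> times
  its centre \<open>-(P + m)/\<tau>\<close>, and its polynomial is differentiated with chain factor
  \<open>-1/\<tau>\<close>, which equals \<open>2 * s * beta \<tau> k\<close>. Both sides thus obey
  the recursion \<open>heat_pCons\<close>.\<close>

theorem poisson_moment:
 "((\<lambda>m. poly (heat (beta \<tau> k) p) (- (P + of_int m) / \<tau>)*dual \<tau> k Q m P) has_sum (\<Sum>\<^sub>\<infinity>n. poly p (lat k Q n)*primal \<tau> k Q n P)) UNIV"
proof (induction p arbitrary: P)
 case 0
 show ?case by (simp add: heat_def)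
next
 case (pCons a p)
 define s where "s = 4 * of_real pi*\<i> * of_nat k"
 have k0: "(of_nat k :: complex) \<noteq> 0" using k by simp
 have s0: "s \<noteq> 0" using k by (simp add: s_def)
 define H where "H = (\<lambda>P. \<Sum>\<^sub>\<infinity>n. poly p (lat k Q n)*primal \<tau> k Q n P)"
 have d1: "((\<lambda>n. deriv (\<lambda>P. poly p (lat k Q n)*primal \<tau> k Q n P) P) has_sum deriv H P) UNIV"
  by (rule has_sum_deriv(2)[OF primal_holomorphic primal_bound decay_rates(1)]) (simp add: H_def)
 have d2: "((\<lambda>m. deriv (\<lambda>P. poly (heat (beta \<tau> k) p) (- (P + of_int m) / \<tau>)*dual \<tau> k Q m P) P) has_sum deriv H P) UNIV"
  by (rule has_sum_deriv(2)[OF dual_holomorphic dual_bound decay_rates(2)]) (use pCons.IH in \<open>simp add: H_def infsumI\<close>)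
 have e1: "deriv (\<lambda>P. poly p (lat k Q n)*primal \<tau> k Q n P) P = s*(lat k Q n*poly p (lat k Q n)*primal \<tau> k Q n P)" for n
  unfolding primal_def s_def by (rule DERIV_imp_deriv) (rule derivative_eq_intros refl | simp)+
 have bs: "2 * beta \<tau> k = - 1/(s*\<tau>)" using tau0 k0 by (simp add: beta_def s_def field_simps)
 have e2: "deriv (\<lambda>P. poly (heat (beta \<tau> k) p) (- (P + of_int m) / \<tau>)*dual \<tau> k Q m P) P =
  s*((- (P + of_int m) / \<tau>*poly (heat (beta \<tau> k) p) (- (P + of_int m) / \<tau>) + 2 * beta \<tau> k*poly (pderiv (heat (beta \<tau> k) p)) (- (P + of_int m) / \<tau>))*dual \<tau> k Q m P)" for m
 proof -
  have D: "(dual \<tau> k Q m has_field_derivative (s*(- (P + of_int m) / \<tau>)*dual \<tau> k Q m P)) (at P)" unfolding dual_def s_def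
   by (rule derivative_eq_intros refl | simp add: tau0)+ (use tau0 in \<open>simp add: field_simps\<close>)
  have L: "((\<lambda>P. - (P + of_int m) / \<tau>) has_field_derivative - 1 / \<tau>) (at P)" by (rule derivative_eq_intros refl | simp add: tau0)+
  have "((\<lambda>P. poly (heat (beta \<tau> k) p) (- (P + of_int m) / \<tau>)*dual \<tau> k Q m P) has_field_derivative
    (poly (pderiv (heat (beta \<tau> k) p)) (- (P + of_int m) / \<tau>)*(- 1 / \<tau>))*dual \<tau> k Q m P + (s*(- (P + of_int m) / \<tau>)*dual \<tau> k Q m P)*poly (heat (beta \<tau> k) p) (- (P + of_int m) / \<tau>)) (at P)"
   by (rule DERIV_mult[OF DERIV_chain2[OF poly_DERIV L] D])
  then show ?thesis unfolding bs by (intro DERIV_imp_deriv, elim DERIV_cong) (use s0 tau0 in \<open>simp add: field_simps\<close>)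
 qed
 have cancel: "1/s*(s*x) = x" for x using s0 by simp
 have h1: "((\<lambda>n. lat k Q n*poly p (lat k Q n)*primal \<tau> k Q n P) has_sum deriv H P/s) UNIV"
  using has_sum_cmult_right[OF d1, of "1/s", unfolded e1 cancel] by simp
 have h2: "((\<lambda>m. (- (P + of_int m) / \<tau>*poly (heat (beta \<tau> k) p) (- (P + of_int m) / \<tau>) + 2 * beta \<tau> k*poly (pderiv (heat (beta \<tau> k) p)) (- (P + of_int m) / \<tau>))*dual \<tau> k Q m P) has_sum deriv H P/s) UNIV"
  using has_sum_cmult_right[OF d2, of "1/s", unfolded e2 cancel] by simp
 have b0: "((\<lambda>n. a*primal \<tau> k Q n P) has_sum a*(\<Sum>\<^sub>\<infinity>n. primal \<tau> k Q n P)) UNIV"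
  using primal_summable[of 1 P] by (intro has_sum_cmult_right) simp
 have "((\<lambda>n. poly (pCons a p) (lat k Q n)*primal \<tau> k Q n P) has_sum (a*(\<Sum>\<^sub>\<infinity>n. primal \<tau> k Q n P) + deriv H P/s)) UNIV"
  using has_sum_add[OF b0 h1] by (simp add: distrib_right)
 then have "(\<Sum>\<^sub>\<infinity>n. poly (pCons a p) (lat k Q n)*primal \<tau> k Q n P) = a*(\<Sum>\<^sub>\<infinity>n. primal \<tau> k Q n P) + deriv H P/s"
  by (rule infsumI)
 moreover have "((\<lambda>m. poly (heat (beta \<tau> k) (pCons a p)) (- (P + of_int m) / \<tau>)*dual \<tau> k Q m P) has_sum (a*(\<Sum>\<^sub>\<infinity>n. primal \<tau> k Q n P) + deriv H P/s)) UNIV"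
  using has_sum_add[OF has_sum_cmult_right[OF poisson_base, of a] h2]
  by (rule has_sum_cong[THEN iffD1, rotated]) (simp add: heat_pCons distrib_right)
 ultimately show ?case by simp
qed

end

lemma lat_of_real: "lat k Q n = of_real (Q + pt k n)" by (simp add: lat_def)

text \<open>The maximum lies at \<open>n/(2k) = -Q\<close>, which is therefore the point where the
  weights are expanded later.\<close>

lemma norm_primal:
 "norm (primal \<tau> k Q n (of_real P)) = exp (- (2*pi*Im \<tau>)*real k*(Q + pt k n)^2)" proof -
 define x where "x = Q + pt k n"
 have "primal \<tau> k Q n (of_real P) = exp (of_real (4*pi*real k*P*x)*\<i> + of_real (2*pi*real k*x^2)*(\<i>*\<tau>))"
  unfolding primal_def lat_of_real x_def[symmetric] by (rule arg_cong[where f=exp]) (simp add: algebra_simps)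
 then show ?thesis unfolding x_def[symmetric] norm_exp_eq_Re by (simp add: algebra_simps)
qed

definition dual_norm :: "complex => real" where
 "dual_norm \<tau> = norm (gauss_const (- of_real pi*\<i>*\<tau>/2))"

definition dual_rate :: "complex => real" where
 "dual_rate \<tau> = 2*pi*Im \<tau>/(norm \<tau>)^2"

lemma gauss_const_dual:
 assumes "Im \<tau> > 0" "k \<ge> 1"
 shows "gauss_const (- of_real pi*\<i>*\<tau>/(2 * of_nat k)) = gauss_const (- of_real pi*\<i>*\<tau>/2) * of_real (sqrt (real k))" proof -
 have "- of_real pi*\<i>*\<tau>/(2 * of_nat k) = of_real (1/real k)*(- of_real pi*\<i>*\<tau>/2)" by simp
 also have "gauss_const ... = gauss_const (- of_real pi*\<i>*\<tau>/2)/of_real (sqrt (1/real k))" by (rule gauss_const_scale) (use assms in auto)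
 finally show ?thesis by (simp add: real_sqrt_divide)
qed

lemma norm_dual:
 assumes "Im \<tau> > 0" "k \<ge> 1"
 shows "norm (dual \<tau> k Q m (of_real P)) = dual_norm \<tau> * sqrt (real k)*exp (- dual_rate \<tau>*real k*(P + real_of_int m)^2)" proof -
 have "mtpi * of_nat k*(of_real P + of_int m)^2 / \<tau> - 4 * of_real pi*\<i> * of_nat k * of_int m * of_real Q
  = of_real (2*pi*real k*(P + real_of_int m)^2)*(- \<i> / \<tau>) + of_real (- 4*pi*real k*real_of_int m*Q)*\<i>" by (simp add: algebra_simps)
 moreover have "Re (- \<i> / \<tau>) = - (Im \<tau>/(norm \<tau>)^2)" by (simp add: Re_divide cmod_power2)
 ultimately have "norm (exp (mtpi * of_nat k*(of_real P + of_int m)^2 / \<tau> - 4 * of_real pi*\<i> * of_nat k * of_int m * of_real Q))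
   = exp (- dual_rate \<tau>*real k*(P + real_of_int m)^2)" proof -
  assume e: "mtpi * of_nat k*(of_real P + of_int m)^2 / \<tau> - 4 * of_real pi*\<i> * of_nat k * of_int m * of_real Q
   = of_real (2*pi*real k*(P + real_of_int m)^2)*(- \<i> / \<tau>) + of_real (- 4*pi*real k*real_of_int m*Q)*\<i>"
   and r: "Re (- \<i> / \<tau>) = - (Im \<tau>/(norm \<tau>)^2)"
  have "Re (of_real x*y + of_real z*\<i>) = x * Re y" for x y z by simp
  then show ?thesis unfolding e norm_exp_eq_Re dual_rate_def using r by (simp only:) (simp add: mult_ac)
 qed
 then show ?thesis unfolding dual_def gauss_const_dual[OF assms] dual_norm_def norm_mult by simp
qed

lemma dual_rate_pos: "Im \<tau> > 0 ==> dual_rate \<tau> > 0" unfolding dual_rate_def by (intro divide_pos_pos) auto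

lemma power_le_exp:
 fixes y :: real
 assumes "y \<ge> 0" shows "y^i \<le> real i^i*exp y" proof (cases "i = 0")
 case False
 have "(y/real i)^i \<le> exp (y/real i)^i" proof (rule power_mono)
  show "y/real i \<le> exp (y/real i)" using exp_ge_add_one_self[of "y/real i"] by linarith
 qed (use assms in auto)
 also have "exp (y/real i)^i = exp y" using False by (simp add: exp_of_nat_mult[symmetric])
 finally show ?thesis using False by (simp add: power_divide field_simps)
qed (use assms in auto)

lemma exp_decay_le_power:
 assumes "c > 0" shows "\<exists>C\<ge>0. \<forall>k\<ge>1. exp (- c*real k) \<le> C/real k^N" proof (intro exI conjI allI impI)
 show "0 \<le> real N^N/c^N" using assms by simp
 fix k :: nat assume k: "1 \<le> k"
 have "(c*real k)^N \<le> real N^N*exp (c*real k)" using assms by (intro power_le_exp) auto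
 then have "c^N*real k^N \<le> real N^N*exp (c*real k)" by (simp add: power_mult_distrib)
 then show "exp (- c*real k) \<le> (real N^N/c^N)/real k^N" using assms k by (simp add: exp_minus field_simps)
qed

text \<open>The exponent is split: one half converts each factor \<open>x^2\<close> into
  \<open>1/k\<close>, the other makes the series converge. The factor \<open>k\<close> is generous
  (the plain sum has order \<open>sqrt k\<close>), but losing a fixed power of \<open>k\<close> does
  no harm.\<close>

lemma gaussian_moment_bound:
 fixes c :: real
 assumes c: "c > 0"
 shows "\<exists>C\<ge>0. \<forall>k\<ge>1. \<forall>Q. (\<lambda>n. (Q + pt k n)^(2*i)*exp (- c*real k*(Q + pt k n)^2)) summable_on UNIV \<and>
   (\<Sum>\<^sub>\<infinity>n. (Q + pt k n)^(2*i)*exp (- c*real k*(Q + pt k n)^2)) \<le> C*real k/real k^i" proof -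
 obtain K where K: "K > 0" "\<And>y. (\<lambda>n::int. 1/(1 + (y + real_of_int n)^2)) summable_on UNIV"
  "\<And>y. (\<Sum>\<^sub>\<infinity>n::int. 1/(1 + (y + real_of_int n)^2)) \<le> K" using infsum_shifted_inverse_square by blast
 define D where "D = real i^i*(2/c)^i*(1 + 8/c)"
 have D0: "D \<ge> 0" using c by (simp add: D_def)
 show ?thesis proof (rule exI[of _ "D*K"], intro conjI allI impI)
  show "0 \<le> D*K" using D0 K by simp
  fix k :: nat and Q :: real assume k: "1 \<le> k"
  have k1: "real k \<ge> 1" using k by simp
  define x where "x = (\<lambda>n::int. Q + pt k n)"
  have bd: "x n^(2*i)*exp (- c*real k*(x n)^2) \<le> (D*real k/real k^i)*(1/(1 + (2*real k*Q + real_of_int n)^2))" for n proof -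
   define t where "t = c*real k*(x n)^2/2"
   have t0: "t \<ge> 0" using c by (simp add: t_def)
   have xt: "(x n)^2 = (2/c)*t/real k" using c k1 by (simp add: t_def)
   have "x n^(2*i) = (2/c)^i*t^i/real k^i" by (simp add: power_mult xt power_mult_distrib power_divide)
   also have "... \<le> (2/c)^i*(real i^i*exp t)/real k^i" using c k1 by (intro divide_right_mono mult_left_mono power_le_exp t0) auto
   finally have 1: "x n^(2*i) \<le> (2/c)^i*(real i^i*exp t)/real k^i" .
   have e: "exp (- c*real k*(x n)^2) = exp (- t)*exp (- t)" by (simp add: exp_add[symmetric] t_def)
   have 2: "exp (- t) \<le> (1 + 8/c)*real k*(1/(1 + (2*real k*Q + real_of_int n)^2))" proof -
    define s where "s = (2*real k*Q + real_of_int n)^2"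
    have s0: "s \<ge> 0" by (simp add: s_def)
    have xs: "x n = (2*real k*Q + real_of_int n)/(2*real k)" using k1 by (simp add: x_def field_simps)
    have ts: "t = c * s/(8*real k)" unfolding t_def xs s_def power_divide using k1 by (simp add: power2_eq_square)
    have "1 + s \<le> (1 + 8/c)*real k*(1 + t)" proof -
     have "(1 + 8/c)*real k*(1 + t) = real k + 8*real k/c + real k*t + 8*real k/c*t" using c by (simp add: field_simps)
     moreover have "8*real k/c*t = s" unfolding ts using c k1 by simp
     moreover have "8*real k/c \<ge> 0" "real k*t \<ge> 0" using c k1 t0 by auto
     ultimately show ?thesis using k1 by linarith
    qed
    also have "... \<le> (1 + 8/c)*real k*exp t" using c k1 by (intro mult_left_mono exp_ge_add_one_self) auto
    finally show ?thesis unfolding s_def[symmetric] exp_minus using s0 by (simp add: field_simps)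
   qed
   have "x n^(2*i)*exp (- c*real k*(x n)^2) \<le> ((2/c)^i*(real i^i*exp t)/real k^i)*(exp (- t)*exp (- t))"
    unfolding e by (intro mult_right_mono 1) auto
   also have "... = ((2/c)^i*real i^i/real k^i)*exp (- t)" by (simp add: exp_minus)
   also have "... \<le> ((2/c)^i*real i^i/real k^i)*((1 + 8/c)*real k*(1/(1 + (2*real k*Q + real_of_int n)^2)))"
    using c by (intro mult_left_mono 2) auto
   finally show ?thesis by (simp add: D_def mult_ac)
  qed
  have S: "(\<lambda>n. (D*real k/real k^i)*(1/(1 + (2*real k*Q + real_of_int n)^2))) summable_on UNIV" by (intro summable_on_cmult_right K)
  have nn: "0 \<le> x n^(2*i)*exp (- c*real k*(x n)^2)" for n by (simp add: power_mult)
  have S1: "(\<lambda>n. x n^(2*i)*exp (- c*real k*(x n)^2)) summable_on UNIV" by (rule summable_on_comparison_test[OF S bd nn])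
  then show "(\<lambda>n. (Q + pt k n)^(2*i)*exp (- c*real k*(Q + pt k n)^2)) summable_on UNIV" unfolding x_def .
  have "(\<Sum>\<^sub>\<infinity>n. x n^(2*i)*exp (- c*real k*(x n)^2)) \<le> (\<Sum>\<^sub>\<infinity>n. (D*real k/real k^i)*(1/(1 + (2*real k*Q + real_of_int n)^2)))"
   by (rule infsum_mono[OF S1 S bd])
  also have "... = (D*real k/real k^i)*(\<Sum>\<^sub>\<infinity>n. 1/(1 + (2*real k*Q + real_of_int n)^2))" by (rule infsum_cmult_right')
  also have "... \<le> (D*real k/real k^i)*K" using D0 by (intro mult_left_mono K) auto
  finally show "(\<Sum>\<^sub>\<infinity>n. (Q + pt k n)^(2*i)*exp (- c*real k*(Q + pt k n)^2)) \<le> D*K*real k/real k^i"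
   unfolding x_def by (simp add: mult_ac)
 qed
qed

text \<open>The uniformity in \<open>b\<close> serves the heat time \<open>beta \<tau> k\<close>,
  which varies with \<open>k\<close> but stays bounded.\<close>

lemma heat_bound:
 "\<exists>C\<ge>0. \<exists>d\<ge>0. \<forall>b. norm b \<le> B --> (\<forall>y. norm (poly (heat b p) y) \<le> C*exp (d*norm y))" proof -
 have "\<forall>i. \<exists>C d. C \<ge> 0 \<and> d \<ge> 0 \<and> (\<forall>y. norm (poly ((pderiv ^^ (2*i)) p) y) \<le> C*exp (d*norm y))"
  using poly_exp_bound by blast
 then obtain C d where Cd: "\<And>i. C i \<ge> 0" "\<And>i. d i \<ge> 0" "\<And>i y. norm (poly ((pderiv ^^ (2*i)) p) y) \<le> C i*exp (d i*norm y)"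
  by metis
 define D where "D = (\<Sum>i\<le>degree p. d i)"
 define E where "E = (\<Sum>i\<le>degree p. \<bar>B\<bar>^i*C i)"
 have "norm (poly (heat b p) y) \<le> E*exp (D*norm y)" if "norm b \<le> B" for b y proof -
  have "norm (poly (heat b p) y) \<le> (\<Sum>i\<le>degree p. norm (b^i/fact i*poly ((pderiv ^^ (2*i)) p) y))"
   unfolding heat_def poly_sum poly_smult by (rule norm_sum)
  also have "... \<le> (\<Sum>i\<le>degree p. (\<bar>B\<bar>^i*C i)*exp (D*norm y))" proof (rule sum_mono)
   fix i assume i: "i \<in> {..degree p}"
   have "norm (b^i/fact i) \<le> \<bar>B\<bar>^i" proof -
    have "norm (b^i/fact i) \<le> norm b^i/1" unfolding norm_divide norm_power norm_fact by (intro divide_left_mono) (auto simp: fact_ge_1)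
    also have "... \<le> \<bar>B\<bar>^i" using that by (simp add: power_mono)
    finally show ?thesis .
   qed
   moreover have "norm (poly ((pderiv ^^ (2*i)) p) y) \<le> C i*exp (D*norm y)" proof -
    have "d i \<le> D" unfolding D_def using i Cd by (intro member_le_sum) auto
    then have "C i*exp (d i*norm y) \<le> C i*exp (D*norm y)" using Cd by (intro mult_left_mono) (auto intro: mult_right_mono)
    then show ?thesis using Cd(3)[of i y] by linarith
   qed
   ultimately have "norm (b^i/fact i)*norm (poly ((pderiv ^^ (2*i)) p) y) \<le> \<bar>B\<bar>^i*(C i*exp (D*norm y))"
    using Cd by (intro mult_mono) auto
   then show "norm (b^i/fact i*poly ((pderiv ^^ (2*i)) p) y) \<le> \<bar>B\<bar>^i*C i*exp (D*norm y)" unfolding norm_mult mult.assoc .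
  qed
  also have "... = E*exp (D*norm y)" unfolding E_def by (simp add: sum_distrib_right)
  finally show ?thesis .
 qed
 moreover have "E \<ge> 0" "D \<ge> 0" unfolding E_def D_def using Cd by (auto intro!: sum_nonneg)
 ultimately show ?thesis by blast
qed

lemma norm_beta_le:
 assumes "k \<ge> 1" shows "norm (beta \<tau> k) \<le> norm (beta \<tau> 1)"
 unfolding beta_def norm_divide norm_mult using assms by (cases "\<tau> = 0") (auto intro!: divide_left_mono mult_right_mono)

lemma beta_scale: "beta \<tau> k = beta \<tau> 1/of_nat k" by (simp add: beta_def)

text \<open>For \<open>|P| <= 3/4\<close> every other index has \<open>|P + m| >= 1/4\<close>, so
  its dual term is exponentially small in \<open>k\<close>. The range 3/4 is wide enough to contain
  both a small \<open>p\<close> and \<open>p + 1/2\<close>.\<close>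

lemma moment_asymptotics:
 assumes tau: "Im \<tau> > 0" shows "\<exists>C\<ge>0. \<forall>k\<ge>1. \<forall>Q P. \<bar>P\<bar> \<le> 3/4 -->
  norm ((\<Sum>\<^sub>\<infinity>n. poly p (lat k Q n)*primal \<tau> k Q n (of_real P)) - poly (heat (beta \<tau> k) p) (- of_real P / \<tau>)*dual \<tau> k Q 0 (of_real P)) \<le> C/real k^N"
proof -
 have t0: "\<tau> \<noteq> 0" using tau by auto
 define v where "v = dual_rate \<tau>"
 have v: "v > 0" unfolding v_def by (rule dual_rate_pos[OF tau])
 obtain Ch d where Ch: "Ch \<ge> 0" "d \<ge> 0" "\<And>b y. norm b \<le> norm (beta \<tau> 1) ==> norm (poly (heat b p) y) \<le> Ch*exp (d*norm y)"
  using heat_bound by blast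
 define G where "G = dual_norm \<tau>"
 have G0: "G \<ge> 0" by (simp add: G_def dual_norm_def)
 define R where "R = d/norm \<tau>"
 define L where "L = exp (R^2/(2*(v/2))) * max 1 (2/(v/2))"
 have L0: "L \<ge> 0" by (simp add: L_def)
 obtain K where K: "K > 0" "\<And>y. (\<lambda>n::int. 1/(1 + (y + real_of_int n)^2)) summable_on UNIV"
  "\<And>y. (\<Sum>\<^sub>\<infinity>n::int. 1/(1 + (y + real_of_int n)^2)) \<le> K" using infsum_shifted_inverse_square by blast
 obtain C1 where C1: "C1 \<ge> 0" "\<And>k. k \<ge> 1 ==> exp (- (v/32)*real k) \<le> C1/real k^(N + 1)"
  using exp_decay_le_power[of "v/32" "N+1"] v by auto
 define C where "C = Ch * G * L*K * C1"
 have "norm ((\<Sum>\<^sub>\<infinity>n. poly p (lat k Q n)*primal \<tau> k Q n (of_real P)) - poly (heat (beta \<tau> k) p) (- of_real P / \<tau>)*dual \<tau> k Q 0 (of_real P)) \<le> C/real k^N"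
  if k: "k \<ge> 1" and P: "\<bar>P\<bar> \<le> 3/4" for k Q P proof -
  have k1: "real k \<ge> 1" using k by simp
  define f where "f = (\<lambda>m. poly (heat (beta \<tau> k) p) (- (of_real P + of_int m) / \<tau>)*dual \<tau> k Q m (of_real P))"
  define S where "S = (\<Sum>\<^sub>\<infinity>n. poly p (lat k Q n)*primal \<tau> k Q n (of_real P))"
  have hs: "(f has_sum S) UNIV" unfolding f_def S_def by (rule poisson_moment[OF tau k])
  have hs0: "(f has_sum (S - f 0)) (UNIV - {0})" by (rule has_sum_Diff[OF hs has_sum_finiteI[of "{0}"]]) auto
  define q where "q = Ch * G * L*(C1/real k^N)"
  have q0: "q \<ge> 0" unfolding q_def using Ch G0 L0 C1 k1 by (intro mult_nonneg_nonneg) auto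
  have bd: "norm (f m) \<le> q*(1/(1 + (P + real_of_int m)^2))" if "m \<in> UNIV - {0}" for m proof -
   define s where "s = (P + real_of_int m)^2"
   have "\<bar>real_of_int m\<bar> \<ge> 1" using that by simp
   then have "\<bar>P + real_of_int m\<bar> \<ge> 1/4" using P by linarith
   then have "(1/4)^2 \<le> \<bar>P + real_of_int m\<bar>^2" by (intro power_mono) auto
   then have s: "s \<ge> 1/16" by (simp add: s_def power2_eq_square)
   have "norm (- (of_real P + of_int m) / \<tau>) = \<bar>P + real_of_int m\<bar>/norm \<tau>"
    unfolding norm_divide norm_minus_cancel by (metis norm_of_real of_real_add of_real_of_int_eq)
   then have 1: "norm (poly (heat (beta \<tau> k) p) (- (of_real P + of_int m) / \<tau>)) \<le> Ch*exp (R*\<bar>P + real_of_int m\<bar>)"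
    using Ch(3)[OF norm_beta_le[OF k], of "- (of_real P + of_int m) / \<tau>"] by (simp add: R_def)
   \<comment> \<open>One half of the exponent is kept for the sum over \<open>m\<close>; the other
     half, through \<open>s >= 1/16\<close>, gives the decay in \<open>k\<close>.\<close>
   have "v * real k * s \<ge> (v/2) * s + (v/32)*real k" proof -
    have a: "real k * s \<ge> 1 * s" using k1 s by (intro mult_right_mono) auto
    have b: "real k * s \<ge> real k*(1/16)" using k1 s by (intro mult_left_mono) auto
    have "real k * s \<ge> s/2 + real k/32" using a b by linarith
    then have "v * (real k * s) \<ge> v * (s/2 + real k/32)" using v by (intro mult_left_mono) auto
    then show ?thesis by (simp add: algebra_simps)
   qed
   then have "exp (- v * real k * s) \<le> exp (- (v/2) * s)*exp (- (v/32)*real k)" by (simp add: exp_add[symmetric])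
   then have 2: "norm (dual \<tau> k Q m (of_real P)) \<le> G * sqrt (real k)*(exp (- (v/2) * s)*exp (- (v/32)*real k))"
    unfolding norm_dual[OF tau k] G_def v_def s_def by (intro mult_left_mono) (auto simp: dual_norm_def)
   have "norm (f m) \<le> (Ch*exp (R*\<bar>P + real_of_int m\<bar>))*(G * sqrt (real k)*(exp (- (v/2) * s)*exp (- (v/32)*real k)))"
    unfolding f_def norm_mult using Ch by (intro mult_mono 1 2) auto
   also have "... = (Ch * G)*(sqrt (real k)*exp (- (v/32)*real k))*exp (- (v/2)*(P + real_of_int m)^2 + R*\<bar>P + real_of_int m\<bar>)"
    unfolding s_def exp_add by (simp add: mult_ac)
   also have "... \<le> (Ch * G)*(C1/real k^N)*(L/(1 + (P + real_of_int m)^2))" proof (intro mult_mono mult_left_mono)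
    show "exp (- (v/2)*(P + real_of_int m)^2 + R*\<bar>P + real_of_int m\<bar>) \<le> L/(1 + (P + real_of_int m)^2)"
     unfolding L_def by (rule exp_neg_square_le) (use v in simp)
    have "sqrt (real k) \<le> real k" using k1 real_le_lsqrt[of "real k" "real k"] by (simp add: power2_eq_square)
    then have "sqrt (real k)*exp (- (v/32)*real k) \<le> real k*(C1/real k^(N + 1))" by (intro mult_mono C1(2)[OF k]) auto
    then show "sqrt (real k)*exp (- (v/32)*real k) \<le> C1/real k^N" using k1 by simp
   qed (use Ch G0 C1 k1 in auto)
   also have "... = q*(1/(1 + (P + real_of_int m)^2))" by (simp add: q_def mult_ac)
   finally show ?thesis .
  qed
  have sm: "(\<lambda>m. q*(1/(1 + (P + real_of_int m)^2))) summable_on UNIV" by (intro summable_on_cmult_right K)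
  have sm0: "(\<lambda>m. q*(1/(1 + (P + real_of_int m)^2))) summable_on (UNIV - {0})" by (rule summable_on_subset_banach[OF sm]) auto
  have "norm (S - f 0) \<le> (\<Sum>\<^sub>\<infinity>m\<in>UNIV - {0}. q*(1/(1 + (P + real_of_int m)^2)))"
   by (rule norm_infsum_le[OF hs0 has_sum_infsum[OF sm0] bd])
  also have "... \<le> (\<Sum>\<^sub>\<infinity>m. q*(1/(1 + (P + real_of_int m)^2)))" by (rule infsum_mono_neutral[OF sm0 sm]) (use q0 in auto)
  also have "... = q*(\<Sum>\<^sub>\<infinity>m. 1/(1 + (P + real_of_int m)^2))" by (rule infsum_cmult_right')
  also have "... \<le> q*K" by (intro mult_left_mono K q0)
  also have "... = C/real k^N" by (simp add: q_def C_def mult_ac)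
  finally show ?thesis unfolding S_def f_def by simp
 qed
 moreover have "C \<ge> 0" unfolding C_def using Ch G0 L0 K C1 by (intro mult_nonneg_nonneg) auto
 ultimately show ?thesis by blast
qed

section \<open>Asymptotics of weighted theta sums\<close>

definition taylor_poly :: "(nat => complex) => nat => complex poly" where
 "taylor_poly c J = (\<Sum>j<J. monom (c j/fact j) j)"

lemma poly_taylor_poly: "poly (taylor_poly c J) y = (\<Sum>j<J. c j/fact j*y^j)" by (simp add: taylor_poly_def poly_sum poly_monom)

lemma has_sum_finite_sum:
 fixes f :: "'i => 'a => complex"
 assumes "\<And>i. i \<in> A ==> (f i has_sum s i) B" shows "((\<lambda>n. \<Sum>i\<in>A. f i n) has_sum (\<Sum>i\<in>A. s i)) B"
 using assms by (induction A rule: infinite_finite_induct) (auto intro!: has_sum_add)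

lemma pderiv_taylor_poly: "pderiv (taylor_poly c J) = taylor_poly (\<lambda>j. c (Suc j)) (J - 1)" proof (cases J)
 case (Suc J')
 have "pderiv (taylor_poly c J) = (\<Sum>j<Suc J'. pderiv (monom (c j/fact j) j))"
  by (simp add: taylor_poly_def Suc pderiv_sum_distrib del: sum.lessThan_Suc)
 also have "... = (\<Sum>j<J'. pderiv (monom (c (Suc j)/fact (Suc j)) (Suc j)))" by (subst sum.lessThan_Suc_shift) (simp add: pderiv_monom)
 also have "... = taylor_poly (\<lambda>j. c (Suc j)) J'" unfolding taylor_poly_def proof (rule sum.cong[OF refl])
  fix j
  have "of_nat (Suc j)*(c (Suc j)/fact (Suc j)) = c (Suc j)/fact j" by (simp only: fact_Suc) (simp add: field_simps del: of_nat_Suc)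
  then show "pderiv (monom (c (Suc j)/fact (Suc j)) (Suc j)) = monom (c (Suc j)/fact j) j" by (simp add: pderiv_monom del: of_nat_Suc fact_Suc)
 qed
 finally show ?thesis by (simp add: Suc)
qed (simp add: taylor_poly_def)

lemma higher_pderiv_taylor_poly:
 "(pderiv ^^ m) (taylor_poly c J) = taylor_poly (\<lambda>j. c (j + m)) (J - m)" by (induction m) (auto simp: pderiv_taylor_poly)

lemma degree_taylor_poly: "degree (taylor_poly c J) \<le> J - 1"
 unfolding taylor_poly_def by (rule degree_sum_le) (auto intro: order_trans[OF degree_monom_le])

lemma heat_sum: "heat b (sum f A) = (\<Sum>x\<in>A. heat b (f x))" proof (induction A rule: infinite_finite_induct)
 case (insert x F)
 then show ?case by (simp add: heat_add)
qed (auto simp: heat_def)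

lemma heat_taylor_poly: "heat b (taylor_poly c J) = (\<Sum>j<J. smult (c j/fact j) (heat b (monom 1 j)))" proof -
 have "taylor_poly c J = (\<Sum>j<J. smult (c j/fact j) (monom 1 j))" by (simp add: taylor_poly_def smult_monom)
 then show ?thesis by (simp add: heat_sum heat_smult)
qed

text \<open>The weights have to agree with the holomorphic \<open>w\<close> only at lattice points
  near \<open>x0\<close>; elsewhere polynomial growth in \<open>k\<close> suffices. This admits
  weights with poles away from the centre and weights that are cut off.\<close>

context
 fixes \<tau> :: complex and \<rho> x0 :: real and w :: "complex => complex"
  and W :: "nat => int => complex" and A :: real and M :: nat
 assumes tau: "Im \<tau> > 0" and rho: "\<rho> > 0"
  and w: "w holomorphic_on ball (of_real x0) (2*\<rho>)"
  and Wb: "\<And>k n. k \<ge> 1 ==> norm (W k n) \<le> A*real k^M"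
  and Wl: "\<And>k n. k \<ge> 1 ==> \<bar>pt k n - x0\<bar> < \<rho> ==> W k n = w (of_real (pt k n))"
begin

lemma dist_centre: "dist (complex_of_real x0) (of_real (- Q)) = \<bar>x0 + Q\<bar>" proof -
 have "complex_of_real x0 - of_real (- Q) = of_real (x0 + Q)" by simp
 then show ?thesis unfolding dist_norm by (simp only: norm_of_real)
qed

lemma derivs_bounded: "\<exists>B\<ge>0. \<forall>j\<le>N. \<forall>z\<in>cball (of_real x0) \<rho>. norm ((deriv ^^ j) w z) \<le> B" proof -
 have "\<forall>j. \<exists>B. \<forall>z\<in>cball (of_real x0) \<rho>. norm ((deriv ^^ j) w z) \<le> B" proof
  fix j
  have "continuous_on (cball (of_real x0) \<rho>) ((deriv ^^ j) w)"
   by (rule continuous_on_subset[OF holomorphic_on_imp_continuous_on[OF holomorphic_higher_deriv[OF w open_ball]]])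
    (use rho in auto)
  then have "bounded ((deriv ^^ j) w ` cball (of_real x0) \<rho>)" by (intro compact_imp_bounded compact_continuous_image) auto
  then show "\<exists>B. \<forall>z\<in>cball (of_real x0) \<rho>. norm ((deriv ^^ j) w z) \<le> B" unfolding bounded_iff by blast
 qed
 then obtain B where B: "\<And>j z. z\<in>cball (of_real x0) \<rho> ==> norm ((deriv ^^ j) w z) \<le> B j" by metis
 have "norm ((deriv ^^ j) w z) \<le> (\<Sum>j\<le>N. \<bar>B j\<bar>)" if "j \<le> N" "z\<in>cball (of_real x0) \<rho>" for j z proof -
  have "norm ((deriv ^^ j) w z) \<le> \<bar>B j\<bar>" using B[OF that(2), of j] by linarith
  also have "... \<le> (\<Sum>j\<le>N. \<bar>B j\<bar>)" by (rule member_le_sum) (use that in auto)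
  finally show ?thesis .
 qed
 moreover have "(\<Sum>j\<le>N. \<bar>B j\<bar>) \<ge> 0" by (intro sum_nonneg) auto
 ultimately show ?thesis by blast
qed

text \<open>The centre of expansion \<open>-Q\<close> is the peak of the Gaussian
  \<open>primal\<close>.\<close>

definition tay :: "nat => real => complex poly" where
 "tay J Q = taylor_poly (\<lambda>j. (deriv ^^ j) w (of_real (- Q))) J"

text \<open>Complex displacements are allowed: this is used both for real \<open>y\<close> and for \<open>y = - P / \<tau>\<close>.\<close>

lemma taylor_error:
 assumes "J \<ge> 1" shows "\<exists>B\<ge>0. \<forall>Q y. \<bar>Q + x0\<bar> \<le> \<rho>/2 --> norm y \<le> \<rho>/2 -->
  norm ((deriv ^^ m) w (of_real (- Q) + y) - poly (taylor_poly (\<lambda>j. (deriv ^^ (j + m)) w (of_real (- Q))) J) y) \<le> B*norm y^J" proof -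
 obtain B where B: "B \<ge> 0" "\<And>j z. j \<le> J + m ==> z \<in> cball (of_real x0) \<rho> ==> norm ((deriv ^^ j) w z) \<le> B"
  using derivs_bounded[of "J + m"] by blast
 obtain n where n: "J = Suc n" using assms by (cases J) auto
 have "norm ((deriv ^^ m) w (of_real (- Q) + y) - poly (taylor_poly (\<lambda>j. (deriv ^^ (j + m)) w (of_real (- Q))) J) y) \<le> B*norm y^J"
  if Q: "\<bar>Q + x0\<bar> \<le> \<rho>/2" and y: "norm y \<le> \<rho>/2" for Q y proof -
  have d: "dist (complex_of_real x0) (of_real (- Q)) \<le> \<rho>/2" unfolding dist_centre using Q by (simp add: add.commute)
  have "cmod ((deriv ^^ (0 + m)) w (of_real (- Q) + y) - (\<Sum>i\<le>n. (deriv ^^ (i + m)) w (of_real (- Q))*((of_real (- Q) + y) - of_real (- Q))^i/fact i))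
    \<le> B * cmod ((of_real (- Q) + y) - of_real (- Q))^Suc n/fact n"
  proof (rule complex_Taylor[of "cball (of_real x0) \<rho>" n "\<lambda>i. (deriv ^^ (i + m)) w"])
   fix i z assume z: "z \<in> cball (complex_of_real x0) \<rho>"
   have zb: "z \<in> ball (complex_of_real x0) (2*\<rho>)" using z rho by auto
   show "((deriv ^^ (i + m)) w has_field_derivative (deriv ^^ (Suc i + m)) w z) (at z within cball (of_real x0) \<rho>)"
    using has_field_derivative_higher_deriv[OF w open_ball zb, of "i + m"] has_field_derivative_at_within by fastforce
  next
   fix z assume z: "z \<in> cball (complex_of_real x0) \<rho>"
   show "norm ((deriv ^^ (Suc n + m)) w z) \<le> B" using B(2)[of "Suc n + m" z] z n by simp
  next
   show "complex_of_real (- Q) \<in> cball (complex_of_real x0) \<rho>" using d rho by simp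
   have "dist (complex_of_real x0) (of_real (- Q) + y) \<le> dist (complex_of_real x0) (of_real (- Q)) + norm y"
    by (metis add_diff_cancel_left' dist_norm dist_triangle norm_minus_commute)
   then show "of_real (- Q) + y \<in> cball (complex_of_real x0) \<rho>" using d y by simp
  qed auto
  also have "... \<le> B*norm y^J/1" unfolding n add_diff_cancel_left' by (rule divide_left_mono) (use B in \<open>auto simp: fact_ge_1\<close>)
  finally show ?thesis unfolding poly_taylor_poly n lessThan_Suc_atMost by simp
 qed
 then show ?thesis using B(1) by blast
qed

text \<open>Close to the peak this is Taylor's bound of order \<open>2I\<close>. Further away only
  crude bounds hold, including the growth \<open>k^M\<close> of the weights; since
  \<open>|x|/h >= 1\<close> there, an extra factor \<open>x^(2M)\<close> can be inserted, whose
  Gaussian moment later pays for \<open>k^M\<close>.\<close>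

lemma W_remainder:
 assumes "I \<ge> 1" shows "\<exists>C\<ge>0. \<forall>k\<ge>1. \<forall>Q n. \<bar>Q + x0\<bar> \<le> \<rho>/2 -->
  norm (W k n - poly (tay (2 * I) Q) (lat k Q n)) \<le>
   C*((Q + pt k n)^(2 * I) + real k^M*(Q + pt k n)^(2*(I + M)))" proof -
 obtain B where B: "B \<ge> 0" "\<And>Q y. \<bar>Q + x0\<bar> \<le> \<rho>/2 ==> norm y \<le> \<rho>/2 ==>
  norm (w (of_real (- Q) + y) - poly (tay (2 * I) Q) y) \<le> B*norm y^(2 * I)" proof -
  have "1 \<le> 2 * I" using assms by simp
  from taylor_error[OF this, of 0]
  have "\<exists>B\<ge>0. \<forall>Q y. \<bar>Q + x0\<bar> \<le> \<rho>/2 --> norm y \<le> \<rho>/2 -->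
   norm (w (of_real (- Q) + y) - poly (tay (2 * I) Q) y) \<le> B*norm y^(2 * I)" unfolding tay_def by (simp only: add_0_right funpow_0)
  then show ?thesis using that by blast
 qed
 obtain D where D: "D \<ge> 0" "\<And>j z. j \<le> 2 * I ==> z \<in> cball (of_real x0) \<rho> ==> norm ((deriv ^^ j) w z) \<le> D"
  using derivs_bounded[of "2 * I"] by blast
 define h where "h = \<rho>/2"
 have h: "h > 0" using rho by (simp add: h_def)
 define E where "E = \<bar>A\<bar> + (\<Sum>j<2 * I. D*h^j)"
 have E0: "E \<ge> 0" unfolding E_def using D h by (intro add_nonneg_nonneg sum_nonneg) auto
 define C where "C = max B (E/h^(2*(I + M)))"
 have C0: "C \<ge> 0" using B by (simp add: C_def)
 have "norm (W k n - poly (tay (2 * I) Q) (lat k Q n)) \<le>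
   C*((Q + pt k n)^(2 * I) + real k^M*(Q + pt k n)^(2*(I + M)))"
  if k: "k \<ge> 1" and Q: "\<bar>Q + x0\<bar> \<le> \<rho>/2" for k Q n proof -
  define x where "x = Q + pt k n"
  have lx: "lat k Q n = of_real x" by (simp add: lat_of_real x_def)
  have ev: "x^(2*m) = \<bar>x\<bar>^(2*m)" for m by (simp add: power_even_abs)
  have n0: "0 \<le> x^(2*m)" for m by (simp add: power_mult)
  have k1: "real k^M \<ge> 1" using k by simp
  show ?thesis proof (cases "\<bar>x\<bar> < h")
   case True
   have "\<bar>pt k n - x0\<bar> < \<rho>" proof -
    have "pt k n - x0 = x - (Q + x0)" by (simp add: x_def)
    then show ?thesis using abs_triangle_ineq4[of x "Q + x0"] True Q unfolding h_def by linarith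
   qed
   then have "W k n = w (of_real (pt k n))" by (rule Wl[OF k])
   also have "of_real (pt k n) = of_real (- Q) + (of_real x :: complex)" by (simp add: x_def)
   finally have "norm (W k n - poly (tay (2 * I) Q) (lat k Q n)) \<le> B*norm (of_real x :: complex)^(2 * I)"
    unfolding lx using B(2)[OF Q, of "of_real x"] True by (simp add: h_def)
   also have "... \<le> C*x^(2 * I)" unfolding norm_of_real ev by (intro mult_right_mono) (auto simp: C_def)
   also have "... \<le> C*(x^(2 * I) + real k^M*x^(2*(I + M)))" using C0 n0[of "I + M"] k1 by (intro mult_left_mono) (auto simp del: mult_2)
   finally show ?thesis unfolding x_def .
  next
   case False
   define t where "t = \<bar>x\<bar>/h"
   have t: "t \<ge> 1" using False h by (simp add: t_def)
   have tx: "\<bar>x\<bar> = h*t" using h by (simp add: t_def)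
   have Qb: "of_real (- Q) \<in> cball (complex_of_real x0) \<rho>" unfolding mem_cball dist_centre using Q rho by (simp add: add.commute)
   have "norm (poly (tay (2 * I) Q) (lat k Q n)) \<le> (\<Sum>j<2 * I. D*h^j*t^(2*(I + M)))" unfolding tay_def poly_taylor_poly
   proof (rule sum_norm_le)
    fix j assume j: "j \<in> {..<2 * I}"
    have "norm ((deriv ^^ j) w (of_real (- Q))/fact j) \<le> D/1"
     unfolding norm_divide norm_fact by (intro frac_le D Qb) (use j fact_ge_1 D in auto)
    moreover have "norm (lat k Q n^j) \<le> h^j*t^(2*(I + M))" unfolding lx norm_power norm_of_real tx power_mult_distrib
     using h t j by (intro mult_left_mono power_increasing) auto
    ultimately have "norm ((deriv ^^ j) w (of_real (- Q))/fact j)*norm (lat k Q n^j) \<le> D*(h^j*t^(2*(I + M)))"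
     using D by (intro mult_mono) auto
    then show "norm ((deriv ^^ j) w (of_real (- Q))/fact j * lat k Q n^j) \<le> D*h^j*t^(2*(I + M))" unfolding norm_mult mult.assoc .
   qed
   also have "... = (\<Sum>j<2 * I. D*h^j)*t^(2*(I + M))*1" by (simp add: sum_distrib_right)
   also have "... \<le> (\<Sum>j<2 * I. D*h^j)*t^(2*(I + M))*real k^M" using D h t k1 by (intro mult_left_mono mult_nonneg_nonneg sum_nonneg) auto
   finally have 1: "norm (poly (tay (2 * I) Q) (lat k Q n)) \<le> (\<Sum>j<2 * I. D*h^j)*t^(2*(I + M))*real k^M" .
   have "norm (W k n) \<le> \<bar>A\<bar>*1*real k^M" using Wb[OF k, of n] by (intro order_trans[OF Wb[OF k]]) (auto intro!: mult_right_mono)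
   also have "... \<le> \<bar>A\<bar>*t^(2*(I + M))*real k^M" using t by (intro mult_right_mono mult_left_mono) auto
   finally have 2: "norm (W k n) \<le> \<bar>A\<bar>*t^(2*(I + M))*real k^M" .
   have "norm (W k n - poly (tay (2 * I) Q) (lat k Q n)) \<le> E*t^(2*(I + M))*real k^M"
    using norm_triangle_ineq4[of "W k n" "poly (tay (2 * I) Q) (lat k Q n)"] 1 2 by (simp add: E_def distrib_right)
   also have "... = (E/h^(2*(I + M)))*(real k^M*x^(2*(I + M)))" unfolding ev tx power_mult_distrib using h by simp
   also have "... \<le> C*(real k^M*x^(2*(I + M)))" using k1 by (intro mult_right_mono mult_nonneg_nonneg n0) (auto simp: C_def)
   also have "... \<le> C*(x^(2 * I) + real k^M*x^(2*(I + M)))" using C0 n0[of I] by (intro mult_left_mono) auto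
   finally show ?thesis unfolding x_def .
  qed
 qed
 then show ?thesis using C0 by blast
qed

lemma W_primal_summable:
 assumes k: "k \<ge> 1" shows "(\<lambda>n. W k n*primal \<tau> k Q n (of_real P)) summable_on UNIV" proof -
 have "(\<lambda>n. (Q + pt k n)^(2*0)*exp (- (2*pi*Im \<tau>)*real k*(Q + pt k n)^2)) summable_on UNIV" proof -
  have "2*pi*Im \<tau> > 0" using tau by simp
  from gaussian_moment_bound[OF this, of 0] k show ?thesis by blast
 qed
 then have s: "(\<lambda>n. (A*real k^M)*norm (primal \<tau> k Q n (of_real P))) summable_on UNIV"
  unfolding norm_primal by (intro summable_on_cmult_right) simp
 show ?thesis by (rule abs_summable_summable[OF Infinite_Sum.abs_summable_on_comparison_test'[OF s]])
   (use Wb[OF k] in \<open>auto simp: norm_mult intro!: mult_right_mono\<close>)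
qed

text \<open>The Taylor polynomial is summed monomial by monomial with
  \<open>moment_asymptotics\<close>. Its constants do not involve \<open>Q\<close>; the dependence
  on \<open>Q\<close> sits in the Taylor coefficients alone, which are bounded, so the estimate is
  uniform.\<close>

lemma theta_sum_taylor:
 assumes I: "I \<ge> 1" shows "\<exists>C\<ge>0. \<forall>k\<ge>1. \<forall>Q P. \<bar>Q + x0\<bar> \<le> \<rho>/2 --> \<bar>P\<bar> \<le> 3/4 -->
  norm ((\<Sum>\<^sub>\<infinity>n. W k n*primal \<tau> k Q n (of_real P)) - poly (heat (beta \<tau> k) (tay (2 * I) Q)) (- of_real P / \<tau>)*dual \<tau> k Q 0 (of_real P))
   \<le> C*real k/real k^I" proof -
 define c where "c = 2*pi*Im \<tau>"
 have c: "c > 0" using tau by (simp add: c_def)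
 obtain C1 where C1: "C1 \<ge> 0" "\<And>k Q n. k \<ge> 1 ==> \<bar>Q + x0\<bar> \<le> \<rho>/2 ==>
  norm (W k n - poly (tay (2 * I) Q) (lat k Q n)) \<le>
   C1*((Q + pt k n)^(2 * I) + real k^M*(Q + pt k n)^(2*(I + M)))" using W_remainder[OF I] by blast
 obtain C2 where C2: "C2 \<ge> 0" "\<And>k Q. k \<ge> 1 ==> (\<lambda>n. (Q + pt k n)^(2 * I)*exp (- c*real k*(Q + pt k n)^2)) summable_on UNIV"
  "\<And>k Q. k \<ge> 1 ==> (\<Sum>\<^sub>\<infinity>n. (Q + pt k n)^(2 * I)*exp (- c*real k*(Q + pt k n)^2)) \<le> C2*real k/real k^I"
  using gaussian_moment_bound[OF c, of I] by blast
 obtain C3 where C3: "C3 \<ge> 0" "\<And>k Q. k \<ge> 1 ==> (\<lambda>n. (Q + pt k n)^(2*(I + M))*exp (- c*real k*(Q + pt k n)^2)) summable_on UNIV"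
  "\<And>k Q. k \<ge> 1 ==> (\<Sum>\<^sub>\<infinity>n. (Q + pt k n)^(2*(I + M))*exp (- c*real k*(Q + pt k n)^2)) \<le> C3*real k/real k^(I + M)"
  using gaussian_moment_bound[OF c, of "I + M"] by blast
 have "\<forall>j. \<exists>C\<ge>0. \<forall>k\<ge>1. \<forall>Q P. \<bar>P\<bar> \<le> 3/4 -->
  norm ((\<Sum>\<^sub>\<infinity>n. poly (monom 1 j) (lat k Q n)*primal \<tau> k Q n (of_real P)) - poly (heat (beta \<tau> k) (monom 1 j)) (- of_real P / \<tau>)*dual \<tau> k Q 0 (of_real P)) \<le> C/real k^I"
  using moment_asymptotics[OF tau] by blast
 then obtain C4 where C4: "\<And>j. C4 j \<ge> 0" "\<And>j k Q P. k \<ge> 1 ==> \<bar>P\<bar> \<le> 3/4 ==>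
  norm ((\<Sum>\<^sub>\<infinity>n. poly (monom 1 j) (lat k Q n)*primal \<tau> k Q n (of_real P)) - poly (heat (beta \<tau> k) (monom 1 j)) (- of_real P / \<tau>)*dual \<tau> k Q 0 (of_real P)) \<le> C4 j/real k^I"
  using that by (elim choice[THEN exE]) blast
 obtain D where D: "D \<ge> 0" "\<And>j z. j \<le> 2 * I ==> z \<in> cball (of_real x0) \<rho> ==> norm ((deriv ^^ j) w z) \<le> D"
  using derivs_bounded[of "2 * I"] by blast
 define C where "C = C1*(C2 + C3) + (\<Sum>j<2 * I. D * C4 j)"
 have "norm ((\<Sum>\<^sub>\<infinity>n. W k n*primal \<tau> k Q n (of_real P)) - poly (heat (beta \<tau> k) (tay (2 * I) Q)) (- of_real P / \<tau>)*dual \<tau> k Q 0 (of_real P))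
   \<le> C*real k/real k^I"
  if k: "k \<ge> 1" and Q: "\<bar>Q + x0\<bar> \<le> \<rho>/2" and P: "\<bar>P\<bar> \<le> 3/4" for k Q P proof -
  have k1: "real k \<ge> 1" using k by simp
  have Qb: "of_real (- Q) \<in> cball (complex_of_real x0) \<rho>" unfolding mem_cball dist_centre using Q rho by (simp add: add.commute)
  define x where "x = (\<lambda>n. Q + pt k n)"
  define u where "u = (\<lambda>n. primal \<tau> k Q n (of_real P))"
  define e where "e = (\<lambda>n. exp (- c*real k*(x n)^2))"
  have nu: "norm (u n) = e n" for n unfolding u_def e_def norm_primal c_def x_def ..
  define T where "T = (\<Sum>\<^sub>\<infinity>n. W k n * u n)"
  define m where "m = (\<lambda>j. (\<Sum>\<^sub>\<infinity>n. poly (monom 1 j) (lat k Q n) * u n))"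
  define a where "a = (\<lambda>j. (deriv ^^ j) w (of_real (- Q))/fact j)"
  have hT: "((\<lambda>n. W k n * u n) has_sum T) UNIV" unfolding T_def u_def by (rule has_sum_infsum[OF W_primal_summable[OF k]])
  have hm: "((\<lambda>n. poly (monom 1 j) (lat k Q n) * u n) has_sum m j) UNIV" for j unfolding m_def u_def by (rule primal_summable[OF tau k])
  have "((\<lambda>n. \<Sum>j<2 * I. a j*(poly (monom 1 j) (lat k Q n) * u n)) has_sum (\<Sum>j<2 * I. a j*m j)) UNIV"
   by (intro has_sum_finite_sum has_sum_cmult_right hm) 
  then have hp: "((\<lambda>n. poly (tay (2 * I) Q) (lat k Q n) * u n) has_sum (\<Sum>j<2 * I. a j*m j)) UNIV"
   unfolding tay_def poly_taylor_poly a_def by (simp add: poly_monom sum_distrib_right mult.assoc)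
  have hr: "((\<lambda>n. (W k n - poly (tay (2 * I) Q) (lat k Q n)) * u n) has_sum (T - (\<Sum>j<2 * I. a j*m j))) UNIV"
   using has_sum_add[OF hT has_sum_cmult_right[OF hp, of "-1"]] by (simp add: left_diff_distrib)
  have hb: "((\<lambda>n. C1*(x n^(2 * I)*e n + real k^M*(x n^(2*(I + M))*e n))) has_sum
    C1*((\<Sum>\<^sub>\<infinity>n. x n^(2 * I)*e n) + real k^M*(\<Sum>\<^sub>\<infinity>n. x n^(2*(I + M))*e n))) UNIV"
   unfolding x_def e_def by (intro has_sum_cmult_right has_sum_add has_sum_infsum C2 C3 k)
  have 1: "norm (T - (\<Sum>j<2 * I. a j*m j)) \<le> C1*(C2 + C3)*real k/real k^I" proof -
   have "norm (T - (\<Sum>j<2 * I. a j*m j)) \<le> C1*((\<Sum>\<^sub>\<infinity>n. x n^(2 * I)*e n) + real k^M*(\<Sum>\<^sub>\<infinity>n. x n^(2*(I + M))*e n))"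
   proof (rule norm_infsum_le[OF hr hb])
    fix n
    have "norm ((W k n - poly (tay (2 * I) Q) (lat k Q n)) * u n) \<le> (C1*(x n^(2 * I) + real k^M*x n^(2*(I + M))))*e n"
     unfolding norm_mult nu x_def by (intro mult_right_mono C1(2)[OF k Q]) (auto simp: e_def)
    then show "norm ((W k n - poly (tay (2 * I) Q) (lat k Q n)) * u n) \<le> C1*(x n^(2 * I)*e n + real k^M*(x n^(2*(I + M))*e n))"
     by (simp add: algebra_simps)
   qed
   also have "... \<le> C1*(C2*real k/real k^I + real k^M*(C3*real k/real k^(I + M)))"
    unfolding x_def e_def using C1 by (intro mult_left_mono add_mono C2(3)[OF k] C3(3)[OF k]) auto
   also have "... = C1*(C2 + C3)*real k/real k^I" using k1 by (simp add: power_add field_simps)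
   finally show ?thesis .
  qed
  define H where "H = (\<lambda>j. poly (heat (beta \<tau> k) (monom 1 j)) (- of_real P / \<tau>)*dual \<tau> k Q 0 (of_real P))"
  have Hs: "poly (heat (beta \<tau> k) (tay (2 * I) Q)) (- of_real P / \<tau>)*dual \<tau> k Q 0 (of_real P) = (\<Sum>j<2 * I. a j * H j)"
   unfolding tay_def heat_taylor_poly H_def a_def by (simp add: poly_sum sum_distrib_right mult.assoc)
  have 2: "norm ((\<Sum>j<2 * I. a j*m j) - (\<Sum>j<2 * I. a j * H j)) \<le> (\<Sum>j<2 * I. D * C4 j)*real k/real k^I" proof -
   have "norm ((\<Sum>j<2 * I. a j*m j) - (\<Sum>j<2 * I. a j * H j)) = norm (\<Sum>j<2 * I. a j*(m j - H j))"
    by (simp add: sum_subtractf right_diff_distrib)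
   also have "... \<le> (\<Sum>j<2 * I. D*(C4 j/real k^I))" proof (rule sum_norm_le)
    fix j assume j: "j \<in> {..<2 * I}"
    have "norm (a j) \<le> D/1" unfolding a_def norm_divide norm_fact by (intro frac_le D Qb) (use j fact_ge_1 D in auto)
    moreover have "norm (m j - H j) \<le> C4 j/real k^I" unfolding m_def H_def u_def by (rule C4(2)[OF k P])
    ultimately show "norm (a j*(m j - H j)) \<le> D*(C4 j/real k^I)" unfolding norm_mult using D by (intro mult_mono) auto
   qed
   also have "... = (\<Sum>j<2 * I. D * C4 j)/real k^I" by (simp add: sum_divide_distrib)
   also have "... \<le> (\<Sum>j<2 * I. D * C4 j)*real k/real k^I" proof (rule divide_right_mono)
    have "(\<Sum>j<2 * I. D * C4 j)*1 \<le> (\<Sum>j<2 * I. D * C4 j)*real k" by (intro mult_left_mono k1 sum_nonneg mult_nonneg_nonneg D C4)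
    then show "(\<Sum>j<2 * I. D * C4 j) \<le> (\<Sum>j<2 * I. D * C4 j)*real k" by simp
   qed simp
   finally show ?thesis .
  qed
  have "norm (T - (\<Sum>j<2 * I. a j * H j)) \<le> C1*(C2 + C3)*real k/real k^I + (\<Sum>j<2 * I. D * C4 j)*real k/real k^I"
   using norm_triangle_mono[OF 1 2] by simp
  then show ?thesis unfolding T_def u_def Hs C_def by (simp add: add_divide_distrib distrib_right)
 qed
 moreover have "C \<ge> 0" unfolding C_def using C1 C2 C3 D C4 by (intro add_nonneg_nonneg mult_nonneg_nonneg sum_nonneg) auto
 ultimately show ?thesis by blast
qed

text \<open>On the dual side stands \<open>w\<close> itself, at the complex point
  \<open>-Q + y\<close> with \<open>y = -P/\<tau>\<close>, instead of a Taylor polynomial. The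
  exchange costs \<open>|y|^(2(I-i))\<close> in the term of index \<open>i\<close>; the factor
  \<open>exp(-v k |y|^2)\<close> of the dual term turns this into \<open>k^(i-I)\<close>, and
  \<open>beta^i\<close> supplies the missing \<open>k^(-i)\<close>.\<close>

theorem theta_sum_asymptotics:
 assumes I: "I \<ge> 1"
 shows "\<exists>C\<ge>0. \<forall>k\<ge>1. \<forall>Q P. \<bar>Q + x0\<bar> \<le> \<rho>/2 --> \<bar>P\<bar> \<le> 3/4 --> \<bar>P\<bar> \<le> norm \<tau>*\<rho>/2 -->
  norm ((\<Sum>\<^sub>\<infinity>n. W k n*primal \<tau> k Q n (of_real P)) -
   dual \<tau> k Q 0 (of_real P)*(\<Sum>i<I. beta \<tau> k^i/fact i*(deriv ^^ (2*i)) w (of_real (- Q) - of_real P / \<tau>)))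
   \<le> C*real k/real k^I" proof -
 have t0: "\<tau> \<noteq> 0" using tau by auto
 obtain C1 where C1: "C1 \<ge> 0" "\<And>k Q P. k \<ge> 1 ==> \<bar>Q + x0\<bar> \<le> \<rho>/2 ==> \<bar>P\<bar> \<le> 3/4 ==>
  norm ((\<Sum>\<^sub>\<infinity>n. W k n*primal \<tau> k Q n (of_real P)) - poly (heat (beta \<tau> k) (tay (2 * I) Q)) (- of_real P / \<tau>)*dual \<tau> k Q 0 (of_real P))
   \<le> C1*real k/real k^I" using theta_sum_taylor[OF I] by blast
 have "\<forall>i. \<exists>B\<ge>0. i < I --> (\<forall>Q y. \<bar>Q + x0\<bar> \<le> \<rho>/2 --> norm y \<le> \<rho>/2 -->
  norm ((deriv ^^ (2*i)) w (of_real (- Q) + y) - poly (taylor_poly (\<lambda>j. (deriv ^^ (j + 2*i)) w (of_real (- Q))) (2 * I - 2*i)) y) \<le> B*norm y^(2 * I - 2*i))"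
 proof
  fix i
  show "\<exists>B\<ge>0. i < I --> (\<forall>Q y. \<bar>Q + x0\<bar> \<le> \<rho>/2 --> norm y \<le> \<rho>/2 -->
   norm ((deriv ^^ (2*i)) w (of_real (- Q) + y) - poly (taylor_poly (\<lambda>j. (deriv ^^ (j + 2*i)) w (of_real (- Q))) (2 * I - 2*i)) y) \<le> B*norm y^(2 * I - 2*i))"
  proof (cases "i < I")
   case True
   then have "1 \<le> 2 * I - 2*i" by simp
   from taylor_error[OF this, of "2*i"] show ?thesis by blast
  qed auto
 qed
 then obtain B where B: "\<And>i. B i \<ge> 0" "\<And>i Q y. i < I ==> \<bar>Q + x0\<bar> \<le> \<rho>/2 ==> norm y \<le> \<rho>/2 ==>
  norm ((deriv ^^ (2*i)) w (of_real (- Q) + y) - poly (taylor_poly (\<lambda>j. (deriv ^^ (j + 2*i)) w (of_real (- Q))) (2 * I - 2*i)) y) \<le> B i*norm y^(2 * I - 2*i)"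
  by metis
 define v where "v = 2*pi*Im \<tau>"
 have v: "v > 0" using tau by (simp add: v_def)
 define b where "b = norm (beta \<tau> 1)"
 define C where "C = C1 + (\<Sum>i<I. dual_norm \<tau>*(b^i*B i)*(real (I - i)^(I - i)/v^(I - i)))"
 have "norm ((\<Sum>\<^sub>\<infinity>n. W k n*primal \<tau> k Q n (of_real P)) -
   dual \<tau> k Q 0 (of_real P)*(\<Sum>i<I. beta \<tau> k^i/fact i*(deriv ^^ (2*i)) w (of_real (- Q) - of_real P / \<tau>)))
   \<le> C*real k/real k^I"
  if k: "k \<ge> 1" and Q: "\<bar>Q + x0\<bar> \<le> \<rho>/2" and P: "\<bar>P\<bar> \<le> 3/4" and P2: "\<bar>P\<bar> \<le> norm \<tau>*\<rho>/2" for k Q P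
 proof -
  have k1: "real k \<ge> 1" using k by simp
  define y where "y = - of_real P / \<tau>"
  have ny: "norm y = \<bar>P\<bar>/norm \<tau>" by (simp add: y_def norm_divide)
  have y: "norm y \<le> \<rho>/2" unfolding ny using P2 t0 by (simp add: field_simps)
  define d where "d = dual \<tau> k Q 0 (of_real P)"
  have nd: "norm d = dual_norm \<tau> * sqrt (real k)*exp (- (v * real k*(norm y)^2))"
   unfolding d_def norm_dual[OF tau k] dual_rate_def v_def ny by (simp add: power_divide)
  define L where "L = (\<lambda>i. (deriv ^^ (2*i)) w (of_real (- Q) + y))"
  define q where "q = (\<lambda>i. poly (taylor_poly (\<lambda>j. (deriv ^^ (j + 2*i)) w (of_real (- Q))) (2 * I - 2*i)) y)"
  \<comment> \<open>Derivatives of order at least \<open>2I\<close> of a polynomial of degree below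
    \<open>2I\<close> vanish, which shortens the heat operator to \<open>I\<close> terms.\<close>
  have hp: "poly (heat (beta \<tau> k) (tay (2 * I) Q)) y = (\<Sum>i<I. beta \<tau> k^i/fact i*q i)" proof -
   have deg: "degree (tay (2 * I) Q) < 2 * I" unfolding tay_def by (rule le_less_trans[OF degree_taylor_poly]) (use I in simp)
   have "poly (heat (beta \<tau> k) (tay (2 * I) Q)) y = (\<Sum>i<2 * I. beta \<tau> k^i/fact i*q i)"
    unfolding heat_eq_sum[OF deg] q_def by (simp add: poly_sum tay_def higher_pderiv_taylor_poly)
   also have "... = (\<Sum>i<I. beta \<tau> k^i/fact i*q i)" proof (rule sum.mono_neutral_right)
    show "\<forall>i\<in>{..<2 * I} - {..<I}. beta \<tau> k^i/fact i*q i = 0" by (auto simp: q_def taylor_poly_def)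
   qed auto
   finally show ?thesis .
  qed
  have 2: "norm (poly (heat (beta \<tau> k) (tay (2 * I) Q)) y * d - d*(\<Sum>i<I. beta \<tau> k^i/fact i * L i))
   \<le> (\<Sum>i<I. dual_norm \<tau>*(b^i*B i)*(real (I - i)^(I - i)/v^(I - i)))*real k/real k^I" proof -
   have "norm (poly (heat (beta \<tau> k) (tay (2 * I) Q)) y * d - d*(\<Sum>i<I. beta \<tau> k^i/fact i * L i))
    = norm (\<Sum>i<I. d*(beta \<tau> k^i/fact i)*(q i - L i))" unfolding hp sum_distrib_left sum_distrib_right sum_subtractf[symmetric]
   proof (intro arg_cong[where f=norm] sum.cong refl)
    fix i
    have "c*x*e - e*(c*y) = e*c*(x - y)" for c x y e :: complex by (simp add: algebra_simps)
    then show "beta \<tau> k^i/fact i*q i * d - d*(beta \<tau> k^i/fact i * L i) = d*(beta \<tau> k^i/fact i)*(q i - L i)" .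
   qed
   also have "... \<le> (\<Sum>i<I. dual_norm \<tau>*(b^i*B i)*(real (I - i)^(I - i)/v^(I - i))*real k/real k^I)" proof (rule sum_norm_le)
    fix i assume i: "i \<in> {..<I}"
    define s where "s = I - i"
    have Is: "I = i + s" and s2: "2 * I - 2*i = 2 * s" using i by (auto simp: s_def)
    have e1: "norm (beta \<tau> k^i/fact i) \<le> b^i/real k^i" proof -
     have "norm (beta \<tau> k^i/fact i) \<le> norm (beta \<tau> k^i)/1"
      unfolding norm_divide norm_fact by (intro divide_left_mono) (auto simp: fact_ge_1)
     also have "norm (beta \<tau> k^i) = b^i/real k^i" unfolding b_def by (subst beta_scale) (simp add: norm_power norm_divide power_divide)
     finally show ?thesis by simp
    qed
    have e2: "norm (q i - L i) \<le> B i*norm y^(2 * s)" using B(2)[OF _ Q y, of i] i unfolding q_def L_def s2 by (simp add: norm_minus_commute)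
    have e3: "norm d*norm y^(2 * s) \<le> dual_norm \<tau>*real k*(real s^s/v^s)/real k^s" proof -
     define t where "t = v * real k*(norm y)^2"
     have "t^s \<le> real s^s*exp t" by (rule power_le_exp) (use v in \<open>simp add: t_def\<close>)
     then have "exp (- t)*t^s \<le> real s^s" by (simp add: exp_minus field_simps)
     moreover have "t^s = (v^s*real k^s)*norm y^(2 * s)" by (simp add: t_def power_mult_distrib power_mult)
     ultimately have "(exp (- t)*norm y^(2 * s))*(v^s*real k^s) \<le> real s^s" by (simp add: mult_ac)
     then have "exp (- t)*norm y^(2 * s) \<le> real s^s/(v^s*real k^s)" using v k1 by (simp add: pos_le_divide_eq)
     moreover have "sqrt (real k) \<le> real k" using k1 real_le_lsqrt[of "real k" "real k"] by (simp add: power2_eq_square)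
     ultimately have "sqrt (real k)*(exp (- t)*norm y^(2 * s)) \<le> real k*(real s^s/(v^s*real k^s))" by (intro mult_mono) auto
     then have "dual_norm \<tau>*(sqrt (real k)*(exp (- t)*norm y^(2 * s))) \<le> dual_norm \<tau>*(real k*(real s^s/(v^s*real k^s)))"
      by (intro mult_left_mono) (auto simp: dual_norm_def)
     then show ?thesis unfolding nd t_def by (simp add: mult_ac)
    qed
    have "norm (d*(beta \<tau> k^i/fact i)*(q i - L i)) = norm d*norm (beta \<tau> k^i/fact i)*norm (q i - L i)" by (simp only: norm_mult)
    also have "... \<le> norm d*(b^i/real k^i)*(B i*norm y^(2 * s))"
     by (intro mult_mono e1 e2 mult_left_mono mult_nonneg_nonneg) (auto simp: b_def)
    also have "... = (b^i*B i/real k^i)*(norm d*norm y^(2 * s))" by simp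
    also have "... \<le> (b^i*B i/real k^i)*(dual_norm \<tau>*real k*(real s^s/v^s)/real k^s)"
     using B k1 by (intro mult_left_mono e3 divide_nonneg_nonneg mult_nonneg_nonneg) (auto simp: b_def)
    also have "... = dual_norm \<tau>*(b^i*B i)*(real s^s/v^s)*real k/real k^I" unfolding Is by (simp add: power_add mult_ac)
    finally show "norm (d*(beta \<tau> k^i/fact i)*(q i - L i)) \<le> dual_norm \<tau>*(b^i*B i)*(real (I - i)^(I - i)/v^(I - i))*real k/real k^I"
     unfolding s_def .
   qed
   also have "... = (\<Sum>i<I. dual_norm \<tau>*(b^i*B i)*(real (I - i)^(I - i)/v^(I - i)))*real k/real k^I"
    by (simp only: sum_divide_distrib sum_distrib_right)
   finally show ?thesis .
  qed
  have y2: "of_real (- Q) - of_real P / \<tau> = of_real (- Q) + y" by (simp add: y_def)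
  show ?thesis using norm_triangle_mono[OF C1(2)[OF k Q P, folded y_def d_def] 2]
   unfolding y2 d_def[symmetric] L_def C_def by (simp add: add_divide_distrib distrib_right)
 qed
 moreover have "C \<ge> 0" unfolding C_def b_def dual_norm_def using C1 B v by (intro add_nonneg_nonneg sum_nonneg mult_nonneg_nonneg) auto
 ultimately show ?thesis by blast
qed

text \<open>Here \<open>-Q - P/\<tau>\<close> may leave the disc where \<open>w\<close> is
  holomorphic, so \<open>w\<close> is not evaluated there. The heat polynomial is merely bounded,
  and the dual factor is exponentially small because \<open>|P| >= \<delta>\<close>.\<close>

theorem theta_sum_negligible:
 assumes \<delta>: "\<delta> > 0"
 shows "\<exists>C\<ge>0. \<forall>k\<ge>1. \<forall>Q P. \<bar>Q + x0\<bar> \<le> \<rho>/2 --> \<bar>P\<bar> \<le> 3/4 --> \<delta> \<le> \<bar>P\<bar> -->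
  norm (\<Sum>\<^sub>\<infinity>n. W k n*primal \<tau> k Q n (of_real P)) \<le> C/real k^N" proof -
 have t0: "\<tau> \<noteq> 0" using tau by auto
 define I where "I = Suc N"
 obtain C1 where C1: "C1 \<ge> 0" "\<And>k Q P. k \<ge> 1 ==> \<bar>Q + x0\<bar> \<le> \<rho>/2 ==> \<bar>P\<bar> \<le> 3/4 ==>
  norm ((\<Sum>\<^sub>\<infinity>n. W k n*primal \<tau> k Q n (of_real P)) - poly (heat (beta \<tau> k) (tay (2 * I) Q)) (- of_real P / \<tau>)*dual \<tau> k Q 0 (of_real P))
   \<le> C1*real k/real k^I" using theta_sum_taylor[of I] by (auto simp: I_def)
 obtain D where D: "D \<ge> 0" "\<And>j z. j \<le> 2 * I ==> z \<in> cball (of_real x0) \<rho> ==> norm ((deriv ^^ j) w z) \<le> D"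
  using derivs_bounded[of "2 * I"] by blast
 have "\<forall>j. \<exists>C\<ge>0. \<exists>d\<ge>0. \<forall>b. norm b \<le> norm (beta \<tau> 1) --> (\<forall>y. norm (poly (heat b (monom 1 j)) y) \<le> C*exp (d*norm y))"
  using heat_bound by blast
 then obtain Ch d where Ch: "\<And>j. Ch j \<ge> 0" "\<And>j. d j \<ge> 0" "\<And>j b y. norm b \<le> norm (beta \<tau> 1) ==> norm (poly (heat b (monom 1 j)) y) \<le> Ch j*exp (d j*norm y)"
  by metis
 define H where "H = (\<Sum>j<2 * I. D*(Ch j*exp (d j*(1/norm \<tau>))))"
 have H0: "H \<ge> 0" unfolding H_def using D Ch by (intro sum_nonneg) auto
 define v where "v = dual_rate \<tau>*\<delta>^2"
 have v: "v > 0" unfolding v_def using dual_rate_pos[OF tau] \<delta> by simp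
 obtain C2 where C2: "C2 \<ge> 0" "\<And>k. k \<ge> 1 ==> exp (- v * real k) \<le> C2/real k^I" using exp_decay_le_power[OF v, of I] by auto
 define C where "C = C1 + H * dual_norm \<tau> * C2"
 have "norm (\<Sum>\<^sub>\<infinity>n. W k n*primal \<tau> k Q n (of_real P)) \<le> C/real k^N"
  if k: "k \<ge> 1" and Q: "\<bar>Q + x0\<bar> \<le> \<rho>/2" and P: "\<bar>P\<bar> \<le> 3/4" and P2: "\<delta> \<le> \<bar>P\<bar>" for k Q P
 proof -
  have k1: "real k \<ge> 1" using k by simp
  have Qb: "of_real (- Q) \<in> cball (complex_of_real x0) \<rho>" unfolding mem_cball dist_centre using Q rho by (simp add: add.commute)
  define y where "y = - of_real P / \<tau>"
  have ny: "norm y \<le> 1/norm \<tau>" using P by (simp add: y_def norm_divide divide_right_mono)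
  have 1: "norm (poly (heat (beta \<tau> k) (tay (2 * I) Q)) y) \<le> H" unfolding tay_def heat_taylor_poly poly_sum H_def proof (rule sum_norm_le)
   fix j assume j: "j \<in> {..<2 * I}"
   have "norm ((deriv ^^ j) w (of_real (- Q))/fact j) \<le> D/1"
    unfolding norm_divide norm_fact by (intro frac_le D Qb) (use j fact_ge_1 D in auto)
   moreover have "norm (poly (heat (beta \<tau> k) (monom 1 j)) y) \<le> Ch j*exp (d j*(1/norm \<tau>))"
   proof (rule order_trans[OF Ch(3)[OF norm_beta_le[OF k]]])
    have "d j*norm y \<le> d j*(1/norm \<tau>)" by (rule mult_left_mono[OF ny Ch(2)])
    then show "Ch j*exp (d j*norm y) \<le> Ch j*exp (d j*(1/norm \<tau>))" by (intro mult_left_mono Ch(1)) simp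
   qed
   ultimately show "norm (poly (smult ((deriv ^^ j) w (of_real (- Q))/fact j) (heat (beta \<tau> k) (monom 1 j))) y) \<le> D*(Ch j*exp (d j*(1/norm \<tau>)))"
    unfolding poly_smult norm_mult using D by (intro mult_mono) auto
  qed
  have 2: "norm (dual \<tau> k Q 0 (of_real P)) \<le> dual_norm \<tau>*(C2/real k^N)" proof -
   have "\<delta>^2 \<le> \<bar>P\<bar>^2" using P2 \<delta> by (intro power_mono) auto
   then have "dual_rate \<tau>*real k*\<delta>^2 \<le> dual_rate \<tau>*real k*P^2" using dual_rate_pos[OF tau] by (intro mult_left_mono) auto
   then have "exp (- dual_rate \<tau>*real k*(P + real_of_int 0)^2) \<le> exp (- v * real k)" by (simp add: v_def mult_ac)
   also have "... \<le> C2/real k^I" by (rule C2(2)[OF k])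
   finally have e: "exp (- dual_rate \<tau>*real k*(P + real_of_int 0)^2) \<le> C2/real k^I" .
   have "sqrt (real k) \<le> real k" using k1 real_le_lsqrt[of "real k" "real k"] by (simp add: power2_eq_square)
   then have "sqrt (real k)*exp (- dual_rate \<tau>*real k*(P + real_of_int 0)^2) \<le> real k*(C2/real k^I)" by (intro mult_mono e) auto
   also have "... = C2/real k^N" using k1 by (simp add: I_def)
   finally have "dual_norm \<tau>*(sqrt (real k)*exp (- dual_rate \<tau>*real k*(P + real_of_int 0)^2)) \<le> dual_norm \<tau>*(C2/real k^N)"
    by (intro mult_left_mono) (auto simp: dual_norm_def)
   then show ?thesis unfolding norm_dual[OF tau k] mult.assoc .
  qed
  have "norm (poly (heat (beta \<tau> k) (tay (2 * I) Q)) y*dual \<tau> k Q 0 (of_real P)) \<le> H*(dual_norm \<tau>*(C2/real k^N))"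
   unfolding norm_mult using H0 by (intro mult_mono 1 2) auto
  moreover have "norm (\<Sum>\<^sub>\<infinity>n. W k n*primal \<tau> k Q n (of_real P)) \<le>
    norm ((\<Sum>\<^sub>\<infinity>n. W k n*primal \<tau> k Q n (of_real P)) - poly (heat (beta \<tau> k) (tay (2 * I) Q)) y*dual \<tau> k Q 0 (of_real P))
    + norm (poly (heat (beta \<tau> k) (tay (2 * I) Q)) y*dual \<tau> k Q 0 (of_real P))" proof -
   have "norm a \<le> norm (a - b) + norm b" for a b :: complex using norm_triangle_sub[of a b] by linarith
   then show ?thesis .
  qed
  moreover have "C1*real k/real k^I = C1/real k^N" using k1 by (simp add: I_def)
  ultimately have "norm (\<Sum>\<^sub>\<infinity>n. W k n*primal \<tau> k Q n (of_real P)) \<le> C1/real k^N + H*(dual_norm \<tau>*(C2/real k^N))"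
   using C1(2)[OF k Q P, folded y_def] by linarith
  also have "... = C/real k^N" by (simp add: C_def add_divide_distrib mult_ac)
  finally show ?thesis .
 qed
 moreover have "C \<ge> 0" unfolding C_def using C1 C2 H0 by (simp add: dual_norm_def)
 ultimately show ?thesis by blast
qed

end

section \<open>Smooth functions and Borel summation\<close>

lemma has_derivative_cong_open:
 assumes "open S" "x \<in> S" "\<And>y. y \<in> S ==> f y = g y"
 shows "(f has_derivative D) (at x) \<longleftrightarrow> (g has_derivative D) (at x)" proof
 assume "(f has_derivative D) (at x)"
 then show "(g has_derivative D) (at x)" by (rule has_derivative_transform_within_open[OF _ assms(1,2)]) (use assms in auto)
next
 assume "(g has_derivative D) (at x)"
 then show "(f has_derivative D) (at x)" by (rule has_derivative_transform_within_open[OF _ assms(1,2)]) (use assms in auto)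
qed

lemma frechet_derivative_cong_open:
 assumes "open S" "x \<in> S" "\<And>y. y \<in> S ==> f y = g y" shows "frechet_derivative f (at x) = frechet_derivative g (at x)"
 unfolding frechet_derivative_def using has_derivative_cong_open[OF assms] by simp

lemma differentiable_cong_open:
 assumes "open S" "x \<in> S" "\<And>y. y \<in> S ==> f y = g y" shows "f differentiable (at x) \<longleftrightarrow> g differentiable (at x)"
 unfolding differentiable_def using has_derivative_cong_open[OF assms] by simp

lemma iter_deriv_cong_open:
 assumes "open S" "x \<in> S" "\<And>y. y \<in> S ==> f y = g y" shows "iter_deriv vs f x = iter_deriv vs g x" proof -
 have "\<forall>x\<in>S. iter_deriv vs f x = iter_deriv vs g x" proof (induction vs)
  case (Cons v vs)
  show ?case proof
   fix x assume "x \<in> S"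
   then show "iter_deriv (v # vs) f x = iter_deriv (v # vs) g x"
    using frechet_derivative_cong_open[OF assms(1), of x "iter_deriv vs f" "iter_deriv vs g"] Cons.IH by simp
  qed
 qed (use assms in auto)
 then show ?thesis using assms by blast
qed

lemma iter_deriv_append: "iter_deriv (us @ vs) f = iter_deriv us (iter_deriv vs f)" by (induction us) auto

text \<open>\<open>smooth_on\<close> offers no order to induct on. Bounding the length of the lists
  provides one, and closure under products and compositions is proved for each
  \<open>n\<close>.\<close>

definition cdiff_on :: "nat => 'a::real_normed_vector set => ('a => 'b::real_normed_vector) => bool" where
 "cdiff_on n S f \<longleftrightarrow> (\<forall>vs. length vs \<le> n --> (\<forall>x\<in>S. iter_deriv vs f differentiable (at x)))"

lemma smooth_on_iff_cdiff_on: "smooth_on S f \<longleftrightarrow> (\<forall>n. cdiff_on n S f)" proof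
 assume R: "\<forall>n. cdiff_on n S f"
 show "smooth_on S f" unfolding smooth_on_def proof (intro allI ballI)
  fix vs :: "'a list" and x assume "x \<in> S"
  then show "iter_deriv vs f differentiable (at x)" using R[rule_format, of "length vs"] by (simp add: cdiff_on_def)
 qed
qed (simp add: smooth_on_def cdiff_on_def)

lemma cdiff_on_0: "cdiff_on 0 S f \<longleftrightarrow> (\<forall>x\<in>S. f differentiable (at x))" unfolding cdiff_on_def by simp

text \<open>The derivative taken first is the last element of the list, hence the case distinction
  at the end of the list.\<close>

lemma cdiff_on_Suc:
 "cdiff_on (Suc n) S f \<longleftrightarrow> (\<forall>x\<in>S. f differentiable (at x)) \<and> (\<forall>v. cdiff_on n S (\<lambda>x. frechet_derivative f (at x) v))"
proof (intro iffI conjI ballI allI)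
 assume L: "cdiff_on (Suc n) S f"
 show "f differentiable (at x)" if "x \<in> S" for x using L[unfolded cdiff_on_def, rule_format, of "[]" x] that by simp
 show "cdiff_on n S (\<lambda>x. frechet_derivative f (at x) v)" for v unfolding cdiff_on_def proof (intro allI impI ballI)
  fix vs :: "'a list" and x assume "length vs \<le> n" "x \<in> S"
  then show "iter_deriv vs (\<lambda>x. frechet_derivative f (at x) v) differentiable (at x)"
   using L[unfolded cdiff_on_def, rule_format, of "vs @ [v]" x] by (simp add: iter_deriv_append)
 qed
next
 assume R: "(\<forall>x\<in>S. f differentiable (at x)) \<and> (\<forall>v. cdiff_on n S (\<lambda>x. frechet_derivative f (at x) v))"
 show "cdiff_on (Suc n) S f" unfolding cdiff_on_def proof (intro allI impI ballI)
  fix vs :: "'a list" and x assume l: "length vs \<le> Suc n" and x: "x \<in> S"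
  show "iter_deriv vs f differentiable (at x)" proof (cases vs rule: rev_cases)
   case Nil then show ?thesis using R x by simp
  next
   case (snoc us v)
   then have "length us \<le> n" using l by simp
   then have "iter_deriv us (\<lambda>x. frechet_derivative f (at x) v) differentiable (at x)" using R x unfolding cdiff_on_def by blast
   then show ?thesis by (simp add: snoc iter_deriv_append)
  qed
 qed
qed

lemma cdiff_on_cong:
 assumes "open S" "\<And>y. y \<in> S ==> f y = g y" shows "cdiff_on n S f \<longleftrightarrow> cdiff_on n S g" proof -
 have "iter_deriv vs f differentiable (at x) \<longleftrightarrow> iter_deriv vs g differentiable (at x)" if "x \<in> S" for vs x
  by (rule differentiable_cong_open[OF assms(1) that iter_deriv_cong_open[OF assms(1)]]) (use assms in auto)
 then show ?thesis unfolding cdiff_on_def by simp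
qed

lemma cdiff_on_le: "m \<le> n ==> cdiff_on n S f ==> cdiff_on m S f" unfolding cdiff_on_def by auto

lemma frechet_eq: "(f has_derivative D) (at x) ==> frechet_derivative f (at x) = D" by (rule frechet_derivative_at[symmetric])

lemma has_derivative_frechet: "f differentiable (at x) ==> (f has_derivative frechet_derivative f (at x)) (at x)"
 by (simp add: frechet_derivative_works[symmetric])

lemma cdiff_on_const: "cdiff_on n S (\<lambda>x. c)" by (induction n arbitrary: c) (auto simp: cdiff_on_0 cdiff_on_Suc)

lemma cdiff_on_bounded_linear:
 assumes "bounded_linear f" shows "cdiff_on n S f" proof -
 have D: "(f has_derivative f) (at x)" for x using bounded_linear_imp_has_derivative[OF assms] .
 have d: "f differentiable (at x)" for x by (rule differentiableI[OF D])
 show ?thesis by (cases n) (auto simp: cdiff_on_0 cdiff_on_Suc frechet_eq[OF D] cdiff_on_const d)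
qed

lemma cdiff_on_linear_image:
 assumes B: "bounded_linear B" and S: "open S" shows "cdiff_on n S f ==> cdiff_on n S (\<lambda>x. B (f x))" proof (induction n arbitrary: f)
 case 0
 then show ?case unfolding cdiff_on_0 by (intro ballI differentiableI[OF bounded_linear.has_derivative[OF B has_derivative_frechet]]) blast
next
 case (Suc n)
 have D: "((\<lambda>x. B (f x)) has_derivative (\<lambda>v. B (frechet_derivative f (at x) v))) (at x)" if "x \<in> S" for x
  using Suc.prems that by (intro bounded_linear.has_derivative[OF B] has_derivative_frechet) (simp add: cdiff_on_Suc)
 have "cdiff_on n S (\<lambda>x. B (frechet_derivative f (at x) v))" for v using Suc.prems by (intro Suc.IH) (simp add: cdiff_on_Suc)
 then have "cdiff_on n S (\<lambda>x. frechet_derivative (\<lambda>x. B (f x)) (at x) v)" for v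
  by (subst cdiff_on_cong[OF S]) (simp_all add: frechet_eq[OF D])
 then show ?case unfolding cdiff_on_Suc by (intro conjI ballI allI) (auto intro: differentiableI[OF D])
qed

lemma cdiff_on_add:
 assumes S: "open S" shows "cdiff_on n S f ==> cdiff_on n S g ==> cdiff_on n S (\<lambda>x. f x + g x)" proof (induction n arbitrary: f g)
 case 0
 then show ?case by (auto simp: cdiff_on_0)
next
 case (Suc n)
 have D: "((\<lambda>x. f x + g x) has_derivative (\<lambda>v. frechet_derivative f (at x) v + frechet_derivative g (at x) v)) (at x)" if "x \<in> S" for x
  using Suc.prems that by (intro has_derivative_add has_derivative_frechet) (simp_all add: cdiff_on_Suc)
 have "cdiff_on n S (\<lambda>x. frechet_derivative f (at x) v + frechet_derivative g (at x) v)" for v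
  using Suc.prems by (intro Suc.IH) (simp_all add: cdiff_on_Suc)
 then have "cdiff_on n S (\<lambda>x. frechet_derivative (\<lambda>x. f x + g x) (at x) v)" for v
  by (subst cdiff_on_cong[OF S]) (simp_all add: frechet_eq[OF D])
 then show ?case unfolding cdiff_on_Suc by (intro conjI ballI allI) (auto intro: differentiableI[OF D])
qed

lemma cdiff_on_mult:
 fixes f g :: "'a::real_normed_vector => complex"
 assumes S: "open S" shows "cdiff_on n S f ==> cdiff_on n S g ==> cdiff_on n S (\<lambda>x. f x * g x)" proof (induction n arbitrary: f g)
 case 0
 then show ?case by (auto simp: cdiff_on_0)
next
 case (Suc n)
 have D: "((\<lambda>x. f x * g x) has_derivative (\<lambda>v. f x * frechet_derivative g (at x) v + frechet_derivative f (at x) v * g x)) (at x)" if "x \<in> S" for x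
  using Suc.prems that by (intro has_derivative_mult has_derivative_frechet) (simp_all add: cdiff_on_Suc)
 have "cdiff_on n S f" "cdiff_on n S g" using Suc.prems cdiff_on_le[of n "Suc n"] by auto
 then have "cdiff_on n S (\<lambda>x. f x * frechet_derivative g (at x) v + frechet_derivative f (at x) v * g x)" for v
  using Suc.prems by (intro cdiff_on_add[OF S] Suc.IH) (simp_all add: cdiff_on_Suc)
 then have "cdiff_on n S (\<lambda>x. frechet_derivative (\<lambda>x. f x * g x) (at x) v)" for v
  by (subst cdiff_on_cong[OF S]) (simp_all add: frechet_eq[OF D])
 then show ?case unfolding cdiff_on_Suc by (intro conjI ballI allI) (auto intro: differentiableI[OF D])
qed

text \<open>The induction generalises over \<open>G\<close>, since the chain rule produces
  \<open>deriv G\<close>, holomorphic on the same open set.\<close>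

lemma cdiff_on_compose_holomorphic:
 fixes f :: "'a::real_normed_vector => complex"
 assumes S: "open S" and \<Omega>: "open \<Omega>" "f ` S \<subseteq> \<Omega>"
 shows "G holomorphic_on \<Omega> ==> cdiff_on n S f ==> cdiff_on n S (\<lambda>x. G (f x))" proof (induction n arbitrary: G)
 case (0 G)
 have "((\<lambda>x. G (f x)) has_derivative (\<lambda>v. deriv G (f x) * frechet_derivative f (at x) v)) (at x)" if "x \<in> S" for x
  using 0 that \<Omega>
  by (intro has_derivative_compose[OF has_derivative_frechet] has_field_derivative_imp_has_derivative holomorphic_derivI[of _ \<Omega>])
   (auto simp: cdiff_on_0)
 then show ?case unfolding cdiff_on_0 by (intro ballI differentiableI)
next
 case (Suc n G)
 have D: "((\<lambda>x. G (f x)) has_derivative (\<lambda>v. deriv G (f x) * frechet_derivative f (at x) v)) (at x)" if "x \<in> S" for x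
  using Suc.prems that \<Omega>
  by (intro has_derivative_compose[OF has_derivative_frechet] has_field_derivative_imp_has_derivative holomorphic_derivI[of _ \<Omega>])
   (auto simp: cdiff_on_Suc)
 have f: "cdiff_on n S f" using Suc.prems cdiff_on_le[of n "Suc n"] by auto
 have "cdiff_on n S (\<lambda>x. deriv G (f x) * frechet_derivative f (at x) v)" for v
  by (rule cdiff_on_mult[OF S Suc.IH[OF holomorphic_deriv[OF Suc.prems(1) \<Omega>(1)] f]])
   (use Suc.prems in \<open>simp add: cdiff_on_Suc\<close>)
 then have "cdiff_on n S (\<lambda>x. frechet_derivative (\<lambda>x. G (f x)) (at x) v)" for v
  by (subst cdiff_on_cong[OF S]) (simp_all add: frechet_eq[OF D])
 then show ?case unfolding cdiff_on_Suc by (intro conjI ballI allI) (auto intro: differentiableI[OF D])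
qed

lemma smooth_on_mult:
 fixes f g :: "'a::real_normed_vector => complex" shows "open S ==> smooth_on S f ==> smooth_on S g ==> smooth_on S (\<lambda>x. f x * g x)"
 by (simp add: smooth_on_iff_cdiff_on cdiff_on_mult)

lemma smooth_on_add: "open S ==> smooth_on S f ==> smooth_on S g ==> smooth_on S (\<lambda>x. f x + g x)"
 by (simp add: smooth_on_iff_cdiff_on cdiff_on_add)

lemma smooth_on_const: "smooth_on S (\<lambda>x. c)" by (simp add: smooth_on_iff_cdiff_on cdiff_on_const)

lemma smooth_on_bounded_linear: "bounded_linear f ==> smooth_on S f" by (simp add: smooth_on_iff_cdiff_on cdiff_on_bounded_linear)

lemma smooth_on_linear_image: "bounded_linear B ==> open S ==> smooth_on S f ==> smooth_on S (\<lambda>x. B (f x))"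
 unfolding smooth_on_iff_cdiff_on using cdiff_on_linear_image[of B S _ f] by blast

lemma smooth_on_compose_holomorphic:
 fixes f :: "'a::real_normed_vector => complex"
 shows "open S ==> open \<Omega> ==> f ` S \<subseteq> \<Omega> ==> G holomorphic_on \<Omega> ==> smooth_on S f ==> smooth_on S (\<lambda>x. G (f x))"
 unfolding smooth_on_iff_cdiff_on using cdiff_on_compose_holomorphic[of S \<Omega> f G] by blast

lemma smooth_on_cong: "open S ==> (\<And>y. y \<in> S ==> f y = g y) ==> smooth_on S f \<longleftrightarrow> smooth_on S g"
 unfolding smooth_on_iff_cdiff_on using cdiff_on_cong[of S f g] by blast

lemma smooth_on_union: "(\<And>i. i \<in> I ==> smooth_on (S i) f) ==> smooth_on (\<Union>i\<in>I. S i) f" unfolding smooth_on_def by simp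

lemma smooth_on_differentiable: "smooth_on S f ==> x \<in> S ==> f differentiable (at x)" unfolding smooth_on_def by (drule spec[of _ "[]"]) simp

text \<open>The argument is affine, so each direction contributes only the constant
  \<open>L v\<close>. Real derivatives of every order are thereby controlled by complex derivatives
  of \<open>G\<close>.\<close>

lemma iter_deriv_holomorphic_compose:
 assumes B: "bounded_linear (B :: complex => 'b::real_normed_vector)" and L: "bounded_linear L"
  and G: "G holomorphic_on \<Omega>" and \<Omega>: "open \<Omega>" and x: "L x + c \<in> \<Omega>"
 shows "iter_deriv vs (\<lambda>x. B (G (L x + c))) x = B (prod_list (map L vs)*(deriv ^^ length vs) G (L x + c))" proof -
 define S where "S = (\<lambda>x. L x + c) -` \<Omega>"
 have S: "open S" unfolding S_def using \<Omega> by (intro open_vimage continuous_intros linear_continuous_on L)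
 have "\<forall>x\<in>S. iter_deriv vs (\<lambda>x. B (G (L x + c))) x = B (prod_list (map L vs)*(deriv ^^ length vs) G (L x + c))"
 proof (induction vs)
  case (Cons v vs)
  show ?case proof
   fix x assume x: "x \<in> S"
   have xO: "L x + c \<in> \<Omega>" using x by (simp add: S_def)
   have "((\<lambda>x. L x + c) has_derivative L) (at x)"
    using has_derivative_add[OF bounded_linear_imp_has_derivative[OF L] has_derivative_const[of c "at x"]] by simp
   from has_derivative_compose[OF this has_field_derivative_imp_has_derivative[OF has_field_derivative_higher_deriv[OF G \<Omega> xO, of "length vs"]]]
   have "((\<lambda>x. (deriv ^^ length vs) G (L x + c)) has_derivative (\<lambda>v. (deriv ^^ Suc (length vs)) G (L x + c) * L v)) (at x)" .
   then have D: "((\<lambda>x. B (prod_list (map L vs)*(deriv ^^ length vs) G (L x + c))) has_derivative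
     (\<lambda>v. B (prod_list (map L vs)*((deriv ^^ Suc (length vs)) G (L x + c) * L v)))) (at x)"
    by (intro bounded_linear.has_derivative[OF B] has_derivative_mult_right)
   have "iter_deriv (v # vs) (\<lambda>x. B (G (L x + c))) x = frechet_derivative (\<lambda>x. B (prod_list (map L vs)*(deriv ^^ length vs) G (L x + c))) (at x) v"
    unfolding iter_deriv.simps by (rule fun_cong[OF frechet_derivative_cong_open[OF S x]]) (use Cons.IH in blast)
   then show "iter_deriv (v # vs) (\<lambda>x. B (G (L x + c))) x = B (prod_list (map L (v # vs))*(deriv ^^ length (v # vs)) G (L x + c))"
    unfolding frechet_eq[OF D] by (simp add: mult_ac)
  qed
 qed auto
 then show ?thesis using x by (simp add: S_def)
qed

text \<open>A sequence with arbitrarily prescribed asymptotic expansion: the expansion is truncated at an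
  order \<open>I k\<close> that grows slowly enough with \<open>k\<close>.\<close>

lemma borel_truncation:
 fixes G :: "nat => complex => complex"
 assumes G: "\<And>i. G i holomorphic_on \<Omega>" and \<Omega>: "open \<Omega>" and K: "compact K" "K \<subseteq> \<Omega>"
 obtains I :: "nat => nat" where
  "\<And>n m. \<exists>C\<ge>0. \<forall>k\<ge>1. \<forall>z\<in>K. norm ((deriv ^^ m) (\<lambda>z. (\<Sum>i<I k. G i z/of_nat k^i) - (\<Sum>i<n. G i z/of_nat k^i)) z) \<le> C/real k^n"
proof -
 have "\<forall>i m. \<exists>B. \<forall>z\<in>K. norm ((deriv ^^ m) (G i) z) \<le> B" proof (intro allI)
  fix i m
  have "continuous_on K ((deriv ^^ m) (G i))"
   by (rule continuous_on_subset[OF holomorphic_on_imp_continuous_on[OF holomorphic_higher_deriv[OF G \<Omega>]] K(2)])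
  then have "bounded ((deriv ^^ m) (G i) ` K)" by (intro compact_imp_bounded compact_continuous_image K)
  then show "\<exists>B. \<forall>z\<in>K. norm ((deriv ^^ m) (G i) z) \<le> B" unfolding bounded_iff by blast
 qed
 then obtain B0 where B0: "\<And>i m z. z \<in> K ==> norm ((deriv ^^ m) (G i) z) \<le> B0 i m" by metis
 define B where "B = (\<lambda>i m. \<bar>B0 i m\<bar>)"
 have B: "norm ((deriv ^^ m) (G i) z) \<le> B i m" if "z \<in> K" for i m z using B0[OF that, of m i] unfolding B_def by linarith
 have Bn: "B i m \<ge> 0" for i m by (simp add: B_def)
 define D where "D = (\<lambda>j. \<Sum>i\<le>j. \<Sum>m\<le>j. B i m)"
 have BD: "B i m \<le> D j" if "i \<le> j" "m \<le> j" for i m j proof -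
  have "B i m \<le> (\<Sum>m\<le>j. B i m)" by (rule member_le_sum) (use that Bn in auto)
  also have "... \<le> D j" unfolding D_def by (rule member_le_sum[of i "{..j}" "\<lambda>i. \<Sum>m\<le>j. B i m"]) (use that Bn in \<open>auto intro!: sum_nonneg\<close>)
  finally show ?thesis .
 qed
 define I where "I = (\<lambda>k. Max {j. j \<le> k \<and> (j = 0 \<or> D j \<le> real k)})"
 have Iin: "I k \<in> {j. j \<le> k \<and> (j = 0 \<or> D j \<le> real k)}" for k unfolding I_def by (rule Max_in) (auto intro!: exI[of _ 0])
 have Ige: "j \<le> I k" if "j \<le> k" "D j \<le> real k" for j k unfolding I_def by (rule Max_ge) (use that in auto)
 have hd: "(deriv ^^ m) (\<lambda>z. (\<Sum>i<a. G i z/of_nat k^i) - (\<Sum>i<b. G i z/of_nat k^i)) z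
   = (\<Sum>i<a. (deriv ^^ m) (G i) z/of_nat k^i) - (\<Sum>i<b. (deriv ^^ m) (G i) z/of_nat k^i)" if "z \<in> \<Omega>" for m a b k z using that
 proof (induction m arbitrary: z)
  case (Suc m)
  have "(deriv ^^ Suc m) (\<lambda>z. (\<Sum>i<a. G i z/of_nat k^i) - (\<Sum>i<b. G i z/of_nat k^i)) z
   = deriv (\<lambda>z. (\<Sum>i<a. (deriv ^^ m) (G i) z/of_nat k^i) - (\<Sum>i<b. (deriv ^^ m) (G i) z/of_nat k^i)) z"
   unfolding funpow.simps o_apply by (intro deriv_cong_ev eventually_mono[OF eventually_nhds_in_open[OF \<Omega> Suc.prems]] Suc.IH refl)
  also have "... = (\<Sum>i<a. (deriv ^^ Suc m) (G i) z/of_nat k^i) - (\<Sum>i<b. (deriv ^^ Suc m) (G i) z/of_nat k^i)"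
   by (intro DERIV_imp_deriv DERIV_diff DERIV_sum DERIV_cdivide has_field_derivative_higher_deriv[OF G \<Omega> Suc.prems])
  finally show ?case .
 qed simp
 have "\<exists>C\<ge>0. \<forall>k\<ge>1. \<forall>z\<in>K. norm ((deriv ^^ m) (\<lambda>z. (\<Sum>i<I k. G i z/of_nat k^i) - (\<Sum>i<n. G i z/of_nat k^i)) z) \<le> C/real k^n" for n m
 proof -
  define j0 where "j0 = max (n + 2) m"
  define k0 where "k0 = max j0 (nat \<lceil>D j0\<rceil>)"
  define E where "E = (\<Sum>i<j0 + n. B i m)"
  have E0: "E \<ge> 0" unfolding E_def by (intro sum_nonneg Bn)
  define C where "C = max (B n m + B (n+1) m + 1) (2*E*real k0^n)"
  have C0: "C \<ge> 0" unfolding C_def using Bn[of n m] Bn[of "n+1" m] by simp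
  have "norm ((deriv ^^ m) (\<lambda>z. (\<Sum>i<I k. G i z/of_nat k^i) - (\<Sum>i<n. G i z/of_nat k^i)) z) \<le> C/real k^n"
   if k: "k \<ge> 1" and z: "z \<in> K" for k z proof -
   have k1: "real k \<ge> 1" using k by simp
   define t where "t = (\<lambda>i. (deriv ^^ m) (G i) z/of_nat k^i)"
   have nt: "norm (t i) \<le> B i m/real k^i" for i
    unfolding t_def norm_divide norm_power norm_of_nat using k1 by (intro divide_right_mono B z) auto
   have zO: "z \<in> \<Omega>" using z K by auto
   have nt1: "norm (t i) \<le> B i m" for i proof -
    have "B i m/real k^i \<le> B i m/1" using k1 Bn by (intro divide_left_mono) auto
    then show ?thesis using nt[of i] by simp
   qed
   show ?thesis unfolding hd[OF zO] t_def[symmetric] proof (cases "I k \<ge> j0")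
    \<comment> \<open>For large \<open>k\<close> the terms of order \<open>n\<close> and
      \<open>n + 1\<close> are bounded individually; each of the at most \<open>k\<close> others is
      at most \<open>k/k^(n+2)\<close>, which adds up to \<open>k^(-n)\<close>.\<close>
    case True
    have Ik: "I k \<ge> n + 2" "I k \<ge> m" "I k \<le> k" using True Iin[of k] by (auto simp: j0_def)
    have DI: "D (I k) \<le> real k" using Iin[of k] Ik by auto
    have split: "{..<I k} = {..<n} \<union> {n..<I k}" using Ik by auto
    have "(\<Sum>i<I k. t i) - (\<Sum>i<n. t i) = (\<Sum>i=n..<I k. t i)" unfolding split by (subst sum.union_disjoint) auto
    also have "{n..<I k} = insert n (insert (n+1) {n+2..<I k})" using Ik by auto
    also have "(\<Sum>i\<in>insert n (insert (n+1) {n+2..<I k}). t i) = t n + (t (n+1) + (\<Sum>i\<in>{n+2..<I k}. t i))" by simp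
    finally have eq: "(\<Sum>i<I k. t i) - (\<Sum>i<n. t i) = t n + (t (n+1) + (\<Sum>i\<in>{n+2..<I k}. t i))" .
    have a: "norm (t n) \<le> B n m/real k^n" by (rule nt)
    have b: "norm (t (n+1)) \<le> B (n+1) m/real k^n" proof -
     have "B (n+1) m/real k^(n+1) \<le> B (n+1) m/real k^n" using k1 Bn by (intro divide_left_mono power_increasing) auto
     then show ?thesis using nt[of "n+1"] by linarith
    qed
    have c: "norm (\<Sum>i\<in>{n+2..<I k}. t i) \<le> 1/real k^n" proof -
     have "norm (\<Sum>i\<in>{n+2..<I k}. t i) \<le> (\<Sum>i\<in>{n+2..<I k}. real k/real k^(n+2))" proof (rule sum_norm_le)
      fix i assume i: "i \<in> {n+2..<I k}"
      have "B i m \<le> real k" using BD[of i "I k" m] DI i Ik by auto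
      then have "B i m/real k^i \<le> real k/real k^(n+2)" using k1 i by (intro frac_le power_increasing) auto
      then show "norm (t i) \<le> real k/real k^(n+2)" using nt[of i] by linarith
     qed
     also have "... = real (I k - (n+2))*(real k/real k^(n+2))" by simp
     also have "... \<le> real k*(real k/real k^(n+2))" using Ik by (intro mult_right_mono) auto
     also have "... = 1/real k^n" using k1 by (simp add: power2_eq_square)
     finally show ?thesis .
    qed
    have "norm ((\<Sum>i<I k. t i) - (\<Sum>i<n. t i)) \<le> norm (t n) + (norm (t (n+1)) + norm (\<Sum>i\<in>{n+2..<I k}. t i))"
     unfolding eq by (intro order_trans[OF norm_triangle_ineq] add_left_mono norm_triangle_ineq)
    also have "... \<le> B n m/real k^n + (B (n+1) m/real k^n + 1/real k^n)" by (intro add_mono a b c)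
    also have "... = (B n m + B (n+1) m + 1)/real k^n" by (simp add: add_divide_distrib)
    also have "... \<le> C/real k^n" by (intro divide_right_mono) (auto simp: C_def)
    finally show "norm ((\<Sum>i<I k. t i) - (\<Sum>i<n. t i)) \<le> C/real k^n" .
   next
    \<comment> \<open>Only the finitely many \<open>k <= k0\<close> remain, and the constant absorbs
      them.\<close>
    case False
    have kk: "k \<le> k0" proof (rule ccontr)
     assume "\<not> k \<le> k0"
     then have "j0 \<le> k" "D j0 \<le> real k" unfolding k0_def by linarith+
     then show False using Ige False by auto
    qed
    have "norm (\<Sum>i<a. t i) \<le> E" if "a \<le> j0 + n" for a proof -
     have "norm (\<Sum>i<a. t i) \<le> (\<Sum>i<a. B i m)" by (rule sum_norm_le) (rule nt1)
     also have "... \<le> E" unfolding E_def using that Bn by (intro sum_mono2) auto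
     finally show ?thesis .
    qed
    from this[of "I k"] this[of n] False have "norm ((\<Sum>i<I k. t i) - (\<Sum>i<n. t i)) \<le> 2*E"
     using norm_triangle_ineq4[of "\<Sum>i<I k. t i" "\<Sum>i<n. t i"] by linarith
    also have "... = 2*E*real k^n/real k^n" using k1 by simp
    also have "... \<le> 2*E*real k0^n/real k^n" using E0 kk by (intro divide_right_mono mult_left_mono power_mono) auto
    also have "... \<le> C/real k^n" by (intro divide_right_mono) (auto simp: C_def)
    finally show "norm ((\<Sum>i<I k. t i) - (\<Sum>i<n. t i)) \<le> C/real k^n" .
   qed
  qed
  then show ?thesis using C0 by blast
 qed
 then show ?thesis by (rule that)
qed

section \<open>Half-form lines and polarized sections\<close>

lemma alpha_eq: "alpha x y = 2*pi*(fst x * snd y - snd x * fst y)" by (simp add: alpha_def omega_def)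

locale half_form_setup =
 fixes j :: "plane => plane"
  and sc :: "complex => 'd::real_normed_vector => 'd"
  and \<phi> :: "'d => 'd => plane => complex"
  and herm :: "'d => 'd => complex"
  and Om :: 'd
 assumes compat: "compatible_complex_structure j"
  and hfl: "half_form_line j sc \<phi> herm"
  and Om_mu: "\<phi> Om Om mu = 1"
begin

lemmas half_form = hfl[unfolded half_form_line_def]

lemma sc_vs: "vector_space sc" by (rule half_form[THEN conjunct1])

lemma sc_of_real: "sc (of_real r) u = r *\<^sub>R u" by (rule half_form[THEN conjunct2, THEN conjunct1, rule_format])

lemma phi_add_right: "\<phi> u (v + v') x = \<phi> u v x + \<phi> u v' x"
 by (rule half_form[THEN conjunct2, THEN conjunct2, THEN conjunct2, THEN conjunct2, THEN conjunct1, rule_format])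

lemma phi_scale_left: "\<phi> (sc c u) v x = c*\<phi> u v x"
 by (rule half_form[THEN conjunct2, THEN conjunct2, THEN conjunct2, THEN conjunct2, THEN conjunct2, THEN conjunct1, rule_format])

lemma phi_scale_right: "\<phi> u (sc c v) x = c*\<phi> u v x"
 by (rule half_form[THEN conjunct2, THEN conjunct2, THEN conjunct2, THEN conjunct2, THEN conjunct2, THEN conjunct2, THEN conjunct1, rule_format])

lemma phi_range: "{\<phi> u v |u v. True} = canonical_line j"
 by (rule half_form[THEN conjunct2, THEN conjunct2, THEN conjunct2, THEN conjunct2, THEN conjunct2, THEN conjunct2, THEN conjunct2, THEN conjunct1])

lemma phi_nondeg: "(\<And>x. \<phi> u v x = 0) ==> u = 0 \<or> v = 0"
 by (rule half_form[THEN conjunct2, THEN conjunct2, THEN conjunct2, THEN conjunct2, THEN conjunct2, THEN conjunct2, THEN conjunct2, THEN conjunct2, THEN conjunct1, rule_format])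

lemma herm_scale: "herm (sc c u) v = c*herm u v"
 by (rule half_form[THEN conjunct2, THEN conjunct2, THEN conjunct2, THEN conjunct2, THEN conjunct2, THEN conjunct2, THEN conjunct2, THEN conjunct2, THEN conjunct2, THEN conjunct2, THEN conjunct1, rule_format])

lemma herm_cnj: "herm v u = cnj (herm u v)"
 by (rule half_form[THEN conjunct2, THEN conjunct2, THEN conjunct2, THEN conjunct2, THEN conjunct2, THEN conjunct2, THEN conjunct2, THEN conjunct2, THEN conjunct2, THEN conjunct2, THEN conjunct2, THEN conjunct1, rule_format])

lemma herm_unitary: "canonical_inner (\<phi> u u') (\<phi> v v') = herm u v * herm u' v'"
 by (rule half_form[THEN conjunct2, THEN conjunct2, THEN conjunct2, THEN conjunct2, THEN conjunct2, THEN conjunct2, THEN conjunct2, THEN conjunct2, THEN conjunct2, THEN conjunct2, THEN conjunct2, THEN conjunct2, THEN conjunct1, rule_format])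

lemma herm_norm: "herm u u = of_real (norm u^2)"
 by (rule half_form[THEN conjunct2, THEN conjunct2, THEN conjunct2, THEN conjunct2, THEN conjunct2, THEN conjunct2, THEN conjunct2, THEN conjunct2, THEN conjunct2, THEN conjunct2, THEN conjunct2, THEN conjunct2, THEN conjunct2, rule_format])

lemma sc_add_left: "sc (a + b) u = sc a u + sc b u" by (rule vector_space.vector_space_assms(2)[OF sc_vs])

lemma sc_add_right: "sc a (u + v) = sc a u + sc a v" by (rule vector_space.vector_space_assms(1)[OF sc_vs])

lemma sc_sc: "sc a (sc b u) = sc (a*b) u" by (rule vector_space.vector_space_assms(3)[OF sc_vs])

lemma sc_1 [simp]: "sc 1 u = u" by (rule vector_space.vector_space_assms(4)[OF sc_vs])

lemma sc_0 [simp]: "sc 0 u = 0" using sc_of_real[of 0 u] by simp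

lemma sc_minus_1: "sc (- 1) u = - u" using sc_of_real[of "-1" u] by simp

lemma sc_zero [simp]: "sc a 0 = 0" using sc_add_right[of a 0 0] by simp

lemma sc_sum_left: "sc (sum f A) u = (\<Sum>x\<in>A. sc (f x) u)" by (induction A rule: infinite_finite_induct) (auto simp: sc_add_left)

lemma sc_sum_right: "sc a (sum f A) = (\<Sum>x\<in>A. sc a (f x))" by (induction A rule: infinite_finite_induct) (auto simp: sc_add_right)

lemma sc_scaleR: "sc (r *\<^sub>R c) u = r *\<^sub>R sc c u" by (simp add: scaleR_conv_of_real flip: sc_sc sc_of_real)

lemma sc_scaleR_right: "sc c (r *\<^sub>R u) = r *\<^sub>R sc c u" unfolding sc_of_real[symmetric] sc_sc by (simp add: mult.commute)

lemma norm_sc: "norm (sc c u) = norm c*norm u" proof -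
 have "herm (sc c u) (sc c u) = c * cnj c*herm u u" unfolding herm_scale[of c u] by (subst herm_cnj) (simp add: herm_scale herm_norm)
 then have "complex_of_real (norm (sc c u)^2) = of_real ((norm c*norm u)^2)"
  unfolding herm_norm using complex_norm_square[of c] by (simp add: power_mult_distrib)
 then have "norm (sc c u)^2 = (norm c*norm u)^2" by (simp only: of_real_eq_iff)
 then show ?thesis by (rule power2_eq_imp_eq) auto
qed

lemma bounded_linear_sc_left: "bounded_linear (\<lambda>c. sc c u)"
 by (rule bounded_linear_intro[of _ "norm u"]) (simp_all add: sc_add_left sc_scaleR norm_sc)

lemma bounded_linear_sc_right: "bounded_linear (sc c)"
 by (rule bounded_linear_intro[of _ "norm c"]) (simp_all add: sc_add_right sc_scaleR_right norm_sc mult.commute)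

text \<open>The complex linear coordinate on \<open>(E, j)\<close>, normalised to be 1 at
  \<open>mu\<close>.\<close>

definition coord :: "plane => complex" where "coord = \<phi> Om Om"

text \<open>Period ratio of the torus: \<open>coord\<close> identifies \<open>E/R\<close> with the
  complex numbers modulo the lattice spanned by 1 and \<open>modulus\<close>.\<close>

definition modulus :: complex where "modulus = coord lam"

lemma coord_canonical: "coord \<in> canonical_line j" using phi_range unfolding coord_def by blast

lemma coord_j: "coord (j v) = \<i>*coord v" using coord_canonical unfolding canonical_line_def by blast

lemma linear_coord: "linear coord" using coord_canonical unfolding canonical_line_def by blast

lemma coord_mu: "coord mu = 1" using Om_mu by (simp add: coord_def)

lemma plane_eq: "x = fst x *\<^sub>R mu + snd x *\<^sub>R lam" by (simp add: mu_def lam_def)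

lemma coord_eq: "coord x = of_real (fst x) + modulus * of_real (snd x)" proof -
 have "coord x = coord (fst x *\<^sub>R mu + snd x *\<^sub>R lam)" by (rule arg_cong[OF plane_eq])
 also have "... = fst x *\<^sub>R coord mu + snd x *\<^sub>R coord lam" by (simp only: linear_add[OF linear_coord] linear_scale[OF linear_coord])
 finally show ?thesis by (simp add: coord_mu modulus_def scaleR_conv_of_real mult.commute)
qed

lemma bounded_linear_coord: "bounded_linear coord" using linear_coord by (rule linear_conv_bounded_linear[THEN iffD1])

lemma modulus_pos: "Im modulus > 0" proof -
 have "omega mu (j mu) > 0" using compat unfolding compatible_complex_structure_def by (auto simp: mu_def zero_prod_def)
 then have y: "snd (j mu) > 0" by (simp add: omega_def mu_def zero_less_mult_iff)
 have "\<i> = of_real (fst (j mu)) + modulus * of_real (snd (j mu))" using coord_j[of mu] coord_mu coord_eq[of "j mu"] by simp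
 then have "Im \<i> = Im (of_real (fst (j mu)) + modulus * of_real (snd (j mu)))" by (rule arg_cong)
 then have "1 = Im modulus * snd (j mu)" by simp
 then show ?thesis using y by (metis zero_less_mult_pos2 zero_less_one)
qed

text \<open>Unitarity of \<open>\<phi>\<close> on the square of \<open>Om\<close>. The factor
  \<open>Im modulus\<close> later cancels against the integral of the theta section.\<close>

lemma norm_Om: "norm Om^4 = Im modulus/(2*pi)" proof -
 have "complex_of_real (norm Om^4) = herm Om Om*herm Om Om" unfolding herm_norm by (simp flip: of_real_mult power_add)
 also have "... = canonical_inner coord coord" unfolding coord_def by (rule herm_unitary[symmetric])
 also have "... = \<i>*(cnj modulus - modulus)/of_real (4*pi)" proof -
  have "omega mu lam = 4*pi" by (simp add: omega_def mu_def lam_def)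
  then show ?thesis by (simp add: canonical_inner_def coord_mu modulus_def[symmetric])
 qed
 also have "... = of_real (Im modulus/(2*pi))" by (simp add: complex_eq_iff)
 finally show ?thesis by (simp only: of_real_eq_iff)
qed

lemma Om_neq_0: "Om \<noteq> 0" proof
 assume "Om = 0"
 then have "norm Om^4 = 0" by simp
 then show False using norm_Om modulus_pos by simp
qed

text \<open>A form of the canonical line is determined by its value at \<open>mu\<close>, since
  \<open>mu\<close> and \<open>j mu\<close> span the plane; the nondegeneracy of
  \<open>\<phi>\<close> carries this over to the half-form line.\<close>

lemma eq_sc_Om: "u = sc (\<phi> Om u mu) Om" proof -
 define t where "t = \<phi> Om u mu"
 have c: "\<phi> Om u \<in> canonical_line j" using phi_range by blast
 then have l: "linear (\<phi> Om u)" and jj: "\<And>v. \<phi> Om u (j v) = \<i>*\<phi> Om u v" by (auto simp: canonical_line_def)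
 have y0: "snd (j mu) \<noteq> 0" proof
  assume "snd (j mu) = 0"
  then have "omega mu (j mu) = 0" by (simp add: omega_def mu_def)
  moreover have "omega mu (j mu) > 0" using compat unfolding compatible_complex_structure_def by (auto simp: mu_def zero_prod_def)
  ultimately show False by simp
 qed
 have ex: "f lam = (\<i> - of_real (fst (j mu)))/of_real (snd (j mu)) * f mu" if "linear f" "f (j mu) = \<i> * f mu" for f :: "plane => complex"
 proof -
  have "f (j mu) = f (fst (j mu) *\<^sub>R mu + snd (j mu) *\<^sub>R lam)" by (rule arg_cong[OF plane_eq])
  also have "... = of_real (fst (j mu)) * f mu + of_real (snd (j mu)) * f lam"
   by (simp only: linear_add[OF that(1)] linear_scale[OF that(1)] scaleR_conv_of_real)
  finally show ?thesis using y0 unfolding that(2) by (simp add: field_simps)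
 qed
 have "\<phi> Om u x = t*coord x" for x proof -
  have "\<phi> Om u x = of_real (fst x)*\<phi> Om u mu + of_real (snd x)*\<phi> Om u lam"
   using linear_add[OF l] linear_scale[OF l] by (metis plane_eq scaleR_conv_of_real)
  moreover have "\<phi> Om u lam = t*modulus" unfolding ex[OF l jj] modulus_def ex[OF linear_coord coord_j] t_def coord_mu by simp
  ultimately show ?thesis unfolding coord_eq t_def by (simp add: algebra_simps)
 qed
 then have "\<phi> Om (u + sc (- t) Om) x = 0" for x by (simp add: phi_add_right phi_scale_right coord_def)
 then have "u + sc (- t) Om = 0" using phi_nondeg Om_neq_0 by blast
 then have "u = - sc (- t) Om" by (simp add: add_eq_0_iff2)
 also have "... = sc t Om" unfolding sc_minus_1[symmetric] sc_sc by simp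
 finally show ?thesis unfolding t_def .
qed

text \<open>Hypothesis \<open>e\<close> says that the covariant derivative is a multiple of
  \<open>coord\<close>, that is, of type (1,0). The linear map \<open>B\<close> lets scalar sections
  and sections with values in the half-form line share one proof.\<close>

lemma dbar_zeroI:
 assumes B: "bounded_linear (B :: complex => 'b::real_normed_vector)" and Bs: "\<And>c z. B (c*z) = sc' c (B z)"
  and D: "(s has_derivative D) (at x)"
  and e: "\<And>v. D v - \<i> * of_nat k * of_real (alpha x v) * s x = e*coord v" shows "dbar j sc' k (\<lambda>x. B (s x)) x v = 0" proof -
 have lin: "B (a + b) = B a + B b" for a b using bounded_linear.linear[OF B] linear_add by blast
 have n: "nabla sc' k (\<lambda>x. B (s x)) x v = B (e*coord v)" for v proof -
  have fd: "frechet_derivative (\<lambda>x. B (s x)) (at x) = (\<lambda>v. B (D v))" by (rule frechet_eq[OF bounded_linear.has_derivative[OF B D]])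
  then have "nabla sc' k (\<lambda>x. B (s x)) x v = B (D v + of_nat k / \<i> * of_real (alpha x v) * s x)" by (simp only: nabla_def lin Bs fd)
  also have "D v + of_nat k / \<i> * of_real (alpha x v) * s x = e*coord v" unfolding e[symmetric] by (simp add: field_simps)
  finally show ?thesis .
 qed
 have "B (e*coord v) + sc' \<i> (B (e*coord (j v))) = B (e*coord v + \<i>*(e*coord (j v)))" by (simp add: lin Bs)
 also have "e*coord v + \<i>*(e*coord (j v)) = 0" by (simp add: coord_j algebra_simps)
 also have "B 0 = 0" by (rule linear_0[OF bounded_linear.linear[OF B]])
 finally show ?thesis unfolding dbar_def n by simp
qed

text \<open>This is the condition for \<open>exp(L x * coord x)\<close> to be a holomorphic section
  of the \<open>k\<close>-th power of the line bundle. The exponent has derivative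
  \<open>L x * coord v + coord x * L v\<close>; the first summand is of type (1,0), and the second
  has to become so after the connection term is subtracted.\<close>

definition polarized :: "nat => (plane => complex) => bool" where
 "polarized k L \<longleftrightarrow> bounded_linear L \<and> (\<exists>\<epsilon>. \<forall>x v. coord x * L v - \<i> * of_nat k * of_real (alpha x v) = \<epsilon> x*coord v)"

text \<open>The resulting Gaussian has modulus \<open>exp(-2 pi k Im(modulus) (snd x)^2)\<close>, so
  it is concentrated along the line of \<open>mu\<close>.\<close>

lemma polarized_mu: "polarized k (\<lambda>x. tpi * of_nat k * of_real (snd x))" unfolding polarized_def proof
 show "bounded_linear (\<lambda>x::plane. tpi * of_nat k * complex_of_real (snd x))"
  by (intro bounded_linear_mult_right[THEN bounded_linear_compose] bounded_linear_compose[OF bounded_linear_of_real bounded_linear_snd])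
 have "coord x*(tpi * of_nat k * of_real (snd v)) - \<i> * of_nat k * of_real (alpha x v)
   = (tpi * of_nat k * of_real (snd x))*coord v" for x v unfolding coord_eq alpha_eq by (simp add: algebra_simps)
 then show "\<exists>\<epsilon>. \<forall>x v. coord x*(tpi * of_nat k * of_real (snd v)) - \<i> * of_nat k * of_real (alpha x v) = \<epsilon> x*coord v"
  by (intro exI[of _ "\<lambda>x. tpi * of_nat k * of_real (snd x)"]) simp
qed

text \<open>The resulting Gaussian has modulus
  \<open>exp(-2 pi k Im(modulus) (fst x)^2 / |modulus|^2)\<close>, so it is concentrated along the
  line of \<open>lam\<close>.\<close>

lemma polarized_lam: "polarized k (\<lambda>x. - (tpi * of_nat k/modulus) * of_real (fst x))" unfolding polarized_def proof
 have m: "modulus \<noteq> 0" using modulus_pos by auto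
 show "bounded_linear (\<lambda>x::plane. - (tpi * of_nat k/modulus) * complex_of_real (fst x))"
  by (intro bounded_linear_mult_right[THEN bounded_linear_compose] bounded_linear_compose[OF bounded_linear_of_real bounded_linear_fst])
 have "coord x*(- (tpi * of_nat k/modulus) * of_real (fst v)) - \<i> * of_nat k * of_real (alpha x v)
   = (- (tpi * of_nat k/modulus) * of_real (fst x))*coord v" for x v unfolding coord_eq alpha_eq using m by (simp add: field_simps)
 then show "\<exists>\<epsilon>. \<forall>x v. coord x*(- (tpi * of_nat k/modulus) * of_real (fst v)) - \<i> * of_nat k * of_real (alpha x v) = \<epsilon> x*coord v"
  by (intro exI[of _ "\<lambda>x. - (tpi * of_nat k/modulus) * of_real (fst x)"]) simp
qed

text \<open>The translated Gaussian sections; the phase makes the translate by \<open>N\<close> holomorphic again.\<close>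

lemma gauss_section_dbar:
 assumes B: "bounded_linear (B :: complex => 'b::real_normed_vector)" and Bs: "\<And>c z. B (c*z) = sc' c (B z)"
  and L: "polarized k L" and H: "H holomorphic_on UNIV"
 shows "dbar j sc' k (\<lambda>x. B (exp (\<i> * of_nat k * of_real (alpha N x) + L (x - N)*coord (x - N)) * H (coord (x - N)))) x v = 0" proof -
 obtain \<epsilon> where bl: "bounded_linear L" and \<epsilon>: "\<And>x v. coord x * L v - \<i> * of_nat k * of_real (alpha x v) = \<epsilon> x*coord v"
  using L unfolding polarized_def by blast
 define y where "y = x - N"
 define E where "E = exp (\<i> * of_nat k * of_real (alpha N x) + L y*coord y)"
 have shift: "((\<lambda>x. f (x - N)) has_derivative f) (at x)" if "bounded_linear f" for f :: "plane => complex"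
  by (rule has_derivative_compose[OF _ bounded_linear_imp_has_derivative[OF that], of _ id, unfolded id_def])
   (auto intro!: derivative_eq_intros)
 have om: "((\<lambda>x. alpha N x) has_derivative (\<lambda>v. alpha N v)) (at x)" unfolding alpha_eq by (auto intro!: derivative_eq_intros)
 have d1: "((\<lambda>x. \<i> * of_nat k * of_real (alpha N x) + L (x - N)*coord (x - N)) has_derivative
   (\<lambda>v. \<i> * of_nat k * of_real (alpha N v) + (L y*coord v + L v * coord y))) (at x)" unfolding y_def
  by (intro has_derivative_add has_derivative_mult_right has_derivative_of_real om has_derivative_mult shift bl bounded_linear_coord)
 have d2: "((\<lambda>x. exp (\<i> * of_nat k * of_real (alpha N x) + L (x - N)*coord (x - N))) has_derivative
   (\<lambda>v. E*(\<i> * of_nat k * of_real (alpha N v) + (L y*coord v + L v * coord y)))) (at x)"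
  unfolding E_def y_def by (rule has_derivative_compose[OF d1[unfolded y_def] has_field_derivative_imp_has_derivative[OF DERIV_exp]])
 have "(H has_field_derivative deriv H (coord y)) (at (coord y))" using H holomorphic_derivI by blast
 then have d3: "((\<lambda>x. H (coord (x - N))) has_derivative (\<lambda>v. deriv H (coord y)*coord v)) (at x)"
  unfolding y_def by (intro has_derivative_compose[OF shift[OF bounded_linear_coord]] has_field_derivative_imp_has_derivative)
 show ?thesis proof (rule dbar_zeroI[OF B Bs has_derivative_mult[OF d2 d3]])
  fix v
  have al: "complex_of_real (alpha x v) = of_real (alpha N v) + of_real (alpha y v)"
   unfolding of_real_add[symmetric] y_def by (rule arg_cong[where f=of_real]) (simp add: alpha_eq algebra_simps)
  have "exp (\<i> * of_nat k * of_real (alpha N x) + L (x - N)*coord (x - N))*(deriv H (coord y)*coord v) +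
   E*(\<i> * of_nat k * of_real (alpha N v) + (L y*coord v + L v * coord y)) * H (coord (x - N)) -
   \<i> * of_nat k * of_real (alpha x v)*(exp (\<i> * of_nat k * of_real (alpha N x) + L (x - N)*coord (x - N)) * H (coord (x - N)))
   = E*deriv H (coord y)*coord v + E * H (coord y)*(L y*coord v + (coord y * L v - \<i> * of_nat k * of_real (alpha y v)))"
   unfolding E_def[symmetric] y_def[symmetric] al by (simp add: algebra_simps)
  also have "... = (E*deriv H (coord y) + E * H (coord y)*(L y + \<epsilon> y))*coord v" unfolding \<epsilon> by (simp add: algebra_simps)
  finally show "exp (\<i> * of_nat k * of_real (alpha N x) + L (x - N)*coord (x - N))*(deriv H (coord y)*coord v) +
   E*(\<i> * of_nat k * of_real (alpha N v) + (L y*coord v + L v * coord y)) * H (coord (x - N)) -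
   \<i> * of_nat k * of_real (alpha x v)*(exp (\<i> * of_nat k * of_real (alpha N x) + L (x - N)*coord (x - N)) * H (coord (x - N)))
   = (E*deriv H (coord y) + E * H (coord y)*(L y + \<epsilon> y))*coord v" .
 qed
qed

lemma gauss_section_smooth:
 assumes S: "open S" and L: "polarized k L" and H: "H holomorphic_on UNIV"
 shows "smooth_on S (\<lambda>x. exp (\<i> * of_nat k * of_real (alpha N x) + L (x - N)*coord (x - N)) * H (coord (x - N)))" proof -
 have bl: "bounded_linear L" using L unfolding polarized_def by blast
 have sub: "smooth_on S (\<lambda>x. f (x - N))" if "bounded_linear f" for f :: "plane => complex" proof -
  have "f (x - N) = f x + (- f N)" for x using linear_diff[OF bounded_linear.linear[OF that]] by simp
  then show ?thesis using smooth_on_add[OF S smooth_on_bounded_linear[OF that] smooth_on_const[of S "- f N"]] by simp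
 qed
 have "bounded_linear (\<lambda>x. \<i> * of_nat k * complex_of_real (alpha N x))" unfolding alpha_eq
  by (rule linear_conv_bounded_linear[THEN iffD1]) (auto intro!: linearI simp: algebra_simps scaleR_conv_of_real)
 from smooth_on_bounded_linear[OF this, of S]
 have ph: "smooth_on S (\<lambda>x. \<i> * of_nat k * complex_of_real (alpha N x))" .
 have e: "smooth_on S (\<lambda>x. exp (\<i> * of_nat k * of_real (alpha N x) + L (x - N)*coord (x - N)))"
  by (rule smooth_on_compose_holomorphic[OF S open_UNIV _ holomorphic_on_exp[of UNIV]
    smooth_on_add[OF S ph smooth_on_mult[OF S sub[OF bl] sub[OF bounded_linear_coord]]]]) simp
 have "smooth_on S (\<lambda>x. H (coord (x - N)))" by (rule smooth_on_compose_holomorphic[OF S open_UNIV _ H sub[OF bounded_linear_coord]]) simp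
 then show ?thesis by (rule smooth_on_mult[OF S e])
qed

lemma quantum_spaceI:
 assumes L: "polarized k L" and H: "H holomorphic_on UNIV"
  and sec: "\<And>r y. r \<in> lattice ==> exp (L (r + y)*coord (r + y)) * H (coord (r + y)) = cis (real k * omega r y/2)*(exp (L y*coord y) * H (coord y))"
 shows "(\<lambda>x. sc (exp (L x*coord x) * H (coord x)) u) \<in> quantum_space j sc k" proof -
 have sm: "smooth_on UNIV (\<lambda>x. exp (L x*coord x) * H (coord x))" using gauss_section_smooth[OF open_UNIV L H, of 0] by (simp add: alpha_eq)
 have "dbar j sc k (\<lambda>x. sc (exp (L x*coord x) * H (coord x)) u) x v = 0" for x v
  using gauss_section_dbar[OF bounded_linear_sc_left[of u] sc_sc[symmetric] L H, of 0] by (simp add: alpha_eq)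
 moreover have "smooth_on UNIV (\<lambda>x. sc (exp (L x*coord x) * H (coord x)) u)"
  by (rule smooth_on_linear_image[OF bounded_linear_sc_left open_UNIV sm])
 ultimately show ?thesis unfolding quantum_space_def is_section_def using sec by (simp add: sc_sc)
qed

lemma quantum_space_add:
 assumes "s \<in> quantum_space j sc k" "t \<in> quantum_space j sc k" shows "(\<lambda>x. s x + t x) \<in> quantum_space j sc k" proof -
 have sm: "smooth_on UNIV s" "smooth_on UNIV t" using assms by (auto simp: quantum_space_def)
 have "frechet_derivative (\<lambda>x. s x + t x) (at x) = (\<lambda>v. frechet_derivative s (at x) v + frechet_derivative t (at x) v)" for x
  by (intro frechet_eq has_derivative_add has_derivative_frechet smooth_on_differentiable[OF sm(1)] smooth_on_differentiable[OF sm(2)]) auto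
 then have "nabla sc k (\<lambda>x. s x + t x) x v = nabla sc k s x v + nabla sc k t x v" for x v unfolding nabla_def by (simp add: sc_add_right)
 then have "dbar j sc k (\<lambda>x. s x + t x) x v = dbar j sc k s x v + dbar j sc k t x v" for x v
  unfolding dbar_def by (simp add: sc_add_right algebra_simps)
 then show ?thesis using assms unfolding quantum_space_def is_section_def by (auto simp: sc_add_right intro!: smooth_on_add)
qed

lemma quantum_space_scale:
 assumes "s \<in> quantum_space j sc k" shows "(\<lambda>x. sc c (s x)) \<in> quantum_space j sc k" proof -
 have sm: "smooth_on UNIV s" using assms by (auto simp: quantum_space_def)
 have "frechet_derivative (\<lambda>x. sc c (s x)) (at x) = (\<lambda>v. sc c (frechet_derivative s (at x) v))" for x
  by (intro frechet_eq bounded_linear.has_derivative[OF bounded_linear_sc_right] has_derivative_frechet smooth_on_differentiable[OF sm]) auto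
 then have "nabla sc k (\<lambda>x. sc c (s x)) x v = sc c (nabla sc k s x v)" for x v unfolding nabla_def by (simp add: sc_add_right sc_sc mult_ac)
 then have "dbar j sc k (\<lambda>x. sc c (s x)) x v = sc c (dbar j sc k s x v)" for x v
  unfolding dbar_def by (simp add: sc_add_right sc_sc sc_scaleR_right mult_ac)
 moreover have "smooth_on UNIV (\<lambda>x. sc c (s x))" by (rule smooth_on_linear_image[OF bounded_linear_sc_right open_UNIV sm])
 ultimately show ?thesis using assms unfolding quantum_space_def is_section_def by (auto simp: sc_sc mult_ac)
qed

lemma quantum_space_zero: "(\<lambda>x. 0) \<in> quantum_space j sc k"
 unfolding quantum_space_def is_section_def dbar_def nabla_def by (simp add: smooth_on_const)

lemma quantum_space_sum:
 "(\<And>i. i \<in> A ==> s i \<in> quantum_space j sc k) ==> (\<lambda>x. \<Sum>i\<in>A. s i x) \<in> quantum_space j sc k"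
proof (induction A rule: infinite_finite_induct)
 case (insert i A)
 then show ?case using quantum_space_add[of "s i" k "\<lambda>x. \<Sum>i\<in>A. s i x"] by simp
qed (auto simp: quantum_space_zero)

end

section \<open>Theta sections\<close>

lemma holomorphic_theta_series:
 fixes h :: "int => complex => complex"
 assumes hol: "\<And>n. h n holomorphic_on UNIV"
  and bd: "\<And>r. \<exists>K R. \<forall>n. \<forall>P\<in>cball 0 r. norm (h n P) \<le> K*exp (- c*(real_of_int n)^2 + R*\<bar>real_of_int n\<bar>)" and c: "c > 0"
 shows "(\<lambda>z. \<Sum>\<^sub>\<infinity>n. h n z) holomorphic_on UNIV" "(\<lambda>n. h n z) summable_on UNIV" proof -
 have u: "uniform_limit (cball 0 r) (\<lambda>X y. \<Sum>n\<in>X. h n y) (\<lambda>y. \<Sum>\<^sub>\<infinity>n. h n y) (finite_subsets_at_top (UNIV::int set))" for r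
 proof -
  obtain K R where KR: "\<And>n P. P\<in>cball 0 r ==> norm (h n P) \<le> K*exp (- c*(real_of_int n)^2 + R*\<bar>real_of_int n\<bar>)"
   using bd[of r] by blast
  show ?thesis by (rule uniform_limit_theta_series[OF c KR])
 qed
 have "(\<lambda>z. \<Sum>\<^sub>\<infinity>n. h n z) holomorphic_on ball 0 r" for r by (rule holomorphic_uniform_limit[OF _ u])
   (auto intro!: always_eventually continuous_intros holomorphic_intros holomorphic_on_subset[OF hol] holomorphic_on_imp_continuous_on)
 then have "(\<lambda>z. \<Sum>\<^sub>\<infinity>n. h n z) field_differentiable (at z)" for z
  by (rule holomorphic_on_imp_differentiable_at[of _ "ball 0 (norm z + 1)"]) auto
 then show "(\<lambda>z. \<Sum>\<^sub>\<infinity>n. h n z) holomorphic_on UNIV" by (simp add: holomorphic_on_def)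
 have "(\<Sum>\<^sub>\<infinity>n. h n z) = (\<Sum>\<^sub>\<infinity>n. h n z)" ..
 show "(\<lambda>n. h n z) summable_on UNIV"
  using has_sum_deriv(1)[OF hol bd c, of "\<lambda>z. \<Sum>\<^sub>\<infinity>n. h n z" z] has_sum_imp_summable by blast
qed

text \<open>The Riemann theta function with modulus \<open>2 k \<tau>\<close> at the argument
  \<open>2 k z\<close>.\<close>

definition theta0 :: "complex => nat => complex => complex" where
 "theta0 \<tau> k z = (\<Sum>\<^sub>\<infinity>n::int. exp (tpi * of_nat k*\<tau>*(of_int n)^2 + 4 * of_real pi*\<i> * of_nat k*z * of_int n))"

lemma theta0_series:
 assumes tau: "Im \<tau> > 0" and k: "k \<ge> 1" shows "theta0 \<tau> k holomorphic_on UNIV"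
  "(\<lambda>n::int. exp (tpi * of_nat k*\<tau>*(of_int n)^2 + 4 * of_real pi*\<i> * of_nat k*z * of_int n)) summable_on UNIV" proof -
 define h where "h = (\<lambda>n z. exp (tpi * of_nat k*\<tau>*(of_int n)^2 + 4 * of_real pi*\<i> * of_nat k*z * of_int n))"
 have hol: "h n holomorphic_on UNIV" for n unfolding h_def by (intro holomorphic_intros)
 have c: "2*pi*real k*Im \<tau> > 0" using tau k by simp
 have bd: "\<exists>K R. \<forall>n. \<forall>P\<in>cball 0 r. norm (h n P) \<le> K*exp (- (2*pi*real k*Im \<tau>)*(real_of_int n)^2 + R*\<bar>real_of_int n\<bar>)" for r
 proof -
  define M where "M = 4*pi*real k*\<bar>r\<bar>"
  obtain K R where KR: "\<forall>n::int. \<forall>l \<mu> \<nu>. norm l \<le> 1*(1 + \<bar>real_of_int n\<bar>) --> norm \<mu> \<le> M --> norm \<nu> \<le> M -->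
   norm (poly [:1:] l*exp (tpi * of_nat k*\<tau>*(of_int n)^2 + \<mu> * of_int n + \<nu>)) \<le> K*exp (Re (tpi * of_nat k*\<tau>)*(real_of_int n)^2 + R*\<bar>real_of_int n\<bar>)"
   using theta_term_bound by blast
  have "norm (h n P) \<le> K*exp (- (2*pi*real k*Im \<tau>)*(real_of_int n)^2 + R*\<bar>real_of_int n\<bar>)" if P: "P \<in> cball 0 r" for n P
  proof -
   have "norm (4 * of_real pi*\<i> * of_nat k*P) \<le> M" using P by (simp add: norm_mult M_def mult_left_mono)
   moreover have "norm (0::complex) \<le> 1*(1 + \<bar>real_of_int n\<bar>)" "norm (0::complex) \<le> M" by (auto simp: M_def)
   ultimately show ?thesis using KR[rule_format, of 0 n "4 * of_real pi*\<i> * of_nat k*P" 0] by (simp add: h_def)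
  qed
  then show ?thesis by blast
 qed
 show "theta0 \<tau> k holomorphic_on UNIV" using holomorphic_theta_series(1)[OF hol bd c] unfolding theta0_def[abs_def] h_def .
 show "(\<lambda>n::int. exp (tpi * of_nat k*\<tau>*(of_int n)^2 + 4 * of_real pi*\<i> * of_nat k*z * of_int n)) summable_on UNIV"
  using holomorphic_theta_series(2)[OF hol bd c, of z] unfolding h_def .
qed

text \<open>Both factors of the squared modulus converge uniformly, so the integral is a limit over
  finite sets of double sums, in which orthogonality leaves the diagonal.\<close>

lemma parseval_lattice:
 fixes a :: "int => complex" and \<kappa> :: int
 assumes M: "M summable_on UNIV" and aM: "\<And>n. norm (a n) \<le> M n" and \<kappa>: "\<kappa> \<noteq> 0"
 shows "((\<lambda>p. complex_of_real ((norm (\<Sum>\<^sub>\<infinity>n. a n*exp (tpi * of_int (\<kappa>*n) * of_real p)))^2)) has_integral (\<Sum>\<^sub>\<infinity>n. of_real ((norm (a n))^2))) {0..1::real}"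
proof -
 define e where "e = (\<lambda>n::int. \<lambda>p::real. exp (tpi * of_int (\<kappa>*n) * of_real p) :: complex)"
 have ne: "norm (e n p) = 1" for n p by (simp add: e_def norm_exp_eq_Re)
 have cont: "continuous_on A (e n)" for A n unfolding e_def by (intro continuous_intros)
 define S where "S = (\<lambda>p. \<Sum>\<^sub>\<infinity>n. a n*e n p)"
 have u1: "uniform_limit {0..1} (\<lambda>X p. \<Sum>n\<in>X. a n*e n p) S (finite_subsets_at_top (UNIV::int set))"
  unfolding S_def by (rule Weierstrass_m_test_general[OF _ M]) (simp add: norm_mult ne aM)
 have contS: "continuous_on {0..1} S" by (rule uniform_limit_theorem[OF _ u1]) (auto intro!: always_eventually continuous_intros cont)
 then have bS: "bounded (S ` {0..1})" by (intro compact_imp_bounded compact_continuous_image) auto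
 have u2: "uniform_limit {0..1} (\<lambda>X p. cnj (\<Sum>n\<in>X. a n*e n p)) (\<lambda>p. cnj (S p)) (finite_subsets_at_top (UNIV::int set))"
  by (rule bounded_linear.uniform_limit[OF bounded_linear_cnj u1])
 have bcS: "bounded ((\<lambda>p. cnj (S p)) ` {0..1})" using bS unfolding bounded_iff by simp
 have u: "uniform_limit {0..1} (\<lambda>X p. (\<Sum>n\<in>X. a n*e n p) * cnj (\<Sum>n\<in>X. a n*e n p)) (\<lambda>p. S p * cnj (S p)) (finite_subsets_at_top (UNIV::int set))"
  by (rule uniform_lim_mult[OF u1 u2 bS bcS])
 obtain I J where I: "\<And>X. ((\<lambda>p. (\<Sum>n\<in>X. a n*e n p) * cnj (\<Sum>n\<in>X. a n*e n p)) has_integral I X) {0..1::real}"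
  and J: "((\<lambda>p. S p * cnj (S p)) has_integral J) {0..1::real}" and lim: "(I \<longlongrightarrow> J) (finite_subsets_at_top (UNIV::int set))"
 proof (rule uniform_limit_integral[OF u])
  show "continuous_on {0..1} (\<lambda>p. (\<Sum>n\<in>X. a n*e n p) * cnj (\<Sum>n\<in>X. a n*e n p))" for X by (intro continuous_intros cont)
 qed auto
 have orth: "((\<lambda>p. e n p * cnj (e m p)) has_integral (if n = m then 1 else 0)) {0..1::real}" for n m proof -
  define d where "d = \<kappa>*(n - m)"
  have ee: "e n p * cnj (e m p) = exp (tpi * of_int d * of_real p)" for p unfolding e_def d_def exp_cnj exp_add[symmetric]
   by (rule arg_cong[where f=exp]) (simp add: algebra_simps)
  show ?thesis proof (cases "n = m")
   case True
   then show ?thesis unfolding ee using has_integral_const_real[of "1::complex" 0 1] by (simp add: d_def)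
  next
   case False
   then have d0: "d \<noteq> 0" using \<kappa> by (simp add: d_def)
   define F where "F = (\<lambda>p::real. exp (tpi * of_int d * of_real p)/(tpi * of_int d))"
   have "(F has_vector_derivative exp (tpi * of_int d * of_real p)) (at p within {0..1})" for p proof -
    have "((\<lambda>z. exp (tpi * of_int d*z)/(tpi * of_int d)) has_field_derivative
     exp (tpi * of_int d * of_real p)) (at (of_real p))" using d0 by (auto intro!: derivative_eq_intros)
    from has_vector_derivative_real_field[OF this] show ?thesis by (simp add: F_def)
   qed
   then have "((\<lambda>p. exp (tpi * of_int d * of_real p)) has_integral (F 1 - F 0)) {0..1}" by (intro fundamental_theorem_of_calculus) auto
   moreover have "exp (tpi * of_int d) = (1 :: complex)" by (subst exp_eq_1) (auto intro!: exI[of _ d])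
   ultimately show ?thesis unfolding ee using False by (simp add: F_def)
  qed
 qed
 have IX: "I X = (\<Sum>n\<in>X. of_real ((norm (a n))^2))" if X: "finite X" for X proof -
  have "((\<lambda>p. \<Sum>n\<in>X. \<Sum>m\<in>X. (a n * cnj (a m))*(e n p * cnj (e m p))) has_integral (\<Sum>n\<in>X. \<Sum>m\<in>X. (a n * cnj (a m))*(if n = m then 1 else 0))) {0..1}"
   by (intro has_integral_sum X has_integral_mult_right orth)
  moreover have "(\<Sum>n\<in>X. \<Sum>m\<in>X. (a n * cnj (a m))*(e n p * cnj (e m p))) = (\<Sum>n\<in>X. a n*e n p) * cnj (\<Sum>n\<in>X. a n*e n p)" for p
   by (simp add: sum_product mult_ac)
  moreover have "(\<Sum>n\<in>X. \<Sum>m\<in>X. (a n * cnj (a m))*(if n = m then 1 else 0)) = (\<Sum>n\<in>X. of_real ((norm (a n))^2))"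
  proof (rule sum.cong[OF refl])
   fix n assume n: "n \<in> X"
   have "(\<Sum>m\<in>X. (a n * cnj (a m))*(if n = m then 1 else 0)) = (\<Sum>m\<in>X. if n = m then a n * cnj (a m) else 0)"
    by (intro sum.cong refl) simp
   also have "... = a n * cnj (a n)" using X n by (simp add: sum.delta)
   finally show "(\<Sum>m\<in>X. (a n * cnj (a m))*(if n = m then 1 else 0)) = of_real ((norm (a n))^2)" by (simp only: complex_norm_square)
  qed
  ultimately have "((\<lambda>p. (\<Sum>n\<in>X. a n*e n p) * cnj (\<Sum>n\<in>X. a n*e n p)) has_integral (\<Sum>n\<in>X. of_real ((norm (a n))^2))) {0..1}"
   by (simp only:)
  then show ?thesis by (rule has_integral_unique[OF I[of X]])
 qed
 have "((\<lambda>X. \<Sum>n\<in>X. complex_of_real ((norm (a n))^2)) \<longlongrightarrow> J) (finite_subsets_at_top UNIV)"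
  by (rule Lim_transform_eventually[OF lim]) (auto intro!: eventually_finite_subsets_at_top_weakI simp: IX)
 then have "J = (\<Sum>\<^sub>\<infinity>n. of_real ((norm (a n))^2))" by (intro infsumI[symmetric]) (simp add: has_sum_def)
 moreover have "S p * cnj (S p) = of_real ((norm (S p))^2)" for p by (simp only: complex_norm_square)
 ultimately show ?thesis using J unfolding S_def e_def by simp
qed

text \<open>The integral over a period is the Fourier coefficient of index 0 of the periodised
  Gaussian, hence the Gaussian integral over the whole line.\<close>

lemma gaussian_periodization_integral:
 assumes A: "A > 0"
 shows "integral {0..1} (\<lambda>q::real. \<Sum>\<^sub>\<infinity>n::int. complex_of_real (exp (- A*(q + real_of_int n)^2))) = of_real (1/sqrt (A/pi))"
proof -
 define f where "f = (\<lambda>z. \<Sum>\<^sub>\<infinity>n\<in>(UNIV :: int set). exp (- complex_of_real A*(of_int n + z)^2))"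
 have RA: "Re (complex_of_real A) > 0" using A by simp
 have hol: "f holomorphic_on UNIV" unfolding f_def by (rule holomorphic_gaussian_periodization[OF RA])
 have fq: "f (of_real q) = (\<Sum>\<^sub>\<infinity>n::int. complex_of_real (exp (- A*(q + real_of_int n)^2)))" for q
  unfolding f_def by (intro infsum_cong) (simp add: exp_of_real[symmetric] add.commute)
 have "gauss_const (of_real A) = integral {-1/2..1/2} (\<lambda>x::real. f (of_real x + 1/2))"
  using gaussian_fourier_coefficient[OF RA, of "1/2" 0] unfolding f_def by simp
 also have "... = integral {0..1} (\<lambda>x::real. f (of_real x))" proof -
  show ?thesis using integral_shift_Icc_real[of "-1/2" "1/2" "\<lambda>x. f (of_real x)" "1/2"] by (simp add: o_def add.commute)
 qed
 also have "gauss_const (of_real A) = of_real (1/sqrt (A/pi))" proof -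
  have "csqrt (of_real (A/pi)) = of_real (sqrt (A/pi))"       by (rule csqrt_unique) (use A in \<open>simp_all flip: of_real_power\<close>)
  then show ?thesis unfolding gauss_const_def by simp
 qed
 finally show ?thesis unfolding fq ..
qed

lemma residue_classes_has_sum:
 fixes f :: "int => complex"
 assumes k: "k \<ge> 1" and s: "\<And>r. r < 2*k ==> ((\<lambda>n. f (2*int k*n + int r)) has_sum s r) UNIV"
 shows "(f has_sum (\<Sum>r<2*k. s r)) UNIV" proof -
 define B where "B = (\<lambda>r. range (\<lambda>n. 2*int k*n + int r))"
 have "(f has_sum (\<Sum>r<2*k. s r)) (\<Union>r\<in>{..<2*k}. B r)" proof (rule sum_has_sum)
  show "(f has_sum s r) (B r)" if "r \<in> {..<2*k}" for r
   unfolding B_def using s[of r] that k by (subst has_sum_reindex) (auto simp: inj_on_def o_def)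
  show "B r \<inter> B r' = {}" if "r \<in> {..<2*k}" "r' \<in> {..<2*k}" "r \<noteq> r'" for r r' proof -
   have "x mod (2*int k) = int r" if "x \<in> B r" "r < 2*k" for x r using that by (auto simp: B_def)
   note md = this
   show ?thesis proof (rule ccontr)
    assume "\<not> ?thesis"
    then obtain x where "x \<in> B r" "x \<in> B r'" by blast
    then have "int r = int r'" using md[of x r] md[of x r'] that by simp
    then show False using that by simp
   qed
  qed
 qed simp
 moreover have "(\<Union>r\<in>{..<2*k}. B r) = UNIV" proof -
  have "n \<in> (\<Union>r\<in>{..<2*k}. B r)" for n proof
   define r where "r = nat (n mod (2*int k))"
   have "n mod (2*int k) \<ge> 0" "n mod (2*int k) < 2*int k" using k by auto
   then have r: "int r = n mod (2*int k)" by (simp add: r_def)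
   then show "r \<in> {..<2*k}" using \<open>n mod (2*int k) < 2*int k\<close> by simp
   have "n = 2*int k*(n div (2*int k)) + int r" unfolding r by simp
   then show "n \<in> B r" unfolding B_def by blast
  qed
  then show ?thesis by auto
 qed
 ultimately show ?thesis by simp
qed

text \<open>Serves to replace the indices \<open>l\<close> and \<open>-l\<close> by residues modulo
  \<open>2k\<close>, where \<open>-l\<close> is represented by \<open>2k - l\<close>; the two fixed
  residues 0 and \<open>k\<close> have to contribute nothing.\<close>

lemma sum_pairs:
 fixes f :: "nat => 'a::comm_monoid_add"
 assumes k: "k \<ge> 1" and f: "f 0 = 0" "f k = 0" shows "(\<Sum>l\<in>{1..<k}. f l + f (2*k - l)) = (\<Sum>r<2*k. f r)" proof -
 have "(\<Sum>r<2*k. f r) = sum f {0..<k} + sum f {k..<2*k}" unfolding lessThan_atLeast0 by (rule sum.atLeastLessThan_concat[symmetric]) auto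
 also have "sum f {0..<k} = f 0 + sum f {Suc 0..<k}" using k by (intro sum.atLeast_Suc_lessThan) simp
 also have "sum f {k..<2*k} = f k + sum f {Suc k..<2*k}" using k by (intro sum.atLeast_Suc_lessThan) simp
 also have "sum f {Suc k..<2*k} = (\<Sum>l\<in>{1..<k}. f (2*k - l))"
  by (rule sum.reindex_bij_witness[of _ "\<lambda>l. 2*k - l" "\<lambda>l. 2*k - l"]) auto
 finally show ?thesis using f by (simp add: sum.distrib)
qed

context half_form_setup
begin

text \<open>The theta section of the residue class of \<open>l\<close> modulo \<open>2k\<close>. Up
  to the factor \<open>(k/2pi)^(1/4)\<close>, a phase close to 1 and the vector \<open>Om\<close> it
  is the basis section of index \<open>l\<close>.\<close>

definition gsec :: "nat => int => plane => complex" where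
 "gsec k l x = exp (mtpi * of_nat k * of_real (fst x) * of_real (snd x)) *
   (\<Sum>\<^sub>\<infinity>n. primal modulus k (snd x) (2*int k*n + l) (of_real (fst x)))"

lemma lat_multiple: "k \<ge> 1 ==> lat k q (2*int k*n) = of_real q + of_int n" unfolding lat_def by (simp add: field_simps)

lemma gsec_0_term:
 assumes "k \<ge> 1" shows "exp (mtpi * of_nat k * of_real (fst x) * of_real (snd x))*primal modulus k (snd x) (2*int k*n) (of_real (fst x))
  = exp (tpi * of_nat k * of_real (snd x)*coord x)*exp (tpi * of_nat k*modulus*(of_int n)^2 + 4 * of_real pi*\<i> * of_nat k*coord x * of_int n)"
 unfolding primal_def lat_multiple[OF assms] exp_add[symmetric] coord_eq by (rule arg_cong[where f=exp]) (simp add: algebra_simps power2_eq_square)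

lemma gsec_0_eq:
 assumes "k \<ge> 1" shows "gsec k 0 x = exp ((tpi * of_nat k * of_real (snd x))*coord x)*theta0 modulus k (coord x)"
 unfolding gsec_def theta0_def infsum_cmult_right'[symmetric] using gsec_0_term[OF assms, of x] by simp

text \<open>Translation by \<open>r\<close> shifts the summation index by the integer
  \<open>snd r\<close>; what remains is the phase of the lattice action, up to an integer multiple
  of \<open>2 pi i\<close>.\<close>

lemma gsec_0_section:
 assumes k: "k \<ge> 1" and r: "r \<in> lattice" shows "gsec k 0 (r + y) = cis (real k * omega r y/2) * gsec k 0 y" proof -
 obtain m n' where r: "fst r = real_of_int m" "snd r = real_of_int n'" using r by (auto simp: lattice_def Ints_def)
 have bij: "bij_betw (\<lambda>n. n + n') UNIV (UNIV::int set)" by (rule bij_betwI[where g="\<lambda>n. n - n'"]) auto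
 have t: "exp (mtpi * of_nat k * of_real (fst (r + y)) * of_real (snd (r + y)))*primal modulus k (snd (r + y)) (2*int k*n) (of_real (fst (r + y)))
  = cis (real k * omega r y/2)*(exp (mtpi * of_nat k * of_real (fst y) * of_real (snd y))*primal modulus k (snd y) (2*int k*(n + n')) (of_real (fst y)))" for n
 proof -
  have "exp (tpi * of_int (int k*m*n' + 2*int k*m*n)) = (1 :: complex)" by (subst exp_eq_1) (auto intro!: exI[of _ "int k*m*n' + 2*int k*m*n"])
  then have "cis (real k * omega r y/2)*(exp (mtpi * of_nat k * of_real (fst y) * of_real (snd y))*primal modulus k (snd y) (2*int k*(n + n')) (of_real (fst y)))
   = exp (tpi * of_int (int k*m*n' + 2*int k*m*n))*(cis (real k * omega r y/2)*(exp (mtpi * of_nat k * of_real (fst y) * of_real (snd y))*primal modulus k (snd y) (2*int k*(n + n')) (of_real (fst y))))"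
   by simp
  also have "... = exp (mtpi * of_nat k * of_real (fst (r + y)) * of_real (snd (r + y)))*primal modulus k (snd (r + y)) (2*int k*n) (of_real (fst (r + y)))"
  proof -
   have om: "real k * omega r y/2 = 2*pi*real k*(fst r * snd y - snd r * fst y)" by (simp add: omega_def)
   show ?thesis unfolding primal_def lat_multiple[OF k] cis_conv_exp exp_add[symmetric] om
    by (rule arg_cong[where f=exp]) (simp add: r algebra_simps power2_eq_square)
  qed
  finally show ?thesis ..
 qed
 have "gsec k 0 (r + y) = (\<Sum>\<^sub>\<infinity>n. cis (real k * omega r y/2)*(exp (mtpi * of_nat k * of_real (fst y) * of_real (snd y))*primal modulus k (snd y) (2*int k*(n + n')) (of_real (fst y))))"
  unfolding gsec_def infsum_cmult_right'[symmetric] add_0_right t ..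
 also have "... = cis (real k * omega r y/2)*(exp (mtpi * of_nat k * of_real (fst y) * of_real (snd y))*(\<Sum>\<^sub>\<infinity>n. (\<lambda>n. primal modulus k (snd y) (2*int k*n) (of_real (fst y))) (n + n')))"
  by (simp only: infsum_cmult_right')
 also have "(\<Sum>\<^sub>\<infinity>n. (\<lambda>n. primal modulus k (snd y) (2*int k*n) (of_real (fst y))) (n + n')) = (\<Sum>\<^sub>\<infinity>n. primal modulus k (snd y) (2*int k*n) (of_real (fst y)))"
  by (rule infsum_reindex_bij_betw[OF bij])
 finally show ?thesis unfolding gsec_def by simp
qed

lemma gsec_0_quantum_space:
 assumes k: "k \<ge> 1" shows "(\<lambda>x. sc (gsec k 0 x) u) \<in> quantum_space j sc k" unfolding gsec_0_eq[OF k]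
 by (rule quantum_spaceI[OF polarized_mu theta0_series(1)[OF modulus_pos k]])
  (use gsec_0_section[OF k] in \<open>simp add: gsec_0_eq[OF k]\<close>)

lemma gsec_0_continuous:
 assumes k: "k \<ge> 1" shows "continuous_on S (gsec k 0)" proof -
 have c: "continuous_on S coord" for S by (rule linear_continuous_on[OF bounded_linear_coord])
 have "continuous_on S (\<lambda>x. theta0 modulus k (coord x))"
  by (rule continuous_on_compose2[OF holomorphic_on_imp_continuous_on[OF theta0_series(1)[OF modulus_pos k]] c]) simp
 then show ?thesis unfolding gsec_0_eq[OF k, abs_def] by (intro continuous_intros c)
qed

lemma gsec_0_pull_back:
 assumes k: "k \<ge> 1" shows "cis (- (real k * omega ((1/(2*real k)) *\<^sub>R mu) y/2)) * gsec k 0 ((1/(2*real k)) *\<^sub>R mu + y) = gsec k 0 y"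
proof -
 have k0: "(of_nat k :: complex) \<noteq> 0" using k by simp
 have "cis (- (real k * omega ((1/(2*real k)) *\<^sub>R mu) y/2))*(exp (mtpi * of_nat k * of_real (fst ((1/(2*real k)) *\<^sub>R mu + y)) * of_real (snd ((1/(2*real k)) *\<^sub>R mu + y)))*primal modulus k (snd ((1/(2*real k)) *\<^sub>R mu + y)) (2*int k*n) (of_real (fst ((1/(2*real k)) *\<^sub>R mu + y))))
  = exp (mtpi * of_nat k * of_real (fst y) * of_real (snd y))*primal modulus k (snd y) (2*int k*n) (of_real (fst y))" for n proof -
  have "exp (tpi * of_int n) = (1 :: complex)" by (subst exp_eq_1) (auto intro!: exI[of _ n])
  then have "exp (mtpi * of_nat k * of_real (fst y) * of_real (snd y))*primal modulus k (snd y) (2*int k*n) (of_real (fst y))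
   = exp (tpi * of_int n)*(exp (mtpi * of_nat k * of_real (fst y) * of_real (snd y))*primal modulus k (snd y) (2*int k*n) (of_real (fst y)))"
   by simp
  also have "... = cis (- (real k * omega ((1/(2*real k)) *\<^sub>R mu) y/2))*(exp (mtpi * of_nat k * of_real (fst ((1/(2*real k)) *\<^sub>R mu + y)) * of_real (snd ((1/(2*real k)) *\<^sub>R mu + y)))*primal modulus k (snd ((1/(2*real k)) *\<^sub>R mu + y)) (2*int k*n) (of_real (fst ((1/(2*real k)) *\<^sub>R mu + y))))"
   unfolding primal_def lat_multiple[OF k] cis_conv_exp exp_add[symmetric] omega_def
   by (rule arg_cong[where f=exp]) (use k0 in \<open>simp add: mu_def field_simps power2_eq_square\<close>)
  finally show ?thesis ..
 qed
 then show ?thesis unfolding gsec_def infsum_cmult_right'[symmetric] by simp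
qed

text \<open>Translation by \<open>lam/2k\<close> moves the sampling points by one step
  \<open>1/(2k)\<close>, hence the residue class by one.\<close>

lemma gsec_Suc:
 assumes k: "k \<ge> 1"
 shows "cis (- (real k * omega ((1/(2*real k)) *\<^sub>R lam) y/2)) * gsec k l ((1/(2*real k)) *\<^sub>R lam + y) = gsec k (l + 1) y" proof -
 have k0: "(of_nat k :: complex) \<noteq> 0" using k by simp
 have l: "lat k (q + 1/(2*real k)) m = lat k q (m + 1)" for q m unfolding lat_def by (simp add: add_divide_distrib)
 have "cis (- (real k * omega ((1/(2*real k)) *\<^sub>R lam) y/2))*exp (mtpi * of_nat k * of_real (fst y) * of_real (snd y + 1/(2*real k)))
  = exp (mtpi * of_nat k * of_real (fst y) * of_real (snd y))" unfolding cis_conv_exp exp_add[symmetric] omega_def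
  by (rule arg_cong[where f=exp]) (use k0 in \<open>simp add: lam_def field_simps\<close>)
 moreover have "primal modulus k (snd y + 1/(2*real k)) (2*int k*n + l) P = primal modulus k (snd y) (2*int k*n + (l + 1)) P" for n P
  unfolding primal_def l by (simp add: add.assoc)
 ultimately show ?thesis unfolding gsec_def by (simp add: lam_def mult.assoc[symmetric] add.commute[of _ "snd y"])
qed

text \<open>The integral over \<open>p\<close> is Parseval's identity; the remaining integral over
  \<open>q\<close> of a sum over integer translates unfolds to a Gaussian integral over the
  line.\<close>

lemma gsec_norm_integral:
 assumes k: "k \<ge> 1"
 shows "integral (cbox (0, 0) (1, 1)) (\<lambda>x. complex_of_real ((norm (gsec k 0 x))^2)) = of_real (1/sqrt (4*real k*Im modulus))" proof -
 define A where "A = 4*pi*real k*Im modulus"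
 have A: "A > 0" using modulus_pos k by (simp add: A_def)
 define a where "a = (\<lambda>(q::real) (n::int). exp (tpi * of_nat k*modulus*(of_real q + of_int n)^2))"
 have na: "(norm (a q n))^2 = exp (- A*(q + real_of_int n)^2)" for q n proof -
  have "tpi * of_nat k*modulus*(of_real q + of_int n)^2 = of_real (2*pi*real k*(q + real_of_int n)^2)*(\<i>*modulus)" by simp
  then have "norm (a q n) = exp (- (2*pi*real k*(q + real_of_int n)^2*Im modulus))" unfolding a_def norm_exp_eq_Re by simp
  then show ?thesis by (simp add: A_def exp_double[symmetric])
 qed
 have c: "continuous_on (cbox (0, 0) (1, 1)) (\<lambda>(p, q). complex_of_real ((norm (gsec k 0 (p, q)))^2))"
  unfolding split_beta by (auto intro!: continuous_intros gsec_0_continuous[OF k])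
 have inner: "integral (cbox 0 1) (\<lambda>p. complex_of_real ((norm (gsec k 0 (p, q)))^2)) = (\<Sum>\<^sub>\<infinity>n. complex_of_real (exp (- A*(q + real_of_int n)^2)))" for q
 proof -
  have g: "gsec k 0 (p, q) = exp (tpi * of_nat k * of_real p * of_real q)*(\<Sum>\<^sub>\<infinity>n. a q n*exp (tpi * of_int (2*int k*n) * of_real p))" for p
   unfolding gsec_def infsum_cmult_right'[symmetric] fst_conv snd_conv add_0_right primal_def lat_multiple[OF k] a_def exp_add[symmetric]
   by (intro infsum_cong arg_cong[where f=exp]) (simp add: algebra_simps power2_eq_square)
  have ng: "norm (gsec k 0 (p, q)) = norm (\<Sum>\<^sub>\<infinity>n. a q n*exp (tpi * of_int (2*int k*n) * of_real p))" for p
   unfolding g norm_mult by (simp add: norm_exp_eq_Re)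
  have "(\<lambda>n. norm (a q n)) summable_on UNIV" proof -
   have "summable_on_bound": "norm (a q n) = norm (exp (- (complex_of_real (A/2))*(of_int n + of_real q)^2))" for n proof -
    have "(norm (a q n))^2 = (norm (exp (- (complex_of_real (A/2))*(of_int n + of_real q)^2)))^2" proof -
     have "- (complex_of_real (A/2))*(of_int n + of_real q)^2 = of_real (- (A/2)*(q + real_of_int n)^2)" by (simp add: add.commute)
     then have "norm (exp (- (complex_of_real (A/2))*(of_int n + of_real q)^2)) = exp (- (A/2)*(q + real_of_int n)^2)"
      unfolding norm_exp_eq_Re by (simp only: Re_complex_of_real)
     then show ?thesis unfolding na by (simp add: exp_double[symmetric] add.commute)
    qed
    then show ?thesis by (rule power2_eq_imp_eq) auto
   qed
   have RA: "Re (complex_of_real (A/2)) > 0" using A by simp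
   show ?thesis unfolding summable_on_bound by (rule Infinite_Sum.abs_summable_on_comparison_test'[OF _ norm_exp_shifted_le[OF RA order_refl]])
     (intro summable_on_cmult_right summable_on_gaussian RA)
  qed
  from integral_unique[OF parseval_lattice[OF this order_refl, of "2*int k"]]
  show ?thesis unfolding ng na[symmetric] using k by simp
 qed
 have "integral (cbox (0, 0) (1, 1)) (\<lambda>x. complex_of_real ((norm (gsec k 0 x))^2)) = integral (cbox 0 1) (\<lambda>p. integral (cbox 0 1) (\<lambda>q. complex_of_real ((norm (gsec k 0 (p, q)))^2)))"
  using integral_prod_continuous[of 0 0 1 1 "\<lambda>x. complex_of_real ((norm (gsec k 0 x))^2)"] c by (simp add: split_beta)
 also have "... = integral (cbox 0 1) (\<lambda>q. integral (cbox 0 1) (\<lambda>p. complex_of_real ((norm (gsec k 0 (p, q)))^2)))"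
  by (rule integral_swap_continuous[OF c])
 also have "... = of_real (1/sqrt (A/pi))" unfolding inner using gaussian_periodization_integral[OF A] by simp
 also have "A/pi = 4*real k*Im modulus" by (simp add: A_def)
 finally show ?thesis .
qed

end

section \<open>Verlinde numbers\<close>

text \<open>Extension of the Verlinde numbers to all integers, odd and \<open>2k\<close>-periodic in
  \<open>n\<close>; with it the state becomes one theta series over the integers.\<close>

definition verlinde :: "nat => nat => int => real" where
 "verlinde g k n = (\<Sum>m\<in>{1..<k}. S_coeff k m 1 powi (1 - 2*int g)*(sqrt (2/real k) * sin (pi*real m * of_int n/real k)))"

lemma verlinde_nat: "verlinde g k (int l) = N_coeff g k l" by (simp add: verlinde_def N_coeff_def S_coeff_def)

lemma verlinde_minus: "verlinde g k (- n) = - verlinde g k n" by (simp add: verlinde_def sum_negf)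

lemma verlinde_0: "verlinde g k 0 = 0" by (simp add: verlinde_def)

lemma sin_add_int_multiple:
 assumes "k \<ge> 1" shows "sin (pi*real m*(of_int n + 2*real k * of_int t)/real k) = sin (pi*real m * of_int n/real k)" proof -
 have "pi*real m*(of_int n + 2*real k * of_int t)/real k = pi*real m * of_int n/real k + 2*pi * of_int (int m*t)"
  using assms by (simp add: field_simps)
 then show ?thesis using sin.plus_of_int[of "pi*real m * of_int n/real k" "int m*t"] by (simp add: mult_ac)
qed

lemma verlinde_period:
 assumes "k \<ge> 1" shows "verlinde g k (n + 2*int k*t) = verlinde g k n" unfolding verlinde_def using sin_add_int_multiple[OF assms] by simp

lemma verlinde_k: "verlinde g k (int k) = 0" proof (cases "k = 0")
 case False
 then have "sin (pi*real m * of_int (int k)/real k) = 0" for m using sin_npi[of m] by (simp add: mult.commute)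
 then show ?thesis unfolding verlinde_def by simp
qed (simp add: verlinde_def)


lemma verlinde_bound_sin:
 assumes k: "k \<ge> 2" and m: "1 \<le> m" "m \<le> k - 1" shows "sin (pi*real m/real k) \<ge> 1/real k" proof -
 \<comment> \<open>Apart from \<open>k = 2\<close>, the interval \<open>[0, pi/k]\<close> lies in
   \<open>[0, pi/3]\<close>, where the sine has slope at least 1/2.\<close>
 have base: "sin (pi/real k) \<ge> 1/real k" proof (cases "k = 2")
  case False
  then have k3: "real k \<ge> 3" using k by simp
  define x where "x = pi/real k"
  have "x \<le> pi/3" unfolding x_def by (rule divide_left_mono) (use k3 in simp_all)
  then have x: "x \<le> pi/3" "0 < x" using k3 by (simp_all add: x_def)
  have "\<exists>z. 0 < z \<and> z < x \<and> sin x - sin 0 = (x - 0) * cos z"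
   by (rule MVT2[of 0 x sin cos]) (use x in \<open>auto intro!: derivative_eq_intros\<close>)
  then obtain z where z: "0 < z" "z < x" "sin x = x * cos z" by auto
  have "cos (pi/3) \<le> cos z" using z x by (intro cos_monotone_0_pi_le) auto
  then have "1/2 \<le> cos z" by (simp add: cos_60)
  then have "x*(1/2) \<le> x * cos z" using x by (intro mult_left_mono) auto
  moreover have "1/real k \<le> x*(1/2)" using k3 pi_ge_two by (simp add: x_def field_simps)
  ultimately show ?thesis using z unfolding x_def by simp
 qed simp
 have sm: "sin (pi/real k) \<le> sin y" if "pi/real k \<le> y" "y \<le> pi/2" for y
  by (rule sin_monotone_2pi_le) (use that k in \<open>auto intro!: order_trans[OF _ divide_nonneg_nonneg]\<close>)
 have km: "real m \<le> real k - 1" using m k by linarith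
 show ?thesis proof (cases "real m \<le> real k/2")
  case True
  have "pi/real k \<le> pi*real m/real k" using m k by (simp add: divide_right_mono)
  moreover have "pi*real m/real k \<le> pi/2" using True k by (simp add: field_simps)
  ultimately show ?thesis using sm[of "pi*real m/real k"] base by linarith
 next
  case False
  define y where "y = pi - pi*real m/real k"
  have yk: "y = pi*(real k - real m)/real k" using k by (simp add: y_def field_simps)
  have "pi*1/real k \<le> y" unfolding yk using km k by (intro divide_right_mono mult_left_mono) auto
  moreover have "y \<le> pi/2" unfolding yk using False k by (simp add: field_simps)
  moreover have "sin y = sin (pi*real m/real k)" by (simp add: y_def)
  ultimately show ?thesis using sm[of y] base by simp
 qed
qed

text \<open>Up to a constant, the discrete Fourier transform of \<open>verlinde\<close>. The value 0
  stands in place of a pole, and matches the fact that the Verlinde sum omits the multiples of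
  \<open>k\<close>.\<close>

definition sine_weight :: "nat => nat => int => complex" where
 "sine_weight g k n = (if int k dvd n then 0 else of_real (sin (pi * of_int n/real k) powi (1 - 2*int g)))"

lemma abs_sin_ge:
 assumes k: "k \<ge> 1" and n: "\<not> int k dvd n" shows "\<bar>sin (pi * of_int n/real k)\<bar> \<ge> 1/real k" proof -
 define m where "m = nat (n mod int k)"
 have "n mod int k \<noteq> 0" using n by (simp add: dvd_eq_mod_eq_0)
 moreover have "0 \<le> n mod int k" "n mod int k < int k" using k by auto
 ultimately have m: "int m = n mod int k" "1 \<le> m" "m \<le> k - 1" "k \<ge> 2" by (auto simp: m_def)
 have "n = int m + (n div int k)*int k" unfolding m by simp
 then have "real_of_int n = real m + of_int (n div int k)*real k" by (metis of_int_add of_int_mult of_int_of_nat_eq)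
 then have "pi * of_int n/real k = pi*real m/real k + pi * of_int (n div int k)" using k by (simp add: field_simps)
 then have "\<bar>sin (pi * of_int n/real k)\<bar> = \<bar>sin (pi*real m/real k) * cos (pi * of_int (n div int k))\<bar>"
  by (simp add: sin_add mult.commute)
 also have "... = \<bar>sin (pi*real m/real k)\<bar>" proof -
  have "sin (pi*real_of_int (n div int k)) = 0" by (simp add: mult.commute)
  then have "\<bar>cos (pi*real_of_int (n div int k))\<bar> = 1" using sin_zero_abs_cos_one by blast
  then show ?thesis by (simp add: abs_mult)
 qed
 finally show ?thesis using verlinde_bound_sin[OF m(4) m(2) m(3)] by linarith
qed

lemma sine_weight_bound:
 assumes k: "k \<ge> 1" shows "norm (sine_weight g k n) \<le> real k^(2 * g)" proof (cases "int k dvd n")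
 case False
 define s where "s = \<bar>sin (pi * of_int n/real k)\<bar>"
 have s: "1/real k \<le> s" unfolding s_def by (rule abs_sin_ge[OF k False])
 have s1: "s \<le> 1" by (simp add: s_def)
 have k1: "real k \<ge> 1" using k by simp
 then have s0: "s > 0" using s by (smt (verit) divide_pos_pos)
 have "norm (sine_weight g k n) = s powi (1 - 2*int g)" using False by (simp add: sine_weight_def s_def norm_power_int)
 also have "... = s * inverse s^(2 * g)" proof -
  have "s powi (1 - 2*int g) = s powi 1 * s powi (- int (2 * g))" using s0 by (subst power_int_add[symmetric]) auto
  then show ?thesis by (simp only: power_int_minus power_int_of_nat power_inverse power_int_1_right)
 qed
 also have "... \<le> 1*real k^(2 * g)" proof (intro mult_mono power_mono s1)
  show "inverse s \<le> real k" using s s0 k1 by (simp add: field_simps)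
 qed (use s0 in auto)
 finally show ?thesis by simp
qed (simp add: sine_weight_def)

text \<open>The sine is a difference of two exponentials; the negative frequency \<open>-m\<close>
  is moved to \<open>2k - m\<close>, where the odd weight changes sign. This fills out the residues
  modulo \<open>2k\<close>, with weight 0 at 0 and \<open>k\<close>. The prefactor collects the
  powers of \<open>sqrt(2/k)\<close> in the two \<open>S\<close> coefficients.\<close>

lemma verlinde_fourier:
 assumes k: "k \<ge> 1" shows "complex_of_real (verlinde g k n) = of_real (sqrt (2/real k) powi (2 - 2*int g))/(2*\<i>) *
  (\<Sum>r<2*k. sine_weight g k (int r)*exp (\<i> * of_real pi * of_nat r * of_int n/of_nat k))" proof -
 define E where "E = sqrt (2/real k) powi (2 - 2*int g)"
 have q0: "sqrt (2/real k) \<noteq> 0" using k by simp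
 define f where "f = (\<lambda>r::nat. sine_weight g k (int r)*exp (\<i> * of_real pi * of_nat r * of_int n/of_nat k))"
 have k0: "(of_nat k :: complex) \<noteq> 0" using k by simp
 have "complex_of_real (S_coeff k m 1 powi (1 - 2*int g)*(sqrt (2/real k) * sin (pi*real m * of_int n/real k)))
   = of_real E/(2*\<i>)*(f m + f (2*k - m))" if m: "m \<in> {1..<k}" for m proof -
  have nd: "\<not> int k dvd int m" using m by (auto dest!: dvd_imp_le simp: int_dvd_int_iff)
  have nd': "\<not> int k dvd int (2*k - m)" proof
   assume "int k dvd int (2*k - m)"
   moreover have "int (2*k - m) = 2*int k - int m" using m by (simp add: of_nat_diff)
   ultimately have "int k dvd 2*int k - int m" by metis
   then have "int k dvd int m" by (metis dvd_diff_commute dvd_minus_iff dvd_triv_right dvd_diff_left_iff)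
   then show False using nd by simp
  qed
  have i: "real_of_int (int (2*k - m)) = 2*real k - real m" using m by (simp add: of_nat_diff)
  have "pi*real_of_int (int (2*k - m))/real k = 2*pi - pi*real m/real k" unfolding i using k by (simp add: field_simps)
  then have "sin (pi*real_of_int (int (2*k - m))/real k) = - sin (pi*real m/real k)" by simp
  then have w': "sine_weight g k (int (2*k - m)) = - sine_weight g k (int m)" using nd nd' by (simp add: sine_weight_def power_int_minus_left)
  have e': "exp (\<i> * of_real pi * of_nat (2*k - m) * of_int n/of_nat k) = exp (- (\<i> * of_real pi * of_nat m * of_int n/of_nat k))" proof -
   have "exp (tpi * of_int n) = (1 :: complex)" by (subst exp_eq_1) (auto intro!: exI[of _ n])
   moreover have "\<i> * of_real pi * of_nat (2*k - m) * of_int n/of_nat k = tpi * of_int n + - (\<i> * of_real pi * of_nat m * of_int n/of_nat k)"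
    using m k0 by (simp add: of_nat_diff field_simps)
   ultimately show ?thesis by (simp only: exp_add mult_1)
  qed
  have s: "complex_of_real (sin (pi*real m * of_int n/real k)) = (exp (\<i> * of_real pi * of_nat m * of_int n/of_nat k) - exp (- (\<i> * of_real pi * of_nat m * of_int n/of_nat k)))/(2*\<i>)"
   unfolding sin_of_real[symmetric] sin_exp_eq by (simp add: mult_ac)
  have p: "S_coeff k m 1 powi (1 - 2*int g) * sqrt (2/real k) = E * sin (pi*real m/real k) powi (1 - 2*int g)" proof -
   have "S_coeff k m 1 powi (1 - 2*int g) = sqrt (2/real k) powi (1 - 2*int g) * sin (pi*real m/real k) powi (1 - 2*int g)"
    by (simp add: S_coeff_def power_int_mult_distrib)
   moreover have "sqrt (2/real k) powi (1 - 2*int g) * sqrt (2/real k) = E" proof -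
    have "sqrt (2/real k) powi (1 - 2*int g + 1) = sqrt (2/real k) powi (1 - 2*int g) * sqrt (2/real k) powi 1"
     by (rule power_int_add) (use q0 in simp)
    then show ?thesis by (simp add: E_def)
   qed
   ultimately show ?thesis by (simp add: mult_ac)
  qed
  have w: "sine_weight g k (int m) = of_real (sin (pi*real m/real k) powi (1 - 2*int g))" using nd by (simp add: sine_weight_def)
  have "complex_of_real (S_coeff k m 1 powi (1 - 2*int g)*(sqrt (2/real k) * sin (pi*real m * of_int n/real k)))
   = of_real (S_coeff k m 1 powi (1 - 2*int g) * sqrt (2/real k)) * of_real (sin (pi*real m * of_int n/real k))" by simp
  also have "... = of_real E * sine_weight g k (int m)*((exp (\<i> * of_real pi * of_nat m * of_int n/of_nat k) - exp (- (\<i> * of_real pi * of_nat m * of_int n/of_nat k)))/(2*\<i>))"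
   unfolding p s w by simp
  also have "... = of_real E/(2*\<i>)*(f m + f (2*k - m))" unfolding f_def w' e' by (simp add: field_simps)
  finally show ?thesis .
 qed
 then have "complex_of_real (verlinde g k n) = (\<Sum>m\<in>{1..<k}. of_real E/(2*\<i>)*(f m + f (2*k - m)))"
  unfolding verlinde_def of_real_sum by (intro sum.cong refl)
 also have "... = of_real E/(2*\<i>)*(\<Sum>r<2*k. f r)"
  unfolding sum_distrib_left[symmetric] by (subst sum_pairs[OF k]) (auto simp: f_def sine_weight_def)
 finally show ?thesis unfolding E_def f_def .
qed

lemma sqrt_powi_bound:
 assumes k: "k \<ge> 1" and g: "g \<ge> 1" shows "sqrt (2/real k) powi (2 - 2*int g) = (real k/2)^(g - 1)" proof -
 have "2 - 2*int g = - int (2*(g - 1))" using g by (simp add: of_nat_diff)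
 then have "sqrt (2/real k) powi (2 - 2*int g) = inverse (sqrt (2/real k)^(2*(g - 1)))" by (simp only: power_int_minus power_int_of_nat)
 also have "sqrt (2/real k)^(2*(g - 1)) = (2/real k)^(g - 1)" by (simp add: power_mult)
 finally show ?thesis by (simp add: power_divide)
qed

lemma verlinde_bound:
 assumes k: "k \<ge> 1" and g: "g \<ge> 1" shows "\<bar>verlinde g k n\<bar> \<le> real k^(3 * g)" proof -
 have k1: "real k \<ge> 1" using k by simp
 have E: "sqrt (2/real k) powi (2 - 2*int g) \<le> real k^(g - 1)" "0 \<le> sqrt (2/real k) powi (2 - 2*int g)"
  unfolding sqrt_powi_bound[OF k g] using k1 by (auto intro!: power_mono)
 have "norm (\<Sum>r<2*k. sine_weight g k (int r)*exp (\<i> * of_real pi * of_nat r * of_int n/of_nat k)) \<le> (\<Sum>r<2*k. real k^(2 * g))"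
 proof (rule sum_norm_le)
  fix r
  have "\<i> * of_real pi * of_nat r * of_int n/of_nat k = \<i> * complex_of_real (pi*real r * of_int n/real k)" by simp
  then have "norm (exp (\<i> * of_real pi * of_nat r * of_int n/of_nat k)) = 1" by (simp only: norm_exp_i_times)
  then show "norm (sine_weight g k (int r)*exp (\<i> * of_real pi * of_nat r * of_int n/of_nat k)) \<le> real k^(2 * g)"
   unfolding norm_mult using sine_weight_bound[OF k] by simp
 qed
 also have "... = 2*real k^(2 * g + 1)" by simp
 finally have S: "norm (\<Sum>r<2*k. sine_weight g k (int r)*exp (\<i> * of_real pi * of_nat r * of_int n/of_nat k)) \<le> 2*real k^(2 * g + 1)" .
 have "\<bar>verlinde g k n\<bar> = norm (complex_of_real (verlinde g k n))" by simp
 also have "... = sqrt (2/real k) powi (2 - 2*int g)/2*norm (\<Sum>r<2*k. sine_weight g k (int r)*exp (\<i> * of_real pi * of_nat r * of_int n/of_nat k))"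
  unfolding verlinde_fourier[OF k] norm_mult norm_divide using E(2) by (simp add: norm_power_int)
 also have "... \<le> real k^(g - 1)/2*(2*real k^(2 * g + 1))" using E by (intro mult_mono S divide_right_mono) auto
 also have "... = real k^(g - 1 + (2 * g + 1))" by (simp add: power_add)
 also have "g - 1 + (2 * g + 1) = 3 * g" using g by simp
 finally show ?thesis .
qed

section \<open>Verlinde numbers at odd arguments as polynomials over a whole period\<close>

definition fdiff :: "(nat => real) => nat => real" where
 "fdiff f i = f (Suc i) - f i"

lemma newton_forward: "f n = (\<Sum>j\<le>n. real (n choose j)*(fdiff ^^ j) f 0)" proof (induction n arbitrary: f)
 case 0
 show ?case by simp
next
 case (Suc n)
 have ext: "g n = (\<Sum>j\<le>Suc n. real (n choose j)*(fdiff ^^ j) g 0)" for g using Suc.IH[of g] by simp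
 have "f (Suc n) = f n + fdiff f n" by (simp add: fdiff_def)
 also have "fdiff f n = (\<Sum>j\<le>n. real (n choose j)*(fdiff ^^ Suc j) f 0)" unfolding Suc.IH[of "fdiff f"] by (simp add: funpow_swap1)
 also have "f n = f 0 + (\<Sum>j\<le>n. real (n choose Suc j)*(fdiff ^^ Suc j) f 0)" unfolding ext[of f] by (subst sum.atMost_Suc_shift) simp
 also have "f 0 + (\<Sum>j\<le>n. real (n choose Suc j)*(fdiff ^^ Suc j) f 0) + (\<Sum>j\<le>n. real (n choose j)*(fdiff ^^ Suc j) f 0)
  = f 0 + (\<Sum>j\<le>n. real (Suc n choose Suc j)*(fdiff ^^ Suc j) f 0)" by (simp add: sum.distrib distrib_right)
 also have "... = (\<Sum>j\<le>Suc n. real (Suc n choose j)*(fdiff ^^ j) f 0)" unfolding sum.atMost_Suc_shift by simp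
 finally show ?case .
qed

lemma fdiff_vanish: "(\<And>i. i \<le> d ==> f i = 0) ==> (fdiff ^^ d) f 0 = 0" proof (induction d arbitrary: f)
 case (Suc d)
 have "(fdiff ^^ d) (fdiff f) 0 = 0" by (rule Suc.IH) (simp add: fdiff_def Suc.prems)
 then show ?case by (simp add: funpow_swap1)
qed simp

lemma fdiff_scale: "(fdiff ^^ d) (\<lambda>i. c * f i) = (\<lambda>i. c*(fdiff ^^ d) f i)"
 by (induction d) (auto simp: fdiff_def fun_eq_iff algebra_simps)

lemma fdiff_shift: "(fdiff ^^ d) (\<lambda>i. f (i + a)) = (\<lambda>i. (fdiff ^^ d) f (i + a))" by (induction d) (auto simp: fdiff_def fun_eq_iff)

text \<open>A centred difference of step 2 multiplies the summand of index \<open>m\<close> by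
  \<open>-4 sin(pi m/k)^2\<close>. This is \<open>-2k\<close> times the square of
  \<open>S_coeff k m 1\<close>, so the genus drops by one.\<close>

lemma verlinde_second_difference:
 assumes k: "k \<ge> 1" shows "verlinde (Suc g) k (n + 2) - 2 * verlinde (Suc g) k n + verlinde (Suc g) k (n - 2) = - 2*real k * verlinde g k n"
proof -
 have "S_coeff k m 1 powi (1 - 2*int (Suc g))*(sqrt (2/real k) * sin (pi*real m * of_int (n + 2)/real k))
   - 2*(S_coeff k m 1 powi (1 - 2*int (Suc g))*(sqrt (2/real k) * sin (pi*real m * of_int n/real k)))
   + S_coeff k m 1 powi (1 - 2*int (Suc g))*(sqrt (2/real k) * sin (pi*real m * of_int (n - 2)/real k))
  = - 2*real k*(S_coeff k m 1 powi (1 - 2*int g)*(sqrt (2/real k) * sin (pi*real m * of_int n/real k)))"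
  if m: "m \<in> {1..<k}" for m proof -
  define x where "x = pi*real m/real k"
  define y where "y = pi*real m * of_int n/real k"
  have a1: "pi*real m * of_int (n + 2)/real k = y + 2*x" "pi*real m * of_int (n - 2)/real k = y - 2*x"
   by (simp_all add: x_def y_def algebra_simps add_divide_distrib diff_divide_distrib)
  have "sin x > 0" unfolding x_def using m by (intro sin_gt_zero) (auto simp: field_simps)
  then have S0: "S_coeff k m 1 \<noteq> 0" using k by (simp add: S_coeff_def x_def)
  have S2: "(S_coeff k m 1)^2 = 2/real k*(sin x)^2" using k by (simp add: S_coeff_def x_def power_mult_distrib)
  have trig: "sin (y + 2*x) - 2 * sin y + sin (y - 2*x) = - 2*real k*((S_coeff k m 1)^2 * sin y)" proof -
   have "sin (y + 2*x) + sin (y - 2*x) = 2 * sin y * cos (2*x)" by (simp add: sin_add sin_diff)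
   then have "sin (y + 2*x) + sin (y - 2*x) = 2 * sin y*(1 - 2*(sin x)^2)" by (simp only: cos_double_sin)
   then have "sin (y + 2*x) - 2 * sin y + sin (y - 2*x) = - 4*(sin x)^2 * sin y" by (simp add: algebra_simps)
   then show ?thesis unfolding S2 using k by simp
  qed
  have pw: "S_coeff k m 1 powi (1 - 2*int g) = S_coeff k m 1 powi (1 - 2*int (Suc g))*(S_coeff k m 1)^2" proof -
   have "S_coeff k m 1 powi ((1 - 2*int (Suc g)) + 2) = S_coeff k m 1 powi (1 - 2*int (Suc g)) * S_coeff k m 1 powi 2"
    by (rule power_int_add) (use S0 in simp)
   then show ?thesis by (simp add: algebra_simps)
  qed
  have "S_coeff k m 1 powi (1 - 2*int (Suc g))*(sqrt (2/real k) * sin (y + 2*x))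
   - 2*(S_coeff k m 1 powi (1 - 2*int (Suc g))*(sqrt (2/real k) * sin y))
   + S_coeff k m 1 powi (1 - 2*int (Suc g))*(sqrt (2/real k) * sin (y - 2*x))
   = S_coeff k m 1 powi (1 - 2*int (Suc g)) * sqrt (2/real k)*(sin (y + 2*x) - 2 * sin y + sin (y - 2*x))" by (simp add: algebra_simps)
  then show ?thesis unfolding a1 y_def[symmetric] trig pw by (simp add: mult_ac)
 qed
 then show ?thesis unfolding verlinde_def sum_distrib_left sum.distrib[symmetric] sum_subtractf[symmetric] by (intro sum.cong refl)
qed

text \<open>In genus 0 the summand is a product of two sines, hence a difference of cosines with the
  consecutive frequencies \<open>b\<close> and \<open>b + 1\<close>, where
  \<open>n = 2b + 1\<close>. The bounds on \<open>n\<close> keep both strictly between 0 and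
  \<open>k\<close>, and then both cosine sums equal -1.\<close>

lemma verlinde_genus_0:
 assumes k: "k \<ge> 1" and n: "odd n" "3 \<le> n" "n \<le> 2*int k - 3" shows "verlinde 0 k n = 0" proof -
 have cs: "(\<Sum>m<k. cos (2*pi*real m * of_int a/real k)) = 0" if a: "0 < a" "a < int k" for a proof -
  define z where "z = cis (2*pi * of_int a/real k)"
  have "z^k = cis (real k*(2*pi * of_int a/real k))" unfolding z_def by (rule Complex.DeMoivre)
  also have "real k*(2*pi * of_int a/real k) = 2*pi * of_int a" using k by simp
  also have "cis (2*pi * of_int a) = 1" by (rule cis_multiple_2pi) simp
  finally have z1: "z^k = 1" .
  have "z \<noteq> 1" proof
   assume "z = 1"
   then have "cos (2*pi * of_int a/real k) = 1" by (simp add: z_def complex_eq_iff)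
   then obtain t :: int where t: "2*pi * of_int a/real k = of_int t*2*pi" by (auto simp: cos_one_2pi_int)
   then have "real_of_int a = of_int t*real k" using k by (simp add: field_simps)
   then have e: "a = t*int k" by (metis of_int_eq_iff of_int_mult of_int_of_nat_eq)
   then have "int k dvd a" by simp
   then show False using zdvd_not_zless[OF a] by simp
  qed
  then have "(\<Sum>m<k. z^m) = 0" using geometric_sum[of z k] z1 by simp
  then have "(\<Sum>m<k. Re (z^m)) = 0" by (simp flip: Re_sum)
  moreover have "Re (z^m) = cos (2*pi*real m * of_int a/real k)" for m unfolding z_def Complex.DeMoivre by (simp add: mult_ac)
  ultimately show ?thesis by simp
 qed
 obtain b where b: "n = 2*b + 1" using n(1) by (auto elim: oddE)
 have ab: "0 < b" "b < int k" "0 < b + 1" "b + 1 < int k" using n b by auto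
 have z: "{..<k} = insert 0 {1..<k}" using k by auto
 have s: "(\<Sum>m\<in>{1..<k}. cos (2*pi*real m * of_int a/real k)) = -1" if a: "0 < a" "a < int k" for a using cs[OF a] unfolding z by simp
 have t: "S_coeff k m 1 powi (1 - 2*int 0)*(sqrt (2/real k) * sin (pi*real m * of_int n/real k))
  = 1/real k*(cos (2*pi*real m * of_int b/real k) - cos (2*pi*real m * of_int (b + 1)/real k))" for m proof -
  define x where "x = pi*real m/real k"
  define y where "y = pi*real m * of_int n/real k"
  have "2*pi*real m * of_int b/real k = y - x" "2*pi*real m * of_int (b + 1)/real k = y + x"
   by (simp_all add: x_def y_def b algebra_simps add_divide_distrib diff_divide_distrib)
  then have "cos (2*pi*real m * of_int b/real k) - cos (2*pi*real m * of_int (b + 1)/real k) = 2 * sin x * sin y" by (simp add: cos_add cos_diff)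
  moreover have "sqrt (2/real k) * sqrt (2/real k) = 2/real k" by simp
  ultimately show ?thesis unfolding S_coeff_def x_def y_def using k by (simp add: field_simps)
 qed
 show ?thesis unfolding verlinde_def t sum_distrib_left[symmetric] sum_subtractf s[OF ab(1,2)] s[OF ab(3,4)] by simp
qed

text \<open>Two forward differences at \<open>i\<close> form the centred difference at
  \<open>i + 1\<close>, which accounts for the shift \<open>i + g\<close>.\<close>

lemma fdiff_verlinde:
 assumes k: "k \<ge> 1"
 shows "(fdiff ^^ (2 * g)) (\<lambda>i. verlinde g k (2*int i + 1)) = (\<lambda>i. (- 2*real k)^g * verlinde 0 k (2*int (i + g) + 1))"
proof (induction g)
 case (Suc g)
 have "fdiff (fdiff (\<lambda>i. verlinde (Suc g) k (2*int i + 1))) = (\<lambda>i. (- 2*real k) * verlinde g k (2*int (i + 1) + 1))" proof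
  fix i
  have "2*int (Suc (Suc i)) + 1 = (2*int (i + 1) + 1) + 2" "2*int i + 1 = (2*int (i + 1) + 1) - 2" by auto
  then show "fdiff (fdiff (\<lambda>i. verlinde (Suc g) k (2*int i + 1))) i = (- 2*real k) * verlinde g k (2*int (i + 1) + 1)"
   unfolding fdiff_def using verlinde_second_difference[OF k, of g "2*int (i + 1) + 1"] by (simp add: algebra_simps)
 qed
 then have "(fdiff ^^ (2 * Suc g)) (\<lambda>i. verlinde (Suc g) k (2*int i + 1)) = (fdiff ^^ (2 * g)) (\<lambda>i. (- 2*real k) * verlinde g k (2*int (i + 1) + 1))"
  by (simp add: funpow_swap1)
 also have "... = (\<lambda>i. (- 2*real k)*(fdiff ^^ (2 * g)) (\<lambda>i. verlinde g k (2*int i + 1)) (i + 1))"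
  unfolding fdiff_scale fdiff_shift[of "2 * g" "\<lambda>i. verlinde g k (2*int i + 1)" 1] ..
 also have "... = (\<lambda>i. (- 2*real k)^Suc g * verlinde 0 k (2*int (i + Suc g) + 1))" unfolding Suc.IH by (simp add: mult.assoc)
 finally show ?case .
qed simp

text \<open>Newton interpolation at the odd integers. Differences of order \<open>2g\<close> and
  more reduce to genus 0 numbers at arguments between \<open>2g + 1\<close> and
  \<open>2k - 3\<close>, and these vanish since \<open>g >= 1\<close>. The range of \<open>l\<close>
  is a full period, twice that of the given polynomials.\<close>

lemma verlinde_polynomial:
 assumes k: "k \<ge> 1" and g: "g \<ge> 1"
 shows "\<exists>R :: real poly. degree R \<le> 2 * g \<and> (\<forall>l. odd l \<and> 1 \<le> l \<and> l \<le> 2*k - 1 --> verlinde g k (int l) = poly R (real l))"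
proof -
 define h where "h = (\<lambda>i. verlinde g k (2*int i + 1))"
 have zero: "(fdiff ^^ j) h 0 = 0" if j: "2 * g \<le> j" "j \<le> k - 1" for j proof -
  obtain d where d: "j = d + 2 * g" using j by (metis le_add_diff_inverse2)
  have "(fdiff ^^ d) ((fdiff ^^ (2 * g)) h) 0 = 0" proof (rule fdiff_vanish)
   fix i assume i: "i \<le> d"
   have "verlinde 0 k (2*int (i + g) + 1) = 0" by (rule verlinde_genus_0[OF k]) (use i d j g k in auto)
   then show "(fdiff ^^ (2 * g)) h i = 0" unfolding h_def fdiff_verlinde[OF k] by simp
  qed
  then show ?thesis unfolding d by (simp add: funpow_add)
 qed
 define nb where "nb = (\<lambda>j. smult (1/fact j) (\<Prod>i\<in>{0..<j}. [:- real i, 1:]))"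
 have nb: "poly (nb j) x = x gchoose j" for j x by (simp add: nb_def poly_prod gbinomial_prod_rev)
 have dnb: "degree (nb j) \<le> j" for j proof -
  have "degree (\<Prod>i\<in>{0..<j}. [:- real i, 1:]) \<le> (\<Sum>i\<in>{0..<j}. degree [:- real i, 1:])"
   using degree_prod_sum_le[of "{0..<j}" "\<lambda>i. [:- real i, 1:]"] by (simp add: o_def)
  then show ?thesis unfolding nb_def using degree_smult_le order_trans by fastforce
 qed
 define R0 where "R0 = (\<Sum>j<2 * g. smult ((fdiff ^^ j) h 0) (nb j))"
 define R where "R = pcompose R0 [:- 1/2, 1/2:]"
 have "degree R0 \<le> 2 * g" unfolding R0_def by (rule degree_sum_le) (auto intro: order_trans[OF degree_smult_le] order_trans[OF dnb])
 then have "degree R \<le> 2 * g" unfolding R_def by (simp add: degree_pcompose)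
 moreover have "verlinde g k (int l) = poly R (real l)" if l: "odd l" "1 \<le> l" "l \<le> 2*k - 1" for l proof -
  obtain i where i: "l = 2*i + 1" using l by (auto elim: oddE)
  have ik: "i \<le> k - 1" using l i by auto
  have "verlinde g k (int l) = h i" by (simp add: h_def i add.commute)
  also have "... = (\<Sum>j\<le>i. real (i choose j)*(fdiff ^^ j) h 0)" by (rule newton_forward)
  also have "... = (\<Sum>j\<in>{..i} \<inter> {..<2 * g}. real (i choose j)*(fdiff ^^ j) h 0)" proof (rule sum.mono_neutral_right)
   show "\<forall>j\<in>{..i} - {..i} \<inter> {..<2 * g}. real (i choose j)*(fdiff ^^ j) h 0 = 0" proof
    fix j assume "j \<in> {..i} - {..i} \<inter> {..<2 * g}"
    then have "2 * g \<le> j" "j \<le> k - 1" using ik by auto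
    then show "real (i choose j)*(fdiff ^^ j) h 0 = 0" using zero by simp
   qed
  qed auto
  also have "... = (\<Sum>j<2 * g. real (i choose j)*(fdiff ^^ j) h 0)" by (rule sum.mono_neutral_left) auto
  also have "... = poly R0 (real i)" unfolding R0_def by (simp add: poly_sum nb binomial_gbinomial mult.commute)
  also have "real i = poly [:- 1/2, 1/2:] (real l)" by (simp add: i field_simps)
  also have "poly R0 ... = poly R (real l)" by (simp only: R_def poly_pcompose)
  finally show ?thesis .
 qed
 ultimately show ?thesis by blast
qed

text \<open>The fractions \<open>(2i + 1)/k\<close> with \<open>i <= degree p\<close> are distinct
  roots, one more than the degree allows.\<close>

lemma poly_zero_if_odd_fractions:
 fixes p :: "real poly"
 assumes k: "k > 2 * degree p + 2" and z: "\<And>l. odd l ==> 1 \<le> l ==> l \<le> k - 1 ==> poly p (real l/real k) = 0" shows "p = 0"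
proof (rule ccontr)
 assume p: "p \<noteq> 0"
 define X where "X = (\<lambda>i. real (2*i + 1)/real k) ` {..degree p}"
 have "inj_on (\<lambda>i. real (2*i + 1)/real k) {..degree p}" using k by (auto simp: inj_on_def)
 then have "card X = Suc (degree p)" unfolding X_def by (simp add: card_image)
 moreover have "X \<subseteq> {x. poly p x = 0}" unfolding X_def using k by (auto intro!: z[of "2 * _ + 1", simplified])
 ultimately have "Suc (degree p) \<le> card {x. poly p x = 0}" using card_mono[OF poly_roots_finite[OF p]] by metis
 then show False using card_poly_roots_bound[OF p] by simp
qed

text \<open>For large \<open>k\<close> the given expansion and the interpolating polynomial agree at
  enough points to coincide, so the expansion extends to all odd \<open>l < 2k\<close>. Oddness and
  periodicity of the Verlinde numbers then give the reflection \<open>y -> 2 - y\<close> for the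
  whole sum. It separates into its coefficients because \<open>1/k^2\<close> takes infinitely many
  values.\<close>

theorem leading_polynomials_antisymmetric:
 assumes g: "g \<ge> 1"
  and P: "\<And>k l. k \<ge> 1 ==> odd l \<and> 1 \<le> l \<and> l \<le> k - 1 ==>
    N_coeff g k l = (kp k)^(3 * g - 2)*(\<Sum>m<g. poly (P m) (real l/real k)/real k^(2*m))"
  and m: "m < g" shows "poly (P m) (2 - y) = - poly (P m) y" proof -
 define D where "D = Max (insert (2 * g) ((\<lambda>m. degree (P m)) ` {..<g}))"
 have DP: "degree (P m) \<le> D" if "m < g" for m unfolding D_def using that by (intro Max_ge) auto
 have Dg: "2 * g \<le> D" unfolding D_def by (intro Max_ge) auto
 have main: "(\<Sum>m<g. (poly (P m) (2 - y) + poly (P m) y)*(1/real k^2)^m) = 0" if k: "k > 2 * D + 2" for k y proof -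
  have k1: "k \<ge> 1" using k by simp
  have kr: "real k > 0" using k1 by simp
  define c where "c = (kp k)^(3 * g - 2)"
  have c0: "c \<noteq> 0" using kr by (simp add: c_def)
  define Qk where "Qk = (\<Sum>m<g. smult (c/real k^(2*m)) (P m))"
  have dQ: "degree Qk \<le> D" unfolding Qk_def by (rule degree_sum_le) (auto intro: order_trans[OF degree_smult_le] DP)
  obtain R where R: "degree R \<le> 2 * g" "\<And>l. odd l ==> 1 \<le> l ==> l \<le> 2*k - 1 ==> verlinde g k (int l) = poly R (real l)"
   using verlinde_polynomial[OF k1 g] by blast
  define Rk where "Rk = pcompose R [:0, real k:]"
  have dR: "degree Rk \<le> D" using R(1) Dg kr by (simp add: Rk_def degree_pcompose)
  have Rkl: "poly Rk (real l/real k) = poly R (real l)" for l using kr by (simp add: Rk_def poly_pcompose)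
  have "Rk - Qk = 0" proof (rule poly_zero_if_odd_fractions[of _ k])
   have "degree (Rk - Qk) \<le> D" using degree_diff_le[OF dR dQ] .
   then show "2 * degree (Rk - Qk) + 2 < k" using k by simp
   fix l assume l: "odd l" "1 \<le> l" "l \<le> k - 1"
   have "poly Rk (real l/real k) = N_coeff g k l" unfolding Rkl verlinde_nat[symmetric] using l by (intro R(2)[symmetric]) auto
   also have "... = poly Qk (real l/real k)" using P[OF k1, of l] l by (simp add: Qk_def poly_sum c_def sum_distrib_left)
   finally show "poly (Rk - Qk) (real l/real k) = 0" by simp
  qed
  then have RQ: "Rk = Qk" by simp
  define S where "S = pcompose Qk [:2, -1:] + Qk"
  have "S = 0" proof (rule poly_zero_if_odd_fractions[of _ k])
   have "degree S \<le> D" unfolding S_def by (rule degree_add_le) (use dQ in \<open>simp_all add: degree_pcompose\<close>)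
   then show "2 * degree S + 2 < k" using k by simp
   fix l assume l: "odd l" "1 \<le> l" "l \<le> k - 1"
   have e: "2 - real l/real k = real (2*k - l)/real k" using l kr by (simp add: of_nat_diff field_simps)
   have "poly Qk (real (2*k - l)/real k) = verlinde g k (int (2*k - l))" unfolding RQ[symmetric] Rkl using l by (intro R(2)[symmetric]) auto
   also have "int (2*k - l) = - int l + 2*int k*1" using l by (simp add: of_nat_diff)
   also have "verlinde g k ... = - verlinde g k (int l)" unfolding verlinde_period[OF k1] verlinde_minus ..
   also have "verlinde g k (int l) = poly Qk (real l/real k)" unfolding RQ[symmetric] Rkl using l by (intro R(2)) auto
   finally show "poly S (real l/real k) = 0" unfolding S_def by (simp add: poly_pcompose e)
  qed
  then have "poly S y = 0" by simp
  then have "c*(\<Sum>m<g. (poly (P m) (2 - y) + poly (P m) y)*(1/real k^2)^m) = 0" unfolding S_def Qk_def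
   by (simp add: poly_pcompose poly_sum sum_distrib_left sum.distrib[symmetric] power_mult power_divide distrib_left distrib_right add_divide_distrib power_one_over field_simps power2_eq_square power_mult_distrib)
  then show ?thesis using c0 by simp
 qed
 define T where "T = (\<Sum>m<g. monom (poly (P m) (2 - y) + poly (P m) y) m)"
 have "T = 0" proof (rule ccontr)
  assume "T \<noteq> 0"
  then have fin: "finite {x. poly T x = 0}" by (rule poly_roots_finite)
  have "(\<lambda>k. 1/real k^2) ` {k. k > 2 * D + 2} \<subseteq> {x. poly T x = 0}" using main[of _ y] by (auto simp: T_def poly_sum poly_monom)
  then have "finite ((\<lambda>k. 1/real k^2) ` {k. k > 2 * D + 2})" using fin finite_subset by blast
  moreover have "inj_on (\<lambda>k. 1/real k^2) {k. k > 2 * D + 2}" by (auto simp: inj_on_def power2_eq_iff)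
  ultimately have "finite {k. k > 2 * D + 2}" by (rule finite_imageD)
  moreover have "infinite {k::nat. k > 2 * D + 2}" using infinite_Ioi[of "2 * D + 2"] by (simp add: greaterThan_def)
  ultimately show False by simp
 qed
 then have "coeff T m = 0" by simp
 then have "poly (P m) (2 - y) + poly (P m) y = 0" using m by (simp add: T_def coeff_sum)
 then show ?thesis by simp
qed

section \<open>The quantum basis\<close>

lemma sum_roots_of_unity:
 assumes k: "k \<ge> 1" and l: "l \<in> {0..<2*int k}" shows "(\<Sum>m<2*k. cis (pi * of_int l/real k)^m) = (if l = 0 then 2 * of_nat k else 0)"
proof (cases "l = 0")
 case False
 define z where "z = cis (pi * of_int l/real k)"
 have "z^(2*k) = cis (2*pi * of_int l)"   proof -
  have "z^(2*k) = cis (real (2*k)*(pi * of_int l/real k))" unfolding z_def by (rule Complex.DeMoivre)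
  also have "real (2*k)*(pi * of_int l/real k) = 2*pi * of_int l" using k by simp
  finally show ?thesis .
 qed
 also have "... = 1" by (rule cis_multiple_2pi) simp
 finally have z1: "z^(2*k) = 1" .
 have "z \<noteq> 1" proof
  assume "z = 1"
  then have "cos (pi * of_int l/real k) = 1" by (simp add: z_def complex_eq_iff)
  then obtain n :: int where n: "pi * of_int l/real k = of_int n*2*pi" by (auto simp: cos_one_2pi_int)
  then have "real_of_int l = of_int n*2*real k" using k by (simp add: field_simps)
  then have e: "l = n*2*int k" by (metis of_int_eq_iff of_int_mult of_int_numeral of_int_of_nat_eq)
  have "n \<ge> 1" proof (rule ccontr)
   assume "\<not> n \<ge> 1"
   then have "n*(2*int k) \<le> 0" by (intro mult_nonpos_nonneg) auto
   then show False using l False e by simp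
  qed
  then have "1*(2*int k) \<le> n*(2*int k)" by (intro mult_right_mono) auto
  then show False using l e by simp
 qed
 then have "(\<Sum>m<2*k. z^m) = 0" using geometric_sum[of z "2*k"] z1 by simp
 then show ?thesis using False by (simp add: z_def)
qed (simp add: k)

context half_form_setup
begin

definition Zsum :: "nat => nat => plane => complex" where
 "Zsum g k x = (\<Sum>\<^sub>\<infinity>n. of_real (verlinde g k n)*primal modulus k (snd x) n (of_real (fst x)))"

text \<open>At the origin the term of index 0 is 1 and all others are exponentially small. Since the
  phase of the basis is fixed there, the theta section already has almost the right phase.\<close>

lemma theta_origin_close:
 "\<exists>C\<ge>0. \<forall>k\<ge>1. norm (gsec k 0 0 - 1) \<le> C/real k^N" proof -
 define c where "c = 2*pi*Im modulus"
 have c: "c > 0" using modulus_pos by (simp add: c_def)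
 obtain C where C: "C \<ge> 0" "\<And>k. k \<ge> 1 ==> exp (- (c/2)*real k) \<le> C/real k^N" using exp_decay_le_power[of "c/2" N] c by auto
 define M where "M = (\<Sum>\<^sub>\<infinity>n::int. exp (- (c/2)*(real_of_int n)^2 + 0*\<bar>real_of_int n\<bar>))"
 have sM: "(\<lambda>n::int. exp (- (c/2)*(real_of_int n)^2 + 0*\<bar>real_of_int n\<bar>)) summable_on UNIV"
  by (rule summable_on_gaussian) (use c in simp)
 have M0: "M \<ge> 0" unfolding M_def by (intro infsum_nonneg) auto
 have "norm (gsec k 0 0 - 1) \<le> (C * M)/real k^N" if k: "k \<ge> 1" for k proof -
  define t where "t = (\<lambda>n::int. exp (tpi * of_nat k*modulus*(of_int n)^2 + 4 * of_real pi*\<i> * of_nat k*coord 0 * of_int n))"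
  have c0: "coord 0 = 0" by (simp add: coord_eq)
  have "gsec k 0 0 = (\<Sum>\<^sub>\<infinity>n. t n)" unfolding gsec_0_eq[OF k] theta0_def t_def by simp
  moreover have st: "t summable_on UNIV" unfolding t_def by (rule theta0_series(2)[OF modulus_pos k])
  ultimately have hs: "(t has_sum gsec k 0 0) UNIV" by simp
  have "(t has_sum (gsec k 0 0 - 1)) (UNIV - {0})" by (rule has_sum_Diff[OF hs has_sum_finiteI[of "{0}"]]) (auto simp: t_def c0)
  moreover have sM': "(\<lambda>n::int. exp (- (c/2)*real k)*exp (- (c/2)*(real_of_int n)^2 + 0*\<bar>real_of_int n\<bar>)) summable_on UNIV"
   by (intro summable_on_cmult_right sM)
  then have sM0: "(\<lambda>n::int. exp (- (c/2)*real k)*exp (- (c/2)*(real_of_int n)^2 + 0*\<bar>real_of_int n\<bar>)) summable_on (UNIV - {0})"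
   by (rule summable_on_subset_banach) auto
  ultimately have "norm (gsec k 0 0 - 1) \<le> (\<Sum>\<^sub>\<infinity>n\<in>UNIV - {0}. exp (- (c/2)*real k)*exp (- (c/2)*(real_of_int n)^2 + 0*\<bar>real_of_int n\<bar>))"
  proof (rule norm_infsum_le[OF _ has_sum_infsum])
   fix n :: int assume "n \<in> UNIV - {0}"
   then have n: "1 \<le> \<bar>real_of_int n\<bar>" by simp
   then have n2: "1 \<le> (real_of_int n)^2" by (metis one_le_power power2_abs)
   have k1: "1 \<le> real k" using k by simp
   have "t n = exp (of_real (2*pi*real k*(real_of_int n)^2)*(\<i>*modulus))" unfolding t_def c0 by (rule arg_cong[where f=exp]) simp
   then have "norm (t n) = exp (- (c*(real k*(real_of_int n)^2)))" unfolding norm_exp_eq_Re by (simp add: c_def)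
   also have "... \<le> exp (- (c/2)*real k + - (c/2)*(real_of_int n)^2)" proof -
    have "real k*(real_of_int n)^2 \<ge> real k*1" using n2 by (intro mult_left_mono) auto
    moreover have "real k*(real_of_int n)^2 \<ge> 1*(real_of_int n)^2" using k1 by (intro mult_right_mono) auto
    ultimately have "c*(real k*(real_of_int n)^2) \<ge> c*((real k + (real_of_int n)^2)/2)" using c by (intro mult_left_mono) auto
    then show ?thesis by (simp add: algebra_simps add_divide_distrib)
   qed
   finally show "norm (t n) \<le> exp (- (c/2)*real k)*exp (- (c/2)*(real_of_int n)^2 + 0*\<bar>real_of_int n\<bar>)"
    by (simp only: mult_zero_left add_0_right exp_add)
  qed
  also have "... \<le> (\<Sum>\<^sub>\<infinity>n. exp (- (c/2)*real k)*exp (- (c/2)*(real_of_int n)^2 + 0*\<bar>real_of_int n\<bar>))"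
   by (rule infsum_mono_neutral[OF sM0 sM']) auto
  also have "... = exp (- (c/2)*real k) * M" unfolding M_def by (rule infsum_cmult_right')
  also have "... \<le> C/real k^N * M" by (rule mult_right_mono[OF C(2)[OF k] M0])
  finally show ?thesis by simp
 qed
 moreover have "C * M \<ge> 0" using C(1) M0 by simp
 ultimately show ?thesis by blast
qed

lemma pull_back_sum:
 "pull_back sc k x (\<lambda>y. \<Sum>i\<in>A. sc (c i) (s i y)) y = (\<Sum>i\<in>A. sc (c i) (pull_back sc k x (s i) y))"
 unfolding pull_back_def by (simp add: sc_sum_right sc_sc mult.commute)

text \<open>Averaging over the powers of the translation by \<open>mu/2k\<close>: the theta section
  is invariant, so in its expansion only the component with eigenvalue 1 survives.\<close>

lemma basis_0_proportional:
 assumes k: "k \<ge> 1" and basis: "quantum_basis j sc herm Om k \<Psi>"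
 obtains c where "\<And>x. sc (gsec k 0 x) Om = sc c (\<Psi> 0 x)" proof -
 define e where "e = (1/(2*real k)) *\<^sub>R mu"
 define w where "w = (\<lambda>l::int. cis (pi * of_int l/real k))"
 have eig: "pull_back sc k e (\<Psi> l) x = sc (w l) (\<Psi> l x)" for l x using basis unfolding quantum_basis_def e_def w_def by blast
 define s where "s = (\<lambda>x. sc (gsec k 0 x) Om)"
 have inv: "pull_back sc k e s x = s x" for x unfolding pull_back_def s_def sc_sc e_def gsec_0_pull_back[OF k] ..
 have "s \<in> quantum_space j sc k" unfolding s_def by (rule gsec_0_quantum_space[OF k])
 from basis[unfolded quantum_basis_def, THEN conjunct2, THEN conjunct2, THEN conjunct2, THEN conjunct1, THEN bspec, OF this]
 obtain c where c: "\<And>x. s x = (\<Sum>l\<in>{0..<2*int k}. sc (c l) (\<Psi> l x))" by blast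
 have it: "s x = (\<Sum>l\<in>{0..<2*int k}. sc (c l*w l^m) (\<Psi> l x))" for m x proof (induction m arbitrary: x)
  case 0
  show ?case using c by simp
 next
  case (Suc m)
  have "s x = pull_back sc k e (\<lambda>y. \<Sum>l\<in>{0..<2*int k}. sc (c l*w l^m) (\<Psi> l y)) x"
   using inv[of x] Suc.IH unfolding pull_back_def by simp
  also have "... = (\<Sum>l\<in>{0..<2*int k}. sc (c l*w l^Suc m) (\<Psi> l x))" unfolding pull_back_sum eig sc_sc by (simp add: mult_ac)
  finally show ?case .
 qed
 have k0: "(of_nat k :: complex) \<noteq> 0" using k by simp
 have "s x = sc (c 0) (\<Psi> 0 x)" for x proof -
  have "sc (2 * of_nat k) (s x) = (\<Sum>m<2*k. s x)" using sc_of_real[of "2*real k" "s x"] by (simp add: sum_constant_scaleR)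
  also have "... = (\<Sum>m<2*k. \<Sum>l\<in>{0..<2*int k}. sc (c l*w l^m) (\<Psi> l x))" by (intro sum.cong refl it)
  also have "... = (\<Sum>l\<in>{0..<2*int k}. \<Sum>m<2*k. sc (c l*w l^m) (\<Psi> l x))" by (rule sum.swap)
  also have "... = (\<Sum>l\<in>{0..<2*int k}. sc (c l*(\<Sum>m<2*k. w l^m)) (\<Psi> l x))" by (simp add: sc_sum_left[symmetric] sum_distrib_left)
  also have "... = (\<Sum>l\<in>{0..<2*int k}. if l = 0 then sc (c 0*(2 * of_nat k)) (\<Psi> 0 x) else 0)"
   by (intro sum.cong refl) (simp add: w_def sum_roots_of_unity[OF k])
  also have "... = sc (2 * of_nat k) (sc (c 0) (\<Psi> 0 x))" using k by (simp add: sc_sc mult.commute)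
  finally have "sc (1/(2 * of_nat k)) (sc (2 * of_nat k) (s x)) = sc (1/(2 * of_nat k)) (sc (2 * of_nat k) (sc (c 0) (\<Psi> 0 x)))" by simp
  then show ?thesis unfolding sc_sc[of "1/(2 * of_nat k)"] using k0 by simp
 qed
 then show ?thesis using that unfolding s_def by blast
qed

lemma herm_sc_sc: "herm (sc c u) (sc c u) = of_real ((norm c)^2)*herm u u" unfolding herm_norm norm_sc by (simp add: power_mult_distrib)

lemma quantum_inner_sc: "quantum_inner herm (\<lambda>x. sc c (s x)) (\<lambda>x. sc c (s x)) = of_real ((norm c)^2) * quantum_inner herm s s"
 unfolding quantum_inner_def herm_sc_sc by simp

lemma omega_mu_lam: "omega mu lam = 4*pi" by (simp add: omega_def mu_def lam_def)

lemma gsec_quantum_inner: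
 assumes k: "k \<ge> 1"
 shows "quantum_inner herm (\<lambda>x. sc (gsec k 0 x) Om) (\<lambda>x. sc (gsec k 0 x) Om) = of_real (4*pi*(norm Om)^2/sqrt (4*real k*Im modulus))"
proof -
 have "quantum_inner herm (\<lambda>x. sc (gsec k 0 x) Om) (\<lambda>x. sc (gsec k 0 x) Om)
  = of_real (4*pi)*(integral (cbox (0, 0) (1, 1)) (\<lambda>x. complex_of_real ((norm (gsec k 0 x))^2))*herm Om Om)"
  unfolding quantum_inner_def herm_sc_sc omega_mu_lam by simp
 then show ?thesis unfolding gsec_norm_integral[OF k] herm_norm by simp
qed

text \<open>\<open>Im modulus\<close> cancels between the theta integral and the norm of
  \<open>Om\<close>, leaving \<open>sqrt(2 pi/k)\<close> as the squared norm of the unnormalised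
  section. This is the origin of the exponent 1/4.\<close>

lemma basis_0_norm:
 assumes k: "k \<ge> 1" shows "4*pi*(norm Om)^2/sqrt (4*real k*Im modulus) = 1/((kp k) powr (1/4))^2" proof -
 have k1: "real k > 0" using k by simp
 have p: "(kp k) powr (1/4) > 0" using k1 by simp
 have "((kp k) powr (1/4))^2 = (kp k) powr (1/2)" unfolding powr_realpow[OF p, symmetric] powr_powr by simp
 also have "... = sqrt (kp k)" by (rule powr_half_sqrt) simp
 finally have r: "((kp k) powr (1/4))^2 = sqrt (kp k)" .
 have "(norm Om)^2 = sqrt (Im modulus/(2*pi))" using norm_Om by (intro real_sqrt_unique[symmetric]) (simp_all flip: power_mult)
 moreover have "4*pi = sqrt (16*pi^2)" by (simp add: real_sqrt_mult)
 ultimately have "4*pi*(norm Om)^2/sqrt (4*real k*Im modulus) = sqrt (16*pi^2*(Im modulus/(2*pi))/(4*real k*Im modulus))"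
  by (simp only: real_sqrt_mult real_sqrt_divide)
 also have "16*pi^2*(Im modulus/(2*pi))/(4*real k*Im modulus) = 1/(kp k)" using modulus_pos k1 by (simp add: field_simps power2_eq_square)
 finally show ?thesis unfolding r by (simp add: real_sqrt_divide)
qed

text \<open>The phase \<open>u\<close> is the one with \<open>u * t = |t|\<close> for
  \<open>t = gsec k 0 0\<close>, because the value of the basis section at the origin is a positive
  multiple of \<open>Om\<close>. Hence \<open>|u - 1|\<close> is controlled by
  \<open>|t - 1|\<close>.\<close>

lemma basis_0_eq:
 assumes k: "k \<ge> 1" and basis: "quantum_basis j sc herm Om k \<Psi>"
 obtains u where "norm u = 1" "norm (u - 1) \<le> 4*norm (gsec k 0 0 - 1)"
  "\<And>x. \<Psi> 0 x = sc (u * of_real ((kp k) powr (1/4)) * gsec k 0 x) Om" proof -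
 obtain c where c: "\<And>x. sc (gsec k 0 x) Om = sc c (\<Psi> 0 x)" using basis_0_proportional[OF k basis] by blast
 define a where "a = (kp k) powr (1/4)"
 have a: "a > 0" using k by (simp add: a_def)
 have "quantum_inner herm (\<Psi> 0) (\<Psi> 0) = 1" using basis k unfolding quantum_basis_def by simp
 then have "complex_of_real ((norm c)^2) = of_real (1/a^2)"
  using gsec_quantum_inner[OF k] quantum_inner_sc[of c "\<Psi> 0"] unfolding c basis_0_norm[OF k] a_def by simp
 then have "(norm c)^2 = (1/a)^2" by (simp only: of_real_eq_iff power_divide power_one)
 from power2_eq_imp_eq[OF this] have nc: "norm c = 1/a" using a by simp
 then have c0: "c \<noteq> 0" using a by auto
 from basis[unfolded quantum_basis_def, THEN conjunct2, THEN conjunct2, THEN conjunct2, THEN conjunct2, THEN conjunct2, THEN conjunct2]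
 obtain r where r: "r > 0" "\<Psi> 0 0 = r *\<^sub>R Om" by blast
 have "sc (gsec k 0 0) Om = sc (c * of_real r) Om" unfolding c r sc_of_real[symmetric] sc_sc ..
 then have "sc (gsec k 0 0 - c * of_real r) Om = 0" using sc_add_left[of "gsec k 0 0 - c * of_real r" "c * of_real r" Om] by simp
 then have "norm (gsec k 0 0 - c * of_real r)*norm Om = 0" unfolding norm_sc[symmetric] by simp
 then have g0: "gsec k 0 0 = c * of_real r" using Om_neq_0 by simp
 define u where "u = 1/(c * of_real a)"
 have nu: "norm u = 1" using a nc by (simp add: u_def norm_divide norm_mult)
 have P: "\<Psi> 0 x = sc (u * of_real a * gsec k 0 x) Om" for x proof -
  have "sc (u * of_real a * gsec k 0 x) Om = sc (u * of_real a) (sc c (\<Psi> 0 x))" unfolding c[symmetric] sc_sc ..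
  also have "... = \<Psi> 0 x" unfolding sc_sc u_def using a c0 by simp
  finally show ?thesis ..
 qed
 have ug: "u * gsec k 0 0 = of_real (norm (gsec k 0 0))" unfolding g0 u_def norm_mult nc using c0 a r by (simp add: field_simps)
 have "norm (u - 1) \<le> 4*norm (gsec k 0 0 - 1)" proof -
  define t where "t = gsec k 0 0"
  have "u - 1 = (of_real (norm t) - 1) - u*(t - 1)" using ug by (simp add: t_def algebra_simps)
  then have "norm (u - 1) \<le> norm (complex_of_real (norm t) - 1) + norm (u*(t - 1))" by (simp only: norm_triangle_ineq4)
  moreover have "norm (u*(t - 1)) = norm (t - 1)" by (simp add: norm_mult nu)
  moreover have "norm (complex_of_real (norm t) - 1) = \<bar>norm t - 1\<bar>" proof -
   have "complex_of_real (norm t) - 1 = of_real (norm t - 1)" by simp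
   then show ?thesis by (simp only: norm_of_real)
  qed
  moreover have "\<bar>norm t - 1\<bar> \<le> norm (t - 1)" using norm_triangle_ineq3[of t 1] by simp
  moreover have "0 \<le> norm (t - 1)" by simp
  ultimately show ?thesis unfolding t_def by linarith
 qed
 from that[OF nu this P[unfolded a_def]] show ?thesis .
qed

lemma basis_eq:
 assumes k: "k \<ge> 1" and basis: "quantum_basis j sc herm Om k \<Psi>"
  and \<Psi>0: "\<And>x. \<Psi> 0 x = sc (c * gsec k 0 x) Om" shows "\<Psi> (int l) x = sc (c * gsec k (int l) x) Om"
proof (induction l arbitrary: x)
 case 0
 show ?case using \<Psi>0 by simp
next
 case (Suc l)
 have "\<Psi> (int l + 1) = pull_back sc k ((1/(2*real k)) *\<^sub>R lam) (\<Psi> (int l))"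
  by (rule basis[unfolded quantum_basis_def, THEN conjunct2, THEN conjunct2, THEN conjunct2, THEN conjunct2,
     THEN conjunct2, THEN conjunct1, THEN spec, symmetric])
 then have "\<Psi> (int l + 1) x = sc (c*(cis (- (real k * omega ((1/(2*real k)) *\<^sub>R lam) x/2)) * gsec k (int l) ((1/(2*real k)) *\<^sub>R lam + x))) Om"
  unfolding pull_back_def Suc.IH sc_sc by (simp add: mult_ac)
 then show ?case unfolding gsec_Suc[OF k] by (simp add: add.commute)
qed

lemma verlinde_bound_summable:
 assumes k: "k \<ge> 1" shows "(\<lambda>n. primal modulus k q (2*int k*n + r) (of_real p)) summable_on UNIV" proof -
 have "(\<lambda>n. primal modulus k q n (of_real p)) summable_on UNIV"
  using primal_summable[OF modulus_pos k, of 1 q "of_real p"] has_sum_imp_summable by fastforce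
 then have "(\<lambda>n. primal modulus k q n (of_real p)) summable_on range (\<lambda>n. 2*int k*n + r)" by (rule summable_on_subset_banach) auto
 then show ?thesis using k by (subst (asm) summable_on_reindex) (auto simp: inj_on_def o_def)
qed

lemma Zsum_eq:
 assumes k: "k \<ge> 1" shows "(\<Sum>r<2*k. of_real (verlinde g k (int r)) * gsec k (int r) x)
  = exp (mtpi * of_nat k * of_real (fst x) * of_real (snd x)) * Zsum g k x" proof -
 define f where "f = (\<lambda>n. of_real (verlinde g k n)*primal modulus k (snd x) n (of_real (fst x)))"
 define s where "s = (\<lambda>r::nat. of_real (verlinde g k (int r))*(\<Sum>\<^sub>\<infinity>n. primal modulus k (snd x) (2*int k*n + int r) (of_real (fst x))))"
 have "((\<lambda>n. f (2*int k*n + int r)) has_sum s r) UNIV" for r proof -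
  have "verlinde g k (2*int k*n + int r) = verlinde g k (int r)" for n using verlinde_period[OF k, of g "int r" n] by (simp add: add.commute)
  then show ?thesis unfolding f_def s_def by (simp add: has_sum_cmult_right has_sum_infsum[OF verlinde_bound_summable[OF k]])
 qed
 then have "(f has_sum (\<Sum>r<2*k. s r)) UNIV" by (intro residue_classes_has_sum[OF k])
 then have "Zsum g k x = (\<Sum>r<2*k. s r)" unfolding Zsum_def f_def by (rule infsumI)
 then show ?thesis unfolding gsec_def s_def by (simp add: sum_distrib_left mult_ac)
qed

text \<open>By oddness and periodicity of the Verlinde numbers, the difference of the sections
  \<open>l\<close> and \<open>-l\<close> with coefficient \<open>N_coeff g k l\<close> is the sum of
  the terms of the residues \<open>l\<close> and \<open>2k - l\<close>.\<close>

theorem Z_state_eq: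
 assumes k: "k \<ge> 1" and basis: "quantum_basis j sc herm Om k (\<Psi> k)"
  and \<Psi>0: "\<And>x. \<Psi> k 0 x = sc (c * gsec k 0 x) Om"
 shows "Z_state \<Psi> g k x = sc (of_real (1/sqrt 2)*c*exp (mtpi * of_nat k * of_real (fst x) * of_real (snd x)) * Zsum g k x) Om" proof -
 define f where "f = (\<lambda>l::nat. sc (of_real (verlinde g k (int l))) (\<Psi> k (int l) x))"
 have per: "\<Psi> k (l + 2*int k) = \<Psi> k l" for l by (rule basis[unfolded quantum_basis_def, THEN conjunct1, THEN spec])
 have "N_coeff g k l *\<^sub>R (\<Psi> k (int l) x - \<Psi> k (- int l) x) = f l + f (2*k - l)" if "l \<in> {1..<k}" for l proof -
  have i: "int (2*k - l) = - int l + 2*int k" using that by (simp add: of_nat_diff)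
  have "verlinde g k (int (2*k - l)) = - N_coeff g k l"
   unfolding i verlinde_nat[symmetric] using verlinde_period[OF k, of g "- int l" 1] by (simp add: verlinde_minus)
  moreover have "\<Psi> k (int (2*k - l)) = \<Psi> k (- int l)" unfolding i by (rule per)
  moreover have "sc (of_real (- N_coeff g k l)) v = - (N_coeff g k l *\<^sub>R v)" for v unfolding sc_of_real by simp
  ultimately show ?thesis unfolding f_def verlinde_nat[of g k l]
   by (simp only: sc_of_real scaleR_diff_right scaleR_minus_left diff_conv_add_uminus scaleR_add_right scaleR_minus_right)
 qed
 then have "(\<Sum>l\<in>{1..<k}. N_coeff g k l *\<^sub>R (\<Psi> k (int l) x - \<Psi> k (- int l) x)) = (\<Sum>l\<in>{1..<k}. f l + f (2*k - l))"
  by (intro sum.cong refl)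
 also have "... = (\<Sum>r<2*k. f r)" by (rule sum_pairs[OF k]) (simp_all add: f_def verlinde_0 verlinde_k)
 also have "... = sc (c*(\<Sum>r<2*k. of_real (verlinde g k (int r)) * gsec k (int r) x)) Om"
  unfolding f_def basis_eq[OF k basis \<Psi>0] sc_sc sum_distrib_left sc_sum_left by (simp add: mult_ac)
 finally show ?thesis unfolding Z_state_def Zsum_eq[OF k] by (simp only: sc_of_real[symmetric] sc_sc mult.assoc)
qed

end

section \<open>Transformation of the state\<close>

lemma gauss_const_kappa:
 assumes tau: "Im \<tau> > 0" and k: "k \<ge> 1"
 shows "gauss_const (- of_real pi*\<i>*\<tau>/(2 * of_nat k)) = of_real (sqrt (2*real k))/csqrt (- \<i>*\<tau>)" proof -
 have e: "- of_real pi*\<i>*\<tau>/(2 * of_nat k) = of_real (1/(2*real k))*(of_real pi*(- \<i>*\<tau>))" by simp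
 have "Re (of_real pi*(- \<i>*\<tau>)) > 0" using tau by simp
 then have "gauss_const (- of_real pi*\<i>*\<tau>/(2 * of_nat k)) = gauss_const (of_real pi*(- \<i>*\<tau>))/of_real (sqrt (1/(2*real k)))"
  unfolding e using k by (intro gauss_const_scale) auto
 also have "gauss_const (of_real pi*(- \<i>*\<tau>)) = 1/csqrt (- \<i>*\<tau>)" unfolding gauss_const_def by simp
 also have "sqrt (1/(2*real k)) = 1/sqrt (2*real k)" by (simp only: real_sqrt_divide real_sqrt_one)
 finally show ?thesis by (simp add: mult.commute)
qed

lemma csqrt_mult_inverse:
 assumes "Re b > 0" shows "csqrt b * csqrt (1/b) = 1" proof -
 have "b \<notin> \<real>\<^sub>\<le>\<^sub>0" "b \<noteq> 0" using assms by (auto simp: complex_nonpos_Reals_iff)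
 then show ?thesis using csqrt_inverse[of b] by (simp add: divide_inverse)
qed

lemma Im_minus_inverse: "Im \<tau> > 0 ==> Im (- 1 / \<tau>) > 0" by (auto simp: Im_divide intro!: divide_pos_pos add_nonneg_pos)

text \<open>The two square roots are inverse to each other because their arguments lie in the right
  half plane. This makes the constant near the first curve independent of
  \<open>modulus\<close>.\<close>

lemma gauss_const_reciprocal:
 assumes tau: "Im \<tau> > 0" and k: "k \<ge> 1"
 shows "gauss_const (- of_real pi*\<i>*\<tau>/(2 * of_nat k))*gauss_const (- of_real pi*\<i>*(- 1 / \<tau>)/(2 * of_nat k)) = 2 * of_nat k" proof -
 have t0: "\<tau> \<noteq> 0" using tau by auto
 have "- \<i>*(- 1 / \<tau>) = 1/(- \<i>*\<tau>)" using t0 by (simp add: field_simps)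
 moreover have "csqrt (- \<i>*\<tau>) * csqrt (1/(- \<i>*\<tau>)) = 1" by (rule csqrt_mult_inverse) (use tau in simp)
 moreover have "complex_of_real (sqrt (2*real k)) * of_real (sqrt (2*real k)) = 2 * of_nat k" proof -
  have "sqrt (2*real k) * sqrt (2*real k) = 2*real k" by simp
  then show ?thesis by (metis of_real_mult of_real_numeral of_real_of_nat_eq)
 qed
 ultimately show ?thesis unfolding gauss_const_kappa[OF tau k] gauss_const_kappa[OF Im_minus_inverse[OF tau] k]
  by (simp only: times_divide_times_eq) simp
qed

text \<open>The character \<open>exp(i pi r n/k)\<close> of a finite Fourier sum is absorbed into a
  translation of \<open>p\<close> by \<open>r/(2k)\<close>, up to a factor that does not involve
  \<open>n\<close>.\<close>

lemma primal_half_period: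
 assumes "k \<ge> 1"
 shows "primal \<tau> k q n (p + of_nat r/(2 * of_nat k)) = exp (tpi * of_nat r * of_real q)*(exp (\<i> * of_real pi * of_nat r * of_int n/of_nat k)*primal \<tau> k q n p)"
proof -
 have k0: "(of_nat k :: complex) \<noteq> 0" using assms by simp
 show ?thesis unfolding primal_def exp_add[symmetric] lat_def
  by (rule arg_cong[where f=exp]) (use k0 in \<open>simp add: field_simps power2_eq_square\<close>)
qed

text \<open>Poisson summation inverts the modulus and exchanges \<open>p\<close> and
  \<open>q\<close>. The residue \<open>r\<close>, which entered as a translation, comes out as a
  residue class of the new summation index.\<close>

lemma dual_eq_primal:
 assumes tau: "Im \<tau> > 0" and k: "k \<ge> 1" shows "exp (- (tpi * of_nat r * of_real q))*dual \<tau> k q m (of_real p + of_nat r/(2 * of_nat k))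
  = gauss_const (- of_real pi*\<i>*\<tau>/(2 * of_nat k))*exp (4 * of_real pi*\<i> * of_nat k * of_real p * of_real q) *
   primal (- 1 / \<tau>) k p (2*int k*m + int r) (of_real (- q))" proof -
 have k0: "(of_nat k :: complex) \<noteq> 0" using k by simp
 have t0: "\<tau> \<noteq> 0" using tau by auto
 have l: "lat k p (2*int k*m + int r) = of_real p + of_nat r/(2 * of_nat k) + of_int m" unfolding lat_def using k0 by (simp add: field_simps)
 define X where "X = of_real p + of_nat r/(2 * of_nat k) + (of_int m :: complex)"
 have r: "(of_nat r :: complex) = 2 * of_nat k*(X - of_real p - of_int m)" unfolding X_def using k0 by (simp add: field_simps)
 have "exp (- (tpi * of_nat r * of_real q))*exp (mtpi * of_nat k*X^2 / \<tau> - 4 * of_real pi*\<i> * of_nat k * of_int m * of_real q)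
  = exp (4 * of_real pi*\<i> * of_nat k * of_real p * of_real q)*exp (4 * of_real pi*\<i> * of_nat k * of_real (- q)*X + tpi * of_nat k*(- 1 / \<tau>)*X^2)"
  unfolding exp_add[symmetric] r by (rule arg_cong[where f=exp]) (use t0 in \<open>simp add: algebra_simps\<close>)
 then show ?thesis unfolding dual_def primal_def l X_def[symmetric] by (simp only: mult.assoc mult.left_commute)
qed

lemma sine_weight_period:
 assumes k: "k \<ge> 1" shows "sine_weight g k (2*int k*m + n) = sine_weight g k n" proof -
 have "int k dvd 2*int k*m + n \<longleftrightarrow> int k dvd n" by (metis dvd_add_right_iff dvd_mult dvd_triv_left mult.commute mult.left_commute)
 moreover have "pi*real_of_int (2*int k*m + n)/real k = pi*real_of_int n/real k + 2*pi * of_int m" using k by (simp add: field_simps)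
 ultimately show ?thesis unfolding sine_weight_def using sin.plus_of_int[of "pi*real_of_int n/real k" m] by (simp add: mult_ac)
qed

context half_form_setup
begin

lemma modulus_neq_0: "modulus \<noteq> 0" using modulus_pos by auto

lemma primal_summable_1:
 assumes k: "k \<ge> 1" shows "((\<lambda>n. primal modulus k q n P) has_sum (\<Sum>\<^sub>\<infinity>n. primal modulus k q n P)) UNIV"
 using primal_summable[OF modulus_pos k, of 1 q P] by simp

text \<open>The Verlinde numbers are replaced by their finite Fourier sum and Poisson summation is
  applied for each residue \<open>r\<close> separately; the \<open>2k\<close> dual series together
  run through all integers.\<close>

theorem Zsum_dual:
 assumes k: "k \<ge> 1" shows "Zsum g k (p, q) = of_real (sqrt (2/real k) powi (2 - 2*int g))/(2*\<i>) *
   (gauss_const (- of_real pi*\<i>*modulus/(2 * of_nat k))*exp (4 * of_real pi*\<i> * of_nat k * of_real p * of_real q)) *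
   (\<Sum>\<^sub>\<infinity>n. sine_weight g k n*primal (- 1/modulus) k p n (of_real (- q)))" proof -
 define D where "D = complex_of_real (sqrt (2/real k) powi (2 - 2*int g))/(2*\<i>)"
 define K where "K = gauss_const (- of_real pi*\<i>*modulus/(2 * of_nat k))*exp (4 * of_real pi*\<i> * of_nat k * of_real p * of_real q)"
 define f where "f = (\<lambda>n. sine_weight g k n*primal (- 1/modulus) k p n (of_real (- q)))"
 define s where "s = (\<lambda>r::nat. exp (- (tpi * of_nat r * of_real q))*(\<Sum>\<^sub>\<infinity>n. primal modulus k q n (of_real p + of_nat r/(2 * of_nat k))))"
 have k0: "(of_nat k :: complex) \<noteq> 0" using k by simp
 have K0: "K \<noteq> 0" using gauss_const_reciprocal[OF modulus_pos k] k0 unfolding K_def by (auto simp del: of_nat_eq_0_iff)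
 have 1: "((\<lambda>n. exp (\<i> * of_real pi * of_nat r * of_int n/of_nat k)*primal modulus k q n (of_real p)) has_sum s r) UNIV" for r :: nat
 proof -
  have "((\<lambda>n. exp (- (tpi * of_nat r * of_real q))*primal modulus k q n (of_real p + of_nat r/(2 * of_nat k))) has_sum s r) UNIV"
   unfolding s_def by (intro has_sum_cmult_right primal_summable_1 k)
  moreover have "exp (- (tpi * of_nat r * of_real q))*primal modulus k q n (of_real p + of_nat r/(2 * of_nat k))
   = exp (\<i> * of_real pi * of_nat r * of_int n/of_nat k)*primal modulus k q n (of_real p)" for n
   unfolding primal_half_period[OF k] by (simp add: mult.assoc[symmetric] exp_add[symmetric])
  ultimately show ?thesis by simp
 qed
 have "((\<lambda>n. \<Sum>r<2*k. sine_weight g k (int r)*(exp (\<i> * of_real pi * of_nat r * of_int n/of_nat k)*primal modulus k q n (of_real p))) has_sum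
  (\<Sum>r<2*k. sine_weight g k (int r) * s r)) UNIV" by (intro has_sum_finite_sum has_sum_cmult_right 1)
 then have "((\<lambda>n. D*(\<Sum>r<2*k. sine_weight g k (int r)*(exp (\<i> * of_real pi * of_nat r * of_int n/of_nat k)*primal modulus k q n (of_real p)))) has_sum
  D*(\<Sum>r<2*k. sine_weight g k (int r) * s r)) UNIV" by (rule has_sum_cmult_right)
 moreover have "D*(\<Sum>r<2*k. sine_weight g k (int r)*(exp (\<i> * of_real pi * of_nat r * of_int n/of_nat k)*primal modulus k q n (of_real p)))
  = of_real (verlinde g k n)*primal modulus k q n (of_real p)" for n
  unfolding verlinde_fourier[OF k] D_def by (simp add: sum_distrib_right mult.assoc)
 ultimately have Z: "Zsum g k (p, q) = D*(\<Sum>r<2*k. sine_weight g k (int r) * s r)" unfolding Zsum_def by (auto intro: infsumI)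
 have "((\<lambda>m. f (2*int k*m + int r)) has_sum (sine_weight g k (int r) * s r/K)) UNIV" for r :: nat proof -
  have "((\<lambda>m. exp (- (tpi * of_nat r * of_real q))*dual modulus k q m (of_real p + of_nat r/(2 * of_nat k))) has_sum s r) UNIV"
   unfolding s_def by (intro has_sum_cmult_right poisson_base modulus_pos k)
  then have "((\<lambda>m. K*primal (- 1/modulus) k p (2*int k*m + int r) (of_real (- q))) has_sum s r) UNIV"
   unfolding dual_eq_primal[OF modulus_pos k] K_def .
  then have "((\<lambda>m. (sine_weight g k (int r)/K)*(K*primal (- 1/modulus) k p (2*int k*m + int r) (of_real (- q)))) has_sum (sine_weight g k (int r)/K) * s r) UNIV"
   by (rule has_sum_cmult_right)
  then show ?thesis unfolding f_def sine_weight_period[OF k] using K0 by simp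
 qed
 then have "(f has_sum (\<Sum>r<2*k. sine_weight g k (int r) * s r/K)) UNIV" by (intro residue_classes_has_sum[OF k])
 then have "(\<Sum>\<^sub>\<infinity>n. f n) = (\<Sum>r<2*k. sine_weight g k (int r) * s r)/K" unfolding sum_divide_distrib by (rule infsumI)
 then show ?thesis unfolding Z D_def[symmetric] K_def[symmetric] f_def[symmetric] using K0 by simp
qed

end

lemma weighted_theta_bound:
 assumes tau: "Im \<tau> > 0"
 shows "\<exists>C\<ge>0. \<forall>k\<ge>1. \<forall>W Q P B. (\<forall>n. norm (W n) \<le> B) --> norm (\<Sum>\<^sub>\<infinity>n. W n*primal \<tau> k Q n (of_real P)) \<le> C*B*real k"
proof -
 have "2*pi*Im \<tau> > 0" using tau by simp
 from gaussian_moment_bound[OF this, of 0]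
 obtain C where C: "C \<ge> 0" "\<And>k Q. k \<ge> 1 ==> (\<lambda>n. exp (- (2*pi*Im \<tau>)*real k*(Q + pt k n)^2)) summable_on UNIV"
  "\<And>k Q. k \<ge> 1 ==> (\<Sum>\<^sub>\<infinity>n. exp (- (2*pi*Im \<tau>)*real k*(Q + pt k n)^2)) \<le> C*real k" by auto
 have "norm (\<Sum>\<^sub>\<infinity>n. W n*primal \<tau> k Q n (of_real P)) \<le> C*B*real k" if k: "k \<ge> 1" and W: "\<forall>n. norm (W n) \<le> B" for k W Q P B
 proof -
  have B0: "B \<ge> 0" using W norm_ge_zero order_trans by blast
  have le: "norm (W n*primal \<tau> k Q n (of_real P)) \<le> B*exp (- (2*pi*Im \<tau>)*real k*(Q + pt k n)^2)" for n
   unfolding norm_mult norm_primal by (rule mult_right_mono) (use W in auto)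
  have sm: "(\<lambda>n. B*exp (- (2*pi*Im \<tau>)*real k*(Q + pt k n)^2)) summable_on UNIV" by (intro summable_on_cmult_right C(2) k)
  have "(\<lambda>n. W n*primal \<tau> k Q n (of_real P)) summable_on UNIV"
   by (rule abs_summable_summable, rule Infinite_Sum.abs_summable_on_comparison_test'[OF sm le])
  then have "norm (\<Sum>\<^sub>\<infinity>n. W n*primal \<tau> k Q n (of_real P)) \<le> (\<Sum>\<^sub>\<infinity>n. B*exp (- (2*pi*Im \<tau>)*real k*(Q + pt k n)^2))"
   by (intro norm_infsum_le[OF has_sum_infsum has_sum_infsum] sm le)
  also have "... = B*(\<Sum>\<^sub>\<infinity>n. exp (- (2*pi*Im \<tau>)*real k*(Q + pt k n)^2))" by (rule infsum_cmult_right')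
  also have "... \<le> B*(C*real k)" by (intro mult_left_mono C(3) k B0)
  finally show ?thesis by (simp add: mult_ac)
 qed
 with C(1) show ?thesis by blast
qed

section \<open>Asymptotics of the state\<close>

text \<open>The theta sum in question peaks at \<open>n/(2k) = -p\<close>, hence the disc around
  \<open>-p0\<close>. The poles of the weight are the half-integers, and a small disc avoids them
  because \<open>2 * p0\<close> is not an integer.\<close>

lemma sine_weight_local:
 assumes p0: "2 * p0 \<notin> \<int>"
 shows "\<exists>\<rho>>0. (\<lambda>z. sin (2 * of_real pi*z) powi (1 - 2*int g)) holomorphic_on ball (complex_of_real (- p0)) (2*\<rho>) \<and>
  (\<forall>k n. k \<ge> 1 --> \<bar>pt k n - (- p0)\<bar> < \<rho> -->
   sine_weight g k n = sin (2 * of_real pi * of_real (pt k n)) powi (1 - 2*int g))" proof -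
 define S where "S = {z. sin (2 * of_real pi*z) \<noteq> (0 :: complex)}"
 have opS: "open S" unfolding S_def by (intro open_Collect_neq continuous_intros)
 have sr: "of_real x \<in> S \<longleftrightarrow> 2*x \<notin> \<int>" for x proof -
  have "sin (2 * of_real pi * complex_of_real x) = of_real (sin (2*pi*x))" by (simp flip: sin_of_real)
  then have "of_real x \<in> S \<longleftrightarrow> sin (2*pi*x) \<noteq> 0" by (simp add: S_def)
  also have "sin (2*pi*x) = 0 \<longleftrightarrow> 2*x \<in> \<int>" unfolding sin_zero_iff_int2 by (auto simp: Ints_def)
  finally show ?thesis .
 qed
 have "- (2 * p0) \<notin> \<int>" using p0 by (metis Ints_minus add.inverse_inverse)
 then have "complex_of_real (- p0) \<in> S" unfolding sr by simp
 then obtain e where e: "e > 0" "ball (complex_of_real (- p0)) e \<subseteq> S" using opS open_contains_ball by blast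
 have hol: "(\<lambda>z. sin (2 * of_real pi*z) powi (1 - 2*int g)) holomorphic_on ball (complex_of_real (- p0)) (2*(e/2))"
  by (intro holomorphic_intros) (use e(2) in \<open>auto simp: S_def\<close>)
 have loc: "sine_weight g k n = sin (2 * of_real pi * of_real (pt k n)) powi (1 - 2*int g)"
  if k: "k \<ge> 1" and n: "\<bar>pt k n - (- p0)\<bar> < e/2" for k n proof -
  have "dist (complex_of_real (- p0)) (of_real (pt k n)) < e"
   unfolding dist_of_real dist_real_def abs_minus_commute[of "- p0"] using n e(1) by linarith
  then have "complex_of_real (pt k n) \<in> S" using e(2) by auto
  then have ni: "2*(pt k n) \<notin> \<int>" unfolding sr .
  have "\<not> int k dvd n" proof
   assume "int k dvd n"
   then obtain t where "n = int k*t" by (elim dvdE)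
   then have "2*(pt k n) = of_int t" using k by simp
   then show False using ni by simp
  qed
  moreover have "sin (2 * of_real pi * complex_of_real (pt k n)) = of_real (sin (pi * of_int n/real k))" proof -
   have "2 * of_real pi * complex_of_real (pt k n) = of_real (pi * of_int n/real k)" by simp
   then show ?thesis by (simp only: sin_of_real)
  qed
  ultimately show ?thesis by (simp add: sine_weight_def)
 qed
 have "e/2 > 0" using e(1) by simp
 with hol loc show ?thesis by blast
qed

lemma powr_quarter_le: "k \<ge> 1 ==> (kp k) powr (1/4) \<le> real k" proof -
 assume k: "k \<ge> 1"
 have "real k/(2*pi) \<le> real k/1" using pi_gt3 by (intro divide_left_mono) auto
 then have "(kp k) powr (1/4) \<le> real k powr (1/4)" by (intro powr_mono2) auto
 also have "... \<le> real k powr 1" using k by (intro powr_mono) auto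
 finally show ?thesis using k by simp
qed

lemma sqrt_2k_le: "k \<ge> 1 ==> sqrt (2*real k) \<le> 2*real k" by (rule real_le_lsqrt) (auto simp: power2_eq_square)

context half_form_setup
begin

abbreviation qpre :: "nat => complex" where
 "qpre k \<equiv> of_real (1/sqrt 2*(kp k) powr (1/4))"

text \<open>Coefficient of the state along \<open>Om\<close>, with the unknown phase of the basis
  replaced by 1.\<close>

definition Z0 :: "nat => nat => plane => complex" where
 "Z0 g k x = qpre k *
   exp (mtpi * of_nat k * of_real (fst x) * of_real (snd x)) * Zsum g k x"

lemma norm_exp_pq: "norm (exp (mtpi * of_nat k * of_real p * of_real q)) = 1" proof -
 have "mtpi * of_nat k * of_real p * of_real q = \<i> * of_real (- 2*pi*real k*p*q)" by simp
 then show ?thesis by (simp only: norm_exp_i_times)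
qed

lemma Z0_bound:
 assumes g: "g \<ge> 1" shows "\<exists>C\<ge>0. \<forall>k\<ge>1. \<forall>x. norm (Z0 g k x) \<le> C*real k^(3 * g + 2)" proof -
 obtain C where C: "C \<ge> 0" "\<And>k W Q P B. k \<ge> 1 ==> (\<forall>n. norm (W n) \<le> B) ==> norm (\<Sum>\<^sub>\<infinity>n. W n*primal modulus k Q n (of_real P)) \<le> C*B*real k"
  using weighted_theta_bound[OF modulus_pos] by blast
 have "norm (Z0 g k x) \<le> C*real k^(3 * g + 2)" if k: "k \<ge> 1" for k x proof -
  have "norm (Zsum g k x) \<le> C*real k^(3 * g)*real k" unfolding Zsum_def by (rule C(2)[OF k]) (use verlinde_bound[OF k g] in simp)
  moreover have "norm (qpre k) \<le> 1*real k" unfolding norm_of_real abs_mult by (intro mult_mono) (use powr_quarter_le[OF k] in auto)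
  ultimately have "norm (Z0 g k x) \<le> (1*real k)*1*(C*real k^(3 * g)*real k)"
   unfolding Z0_def norm_mult norm_exp_pq using C(1) by (intro mult_mono) auto
  then show ?thesis by (simp add: power_add power2_eq_square mult_ac)
 qed
 with C(1) show ?thesis by blast
qed

context
 fixes \<Psi> :: "nat => int => plane => 'd"
 assumes basis: "\<And>k. k \<ge> 1 ==> quantum_basis j sc herm Om k (\<Psi> k)"
begin

lemma Z_state_phase:
 assumes k: "k \<ge> 1"
 shows "\<exists>u. norm u = 1 \<and> norm (u - 1) \<le> 4*norm (gsec k 0 0 - 1) \<and> (\<forall>x. Z_state \<Psi> g k x = sc (u * Z0 g k x) Om)"
proof (rule basis_0_eq[OF k basis[OF k]])
 fix u assume u: "norm u = 1" "norm (u - 1) \<le> 4*norm (gsec k 0 0 - 1)"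
  "\<And>x. \<Psi> k 0 x = sc (u * of_real ((kp k) powr (1/4)) * gsec k 0 x) Om"
 have "Z_state \<Psi> g k x = sc (u * Z0 g k x) Om" for x
  unfolding Z_state_eq[of k \<Psi> "u * of_real ((kp k) powr (1/4))", OF k basis[OF k] u(3)] Z0_def of_real_mult by (simp only: mult_ac)
 with u(1,2) show ?thesis by blast
qed

lemma Z_state_bound:
 assumes g: "g \<ge> 1" shows "\<exists>C\<ge>0. \<forall>k\<ge>1. \<forall>x. norm (Z_state \<Psi> g k x) \<le> C*real k^(3 * g + 2)" proof -
 obtain C where C: "C \<ge> 0" "\<And>k x. k \<ge> 1 ==> norm (Z0 g k x) \<le> C*real k^(3 * g + 2)" using Z0_bound[OF g] by blast
 have "norm (Z_state \<Psi> g k x) \<le> (C*norm Om)*real k^(3 * g + 2)" if k: "k \<ge> 1" for k x proof -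
  obtain u where u: "norm u = 1" "norm (u - 1) \<le> 4*norm (gsec k 0 0 - 1)" "\<And>x. Z_state \<Psi> g k x = sc (u * Z0 g k x) Om"
   using Z_state_phase[OF k] by blast
  have "norm (Z0 g k x)*norm Om \<le> C*real k^(3 * g + 2)*norm Om" by (intro mult_right_mono C(2) k) auto
  then show ?thesis unfolding u(3) norm_sc norm_mult u(1) by (simp add: mult_ac)
 qed
 moreover have "C*norm Om \<ge> 0" using C(1) by simp
 ultimately show ?thesis by blast
qed

text \<open>The phase error decays faster than any power of \<open>k\<close>, while
  \<open>Z0\<close> grows at most polynomially.\<close>

lemma Z_state_close:
 assumes g: "g \<ge> 1" shows "\<exists>C\<ge>0. \<forall>k\<ge>1. \<forall>x. norm (Z_state \<Psi> g k x - sc (Z0 g k x) Om) \<le> C/real k^n"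
proof -
 obtain C where C: "C \<ge> 0" "\<And>k x. k \<ge> 1 ==> norm (Z0 g k x) \<le> C*real k^(3 * g + 2)" using Z0_bound[OF g] by blast
 obtain D where D: "D \<ge> 0" "\<And>k. k \<ge> 1 ==> norm (gsec k 0 0 - 1) \<le> D/real k^(n + (3 * g + 2))" using theta_origin_close by blast
 have "norm (Z_state \<Psi> g k x - sc (Z0 g k x) Om) \<le> (4 * D*C*norm Om)/real k^n" if k: "k \<ge> 1" for k x proof -
  obtain u where u: "norm u = 1" "norm (u - 1) \<le> 4*norm (gsec k 0 0 - 1)" "\<And>x. Z_state \<Psi> g k x = sc (u * Z0 g k x) Om"
   using Z_state_phase[OF k] by blast
  have k0: "real k > 0" using k by simp
  have "Z_state \<Psi> g k x - sc (Z0 g k x) Om = sc ((u - 1) * Z0 g k x) Om"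
   unfolding u(3) using sc_add_left[of "(u - 1) * Z0 g k x" "Z0 g k x" Om] by (simp add: algebra_simps)
  then have "norm (Z_state \<Psi> g k x - sc (Z0 g k x) Om) = norm (u - 1)*norm (Z0 g k x)*norm Om" by (simp add: norm_sc norm_mult)
  also have "... \<le> (4*(D/real k^(n + (3 * g + 2))))*(C*real k^(3 * g + 2))*norm Om"
   by (intro mult_mono order_trans[OF u(2)] C(2) D(2) k) (use C(1) D(1) in \<open>auto intro!: D(2) k\<close>)
  also have "... = (4 * D*C*norm Om)/real k^n" using k0 by (simp add: power_add)
  finally show ?thesis .
 qed
 moreover have "4 * D*C*norm Om \<ge> 0" using C(1) D(1) by simp
 ultimately show ?thesis by blast
qed

lemma Z_state_quantum_space:
 assumes k: "k \<ge> 1" shows "Z_state \<Psi> g k \<in> quantum_space j sc k" proof -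
 have q: "\<Psi> k l \<in> quantum_space j sc k" for l by (rule basis[OF k, unfolded quantum_basis_def, THEN conjunct2, THEN conjunct1, THEN spec])
 have "(\<lambda>x. sc (of_real (1/sqrt 2)) (\<Sum>l\<in>{1..<k}. sc (of_real (N_coeff g k l)) (\<Psi> k (int l) x + sc (- 1) (\<Psi> k (- int l) x)))) \<in> quantum_space j sc k"
  by (intro quantum_space_scale quantum_space_sum quantum_space_add q)
 then show ?thesis unfolding Z_state_def sc_of_real sc_minus_1 by simp
qed

lemma Z_state_admissible:
 assumes g: "g \<ge> 1" shows "admissible j sc herm (Z_state \<Psi> g)" proof -
 obtain C where C: "C \<ge> 0" "\<And>k x. k \<ge> 1 ==> norm (Z_state \<Psi> g k x) \<le> C*real k^(3 * g + 2)" using Z_state_bound[OF g] by blast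
 have "quantum_norm herm (Z_state \<Psi> g k) \<le> (sqrt (4*pi)*C)*real k powr (3*real g + 2)" if k: "k \<ge> 1" for k proof -
  define B where "B = C*real k^(3 * g + 2)"
  have B0: "B \<ge> 0" using C(1) by (simp add: B_def)
  define f where "f = (\<lambda>x. herm (Z_state \<Psi> g k x) (Z_state \<Psi> g k x))"
  have fb: "norm (f x) \<le> B^2" for x unfolding f_def herm_norm norm_of_real using C(2)[OF k, of x] by (simp add: B_def power_mono)
  \<comment> \<open>If \<open>f\<close> is not integrable, its integral is 0 by convention and the
    bound is trivial.\<close>
  have "norm (integral (cbox (0, 0) (1, 1)) f) \<le> B^2" proof (cases "f integrable_on cbox (0, 0) (1, 1)")
   case True
   have "norm (integral (cbox (0, 0) (1, 1)) f) \<le> integral (cbox (0, 0) (1, 1)) (\<lambda>x::plane. B^2)"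
    by (rule integral_norm_bound_integral[OF True]) (use fb in auto)
   also have "... = B^2" by (simp add: content_Pair)
   finally show ?thesis .
  next
   case False
   then show ?thesis by (simp add: not_integrable_integral)
  qed
  then have "Re (quantum_inner herm (Z_state \<Psi> g k) (Z_state \<Psi> g k)) \<le> 4*pi*B^2"
   unfolding quantum_inner_def omega_mu_lam f_def[symmetric] using abs_Re_le_cmod[of "integral (cbox (0, 0) (1, 1)) f"] by simp
  then have "quantum_norm herm (Z_state \<Psi> g k) \<le> sqrt (4*pi*B^2)" unfolding quantum_norm_def by (rule real_sqrt_le_mono)
  also have "... = sqrt (4*pi)*B" using B0 by (simp add: real_sqrt_mult)
  also have "real k^(3 * g + 2) = real k powr real (3 * g + 2)" using k by (intro powr_realpow[symmetric]) simp
  then have "sqrt (4*pi)*B = (sqrt (4*pi)*C)*real k powr (3*real g + 2)" unfolding B_def by (simp add: add.commute)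
  finally show ?thesis .
 qed
 then show ?thesis unfolding admissible_def using Z_state_quantum_space by blast
qed

lemma Z_state_section:
 assumes k: "k \<ge> 1" shows "is_section sc k UNIV (Z_state \<Psi> g k)" using Z_state_quantum_space[OF k] unfolding quantum_space_def by blast

end

section \<open>Expansion near the first curve\<close>

abbreviation "pref g k \<equiv> qpre k*(of_real (sqrt (2/real k) powi (2 - 2*int g))/(2*\<i>)*gauss_const (- of_real pi*\<i>*modulus/(2 * of_nat k)))"

lemma Zsum_dual_bound:
 assumes g: "g \<ge> 1" shows "\<exists>C\<ge>0. \<forall>k\<ge>1. norm (pref g k) \<le> C*real k^(g + 1)" proof -
 define C where "C = 2/norm (csqrt (- \<i>*modulus))"
 have "norm (pref g k) \<le> C*real k^(g + 1)" if k: "k \<ge> 1" for k proof -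
  have a: "norm (qpre k) \<le> 1*real k" unfolding norm_of_real abs_mult by (intro mult_mono) (use powr_quarter_le[OF k] in auto)
  have b: "norm (complex_of_real (sqrt (2/real k) powi (2 - 2*int g))/(2*\<i>)) \<le> real k^(g - 1)" proof -
   have "norm (complex_of_real (sqrt (2/real k) powi (2 - 2*int g))/(2*\<i>)) = (real k/2)^(g - 1)/2"
    unfolding sqrt_powi_bound[OF k g] by (simp add: norm_divide norm_power norm_mult)
   also have "... \<le> (real k/2)^(g - 1)" by simp
   also have "... \<le> real k^(g - 1)" by (intro power_mono) auto
   finally show ?thesis .
  qed
  have c: "norm (gauss_const (- of_real pi*\<i>*modulus/(2 * of_nat k))) \<le> C*real k"
   unfolding gauss_const_kappa[OF modulus_pos k] norm_divide norm_of_real C_def using sqrt_2k_le[OF k] by (simp add: divide_right_mono)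
  have "norm (pref g k) \<le> (1*real k)*(real k^(g - 1)*(C*real k))"
   unfolding norm_mult[of "qpre k"] norm_mult[of "complex_of_real (sqrt (2/real k) powi (2 - 2*int g))/(2*\<i>)"]
   by (intro mult_mono a b c) (auto simp: C_def)
  also have "... = C*real k^(1 + (g - 1) + 1)" by (simp add: power_add)
  also have "1 + (g - 1) + 1 = g + 1" using g by simp
  finally show ?thesis .
 qed
 moreover have "C \<ge> 0" by (simp add: C_def)
 ultimately show ?thesis by blast
qed

lemma Z0_dual:
 assumes k: "k \<ge> 1" shows "Z0 g k (p, q) = pref g k*(exp (tpi * of_nat k * of_real p * of_real q) *
   (\<Sum>\<^sub>\<infinity>n. sine_weight g k n*primal (- 1/modulus) k p n (of_real (- q))))" proof -
 have "exp (mtpi * of_nat k * of_real p * of_real q)*exp (4 * of_real pi*\<i> * of_nat k * of_real p * of_real q) = exp (tpi * of_nat k * of_real p * of_real q)"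
  unfolding exp_add[symmetric] by (rule arg_cong[where f=exp]) simp
 then show ?thesis unfolding Z0_def Zsum_dual[OF k] fst_conv snd_conv by (simp add: mult_ac)
qed

text \<open>The two Poisson constants multiply to \<open>2k\<close>. Together with
  \<open>(k/2)^(g-1)\<close> from the Verlinde normalisation this gives the power
  \<open>(k/2pi)^g\<close> and the factor \<open>pi^g\<close>; the \<open>-i\<close> comes from the
  \<open>1/(2i)\<close> of the sine.\<close>

lemma region_1_constant:
 assumes k: "k \<ge> 1" and g: "g \<ge> 1" shows "pref g k*gauss_const (- of_real pi*\<i>*(- 1/modulus)/(2 * of_nat k))
  = of_real ((kp k) powr (1/4 + real g))*(- \<i> * of_real (sqrt 2*pi^g))" proof -
 have k0: "real k > 0" using k by simp
 have "(kp k) powr (1/4 + real g) = (kp k) powr (1/4)*(kp k)^g" unfolding powr_add using k0 by (simp add: powr_realpow)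
 moreover have "(real k/2)^(g - 1)*real k = 2*pi^g*(kp k)^g" proof -
  obtain h where h: "g = Suc h" using g by (cases g) auto
  show ?thesis unfolding h by (simp add: power_divide power_mult_distrib)
 qed
 moreover have "1/sqrt 2*a*(2*pi^g*X) = a*X*(sqrt 2*pi^g)" for a X proof -
  have "1/sqrt 2*a*(2*pi^g*X) = (2/sqrt 2)*(a*X*pi^g)" by simp
  also have "2/sqrt 2 = sqrt 2" by (simp add: real_div_sqrt)
  finally show ?thesis by (simp only: mult_ac)
 qed
 ultimately have r: "1/sqrt 2*(kp k) powr (1/4)*((real k/2)^(g - 1)*real k) = (kp k) powr (1/4 + real g)*(sqrt 2*pi^g)" by (simp only:)
 define K where "K = gauss_const (- of_real pi*\<i>*modulus/(2 * of_nat k))*gauss_const (- of_real pi*\<i>*(- 1/modulus)/(2 * of_nat k))"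
 have K: "K = 2 * of_nat k" unfolding K_def by (rule gauss_const_reciprocal[OF modulus_pos k])
 have "pref g k*gauss_const (- of_real pi*\<i>*(- 1/modulus)/(2 * of_nat k))
  = qpre k*(of_real ((real k/2)^(g - 1))/(2*\<i>))*K" unfolding sqrt_powi_bound[OF k g] K_def by (simp only: mult.assoc)
 also have "... = - \<i> * of_real (1/sqrt 2*(kp k) powr (1/4)*((real k/2)^(g - 1)*real k))" unfolding K by (simp add: field_simps)
 finally show ?thesis unfolding r by simp
qed

text \<open>Term of order \<open>i\<close> of the heat operator applied to
  \<open>sin(2 pi z)^(1-2g)\<close>. The argument is \<open>-z\<close> because the theta sum peaks
  at \<open>n/(2k) = -p\<close>; as the weight is odd, this turns \<open>-i\<close> into
  \<open>i\<close> in the leading symbol.\<close>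

definition amp1 :: "nat => nat => complex => complex" where
 "amp1 g i z = (- \<i> * of_real (sqrt 2*pi^g))*(beta (- 1/modulus) 1^i/fact i*(deriv ^^ (2*i)) (\<lambda>z. sin (2 * of_real pi*z) powi (1 - 2*int g)) (- z))"

abbreviation "rem1 g M k p q \<equiv> Z0 g k (p, q) - of_real ((kp k) powr (1/4 + real g))*(exp (tpi * of_real q*coord (p, q))^k*(\<Sum>i<M. amp1 g i (coord (p, q))/of_nat k^i))"

text \<open>\<open>theta_sum_asymptotics\<close> is applied to the modulus \<open>-1/modulus\<close>
  with \<open>Q = p\<close> and \<open>P = -q\<close>. The evaluation point becomes
  \<open>- coord (p, q)\<close>, and the surviving dual term times the phase is the
  \<open>k\<close>-th power of \<open>exp(2 pi i q coord (p, q))\<close>, up to a constant.\<close>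

theorem region_1_asymptotics:
 assumes g: "g \<ge> 1" and p0: "2 * p0 \<notin> \<int>"
 shows "\<exists>\<epsilon>>0. \<forall>M\<ge>1. \<exists>C\<ge>0. \<forall>k\<ge>1. \<forall>p q. \<bar>p - p0\<bar> \<le> \<epsilon> --> \<bar>q\<bar> \<le> \<epsilon> -->
  norm (rem1 g M k p q)
   \<le> C*real k^(g + 2)/real k^M" proof -
 define w where "w = (\<lambda>z::complex. sin (2 * of_real pi*z) powi (1 - 2*int g))"
 obtain \<rho> where \<rho>: "\<rho> > 0" "w holomorphic_on ball (of_real (- p0)) (2*\<rho>)"
  "\<And>k n. k \<ge> 1 ==> \<bar>pt k n - (- p0)\<bar> < \<rho> ==> sine_weight g k n = w (of_real (pt k n))"
  using sine_weight_local[OF p0, of g] unfolding w_def by blast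
 define \<tau>' where "\<tau>' = - 1/modulus"
 have t': "Im \<tau>' > 0" unfolding \<tau>'_def by (rule Im_minus_inverse[OF modulus_pos])
 then have nt: "norm \<tau>' > 0" by auto
 have Wb: "norm (sine_weight g k n) \<le> 1*real k^(2 * g)" if "k \<ge> 1" for k n using sine_weight_bound[OF that] by simp
 \<comment> \<open>The bounds keep \<open>p\<close> inside the disc of the weight, \<open>q\<close>
   in the range where one dual term survives, and the complex evaluation point inside the
   disc.\<close>
 define \<epsilon> where "\<epsilon> = min (\<rho>/2) (min (3/4) (norm \<tau>'*\<rho>/2))"
 have e0: "\<epsilon> > 0" using \<rho>(1) nt by (simp add: \<epsilon>_def)
 obtain C0 where C0: "C0 \<ge> 0" "\<And>k. k \<ge> 1 ==> norm (pref g k) \<le> C0*real k^(g + 1)" using Zsum_dual_bound[OF g] by blast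
 have "\<exists>C\<ge>0. \<forall>k\<ge>1. \<forall>p q. \<bar>p - p0\<bar> \<le> \<epsilon> --> \<bar>q\<bar> \<le> \<epsilon> -->
  norm (rem1 g M k p q)
   \<le> C*real k^(g + 2)/real k^M" if M: "M \<ge> 1" for M proof -
  have "\<exists>C1\<ge>0. \<forall>k\<ge>1. \<forall>Q P. \<bar>Q + - p0\<bar> \<le> \<rho>/2 --> \<bar>P\<bar> \<le> 3/4 --> \<bar>P\<bar> \<le> norm \<tau>'*\<rho>/2 -->
   norm ((\<Sum>\<^sub>\<infinity>n. sine_weight g k n*primal \<tau>' k Q n (of_real P)) -
    dual \<tau>' k Q 0 (of_real P)*(\<Sum>i<M. beta \<tau>' k^i/fact i*(deriv ^^ (2*i)) w (of_real (- Q) - of_real P / \<tau>')))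
    \<le> C1*real k/real k^M" by (rule theta_sum_asymptotics[OF t' \<rho>(1,2), where W="sine_weight g" and A=1 and M="2 * g"])
     (rule Wb, assumption, rule \<rho>(3), assumption, assumption, rule M)
  then obtain C1 where C1: "C1 \<ge> 0" "\<forall>k\<ge>1. \<forall>Q P. \<bar>Q + - p0\<bar> \<le> \<rho>/2 --> \<bar>P\<bar> \<le> 3/4 --> \<bar>P\<bar> \<le> norm \<tau>'*\<rho>/2 -->
   norm ((\<Sum>\<^sub>\<infinity>n. sine_weight g k n*primal \<tau>' k Q n (of_real P)) -
    dual \<tau>' k Q 0 (of_real P)*(\<Sum>i<M. beta \<tau>' k^i/fact i*(deriv ^^ (2*i)) w (of_real (- Q) - of_real P / \<tau>')))
    \<le> C1*real k/real k^M" by (elim exE conjE) (rule that)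
  have main: "norm (rem1 g M k p q)
   \<le> (C0 * C1)*real k^(g + 2)/real k^M" if k: "k \<ge> 1" and pq: "\<bar>p - p0\<bar> \<le> \<epsilon>" "\<bar>q\<bar> \<le> \<epsilon>" for k p q
  proof -
   define S where "S = (\<Sum>\<^sub>\<infinity>n. sine_weight g k n*primal \<tau>' k p n (of_real (- q)))"
   define A where "A = pref g k"
   define Ka where "Ka = gauss_const (- of_real pi*\<i>*\<tau>'/(2 * of_nat k))"
   define Sg where "Sg = (\<Sum>i<M. beta \<tau>' k^i/fact i*(deriv ^^ (2*i)) w (- coord (p, q)))"
   define X where "X = exp (tpi * of_nat k * of_real p * of_real q)"
   have m0: "modulus \<noteq> 0" by (rule modulus_neq_0)
   have arg: "of_real (- p) - of_real (- q) / \<tau>' = - coord (p, q)" unfolding \<tau>'_def coord_eq using m0 by (simp add: field_simps)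
   have dual: "X*dual \<tau>' k p 0 (of_real (- q)) = Ka*exp (tpi * of_real q*coord (p, q))^k"
    unfolding X_def dual_def Ka_def[symmetric] exp_of_nat_mult[symmetric] mult.left_commute[of _ Ka] exp_add[symmetric]
    by (rule arg_cong[where f="\<lambda>z. Ka*exp z"]) (use m0 in \<open>simp add: \<tau>'_def coord_eq field_simps power2_eq_square\<close>)
   have amp: "(- \<i> * of_real (sqrt 2*pi^g)) * Sg = (\<Sum>i<M. amp1 g i (coord (p, q))/of_nat k^i)"
    unfolding Sg_def sum_distrib_left amp1_def w_def[symmetric] \<tau>'_def[symmetric]
    by (rule sum.cong[OF refl], subst beta_scale) (simp add: power_divide)
   have AK: "A * Ka = of_real ((kp k) powr (1/4 + real g))*(- \<i> * of_real (sqrt 2*pi^g))"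
    unfolding A_def Ka_def \<tau>'_def by (rule region_1_constant[OF k g])
   have Zeq: "Z0 g k (p, q) = A*(X * S)" unfolding Z0_dual[OF k] A_def S_def X_def \<tau>'_def ..
   have Eeq: "of_real ((kp k) powr (1/4 + real g))*(E*(\<Sum>i<M. amp1 g i (coord (p, q))/of_nat k^i)) = (A * Ka)*(E * Sg)" for E
    unfolding AK amp[symmetric] by (simp only: mult_ac)
   have "rem1 g M k p q
    = A*(X * S) - (A * Ka)*(exp (tpi * of_real q*coord (p, q))^k * Sg)" unfolding Zeq Eeq ..
   also have "... = A*X * S - A*(Ka*exp (tpi * of_real q*coord (p, q))^k) * Sg" by (simp only: mult_ac)
   also have "... = A*X*(S - dual \<tau>' k p 0 (of_real (- q)) * Sg)" unfolding dual[symmetric] by (simp add: algebra_simps)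
   finally have "norm (rem1 g M k p q)
    = norm A*norm X*norm (S - dual \<tau>' k p 0 (of_real (- q)) * Sg)" by (simp only: norm_mult)
   also have "norm X = 1" unfolding X_def using norm_exp_pq[of k "- p" q] by simp
   also have "norm A*1*norm (S - dual \<tau>' k p 0 (of_real (- q)) * Sg) \<le> (C0*real k^(g + 1))*1*(C1*real k/real k^M)" proof (intro mult_mono)
    show "norm A \<le> C0*real k^(g + 1)" unfolding A_def by (rule C0(2)[OF k])
    show "norm (S - dual \<tau>' k p 0 (of_real (- q)) * Sg) \<le> C1*real k/real k^M"
     unfolding S_def Sg_def arg[symmetric] by (rule C1(2)[rule_format, OF k]) (use pq in \<open>auto simp: \<epsilon>_def\<close>)
   qed (use C0(1) in auto)
   finally show ?thesis by (simp add: mult_ac)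
  qed
  have "C0 * C1 \<ge> 0" using C0(1) C1(1) by simp
  then show ?thesis by (intro exI[of _ "C0 * C1"] conjI allI impI) (assumption, rule main)
 qed
 note H = this
 show ?thesis proof (intro exI[of _ \<epsilon>] conjI e0, rule allI, rule impI)
  fix M :: nat assume "1 \<le> M"
  then show "\<exists>C\<ge>0. \<forall>k\<ge>1. \<forall>p q. \<bar>p - p0\<bar> \<le> \<epsilon> --> \<bar>q\<bar> \<le> \<epsilon> -->
  norm (rem1 g M k p q)
   \<le> C*real k^(g + 2)/real k^M" by (rule H)
 qed
qed

theorem region_1_negligible:
 assumes g: "g \<ge> 1" and p0: "2 * p0 \<notin> \<int>" and \<delta>: "\<delta> > 0"
 shows "\<exists>\<epsilon>>0. \<forall>n. \<exists>C\<ge>0. \<forall>k\<ge>1. \<forall>p q. \<bar>p - p0\<bar> \<le> \<epsilon> --> \<delta> \<le> \<bar>q\<bar> --> \<bar>q\<bar> \<le> 3/4 -->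
  norm (Z0 g k (p, q)) \<le> C/real k^n" proof -
 define w where "w = (\<lambda>z::complex. sin (2 * of_real pi*z) powi (1 - 2*int g))"
 obtain \<rho> where \<rho>: "\<rho> > 0" "w holomorphic_on ball (of_real (- p0)) (2*\<rho>)"
  "\<And>k n. k \<ge> 1 ==> \<bar>pt k n - (- p0)\<bar> < \<rho> ==> sine_weight g k n = w (of_real (pt k n))"
  using sine_weight_local[OF p0, of g] unfolding w_def by blast
 have t': "Im (- 1/modulus) > 0" by (rule Im_minus_inverse[OF modulus_pos])
 have Wb: "norm (sine_weight g k n) \<le> 1*real k^(2 * g)" if "k \<ge> 1" for k n using sine_weight_bound[OF that] by simp
 obtain C0 where C0: "C0 \<ge> 0" "\<And>k. k \<ge> 1 ==> norm (pref g k) \<le> C0*real k^(g + 1)" using Zsum_dual_bound[OF g] by blast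
 have "\<exists>C\<ge>0. \<forall>k\<ge>1. \<forall>p q. \<bar>p - p0\<bar> \<le> \<rho>/2 --> \<delta> \<le> \<bar>q\<bar> --> \<bar>q\<bar> \<le> 3/4 --> norm (Z0 g k (p, q)) \<le> C/real k^n" for n
 proof -
  have "\<exists>C1\<ge>0. \<forall>k\<ge>1. \<forall>Q P. \<bar>Q + - p0\<bar> \<le> \<rho>/2 --> \<bar>P\<bar> \<le> 3/4 --> \<delta> \<le> \<bar>P\<bar> -->
   norm (\<Sum>\<^sub>\<infinity>n. sine_weight g k n*primal (- 1/modulus) k Q n (of_real P)) \<le> C1/real k^(n + (g + 1))"
   by (rule theta_sum_negligible[OF t' \<rho>(1,2), where W="sine_weight g" and A=1 and M="2 * g"])
     (rule Wb, assumption, rule \<rho>(3), assumption, assumption, rule \<delta>)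
  then obtain C1 where C1: "C1 \<ge> 0" "\<forall>k\<ge>1. \<forall>Q P. \<bar>Q + - p0\<bar> \<le> \<rho>/2 --> \<bar>P\<bar> \<le> 3/4 --> \<delta> \<le> \<bar>P\<bar> -->
   norm (\<Sum>\<^sub>\<infinity>n. sine_weight g k n*primal (- 1/modulus) k Q n (of_real P)) \<le> C1/real k^(n + (g + 1))"
   by (elim exE conjE) (rule that)
  have main: "norm (Z0 g k (p, q)) \<le> (C0 * C1)/real k^n" if k: "k \<ge> 1" and pq: "\<bar>p - p0\<bar> \<le> \<rho>/2" "\<delta> \<le> \<bar>q\<bar>" "\<bar>q\<bar> \<le> 3/4" for k p q
  proof -
   have k0: "real k > 0" using k by simp
   have X: "norm (exp (tpi * of_nat k * of_real p * of_real q)) = 1" using norm_exp_pq[of k "- p" q] by simp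
   define A where "A = pref g k"
   have "norm (Z0 g k (p, q)) = norm A*norm (\<Sum>\<^sub>\<infinity>n. sine_weight g k n*primal (- 1/modulus) k p n (of_real (- q)))"
    unfolding Z0_dual[OF k] A_def[symmetric] norm_mult X by simp
   also have "... \<le> (C0*real k^(g + 1))*(C1/real k^(n + (g + 1)))" proof (intro mult_mono)
    show "norm A \<le> C0*real k^(g + 1)" unfolding A_def by (rule C0(2)[OF k])
    show "norm (\<Sum>\<^sub>\<infinity>n. sine_weight g k n*primal (- 1/modulus) k p n (of_real (- q))) \<le> C1/real k^(n + (g + 1))"
     by (rule C1(2)[rule_format, OF k]) (use pq in auto)
   qed (use C0(1) in auto)
   also have "... = (C0 * C1)/real k^n" using k0 by (simp add: power_add)
   finally show ?thesis .
  qed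
  have "C0 * C1 \<ge> 0" using C0(1) C1(1) by simp
  then show ?thesis by (intro exI[of _ "C0 * C1"] conjI allI impI) (assumption, rule main)
 qed
 note H = this
 have "\<rho>/2 > 0" using \<rho>(1) by simp
 then show ?thesis using H by (rule_tac exI[of _ "\<rho>/2"]) (rule conjI, assumption, rule allI, rule H)
qed

end

section \<open>Expansion near the second curve\<close>

lemma verlinde_even:
 assumes n: "even n" shows "verlinde g k n = 0" proof (cases "k = 0")
 case False
 define f where "f = (\<lambda>m. S_coeff k m 1 powi (1 - 2*int g)*(sqrt (2/real k) * sin (pi*real m * of_int n/real k)))"
 obtain b where b: "n = 2*b" using n by (elim evenE)
 \<comment> \<open>The reflection \<open>m -> k - m\<close> fixes \<open>S_coeff k m 1\<close> and,
   for even \<open>n\<close>, changes the sign of the other sine.\<close>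
 have "f (k - m) = - f m" if m: "m \<in> {1..<k}" for m proof -
  have r: "real (k - m) = real k - real m" using m by (simp add: of_nat_diff)
  have e1: "pi*real (k - m)*1/real k = pi - pi*real m*1/real k" unfolding r using False by (simp add: field_simps)
  have e2: "pi*real (k - m) * of_int n/real k = - (pi*real m * of_int n/real k) + 2*pi * of_int b"
   unfolding r b using False by (simp add: field_simps)
  have "sin (pi*real (k - m) * of_int n/real k) = - sin (pi*real m * of_int n/real k)"
   unfolding e2 using sin.plus_of_int[of "- (pi*real m * of_int n/real k)" b] by (simp add: mult_ac)
  moreover have "S_coeff k (k - m) 1 = S_coeff k m 1" unfolding S_coeff_def of_nat_1 e1 by simp
  ultimately show ?thesis unfolding f_def by simp
 qed
 then have "(\<Sum>m\<in>{1..<k}. f m) = (\<Sum>m\<in>{1..<k}. - f m)"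
  by (intro sum.reindex_bij_witness[of _ "\<lambda>m. k - m" "\<lambda>m. k - m"]) auto
 then have "(\<Sum>m\<in>{1..<k}. f m) = 0" by (simp add: sum_negf)
 then show ?thesis unfolding verlinde_def f_def .
qed (simp add: verlinde_def)

definition cpoly :: "real poly => complex => complex" where
 "cpoly p z = (\<Sum>i\<le>degree p. of_real (coeff p i)*z^i)"

lemma cpoly_of_real: "cpoly p (of_real x) = of_real (poly p x)" by (simp add: cpoly_def poly_altdef)

lemma holomorphic_cpoly: "(\<lambda>z. cpoly p (2*z)) holomorphic_on S" unfolding cpoly_def by (intro holomorphic_intros)

lemma sum_shift_down: "(\<Sum>l<M. if a \<le> l then f (l - a) else 0) = (\<Sum>i<M - a. f i)" for f :: "nat => complex"
 by (induction M) (auto simp: Suc_diff_le)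

text \<open>Regroups by total order the powers \<open>x^(-2m)\<close> from the Verlinde polynomials
  and \<open>x^(-i)\<close> from the heat operator. The bound \<open>M - 2*m\<close> is truncated
  subtraction: the inner sum is empty once \<open>2m >= M\<close>.\<close>

lemma sum_shifted_expansions:
 fixes x :: complex
 shows "(\<Sum>m<g. 1/x^(2*m)*(\<Sum>i<M - 2*m. b m i/x^i)) = (\<Sum>l<M. (\<Sum>m | m < g \<and> 2*m \<le> l. b m (l - 2*m))/x^l)" proof -
 have "(\<Sum>m<g. 1/x^(2*m)*(\<Sum>i<M - 2*m. b m i/x^i)) = (\<Sum>m<g. \<Sum>i<M - 2*m. b m i/x^(i + 2*m))"
  by (simp add: sum_distrib_left power_add mult.commute)
 also have "... = (\<Sum>m<g. \<Sum>l<M. if 2*m \<le> l then b m (l - 2*m)/x^(l - 2*m + 2*m) else 0)"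
  unfolding sum_shift_down[where f="\<lambda>i. b m i/x^(i + 2*m)" and a="2*m" for m] ..
 also have "... = (\<Sum>l<M. \<Sum>m<g. if 2*m \<le> l then b m (l - 2*m)/x^(l - 2*m + 2*m) else 0)" by (rule sum.swap)
 also have "... = (\<Sum>l<M. (\<Sum>m | m < g \<and> 2*m \<le> l. b m (l - 2*m))/x^l)" proof (rule sum.cong[OF refl])
  fix l
  have "(\<Sum>m<g. if 2*m \<le> l then b m (l - 2*m)/x^(l - 2*m + 2*m) else 0) = (\<Sum>m | m < g \<and> 2*m \<le> l. b m (l - 2*m)/x^(l - 2*m + 2*m))"
   by (rule sum.mono_neutral_cong_right) auto
  also have "... = (\<Sum>m | m < g \<and> 2*m \<le> l. b m (l - 2*m)/x^l)" by (rule sum.cong) auto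
  finally show "(\<Sum>m<g. if 2*m \<le> l then b m (l - 2*m)/x^(l - 2*m + 2*m) else 0) = (\<Sum>m | m < g \<and> 2*m \<le> l. b m (l - 2*m))/x^l"
   by (simp only: sum_divide_distrib)
 qed
 finally show ?thesis .
qed

text \<open>\<open>O(h k)\<close> uniformly on \<open>D\<close>, with one constant for all
  \<open>k >= 1\<close>; it keeps the constants out of sums of several error terms.\<close>

definition unif_bigo :: "(real => real => bool) => (nat => real) => (nat => real => real => complex) => bool" where
 "unif_bigo D h f \<longleftrightarrow> (\<exists>C\<ge>0. \<forall>k\<ge>1. \<forall>p q. D p q --> norm (f k p q) \<le> C*h k)"

lemma unif_bigo_add:
 assumes "unif_bigo D h f" "unif_bigo D h f'" shows "unif_bigo D h (\<lambda>k p q. f k p q + f' k p q)" proof -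
 obtain C C' where C: "C \<ge> 0" "\<forall>k\<ge>1. \<forall>p q. D p q --> norm (f k p q) \<le> C*h k"
  and C': "C' \<ge> 0" "\<forall>k\<ge>1. \<forall>p q. D p q --> norm (f' k p q) \<le> C'*h k" using assms unfolding unif_bigo_def by auto
 have "norm (f k p q + f' k p q) \<le> (C + C')*h k" if "k \<ge> 1" "D p q" for k p q proof -
  have "norm (f k p q + f' k p q) \<le> norm (f k p q) + norm (f' k p q)" by (rule norm_triangle_ineq)
  also have "... \<le> C*h k + C'*h k" using C(2) C'(2) that by (intro add_mono) auto
  finally show ?thesis by (simp add: algebra_simps)
 qed
 then show ?thesis unfolding unif_bigo_def using C(1) C'(1) by (intro exI[of _ "C + C'"]) auto
qed

lemma unif_bigo_sum:
 assumes "\<And>i. i \<in> A ==> unif_bigo D h (f i)" shows "unif_bigo D h (\<lambda>k p q. \<Sum>i\<in>A. f i k p q)" proof -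
 have "unif_bigo D h (\<lambda>k p q. 0)" unfolding unif_bigo_def by (intro exI[of _ 0]) auto
 then show ?thesis using assms by (induction A rule: infinite_finite_induct) (simp_all add: unif_bigo_add)
qed

lemma unif_bigo_mult:
 assumes f: "unif_bigo D h f" and c: "\<And>k p q. k \<ge> 1 ==> D p q ==> norm (c k p q) \<le> B * s k" "\<And>k. k \<ge> 1 ==> B * s k \<ge> 0" "B \<ge> 0"
  and le: "\<And>k. k \<ge> 1 ==> s k*h k \<le> h' k" shows "unif_bigo D h' (\<lambda>k p q. c k p q * f k p q)" proof -
 obtain C where C: "C \<ge> 0" "\<forall>k\<ge>1. \<forall>p q. D p q --> norm (f k p q) \<le> C*h k" using f unfolding unif_bigo_def by auto
 have "norm (c k p q * f k p q) \<le> (B*C)*h' k" if kd: "k \<ge> 1" "D p q" for k p q proof -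
  have "norm (c k p q * f k p q) \<le> (B * s k)*(C*h k)" unfolding norm_mult using C(2) kd by (intro mult_mono c) auto
  also have "... = (B*C)*(s k*h k)" by simp
  also have "... \<le> (B*C)*h' k" by (intro mult_left_mono le) (use kd c(3) C(1) in auto)
  finally show ?thesis .
 qed
 moreover have "B*C \<ge> 0" using c(3) C(1) by simp
 ultimately show ?thesis unfolding unif_bigo_def by blast
qed

lemma weighted_theta_summable:
 assumes tau: "Im \<tau> > 0" and k: "k \<ge> 1" and W: "\<And>n. norm (W n) \<le> B"
 shows "((\<lambda>n. W n*primal \<tau> k Q n (of_real P)) has_sum (\<Sum>\<^sub>\<infinity>n. W n*primal \<tau> k Q n (of_real P))) UNIV" proof -
 have c: "2*pi*Im \<tau> > 0" using tau by simp
 have sm: "(\<lambda>n. B*exp (- (2*pi*Im \<tau>)*real k*(Q + pt k n)^2)) summable_on UNIV"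
  using gaussian_moment_bound[OF c, of 0] k by (intro summable_on_cmult_right) auto
 have le: "norm (W n*primal \<tau> k Q n (of_real P)) \<le> B*exp (- (2*pi*Im \<tau>)*real k*(Q + pt k n)^2)" for n
  unfolding norm_mult norm_primal by (rule mult_right_mono) (use W in auto)
 show ?thesis by (rule has_sum_infsum, rule abs_summable_summable, rule Infinite_Sum.abs_summable_on_comparison_test'[OF sm le])
qed

lemma exp_i_pi_int: "exp (\<i> * of_real pi * of_int n) = (if even n then 1 else - 1 :: complex)" proof -
 have "exp (\<i> * of_real pi * of_int n) = cis (pi * of_int n)" by (simp add: cis_conv_exp mult.assoc)
 also have "... = (if even n then 1 else - 1)" by (simp add: complex_eq_iff cos_integer_2pi minus_one_power_iff cos_npi_int mult.commute)
 finally show ?thesis .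
qed

context half_form_setup
begin

context
 fixes g :: nat and P :: "nat => real poly"
begin

text \<open>The polynomial stands for Verlinde numbers over one period only, and the cut-off keeps
  the weight bounded. In terms of \<open>n/(2k)\<close> the period is \<open>(0, 1)\<close>, which
  corresponds to \<open>-1 < q < 0\<close>.\<close>

definition Wpol :: "nat => nat => int => complex" where
 "Wpol m k n = (if 0 < n \<and> n < 2*int k then of_real (poly (P m) (of_int n/real k)) else 0)"

text \<open>Zero for \<open>0 < n < 2k\<close> and polynomially bounded elsewhere, hence a weight
  whose local function is 0 and which leaves no trace in the expansion.\<close>

definition Wrest :: "nat => int => complex" where
 "Wrest k n = of_real (verlinde g k n)/of_real ((kp k)^(3 * g - 2)) - (if odd n then \<Sum>m<g. Wpol m k n/of_nat k^(2*m) else 0)"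

definition Tpol :: "nat => nat => real => real => complex" where
 "Tpol m k p q = (\<Sum>\<^sub>\<infinity>n. Wpol m k n*primal modulus k q n (of_real p))"

definition Trest :: "nat => real => real => complex" where
 "Trest k p q = (\<Sum>\<^sub>\<infinity>n. Wrest k n*primal modulus k q n (of_real p))"

text \<open>At order \<open>l\<close> the polynomial of index \<open>m\<close>, which carries
  \<open>k^(-2m)\<close>, enters with heat order \<open>l - 2m\<close>. The factor
  \<open>1/csqrt(-i modulus)\<close> stems from the Poisson constant; up to an eighth root of unity
  it is the coefficient of the half-form of \<open>dq\<close>.\<close>

definition amp2 :: "nat => complex => complex" where
 "amp2 l z = of_real (sqrt (pi/2))/csqrt (- \<i>*modulus)*(\<Sum>m | m < g \<and> 2*m \<le> l.
   beta modulus 1^(l - 2*m)/fact (l - 2*m)*(deriv ^^ (2*(l - 2*m))) (\<lambda>z. cpoly (P m) (2*z)) (- z/modulus))"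

abbreviation "rem2 M k p q \<equiv> Z0 g k (p, q) - of_real ((kp k) powr (1/4 + (3*real g - 3/2)))*(exp (- (tpi/modulus) * of_real p*coord (p, q))^k*(\<Sum>i<M. amp2 i (coord (p, q))/of_nat k^i))"

context
 assumes g: "g \<ge> 1"
  and P: "\<And>k l. k \<ge> 1 ==> odd l \<and> 1 \<le> l \<and> l \<le> k - 1 ==>
    N_coeff g k l = (kp k)^(3 * g - 2)*(\<Sum>m<g. poly (P m) (real l/real k)/real k^(2*m))"
begin

lemma Wpol_bound: "\<exists>B\<ge>0. \<forall>k n. norm (Wpol m k n) \<le> B" proof -
 have "compact ((\<lambda>x. poly (P m) x) ` {0..2})" by (intro compact_continuous_image continuous_intros) auto
 then have "bounded ((\<lambda>x. poly (P m) x) ` {0..2})" by (rule compact_imp_bounded)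
 then obtain B where B: "B > 0" "\<And>x. x \<in> {0..2} ==> \<bar>poly (P m) x\<bar> \<le> B" unfolding bounded_pos by auto
 have "norm (Wpol m k n) \<le> B" for k n proof (cases "0 < n \<and> n < 2*int k")
  case True
  then have "real_of_int n < real_of_int (2*int k)" by (simp only: of_int_less_iff)
  then have "real_of_int n/real k \<in> {0..2}" using True by (auto simp: field_simps)
  then show ?thesis using B(2) True by (simp add: Wpol_def)
 qed (use B(1) in \<open>auto simp: Wpol_def\<close>)
 then show ?thesis using B(1) by (intro exI[of _ B]) auto
qed

text \<open>For \<open>n < k\<close> this is the hypothesis \<open>P\<close>. For
  \<open>n > k\<close> one reflects to \<open>2k - n\<close>, under which Verlinde numbers and
  polynomials change sign together. At \<open>n = k\<close> both sides vanish, the polynomials being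
  antisymmetric about 1.\<close>

lemma verlinde_Wpol:
 assumes k: "k \<ge> 1" and n: "odd n" "0 < n" "n < 2*int k"
 shows "complex_of_real (verlinde g k n) = of_real ((kp k)^(3 * g - 2))*(\<Sum>m<g. Wpol m k n/of_nat k^(2*m))" proof -
 have main: "verlinde g k n = (kp k)^(3 * g - 2)*(\<Sum>m<g. poly (P m) (of_int n/real k)/real k^(2*m))" proof -
  have k0: "real k > 0" using k by simp
  have small: "verlinde g k l = (kp k)^(3 * g - 2)*(\<Sum>m<g. poly (P m) (of_int l/real k)/real k^(2*m))"
   if l: "odd l" "0 < l" "l < int k" for l proof -
   define l' where "l' = nat l"
   have l': "l = int l'" "odd l'" "1 \<le> l'" "l' \<le> k - 1" using l by (auto simp: l'_def even_nat_iff)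
   show ?thesis unfolding l'(1) verlinde_nat using P[OF k, of l'] l' by simp
  qed
  have anti: "poly (P m) (2 - y) = - poly (P m) y" if "m < g" for m y by (rule leading_polynomials_antisymmetric[OF g _ that]) (rule P)
  consider "n < int k" | "n = int k" | "n > int k" by linarith
  then show ?thesis proof cases
   case 1
   then show ?thesis using small n by blast
  next
   case 2
   have "poly (P m) 1 = 0" if "m < g" for m using anti[OF that, of 1] by simp
   then show ?thesis unfolding 2 verlinde_k using k0 by simp
  next
   case 3
   define l where "l = 2*int k - n"
   have l: "odd l" "0 < l" "l < int k" using n 3 by (auto simp: l_def)
   have "verlinde g k n = verlinde g k (- l + 2*int k*1)" by (simp add: l_def)
   also have "... = - verlinde g k l" unfolding verlinde_period[OF k] verlinde_minus ..
   also have "... = (kp k)^(3 * g - 2)*(\<Sum>m<g. - poly (P m) (of_int l/real k)/real k^(2*m))" unfolding small[OF l] by (simp add: sum_negf)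
   also have "(\<Sum>m<g. - poly (P m) (of_int l/real k)/real k^(2*m)) = (\<Sum>m<g. poly (P m) (of_int n/real k)/real k^(2*m))"
   proof (rule sum.cong[OF refl])
    fix m assume "m \<in> {..<g}"
    moreover have "of_int n/real k = 2 - of_int l/real k" using k0 by (simp add: l_def field_simps)
    ultimately show "- poly (P m) (of_int l/real k)/real k^(2*m) = poly (P m) (of_int n/real k)/real k^(2*m)"
     using anti[of m "of_int l/real k"] by simp
   qed
   finally show ?thesis .
  qed
 qed
 show ?thesis unfolding main Wpol_def using n by simp
qed

lemma c_neq_0: "k \<ge> 1 ==> complex_of_real ((kp k)^(3 * g - 2)) \<noteq> 0" by simp

lemma Wrest_local:
 assumes k: "k \<ge> 1" and n: "0 < n" "n < 2*int k" shows "Wrest k n = 0"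
 using verlinde_Wpol[OF k _ n] verlinde_even[of n g k] c_neq_0[OF k] unfolding Wrest_def by (cases "even n") auto

lemma Wrest_bound: "\<exists>B\<ge>0. \<forall>k\<ge>1. \<forall>n. norm (Wrest k n) \<le> B*real k^(3 * g)" proof -
 have "\<forall>m. \<exists>B. B \<ge> 0 \<and> (\<forall>k n. norm (Wpol m k n) \<le> B)" using Wpol_bound by blast
 then obtain B where B: "\<And>m. B m \<ge> 0" "\<And>m k n. norm (Wpol m k n) \<le> B m" using choice by metis
 define B' where "B' = (2*pi)^(3 * g - 2) + (\<Sum>m<g. B m)"
 have "norm (Wrest k n) \<le> B'*real k^(3 * g)" if k: "k \<ge> 1" for k n proof -
  have k1: "real k \<ge> 1" using k by simp
  have "norm (complex_of_real (verlinde g k n)/of_real ((kp k)^(3 * g - 2))) = \<bar>verlinde g k n\<bar>*((2*pi)^(3 * g - 2)/real k^(3 * g - 2))"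
   by (simp add: norm_divide norm_power norm_mult power_divide)
  also have "... \<le> real k^(3 * g)*((2*pi)^(3 * g - 2)/1)" using k1 by (intro mult_mono verlinde_bound[OF k g] divide_left_mono) auto
  finally have 1: "norm (complex_of_real (verlinde g k n)/of_real ((kp k)^(3 * g - 2))) \<le> (2*pi)^(3 * g - 2)*real k^(3 * g)" by (simp add: mult.commute)
  have "norm (\<Sum>m<g. Wpol m k n/of_nat k^(2*m)) \<le> (\<Sum>m<g. B m)" proof (rule sum_norm_le)
   fix m
   have "norm (Wpol m k n/of_nat k^(2*m)) \<le> B m/1" unfolding norm_divide norm_power norm_of_nat by (intro frac_le B(2) B(1)) (use k1 in auto)
   then show "norm (Wpol m k n/of_nat k^(2*m)) \<le> B m" by simp
  qed
  also have "... \<le> (\<Sum>m<g. B m)*real k^(3 * g)"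
   using mult_left_mono[of 1 "real k^(3 * g)" "\<Sum>m<g. B m"] k1 B(1) by (simp add: sum_nonneg)
  finally have 2: "norm (\<Sum>m<g. Wpol m k n/of_nat k^(2*m)) \<le> (\<Sum>m<g. B m)*real k^(3 * g)" .
  have 3: "norm (if odd n then \<Sum>m<g. Wpol m k n/of_nat k^(2*m) else 0) \<le> (\<Sum>m<g. B m)*real k^(3 * g)"
   using 2 order_trans[OF norm_ge_zero 2] by simp
  have "norm (Wrest k n) \<le> (2*pi)^(3 * g - 2)*real k^(3 * g) + (\<Sum>m<g. B m)*real k^(3 * g)"
   unfolding Wrest_def by (rule order_trans[OF norm_triangle_ineq4 add_mono[OF 1 3]])
  then show ?thesis by (simp add: B'_def distrib_right)
 qed
 moreover have "B' \<ge> 0" unfolding B'_def using B(1) by (simp add: sum_nonneg)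
 ultimately show ?thesis by blast
qed

text \<open>The odd part of a theta sum with weight \<open>w\<close> is half the difference of its values at \<open>p\<close> and \<open>p + 1/2\<close>.\<close>

lemma Zsum_odd_part:
 assumes k: "k \<ge> 1" shows "Zsum g k (p, q) = of_real ((kp k)^(3 * g - 2)) *
  ((\<Sum>m<g. 1/of_nat k^(2*m)*(1/2*(Tpol m k p q - exp (- (tpi * of_nat k * of_real q)) * Tpol m k (p + 1/2) q))) + Trest k p q)" proof -
 define c where "c = complex_of_real ((kp k)^(3 * g - 2))"
 define e where "e = exp (- (tpi * of_nat k * complex_of_real q))"
 have c0: "c \<noteq> 0" unfolding c_def by (rule c_neq_0[OF k])
 have k0: "(of_nat k :: complex) \<noteq> 0" using k by simp
 obtain B where B: "\<forall>n. norm (Wrest k n) \<le> B*real k^(3 * g)" using Wrest_bound k by blast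
 have sW: "((\<lambda>n. Wpol m k n*primal modulus k q n (of_real x)) has_sum Tpol m k x q) UNIV" for m x proof -
  obtain B where "\<And>n. norm (Wpol m k n) \<le> B" using Wpol_bound[of m] by blast
  from weighted_theta_summable[OF modulus_pos k, of "Wpol m k", OF this] show ?thesis unfolding Tpol_def .
 qed
 have sR: "((\<lambda>n. Wrest k n*primal modulus k q n (of_real p)) has_sum Trest k p q) UNIV"
  unfolding Trest_def by (rule weighted_theta_summable[OF modulus_pos k]) (rule B[rule_format])
 have "((\<lambda>n. c*((\<Sum>m<g. 1/of_nat k^(2*m)*(1/2*(Wpol m k n*primal modulus k q n (of_real p) + - e*(Wpol m k n*primal modulus k q n (of_real (p + 1/2)))))) + Wrest k n*primal modulus k q n (of_real p))) has_sum
  c*((\<Sum>m<g. 1/of_nat k^(2*m)*(1/2*(Tpol m k p q + - e * Tpol m k (p + 1/2) q))) + Trest k p q)) UNIV"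
  by (intro has_sum_cmult_right has_sum_add has_sum_finite_sum sW sR)
 moreover have "c*((\<Sum>m<g. 1/of_nat k^(2*m)*(1/2*(Wpol m k n*primal modulus k q n (of_real p) + - e*(Wpol m k n*primal modulus k q n (of_real (p + 1/2)))))) + Wrest k n*primal modulus k q n (of_real p))
  = of_real (verlinde g k n)*primal modulus k q n (of_real p)" for n proof -
  define s where "s = (if even n then 1 else - 1 :: complex)"
  define pr where "pr = primal modulus k q n (of_real p)"
  define w where "w = (\<Sum>m<g. Wpol m k n/of_nat k^(2*m))"
  \<comment> \<open>The half period is the translation by \<open>r/(2k)\<close> with
    \<open>r = k\<close>, whose character is \<open>(-1)^n\<close>.\<close>
  have h: "complex_of_real (p + 1/2) = of_real p + of_nat k/(2 * of_nat k)" using k0 by simp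
  have "\<i> * of_real pi * of_nat k * of_int n/of_nat k = \<i> * of_real pi*(of_int n :: complex)" using k0 by simp
  then have "primal modulus k q n (of_real (p + 1/2)) = exp (tpi * of_nat k * of_real q)*(s * pr)"
   unfolding h primal_half_period[OF k] by (simp only: exp_i_pi_int s_def pr_def)
  then have ep: "e*primal modulus k q n (of_real (p + 1/2)) = s * pr" by (simp add: e_def mult.assoc[symmetric] exp_add[symmetric])
  have "(\<Sum>m<g. 1/of_nat k^(2*m)*(1/2*(Wpol m k n * pr + - e*(Wpol m k n*primal modulus k q n (of_real (p + 1/2))))))
   = (\<Sum>m<g. Wpol m k n/of_nat k^(2*m)*((1 - s)/2 * pr))" proof (rule sum.cong[OF refl])
   fix m
   have "- e*(Wpol m k n*primal modulus k q n (of_real (p + 1/2))) = - (Wpol m k n*(e*primal modulus k q n (of_real (p + 1/2))))" by simp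
   also have "... = - (Wpol m k n*(s * pr))" unfolding ep ..
   finally have A: "- e*(Wpol m k n*primal modulus k q n (of_real (p + 1/2))) = - (Wpol m k n*(s * pr))" .
   show "1/of_nat k^(2*m)*(1/2*(Wpol m k n * pr + - e*(Wpol m k n*primal modulus k q n (of_real (p + 1/2))))) = Wpol m k n/of_nat k^(2*m)*((1 - s)/2 * pr)"
    unfolding A using k0 by (simp add: field_simps)
  qed
  also have "... = w*((1 - s)/2 * pr)" unfolding w_def by (rule sum_distrib_right[symmetric])
  finally have S: "(\<Sum>m<g. 1/of_nat k^(2*m)*(1/2*(Wpol m k n * pr + - e*(Wpol m k n*primal modulus k q n (of_real (p + 1/2)))))) = w*((1 - s)/2 * pr)" .
  have "c*((\<Sum>m<g. 1/of_nat k^(2*m)*(1/2*(Wpol m k n * pr + - e*(Wpol m k n*primal modulus k q n (of_real (p + 1/2)))))) + Wrest k n * pr)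
   = c*(w*((1 - s)/2) + Wrest k n) * pr" unfolding S by (simp add: algebra_simps)
  also have "c*(w*((1 - s)/2) + Wrest k n) = of_real (verlinde g k n)"
   unfolding Wrest_def w_def[symmetric] c_def[symmetric] s_def using c0 by (simp add: field_simps)
  finally show ?thesis unfolding pr_def .
 qed
 ultimately have "((\<lambda>n. of_real (verlinde g k n)*primal modulus k q n (of_real p)) has_sum
  c*((\<Sum>m<g. 1/of_nat k^(2*m)*(1/2*(Tpol m k p q + - e * Tpol m k (p + 1/2) q))) + Trest k p q)) UNIV" by (simp only:)
 then show ?thesis unfolding Zsum_def c_def e_def by (simp add: infsumI)
qed

text \<open>The Poisson constant contributes \<open>sqrt(2k)\<close>, and the factor 1/2 comes from
  selecting the odd terms. Then \<open>sqrt(2k)/(2 sqrt 2) = sqrt(k/2pi) sqrt(pi/2)\<close>, which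
  raises the exponent \<open>3g - 2\<close> to \<open>3g - 3/2\<close> and leaves the constant
  \<open>sqrt(pi/2)\<close>.\<close>

lemma region_2_constant:
 assumes k: "k \<ge> 1" shows "qpre k * of_real ((kp k)^(3 * g - 2))*(1/2)*gauss_const (- of_real pi*\<i>*modulus/(2 * of_nat k))
  = of_real ((kp k) powr (1/4 + (3*real g - 3/2)))*(of_real (sqrt (pi/2))/csqrt (- \<i>*modulus))" proof -
 have k0: "real k > 0" using k by simp
 define x where "x = real k/(2*pi)"
 have x: "x > 0" using k0 by (simp add: x_def)
 have "1/4 + (3*real g - 3/2) = 1/4 + (real (3 * g - 2) + 1/2)" using g by (simp add: of_nat_diff)
 then have "x powr (1/4 + (3*real g - 3/2)) = x powr (1/4 + (real (3 * g - 2) + 1/2))" by (simp only:)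
 also have "... = x powr (1/4)*(x^(3 * g - 2) * sqrt x)" by (simp only: powr_add powr_realpow[OF x] powr_half_sqrt[OF less_imp_le[OF x]])
 finally have "x powr (1/4 + (3*real g - 3/2)) = x powr (1/4)*(x^(3 * g - 2) * sqrt x)" .
 moreover have "sqrt (2*real k)/sqrt 2/2 = sqrt x * sqrt (pi/2)" proof -
  have "sqrt (2*real k)/sqrt 2/2 = sqrt (2*real k/2/4)" by (simp only: real_sqrt_divide real_sqrt_four)
  also have "2*real k/2/4 = x*(pi/2)" by (simp add: x_def)
  finally show ?thesis by (simp only: real_sqrt_mult)
 qed
 ultimately have r: "1/sqrt 2*x powr (1/4)*x^(3 * g - 2)*(1/2) * sqrt (2*real k) = x powr (1/4 + (3*real g - 3/2)) * sqrt (pi/2)" proof -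
  assume a: "x powr (1/4 + (3*real g - 3/2)) = x powr (1/4)*(x^(3 * g - 2) * sqrt x)" and b: "sqrt (2*real k)/sqrt 2/2 = sqrt x * sqrt (pi/2)"
  have "1/sqrt 2*x powr (1/4)*x^(3 * g - 2)*(1/2) * sqrt (2*real k) = x powr (1/4)*x^(3 * g - 2)*(sqrt (2*real k)/sqrt 2/2)" by simp
  also have "... = x powr (1/4 + (3*real g - 3/2)) * sqrt (pi/2)" unfolding a b by (simp only: mult_ac)
  finally show ?thesis .
 qed
 have "of_real (1/sqrt 2*x powr (1/4)) * of_real (x^(3 * g - 2))*(1/2)*(of_real (sqrt (2*real k))/csqrt (- \<i>*modulus))
  = of_real (1/sqrt 2*x powr (1/4)*x^(3 * g - 2)*(1/2) * sqrt (2*real k))/csqrt (- \<i>*modulus)" by simp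
 then show ?thesis unfolding gauss_const_kappa[OF modulus_pos k] x_def[symmetric] r by simp
qed

text \<open>There are three contributions. The sums with polynomial weights at \<open>p\<close>
  carry the expansion; those at \<open>p + 1/2\<close> are negligible because
  \<open>1/4 <= |p + 1/2| <= 3/4\<close>; the rest has local weight 0, so all its coefficients
  vanish.\<close>

theorem region_2_asymptotics:
 assumes q0: "- 1 < q0" "q0 < 0"
 shows "\<exists>\<epsilon>>0. \<forall>M\<ge>1. \<exists>C\<ge>0. \<forall>k\<ge>1. \<forall>p q. \<bar>p\<bar> \<le> \<epsilon> --> \<bar>q - q0\<bar> \<le> \<epsilon> -->
  norm (rem2 M k p q)
   \<le> C*real k^(3 * g)/real k^M" proof -
 \<comment> \<open>Distance of the centre \<open>-q0\<close> from the ends of \<open>(0, 1)\<close>: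
   lattice points \<open>n/(2k)\<close> closer than this satisfy \<open>0 < n < 2k\<close>.\<close>
 define \<rho> where "\<rho> = min (- q0) (1 + q0)"
 have \<rho>: "\<rho> > 0" using q0 by (simp add: \<rho>_def)
 have m0: "modulus \<noteq> 0" by (rule modulus_neq_0)
 define \<epsilon> where "\<epsilon> = min (\<rho>/2) (min (1/4) (norm modulus*\<rho>/2))"
 have e0: "\<epsilon> > 0" using \<rho> m0 by (simp add: \<epsilon>_def)
 define D where "D = (\<lambda>p q. \<bar>p\<bar> \<le> \<epsilon> \<and> \<bar>q - q0\<bar> \<le> \<epsilon>)"
 have D: "\<bar>q + - q0\<bar> \<le> \<rho>/2" "\<bar>p\<bar> \<le> 3/4" "\<bar>p\<bar> \<le> norm modulus*\<rho>/2" "\<bar>p + 1/2\<bar> \<le> 3/4" "1/4 \<le> \<bar>p + 1/2\<bar>" if "D p q" for p q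
  using that unfolding D_def \<epsilon>_def by auto
 have loc: "0 < n \<and> n < 2*int k" if k: "k \<ge> 1" and n: "\<bar>pt k n - - q0\<bar> < \<rho>" for k n proof -
  have "0 < pt k n" "pt k n < 1" using n unfolding \<rho>_def by linarith+
  then have "0 < real_of_int n" "real_of_int n < real_of_int (2*int k)" using k by (auto simp: field_simps)
  then show ?thesis by (simp only: of_int_less_iff of_int_0_less_iff)
 qed
 define w where "w = (\<lambda>m z. cpoly (P m) (2*z))"
 have Wl: "Wpol m k n = w m (of_real (pt k n))" if "k \<ge> 1" "\<bar>pt k n - - q0\<bar> < \<rho>" for m k n proof -
  have "2 * complex_of_real (pt k n) = of_real (of_int n/real k)" by simp
  then show ?thesis using loc[OF that] unfolding w_def by (simp only: cpoly_of_real Wpol_def) simp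
 qed
 have Rl: "Wrest k n = (\<lambda>z. 0) (complex_of_real (pt k n))" if "k \<ge> 1" "\<bar>pt k n - - q0\<bar> < \<rho>" for k n
  using Wrest_local[OF that(1)] loc[OF that] by simp
 define der where "der = (\<lambda>m i z. (deriv ^^ (2*i)) (w m) (- z/modulus))"
 have arg: "of_real (- q) - of_real p/modulus = - coord (p, q)/modulus" for p q unfolding coord_eq using m0 by (simp add: field_simps)
 have "\<exists>C\<ge>0. \<forall>k\<ge>1. \<forall>p q. \<bar>p\<bar> \<le> \<epsilon> --> \<bar>q - q0\<bar> \<le> \<epsilon> -->
  norm (rem2 M k p q)
   \<le> C*real k^(3 * g)/real k^M" if M: "M \<ge> 1" for M proof -
  define h where "h = (\<lambda>k::nat. real k/real k^M)"
  define Sg where "Sg = (\<lambda>m k p q. \<Sum>i<M - 2*m. beta modulus k^i/fact i * der m i (coord (p, q)))"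
  have 1: "unif_bigo D (\<lambda>k. real k/real k^(M - 2*m)) (\<lambda>k p q. Tpol m k p q - dual modulus k q 0 (of_real p) * Sg m k p q)" for m
  proof -
   obtain B where B: "B \<ge> 0" "\<forall>k n. norm (Wpol m k n) \<le> B" using Wpol_bound[of m] by auto
   \<comment> \<open>If no term is retained, the expansion theorem, which asks for order at least 1,
     does not apply. A bound of order \<open>k\<close> is enough then, since the sum is later
     multiplied by \<open>k^(-2m)\<close>.\<close>
   show ?thesis proof (cases "M - 2*m = 0")
    case True
    obtain C where C: "C \<ge> 0" "\<forall>k\<ge>1. \<forall>W Q P B. (\<forall>n. norm (W n) \<le> B) --> norm (\<Sum>\<^sub>\<infinity>n. W n*primal modulus k Q n (of_real P)) \<le> C*B*real k"
     using weighted_theta_bound[OF modulus_pos] by auto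
    have "norm (Tpol m k p q) \<le> C*B*real k" if "k \<ge> 1" for k p q
     unfolding Tpol_def using C(2)[rule_format, OF that, of "Wpol m k"] B(2) by blast
    moreover have "C*B \<ge> 0" using B(1) C(1) by simp
    ultimately show ?thesis unfolding unif_bigo_def Sg_def True by (intro exI[of _ "C*B"]) auto
   next
    case False
    have "\<exists>C\<ge>0. \<forall>k\<ge>1. \<forall>Q P. \<bar>Q + - q0\<bar> \<le> \<rho>/2 --> \<bar>P\<bar> \<le> 3/4 --> \<bar>P\<bar> \<le> norm modulus*\<rho>/2 -->
     norm ((\<Sum>\<^sub>\<infinity>n. Wpol m k n*primal modulus k Q n (of_real P)) -
      dual modulus k Q 0 (of_real P)*(\<Sum>i<M - 2*m. beta modulus k^i/fact i*(deriv ^^ (2*i)) (w m) (of_real (- Q) - of_real P/modulus)))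
      \<le> C*real k/real k^(M - 2*m)" proof (rule theta_sum_asymptotics[OF modulus_pos \<rho>, where W="Wpol m" and A=B and M=0])
     show "w m holomorphic_on ball (complex_of_real (- q0)) (2*\<rho>)" unfolding w_def by (rule holomorphic_cpoly)
    qed (use B False Wl in auto)
    then obtain C where C: "C \<ge> 0" "\<forall>k\<ge>1. \<forall>Q P. \<bar>Q + - q0\<bar> \<le> \<rho>/2 --> \<bar>P\<bar> \<le> 3/4 --> \<bar>P\<bar> \<le> norm modulus*\<rho>/2 -->
     norm ((\<Sum>\<^sub>\<infinity>n. Wpol m k n*primal modulus k Q n (of_real P)) -
      dual modulus k Q 0 (of_real P)*(\<Sum>i<M - 2*m. beta modulus k^i/fact i*(deriv ^^ (2*i)) (w m) (of_real (- Q) - of_real P/modulus)))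
      \<le> C*real k/real k^(M - 2*m)" by (elim exE conjE) (rule that)
    show ?thesis unfolding unif_bigo_def proof (intro exI[of _ C] conjI C(1) allI impI)
     fix k :: nat and p q assume k: "1 \<le> k" and d: "D p q"
     from C(2)[rule_format, OF k D(1)[OF d] D(2)[OF d] D(3)[OF d]]
     show "norm (Tpol m k p q - dual modulus k q 0 (of_real p) * Sg m k p q) \<le> C*(real k/real k^(M - 2*m))"
      unfolding Tpol_def Sg_def der_def arg by simp
    qed
   qed
  qed
  have 2: "unif_bigo D h (\<lambda>k p q. Tpol m k (p + 1/2) q)" for m proof -
   obtain B where B: "B \<ge> 0" "\<forall>k n. norm (Wpol m k n) \<le> B" using Wpol_bound[of m] by auto
   have "\<exists>C\<ge>0. \<forall>k\<ge>1. \<forall>Q P. \<bar>Q + - q0\<bar> \<le> \<rho>/2 --> \<bar>P\<bar> \<le> 3/4 --> 1/4 \<le> \<bar>P\<bar> -->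
     norm (\<Sum>\<^sub>\<infinity>n. Wpol m k n*primal modulus k Q n (of_real P)) \<le> C/real k^M"
   proof (rule theta_sum_negligible[OF modulus_pos \<rho>, where W="Wpol m" and A=B and M=0 and w="w m"])
    show "w m holomorphic_on ball (complex_of_real (- q0)) (2*\<rho>)" unfolding w_def by (rule holomorphic_cpoly)
   qed (use B Wl in auto)
   then obtain C where C: "C \<ge> 0" "\<forall>k\<ge>1. \<forall>Q P. \<bar>Q + - q0\<bar> \<le> \<rho>/2 --> \<bar>P\<bar> \<le> 3/4 --> 1/4 \<le> \<bar>P\<bar> -->
     norm (\<Sum>\<^sub>\<infinity>n. Wpol m k n*primal modulus k Q n (of_real P)) \<le> C/real k^M" by (elim exE conjE) (rule that)
   show ?thesis unfolding unif_bigo_def proof (intro exI[of _ C] conjI C(1) allI impI)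
    fix k :: nat and p q assume k: "1 \<le> k" and d: "D p q"
    have "norm (Tpol m k (p + 1/2) q) \<le> C/real k^M" unfolding Tpol_def by (rule C(2)[rule_format, OF k D(1)[OF d] D(4)[OF d] D(5)[OF d]])
    also have "C*1 \<le> C*real k" using k C(1) by (intro mult_left_mono) auto
    then have "C/real k^M \<le> C*h k" unfolding h_def by (simp add: divide_right_mono)
    finally show "norm (Tpol m k (p + 1/2) q) \<le> C*h k" .
   qed
  qed
  have 3: "unif_bigo D h (\<lambda>k p q. Trest k p q)" proof -
   obtain B where B: "B \<ge> 0" "\<forall>k\<ge>1. \<forall>n. norm (Wrest k n) \<le> B*real k^(3 * g)" using Wrest_bound by auto
   have "\<exists>C\<ge>0. \<forall>k\<ge>1. \<forall>Q P. \<bar>Q + - q0\<bar> \<le> \<rho>/2 --> \<bar>P\<bar> \<le> 3/4 --> \<bar>P\<bar> \<le> norm modulus*\<rho>/2 -->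
    norm ((\<Sum>\<^sub>\<infinity>n. Wrest k n*primal modulus k Q n (of_real P)) -
     dual modulus k Q 0 (of_real P)*(\<Sum>i<M. beta modulus k^i/fact i*(deriv ^^ (2*i)) (\<lambda>z. 0) (of_real (- Q) - of_real P/modulus)))
     \<le> C*real k/real k^M" by (rule theta_sum_asymptotics[OF modulus_pos \<rho>, where W="Wrest" and A=B and M="3 * g"]) (use B M Rl in auto)
   then obtain C where C: "C \<ge> 0" "\<forall>k\<ge>1. \<forall>Q P. \<bar>Q + - q0\<bar> \<le> \<rho>/2 --> \<bar>P\<bar> \<le> 3/4 --> \<bar>P\<bar> \<le> norm modulus*\<rho>/2 -->
    norm ((\<Sum>\<^sub>\<infinity>n. Wrest k n*primal modulus k Q n (of_real P)) -
     dual modulus k Q 0 (of_real P)*(\<Sum>i<M. beta modulus k^i/fact i*(deriv ^^ (2*i)) (\<lambda>z. 0) (of_real (- Q) - of_real P/modulus)))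
     \<le> C*real k/real k^M" by (elim exE conjE) (rule that)
   show ?thesis unfolding unif_bigo_def proof (intro exI[of _ C] conjI C(1) allI impI)
    fix k :: nat and p q assume k: "1 \<le> k" and d: "D p q"
    have z: "(deriv ^^ (2*i)) (\<lambda>z. 0) z = (0::complex)" for i z by (simp add: higher_deriv_const)
    from C(2)[rule_format, OF k D(1)[OF d] D(2)[OF d] D(3)[OF d]]
    show "norm (Trest k p q) \<le> C*h k" unfolding Trest_def h_def z by simp
   qed
  qed
  define pre where "pre = (\<lambda>k. qpre k * of_real ((kp k)^(3 * g - 2)))"
  define X where "X = (\<lambda>k p q. exp (mtpi * of_nat k * complex_of_real p * complex_of_real q))"
  define e where "e = (\<lambda>k q. exp (- (tpi * of_nat k * complex_of_real q)))"
  define err where "err = (\<lambda>k p q. (\<Sum>m<g. (1/2*(1/of_nat k^(2*m)))*(Tpol m k p q - dual modulus k q 0 (of_real p) * Sg m k p q))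
   + (\<Sum>m<g. (- (1/2)*(1/of_nat k^(2*m))*e k q) * Tpol m k (p + 1/2) q) + Trest k p q)"
  have ne: "norm (e k q) = 1" for k q using norm_exp_pq[of k 1 q] by (simp add: e_def)
  have b_err: "unif_bigo D h err" unfolding err_def proof (intro unif_bigo_add unif_bigo_sum 3)
   fix m
   show "unif_bigo D h (\<lambda>k p q. (1/2*(1/of_nat k^(2*m)))*(Tpol m k p q - dual modulus k q 0 (of_real p) * Sg m k p q))"
   proof (rule unif_bigo_mult[OF 1, where B=1 and s="\<lambda>k. 1/real k^(2*m)"])
    fix k :: nat assume k: "1 \<le> k"
    have "real k^M \<le> real k^(2*m + (M - 2*m))" using k by (intro power_increasing) auto
    then show "1/real k^(2*m)*(real k/real k^(M - 2*m)) \<le> h k" unfolding h_def using k by (simp add: power_add[symmetric] divide_left_mono)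
   qed (auto simp: norm_divide norm_mult norm_power intro!: divide_left_mono)
   show "unif_bigo D h (\<lambda>k p q. (- (1/2)*(1/of_nat k^(2*m))*e k q) * Tpol m k (p + 1/2) q)"
   proof (rule unif_bigo_mult[OF 2, where B=1 and s="\<lambda>k. 1"])
    fix k p q assume k: "(1::nat) \<le> k"
    have "1 \<le> real k^(2*m)" using k by simp
    then have "1/real k^(2*m) \<le> 1/1" by (intro frac_le) auto
    moreover have "norm (- (1/2)*(1/of_nat k^(2*m))*e k q) = 1/2*(1/real k^(2*m))" unfolding norm_mult ne by (simp add: norm_divide norm_power)
    moreover have "0 \<le> 1/real k^(2*m)" by simp
    ultimately show "norm (- (1/2)*(1/of_nat k^(2*m))*e k q) \<le> 1*1" by linarith
   qed auto
  qed
  have b_tot: "unif_bigo D (\<lambda>k. real k^(3 * g)/real k^M) (\<lambda>k p q. (pre k*X k p q) * err k p q)"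
  proof (rule unif_bigo_mult[OF b_err, where B=1 and s="\<lambda>k. real k^(1 + (3 * g - 2))"])
   fix k p q assume k: "(1::nat) \<le> k"
   have "norm (pre k) \<le> (1*real k)*real k^(3 * g - 2)" unfolding pre_def norm_mult norm_of_real abs_mult proof (intro mult_mono)
    have "real k/(2*pi) \<le> real k/1" using pi_gt3 by (intro divide_left_mono) auto
    then have "(kp k)^(3 * g - 2) \<le> real k^(3 * g - 2)" by (intro power_mono) auto
    then show "\<bar>(kp k)^(3 * g - 2)\<bar> \<le> real k^(3 * g - 2)" by simp
   qed (use powr_quarter_le[OF k] in auto)
   then show "norm (pre k*X k p q) \<le> 1*real k^(1 + (3 * g - 2))" unfolding norm_mult X_def norm_exp_pq by simp
  next
   fix k :: nat assume "1 \<le> k"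
   have "real k^(1 + (3 * g - 2))*real k = real k^(1 + (3 * g - 2) + 1)" by simp
   also have "1 + (3 * g - 2) + 1 = 3 * g" using g by simp
   finally show "real k^(1 + (3 * g - 2))*h k \<le> real k^(3 * g)/real k^M" by (simp add: h_def)
  qed auto
  have eq: "rem2 M k p q
   = (pre k*X k p q) * err k p q" if k: "k \<ge> 1" for k p q proof -
   define E where "E = exp (- (tpi/modulus) * of_real p*coord (p, q))^k"
   define Ka where "Ka = gauss_const (- of_real pi*\<i>*modulus/(2 * of_nat k))"
   define c' where "c' = of_real (sqrt (pi/2))/csqrt (- \<i>*modulus)"
   define S where "S = (\<Sum>m<g. 1/of_nat k^(2*m) * Sg m k p q)"
   define d where "d = dual modulus k q 0 (of_real p)"
   have dual: "X k p q * d = Ka*E"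
    unfolding X_def d_def dual_def Ka_def[symmetric] E_def exp_of_nat_mult[symmetric] mult.left_commute[of _ Ka] exp_add[symmetric]
    by (rule arg_cong[where f="\<lambda>z. Ka*exp z"]) (use m0 in \<open>simp add: coord_eq field_simps power2_eq_square\<close>)
   have "Sg m k p q = (\<Sum>i<M - 2*m. (beta modulus 1^i/fact i * der m i (coord (p, q)))/of_nat k^i)" for m
    unfolding Sg_def by (rule sum.cong[OF refl], subst beta_scale) (simp add: power_divide)
   then have "S = (\<Sum>l<M. (\<Sum>m | m < g \<and> 2*m \<le> l. beta modulus 1^(l - 2*m)/fact (l - 2*m) * der m (l - 2*m) (coord (p, q)))/of_nat k^l)"
    unfolding S_def by (simp only: sum_shifted_expansions)
   then have amp: "c' * S = (\<Sum>l<M. amp2 l (coord (p, q))/of_nat k^l)"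
    unfolding amp2_def c'_def der_def w_def by (simp only: sum_distrib_left times_divide_eq_right)
   have con: "pre k*(1/2) * Ka = of_real ((kp k) powr (1/4 + (3*real g - 3/2)))*c'"
    unfolding pre_def Ka_def c'_def by (rule region_2_constant[OF k])
   have Z: "Z0 g k (p, q) = pre k*X k p q*((\<Sum>m<g. 1/of_nat k^(2*m)*(1/2*(Tpol m k p q - e k q * Tpol m k (p + 1/2) q))) + Trest k p q)"
    unfolding Z0_def Zsum_odd_part[OF k] pre_def X_def e_def fst_conv snd_conv by (simp only: mult_ac)
   have err: "err k p q = (\<Sum>m<g. 1/of_nat k^(2*m)*(1/2*(Tpol m k p q - e k q * Tpol m k (p + 1/2) q))) + Trest k p q - (1/2) * d * S"
    unfolding err_def S_def d_def sum_distrib_left by (simp add: sum.distrib[symmetric] sum_subtractf[symmetric] algebra_simps)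
   have "of_real ((kp k) powr (1/4 + (3*real g - 3/2)))*(E*(c' * S)) = (pre k*(1/2) * Ka)*(E * S)" unfolding con by (simp only: mult_ac)
   also have "... = pre k*(1/2)*(Ka*E) * S" by (simp only: mult_ac)
   also have "... = pre k*X k p q*((1/2) * d * S)" unfolding dual[symmetric] by (simp only: mult_ac)
   finally show ?thesis unfolding Z err E_def[symmetric] amp[symmetric] by (simp only: right_diff_distrib)
  qed
  from b_tot obtain C where C: "C \<ge> 0" "\<forall>k\<ge>1. \<forall>p q. D p q --> norm ((pre k*X k p q) * err k p q) \<le> C*(real k^(3 * g)/real k^M)"
   unfolding unif_bigo_def by auto
  show ?thesis proof (rule exI[of _ C], intro conjI C(1) allI impI)
   fix k :: nat and p q assume k: "1 \<le> k" and "\<bar>p\<bar> \<le> \<epsilon>" "\<bar>q - q0\<bar> \<le> \<epsilon>"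
   then have "D p q" by (simp add: D_def)
   from C(2)[rule_format, OF k this]
   show "norm (rem2 M k p q)
   \<le> C*real k^(3 * g)/real k^M" unfolding eq[OF k] by simp
  qed
 qed
 note H = this
 show ?thesis by (rule exI[of _ \<epsilon>], rule conjI, rule e0, rule allI, rule impI, rule H)
qed

end

end

text \<open>Only odd \<open>n\<close> contribute, and for them the half period yields
  \<open>exp(i pi n) = -1\<close>. This is the sign between the two components of the second
  curve.\<close>

lemma Z0_half_shift:
 assumes k: "k \<ge> 1" shows "Z0 g k (p + 1/2, q) = - exp (\<i> * of_real pi * of_nat k * of_real q) * Z0 g k (p, q)" proof -
 define Q where "Q = exp (tpi * of_nat k * complex_of_real q)"
 have k0: "(of_nat k :: complex) \<noteq> 0" using k by simp
 have "of_real (verlinde g k n)*primal modulus k q n (of_real (p + 1/2)) = - Q*(of_real (verlinde g k n)*primal modulus k q n (of_real p))" for n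
 proof -
  have h: "complex_of_real (p + 1/2) = of_real p + of_nat k/(2 * of_nat k)" using k0 by simp
  have i: "\<i> * of_real pi * of_nat k * of_int n/of_nat k = \<i> * of_real pi*(of_int n :: complex)" using k0 by simp
  show ?thesis unfolding h primal_half_period[OF k] i exp_i_pi_int Q_def[symmetric] using verlinde_even[of n g k] by (cases "even n") auto
 qed
 then have Z: "Zsum g k (p + 1/2, q) = - Q * Zsum g k (p, q)" unfolding Zsum_def fst_conv snd_conv by (simp only: infsum_cmult_right')
 have e: "exp (mtpi * of_nat k * of_real (p + 1/2) * of_real q)*Q = exp (\<i> * of_real pi * of_nat k * of_real q)*exp (mtpi * of_nat k * of_real p * of_real q)"
  unfolding Q_def exp_add[symmetric] by (rule arg_cong[where f=exp]) (simp add: algebra_simps)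
 have "Z0 g k (p + 1/2, q) = - (qpre k *
   (exp (mtpi * of_nat k * of_real (p + 1/2) * of_real q)*Q) * Zsum g k (p, q))" unfolding Z0_def fst_conv snd_conv Z by simp
 then show ?thesis unfolding e unfolding Z0_def fst_conv snd_conv by simp
qed

end

section \<open>Lagrangian states\<close>

lemma saturation_memI: "r \<in> lattice ==> y \<in> S ==> r + y \<in> saturation S" unfolding saturation_def by blast

lemma lattice_add: "r \<in> lattice ==> s \<in> lattice ==> r + s \<in> lattice" unfolding lattice_def by (auto simp: mem_Times_iff)

lemma lattice_minus: "r \<in> lattice ==> - r \<in> lattice" unfolding lattice_def by (auto simp: mem_Times_iff)

lemma lattice_0: "0 \<in> lattice" unfolding lattice_def by (auto simp: mem_Times_iff)

lemma saturated_saturation: "saturated (saturation S)" unfolding saturated_def saturation_def using lattice_add by (force simp: add.assoc[symmetric])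

lemma saturated_translate: "saturated S ==> r \<in> lattice ==> r + y \<in> S \<longleftrightarrow> y \<in> S"
 unfolding saturated_def using lattice_minus by (metis add.commute add_minus_cancel minus_add_cancel)

lemma saturation_UN: "saturation S = (\<Union>r\<in>lattice. (+) r ` S)" unfolding saturation_def by blast

lemma open_saturation: "open S ==> open (saturation S)" unfolding saturation_UN by (intro open_UN ballI open_translation)

lemma open_M_saturation: "open S ==> open_M (saturation S)" unfolding open_M_def using open_saturation saturated_saturation by blast

lemma saturation_subset: "saturated U ==> S \<subseteq> U ==> saturation S \<subseteq> U" unfolding saturation_def saturated_def by blast

text \<open>On the lattice \<open>omega\<close> takes values in the integer multiples of
  \<open>4 pi\<close>, so successive lattice translations compose without an extra phase.\<close>

lemma omega_lattice: 
 assumes "r \<in> lattice" "s \<in> lattice" shows "cis (real k * omega r s/2) = 1" proof -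
 obtain a b c d :: int where e: "r = (of_int a, of_int b)" "s = (of_int c, of_int d)" using assms unfolding lattice_def by (auto elim!: Ints_cases)
 have "real k * omega r s/2 = 2*pi * of_int (int k*(a * d - b*c))" unfolding e omega_def by (simp add: field_simps)
 then show ?thesis by (simp only: cis_multiple_2pi Ints_of_int)
qed

lemma omega_add_left: "omega (x + y) z = omega x z + omega y z" by (simp add: omega_def algebra_simps)

lemma omega_add_right: "omega x (y + z) = omega x y + omega x z" by (simp add: omega_def algebra_simps)

lemma omega_self: "omega x x = 0" by (simp add: omega_def)

text \<open>The half-open unit square centred at \<open>a\<close> is a fundamental domain; \<open>nearest a x\<close> is the
  lattice vector that translates it onto a neighbour containing \<open>x\<close>.\<close>

definition nearest :: "plane => plane => plane" where
 "nearest a x = (of_int \<lfloor>fst x - fst a + 1/2\<rfloor>, of_int \<lfloor>snd x - snd a + 1/2\<rfloor>)"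

definition square :: "plane => real => plane set" where
 "square a e = {x. \<bar>fst x - fst a\<bar> < e \<and> \<bar>snd x - snd a\<bar> < e}"

lemma open_square: "open (square a e)" proof -
 have "open {x::plane. \<bar>fst x - fst a\<bar> < e}" "open {x::plane. \<bar>snd x - snd a\<bar> < e}"
  by (intro open_Collect_less continuous_intros)+
 then have "open ({x::plane. \<bar>fst x - fst a\<bar> < e} \<inter> {x. \<bar>snd x - snd a\<bar> < e})" by (rule open_Int)
 moreover have "square a e = {x::plane. \<bar>fst x - fst a\<bar> < e} \<inter> {x. \<bar>snd x - snd a\<bar> < e}" unfolding square_def by auto
 ultimately show ?thesis by simp
qed

lemma nearest_eq:
 assumes "r \<in> lattice" "y \<in> square a e" "e \<le> 1/4" shows "nearest a (r + y) = r" proof -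
 obtain m n :: int where r: "r = (of_int m, of_int n)" using assms(1) unfolding lattice_def by (auto elim!: Ints_cases)
 have "\<lfloor>of_int m + fst y - fst a + 1/2\<rfloor> = m" "\<lfloor>of_int n + snd y - snd a + 1/2\<rfloor> = n"
  using assms(2,3) unfolding square_def floor_eq_iff by (auto simp: abs_less_iff)
 then show ?thesis unfolding nearest_def r by (simp add: algebra_simps)
qed

context half_form_setup
begin

text \<open>The local condition of \<open>lagrangian_state\<close> at a single point. It is isolated
  because it is invariant under lattice translations and can be checked at a convenient
  representative.\<close>

definition lag_at :: "plane set => (nat => plane => 'd) => plane set => (plane => complex) => (plane => 'd) => real => plane => bool" where
 "lag_at U \<xi> \<Gamma> \<Theta> \<sigma> N x0 \<longleftrightarrow> (\<exists>V F f c.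
    open_M V \<and> x0 \<in> V \<and> V \<subseteq> U \<and>
    is_section (*) 1 V F \<and> smooth_on V F \<and>
    (\<forall>x\<in>\<Gamma> \<inter> V. F x = \<Theta> x) \<and> (\<forall>x\<in>V - \<Gamma>. norm (F x) < 1) \<and>
    (\<forall>v. vanishes_inf_order (\<Gamma> \<inter> V) (\<lambda>x. dbar j (*) 1 F x v)) \<and>
    (\<forall>k\<ge>1. is_section sc 0 V (f k) \<and> smooth_on V (f k)) \<and>
    (\<forall>l. is_section sc 0 V (c l) \<and> smooth_on V (c l)) \<and>
    asymp_expansion V f c \<and> (\<forall>x\<in>\<Gamma> \<inter> V. c 0 x = \<sigma> x) \<and>
    (\<forall>n. \<exists>C. \<forall>k\<ge>1. \<forall>x\<in>V.
      norm (\<xi> k x - ((kp k) powr (1/4 + N)) *\<^sub>R sc (F x^k) (f k x)) \<le> C/real k^n))"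

lemma lag_at_translate:
 assumes "lag_at U \<xi> \<Gamma> \<Theta> \<sigma> N x0" "r \<in> lattice" shows "lag_at U \<xi> \<Gamma> \<Theta> \<sigma> N (r + x0)" proof -
 have "r + x0 \<in> V" if "open_M V" "x0 \<in> V" for V using that assms(2) unfolding open_M_def saturated_def by blast
 with assms(1) show ?thesis unfolding lag_at_def by (elim exE conjE) (intro exI conjI, assumption+)
qed

text \<open>The Gaussian section \<open>exp(L y * coord y)\<close> transported by the Heisenberg
  action of \<open>n0\<close>.\<close>

definition phase0 :: "plane => (plane => complex) => plane => complex" where
 "phase0 n0 L y = exp (\<i> * of_real (alpha n0 y) + L (y - n0)*coord (y - n0))"

text \<open>All data are given on one square around \<open>x0\<close>, of half-side at most 1/4, so
  that its lattice translates are disjoint. In \<open>approx\<close> the loss \<open>k^d\<close> is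
  fixed while \<open>M\<close> is arbitrary; this makes the crude powers of \<open>k\<close> in the
  earlier estimates harmless. One sequence \<open>G\<close> has to serve every
  \<open>M\<close>.\<close>

context
 fixes U \<Gamma> :: "plane set" and \<xi> :: "nat => plane => 'd" and \<Theta> :: "plane => complex" and \<sigma> :: "plane => 'd" and N :: real
  and x0 n0 :: plane and e :: real and d :: nat and L :: "plane => complex" and G :: "nat => complex => complex" and \<Omega> :: "complex set"
 assumes U: "saturated U" and \<Gamma>: "saturated \<Gamma>" and e: "e > 0" "e \<le> 1/4" and WU: "square x0 e \<subseteq> U"
  and sec: "\<And>k. k \<ge> 1 ==> is_section sc k UNIV (\<xi> k)" and \<Theta>: "is_section (*) 1 \<Gamma> \<Theta>" and \<sigma>: "is_section sc 0 \<Gamma> \<sigma>"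
  and L: "polarized 1 L"
  and on: "\<And>y. y \<in> square x0 e ==> y \<in> \<Gamma> ==> phase0 n0 L y = \<Theta> y \<and> norm (\<Theta> y) = 1 \<and> sc (G 0 (coord (y - n0))) Om = \<sigma> y"
  and off: "\<And>y. y \<in> square x0 e ==> y \<notin> \<Gamma> ==> norm (phase0 n0 L y) < 1"
  and G: "\<And>i. G i holomorphic_on \<Omega>" and \<Omega>: "open \<Omega>"
  and img: "(\<lambda>y. coord (y - n0)) ` cbox (fst x0 - e, snd x0 - e) (fst x0 + e, snd x0 + e) \<subseteq> \<Omega>"
  and approx: "\<And>M. M \<ge> 1 ==> \<exists>C\<ge>0. \<forall>k\<ge>1. \<forall>y\<in>square x0 e.
    norm (\<xi> k y - ((kp k) powr (1/4 + N)) *\<^sub>R sc (phase0 n0 L y^k) (sc (\<Sum>i<M. G i (coord (y - n0))/of_nat k^i) Om)) \<le> C*real k^d/real k^M"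
begin

text \<open>Extension from the square to its lattice translates with the multiplier that sections of
  the line bundle must obey.\<close>

definition ext_phase :: "plane => complex" where
 "ext_phase x = cis (omega (nearest x0 x) x/2) * phase0 n0 L (x - nearest x0 x)"

definition ext_amp :: "(complex => complex) => plane => 'd" where
 "ext_amp H x = sc (H (coord (x - nearest x0 x - n0))) Om"

abbreviation "W0 \<equiv> square x0 e"
abbreviation "V0 \<equiv> saturation W0"

lemma ext_phase_translate: "r \<in> lattice ==> y \<in> W0 ==> ext_phase (r + y) = cis (omega r y/2) * phase0 n0 L y"
 unfolding ext_phase_def using nearest_eq[of r y x0 e] e by (simp add: omega_add_right omega_self)

lemma ext_amp_translate: "r \<in> lattice ==> y \<in> W0 ==> ext_amp H (r + y) = sc (H (coord (y - n0))) Om"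
 unfolding ext_amp_def using nearest_eq[of r y x0 e] e by simp

lemma V0_cases:
 assumes "x \<in> V0"
 obtains r y where "r \<in> lattice" "y \<in> W0" "x = r + y" using assms unfolding saturation_def by blast

text \<open>On each translate the extension is again a Gaussian section, centred at
  \<open>r + n0\<close>, up to a constant phase. Smoothness and holomorphy are inherited in this way
  although \<open>nearest\<close> jumps.\<close>

lemma ext_phase_local:
 assumes "r \<in> lattice" "x \<in> (+) r ` W0"
 shows "ext_phase x = cis (- (omega n0 r/2))*(exp (\<i> * of_nat 1 * of_real (alpha (r + n0) x) + L (x - (r + n0))*coord (x - (r + n0)))*1)" proof -
 obtain y where y: "y \<in> W0" "x = r + y" using assms by auto
 have "ext_phase x = cis (omega r y/2) * phase0 n0 L y" unfolding y(2) by (rule ext_phase_translate[OF assms(1) y(1)])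
 also have "... = exp (\<i> * of_real (omega r y/2) + (\<i> * of_real (alpha n0 y) + L (y - n0)*coord (y - n0)))"
  unfolding phase0_def cis_conv_exp exp_add ..
 also have "\<i> * of_real (omega r y/2) + (\<i> * of_real (alpha n0 y) + L (y - n0)*coord (y - n0))
  = \<i> * of_real (- (omega n0 r/2)) + (\<i> * of_nat 1 * of_real (alpha (r + n0) x) + L (x - (r + n0))*coord (x - (r + n0)))"
  unfolding y(2) alpha_def omega_add_left omega_add_right omega_self by (simp add: algebra_simps add_divide_distrib)
 also have "exp ... = cis (- (omega n0 r/2))*(exp (\<i> * of_nat 1 * of_real (alpha (r + n0) x) + L (x - (r + n0))*coord (x - (r + n0)))*1)"
  unfolding cis_conv_exp exp_add by simp
 finally show ?thesis .
qed

lemma open_translate_W0: "open ((+) r ` W0)" by (intro open_translation open_square)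

lemma ext_amp_local:
 assumes "r \<in> lattice" "x \<in> (+) r ` W0" shows "ext_amp H x = sc (H (coord x + - coord (r + n0))) Om" proof -
 obtain y where y: "y \<in> W0" "x = r + y" using assms by auto
 have "coord (y - n0) = coord x + - coord (r + n0)" unfolding y(2) coord_eq by (simp add: algebra_simps)
 then show ?thesis unfolding y(2) ext_amp_translate[OF assms(1) y(1)] by simp
qed

lemma W0_cbox: "y \<in> W0 ==> y \<in> cbox (fst x0 - e, snd x0 - e) (fst x0 + e, snd x0 + e)"
 unfolding square_def by (cases y) (auto simp: cbox_Pair_eq abs_less_iff)

lemma coord_translate_in:
 assumes "x \<in> (+) r ` W0"
 shows "coord x + - coord (r + n0) \<in> (\<lambda>y. coord (y - n0)) ` cbox (fst x0 - e, snd x0 - e) (fst x0 + e, snd x0 + e)" proof -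
 obtain y where y: "y \<in> W0" "x = r + y" using assms by auto
 have "coord x + - coord (r + n0) = coord (y - n0)" unfolding y(2) coord_eq by (simp add: algebra_simps)
 with W0_cbox[OF y(1)] show ?thesis by blast
qed

lemma smooth_ext_phase: "smooth_on V0 ext_phase" unfolding saturation_UN proof (rule smooth_on_union)
 fix r assume r: "r \<in> lattice"
 have "smooth_on ((+) r ` W0) (\<lambda>x. cis (- (omega n0 r/2))*(exp (\<i> * of_nat 1 * of_real (alpha (r + n0) x) + L (x - (r + n0))*coord (x - (r + n0)))*1))"
  by (rule smooth_on_linear_image[OF bounded_linear_mult_right open_translate_W0 gauss_section_smooth[OF open_translate_W0 L holomorphic_on_const]])
 note * = this
 show "smooth_on ((+) r ` W0) ext_phase" by (rule smooth_on_cong[THEN iffD2, OF open_translate_W0]) (rule ext_phase_local[OF r], assumption, rule *)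
qed

lemma dbar_ext_phase: "x \<in> V0 ==> dbar j (*) 1 ext_phase x v = 0" proof -
 assume "x \<in> V0"
 then obtain r where r: "r \<in> lattice" "x \<in> (+) r ` W0" unfolding saturation_UN by blast
 define h where "h = (\<lambda>x. cis (- (omega n0 r/2))*(exp (\<i> * of_nat 1 * of_real (alpha (r + n0) x) + L (x - (r + n0))*coord (x - (r + n0)))*1))"
 have hx: "ext_phase y = h y" if "y \<in> (+) r ` W0" for y unfolding h_def by (rule ext_phase_local[OF r(1) that])
 have "dbar j (*) 1 h x v = 0" unfolding h_def
  by (rule gauss_section_dbar[OF bounded_linear_mult_right _ L holomorphic_on_const]) (simp add: mult.left_commute)
 moreover have "frechet_derivative ext_phase (at x) = frechet_derivative h (at x)"
  by (rule frechet_derivative_cong_open[OF open_translate_W0 r(2) hx])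
 ultimately show ?thesis unfolding dbar_def nabla_def hx[OF r(2)] by simp
qed

lemma smooth_ext_amp:
 assumes "H holomorphic_on \<Omega>" shows "smooth_on V0 (ext_amp H)" unfolding saturation_UN proof (rule smooth_on_union)
 fix r assume r: "r \<in> lattice"
 have "smooth_on ((+) r ` W0) (\<lambda>x. sc (H (coord x + - coord (r + n0))) Om)"
 proof (rule smooth_on_linear_image[OF bounded_linear_sc_left open_translate_W0], rule smooth_on_compose_holomorphic[OF open_translate_W0 \<Omega> _ assms])
  show "(\<lambda>x. coord x + - coord (r + n0)) ` (+) r ` W0 \<subseteq> \<Omega>" using coord_translate_in img by blast
  show "smooth_on ((+) r ` W0) (\<lambda>x. coord x + - coord (r + n0))"
   by (intro smooth_on_add open_translate_W0 smooth_on_const smooth_on_bounded_linear bounded_linear_coord)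
 qed
 note * = this
 show "smooth_on ((+) r ` W0) (ext_amp H)" by (rule smooth_on_cong[THEN iffD2, OF open_translate_W0]) (rule ext_amp_local[OF r], assumption, rule *)
qed

text \<open>Two lattice translations are composed; the phase between their multipliers is 1 by
  \<open>omega_lattice\<close>.\<close>

lemma section_ext_phase: "is_section (*) 1 V0 ext_phase" unfolding is_section_def proof (intro ballI)
 fix r x assume r: "r \<in> lattice" and "x \<in> V0"
 then obtain s y where s: "s \<in> lattice" "y \<in> W0" "x = s + y" by (elim V0_cases)
 have "ext_phase (r + x) = cis (omega (r + s) y/2) * phase0 n0 L y"
  unfolding s(3) add.assoc[symmetric] by (rule ext_phase_translate[OF lattice_add[OF r s(1)] s(2)])
 also have "cis (omega (r + s) y/2) = cis (real 1 * omega r x/2)*cis (omega s y/2)" proof -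
  have "cis (real 1 * omega r x/2) = cis (real 1 * omega r s/2)*cis (omega r y/2)"
   unfolding s(3) omega_add_right cis_mult by (simp add: add_divide_distrib)
  also have "... = cis (omega r y/2)" using omega_lattice[OF r s(1), of 1] by simp
  finally show ?thesis unfolding omega_add_left by (simp add: cis_mult add_divide_distrib)
 qed
 finally show "ext_phase (r + x) = cis (real 1 * omega r x/2) * ext_phase x" unfolding s(3) ext_phase_translate[OF s(1,2)] by (simp add: mult.assoc)
qed

lemma section_ext_amp: "is_section sc 0 V0 (ext_amp H)" unfolding is_section_def proof (intro ballI)
 fix r x assume r: "r \<in> lattice" and "x \<in> V0"
 then obtain s y where s: "s \<in> lattice" "y \<in> W0" "x = s + y" by (elim V0_cases)
 have "ext_amp H (r + x) = sc (H (coord (y - n0))) Om"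
  unfolding s(3) add.assoc[symmetric] by (rule ext_amp_translate[OF lattice_add[OF r s(1)] s(2)])
 then show "ext_amp H (r + x) = sc (cis (real 0 * omega r x/2)) (ext_amp H x)" unfolding s(3) ext_amp_translate[OF s(1,2)] by simp
qed

text \<open>\<open>F\<close> is the extended Gaussian, \<open>f\<close> a Borel sum of the
  amplitudes and \<open>c\<close> the amplitudes themselves. Lattice translations do not change the
  local complex argument, so all derivative estimates reduce to complex derivatives on the single
  compact set \<open>K\<close>.\<close>

theorem lag_atI: "lag_at U \<xi> \<Gamma> \<Theta> \<sigma> N x0" proof -
 define K where "K = (\<lambda>y. coord (y - n0)) ` cbox (fst x0 - e, snd x0 - e) (fst x0 + e, snd x0 + e)"
 have K: "compact K" "K \<subseteq> \<Omega>" proof -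
  show "compact K" unfolding K_def
   by (intro compact_continuous_image continuous_intros bounded_linear.continuous_on[OF bounded_linear_coord] compact_cbox)
 qed (use img in \<open>simp add: K_def\<close>)
 define Q where "Q = (\<lambda>(I :: nat => nat) n m. \<exists>C\<ge>0. \<forall>k\<ge>1. \<forall>z\<in>K. norm ((deriv ^^ m) (\<lambda>z. (\<Sum>i<I k. G i z/of_nat k^i) - (\<Sum>i<n. G i z/of_nat k^i)) z) \<le> C/real k^n)"
 have "\<exists>I. \<forall>n m. Q I n m" proof (rule borel_truncation[of G, OF G \<Omega> K])
  fix I :: "nat => nat"
  assume "\<And>n m. \<exists>C\<ge>0. \<forall>k\<ge>1. \<forall>z\<in>K. norm ((deriv ^^ m) (\<lambda>z. (\<Sum>i<I k. G i z/of_nat k^i) - (\<Sum>i<n. G i z/of_nat k^i)) z) \<le> C/real k^n"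
  then have "\<forall>n m. Q I n m" unfolding Q_def by (intro allI)
  then show ?thesis by blast
 qed
 then obtain I where "\<forall>n m. Q I n m" by (rule exE)
 note I = this[unfolded Q_def, rule_format]
 define Gk where "Gk = (\<lambda>k z. \<Sum>i<I k. G i z/of_nat k^i)"
 have Gk: "Gk k holomorphic_on \<Omega>" if "k \<ge> 1" for k unfolding Gk_def using that by (intro holomorphic_intros G) auto
 define f where "f = (\<lambda>k. ext_amp (Gk k))"
 define c where "c = (\<lambda>l. ext_amp (G l))"
 have xV: "x0 \<in> V0" using saturation_memI[OF lattice_0, of x0 W0] e by (simp add: square_def)
 have exp: "asymp_expansion V0 f c" unfolding asymp_expansion_def proof (intro allI impI)
  fix n :: nat and vs :: "plane list" and Kx assume Kx: "compact Kx \<and> Kx \<subseteq> V0"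
  obtain C where C: "C \<ge> 0" "\<forall>k\<ge>1. \<forall>z\<in>K. norm ((deriv ^^ length vs) (\<lambda>z. (\<Sum>i<I k. G i z/of_nat k^i) - (\<Sum>i<n. G i z/of_nat k^i)) z) \<le> C/real k^n"
   using I[of "length vs" n] by auto
  define p where "p = prod_list (map coord vs)"
  have "norm (iter_deriv vs (\<lambda>y. f k y - (\<Sum>l<n. (1/real k^l) *\<^sub>R c l y)) x) \<le> (norm p*C*norm Om)/real k^n"
   if k: "k \<ge> 1" and x: "x \<in> Kx" for k x proof -
   obtain r where r: "r \<in> lattice" "x \<in> (+) r ` W0" using x Kx unfolding saturation_UN by blast
   define H where "H = (\<lambda>z. (\<Sum>i<I k. G i z/of_nat k^i) - (\<Sum>i<n. G i z/of_nat k^i))"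
   have H: "H holomorphic_on \<Omega>" unfolding H_def using k by (intro holomorphic_intros G) auto
   have loc: "f k y - (\<Sum>l<n. (1/real k^l) *\<^sub>R c l y) = sc (H (coord y + - coord (r + n0))) Om" if y: "y \<in> (+) r ` W0" for y proof -
    define z where "z = coord y + - coord (r + n0)"
    have "(\<Sum>l<n. (1/real k^l) *\<^sub>R c l y) = (\<Sum>l<n. sc (of_real (1/real k^l) * G l z) Om)"
     unfolding c_def ext_amp_local[OF r(1) y] z_def sc_of_real[symmetric] sc_sc ..
    also have "... = sc (\<Sum>l<n. G l z/of_nat k^l) Om" unfolding sc_sum_left by simp
    finally have "f k y - (\<Sum>l<n. (1/real k^l) *\<^sub>R c l y) = sc (Gk k z) Om - sc (\<Sum>l<n. G l z/of_nat k^l) Om"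
     unfolding f_def ext_amp_local[OF r(1) y] z_def by simp
    also have "... = sc (H z) Om" using sc_add_left[of "H z" "\<Sum>l<n. G l z/of_nat k^l" Om] by (simp add: H_def Gk_def)
    finally show ?thesis unfolding z_def .
   qed
   have zin: "coord x + - coord (r + n0) \<in> K" unfolding K_def by (rule coord_translate_in[OF r(2)])
   have "iter_deriv vs (\<lambda>y. f k y - (\<Sum>l<n. (1/real k^l) *\<^sub>R c l y)) x = iter_deriv vs (\<lambda>y. sc (H (coord y + - coord (r + n0))) Om) x"
    by (rule iter_deriv_cong_open[OF open_translate_W0 r(2) loc])
   also have "... = sc (p*(deriv ^^ length vs) H (coord x + - coord (r + n0))) Om"
    unfolding p_def by (rule iter_deriv_holomorphic_compose[OF bounded_linear_sc_left bounded_linear_coord H \<Omega>]) (use zin K(2) in blast)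
   finally have "norm (iter_deriv vs (\<lambda>y. f k y - (\<Sum>l<n. (1/real k^l) *\<^sub>R c l y)) x) = norm p*norm ((deriv ^^ length vs) H (coord x + - coord (r + n0)))*norm Om"
    by (simp add: norm_sc norm_mult)
   also have "... \<le> norm p*(C/real k^n)*norm Om" unfolding H_def using C(2) k zin by (intro mult_right_mono mult_left_mono) auto
   finally show ?thesis by simp
  qed
  then show "\<exists>C. \<forall>k\<ge>1. \<forall>x\<in>Kx. norm (iter_deriv vs (\<lambda>y. f k y - (\<Sum>l<n. (1/real k^l) *\<^sub>R c l y)) x) \<le> C/real k^n" by blast
 qed
 have le1: "norm (phase0 n0 L y) \<le> 1" if "y \<in> W0" for y using on[OF that] off[OF that] by (cases "y \<in> \<Gamma>") auto
 have est: "\<exists>C. \<forall>k\<ge>1. \<forall>x\<in>V0. norm (\<xi> k x - ((kp k) powr (1/4 + N)) *\<^sub>R sc (ext_phase x^k) (f k x)) \<le> C/real k^n" for n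
 proof -
  define a where "a = nat \<lceil>\<bar>1/4 + N\<bar>\<rceil>"
  \<comment> \<open>Here \<open>k^a\<close> accounts for the growth of the prefactor,
    \<open>k^d\<close> for the loss in \<open>approx\<close>, and \<open>n\<close> is the decay
    asked for.\<close>
  define M where "M = Suc (n + d + a)"
  have M1: "M \<ge> 1" by (simp add: M_def)
  have a: "1/4 + N \<le> real a" unfolding a_def using real_nat_ceiling_ge[of "\<bar>1/4 + N\<bar>"] by linarith
  obtain C1 where C1: "C1 \<ge> 0" "\<forall>k\<ge>1. \<forall>y\<in>W0. norm (\<xi> k y - ((kp k) powr (1/4 + N)) *\<^sub>R sc (phase0 n0 L y^k) (sc (\<Sum>i<M. G i (coord (y - n0))/of_nat k^i) Om)) \<le> C1*real k^d/real k^M"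
   using approx[of M, OF M1] by (elim exE conjE) (rule that)
  obtain C2 where C2: "C2 \<ge> 0" "\<forall>k\<ge>1. \<forall>z\<in>K. norm ((deriv ^^ 0) (\<lambda>z. (\<Sum>i<I k. G i z/of_nat k^i) - (\<Sum>i<M. G i z/of_nat k^i)) z) \<le> C2/real k^M"
   using I[of 0 M] by auto
  define B where "B = (1/(2*pi)) powr (1/4 + N)"
  have "norm (\<xi> k x - ((kp k) powr (1/4 + N)) *\<^sub>R sc (ext_phase x^k) (f k x)) \<le> (C1 + B * C2*norm Om)/real k^n"
   if k: "k \<ge> 1" and x: "x \<in> V0" for k x proof -
   obtain r y where r: "r \<in> lattice" "y \<in> W0" "x = r + y" by (rule V0_cases[OF x])
   define P where "P = (kp k) powr (1/4 + N)"
   have k1: "real k \<ge> 1" using k by simp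
   have P: "0 \<le> P" "P \<le> B*real k^a" proof -
    have "P = (real k*(1/(2*pi))) powr (1/4 + N)" by (simp add: P_def)
    also have "... = real k powr (1/4 + N)*B" unfolding B_def by (rule powr_mult)
    also have "real k powr (1/4 + N) \<le> real k powr real a" by (rule powr_mono[OF a k1])
    also have "real k powr real a = real k^a" using k1 by (intro powr_realpow) auto
    finally show "P \<le> B*real k^a" by (simp add: B_def mult.commute mult_right_mono)
   qed (simp add: P_def)
   define ph where "ph = phase0 n0 L y^k"
   define cc where "cc = cis (real k * omega r y/2)"
   have z: "coord (y - n0) \<in> K" unfolding K_def using W0_cbox[OF r(2)] by blast
   have "ext_phase x^k = cc * ph"
    unfolding r(3) ext_phase_translate[OF r(1,2)] ph_def cc_def power_mult_distrib Complex.DeMoivre by (simp add: mult.commute)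
   moreover have "\<xi> k x = sc cc (\<xi> k y)" unfolding r(3) cc_def using sec[OF k] r(1) unfolding is_section_def by blast
   moreover have "f k x = sc (Gk k (coord (y - n0))) Om" unfolding f_def r(3) by (rule ext_amp_translate[OF r(1,2)])
   ultimately have "\<xi> k x - P *\<^sub>R sc (ext_phase x^k) (f k x) = sc cc (\<xi> k y) - sc cc (P *\<^sub>R sc ph (sc (Gk k (coord (y - n0))) Om))"
    by (simp add: sc_sc sc_scaleR_right mult.assoc)
   also have "... = sc cc (\<xi> k y - P *\<^sub>R sc ph (sc (Gk k (coord (y - n0))) Om))"
    using sc_add_right[of cc "\<xi> k y - P *\<^sub>R sc ph (sc (Gk k (coord (y - n0))) Om)" "P *\<^sub>R sc ph (sc (Gk k (coord (y - n0))) Om)"] by simp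
   finally have "norm (\<xi> k x - P *\<^sub>R sc (ext_phase x^k) (f k x)) = norm (\<xi> k y - P *\<^sub>R sc ph (sc (Gk k (coord (y - n0))) Om))"
    by (simp add: norm_sc cc_def)
   also have "... \<le> norm (\<xi> k y - P *\<^sub>R sc ph (sc (\<Sum>i<M. G i (coord (y - n0))/of_nat k^i) Om))
     + norm (P *\<^sub>R sc ph (sc (\<Sum>i<M. G i (coord (y - n0))/of_nat k^i) Om) - P *\<^sub>R sc ph (sc (Gk k (coord (y - n0))) Om))"
    using norm_triangle_ineq[of "\<xi> k y - P *\<^sub>R sc ph (sc (\<Sum>i<M. G i (coord (y - n0))/of_nat k^i) Om)"
     "P *\<^sub>R sc ph (sc (\<Sum>i<M. G i (coord (y - n0))/of_nat k^i) Om) - P *\<^sub>R sc ph (sc (Gk k (coord (y - n0))) Om)"] by simp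
   also have "... \<le> C1/real k^n + B * C2*norm Om/real k^n" proof (rule add_mono)
    have "norm (\<xi> k y - P *\<^sub>R sc ph (sc (\<Sum>i<M. G i (coord (y - n0))/of_nat k^i) Om)) \<le> C1*real k^d/real k^M"
     unfolding P_def ph_def using C1(2) k r(2) by blast
    also have "... \<le> C1/real k^n" proof -
     have "real k^(d + n) \<le> real k^M" using k1 by (intro power_increasing) (auto simp: M_def)
     then have "C1*(real k^d*real k^n) \<le> C1*real k^M" unfolding power_add by (intro mult_left_mono C1(1))
     then show ?thesis using k1 by (simp add: field_simps)
    qed
    finally show "norm (\<xi> k y - P *\<^sub>R sc ph (sc (\<Sum>i<M. G i (coord (y - n0))/of_nat k^i) Om)) \<le> C1/real k^n" .
    define D where "D = (\<Sum>i<I k. G i (coord (y - n0))/of_nat k^i) - (\<Sum>i<M. G i (coord (y - n0))/of_nat k^i)"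
    have D: "norm D \<le> C2/real k^M" using C2(2)[rule_format, OF k z] by (simp add: D_def)
    have "norm (P *\<^sub>R sc ph (sc (\<Sum>i<M. G i (coord (y - n0))/of_nat k^i) Om) - P *\<^sub>R sc ph (sc (Gk k (coord (y - n0))) Om)) = P*(norm ph*norm D*norm Om)"
    proof -
     have "Gk k (coord (y - n0)) = D + (\<Sum>i<M. G i (coord (y - n0))/of_nat k^i)" by (simp add: D_def Gk_def)
     then have "P *\<^sub>R sc ph (sc (\<Sum>i<M. G i (coord (y - n0))/of_nat k^i) Om) - P *\<^sub>R sc ph (sc (Gk k (coord (y - n0))) Om) = - (P *\<^sub>R sc (ph * D) Om)"
      by (simp add: sc_add_left sc_add_right scaleR_add_right sc_sc)
     then show ?thesis using P(1) by (simp add: norm_sc norm_mult)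
    qed
    also have "... \<le> (B*real k^a)*(1*(C2/real k^M)*norm Om)" proof (intro mult_mono P D)
     show "norm ph \<le> 1" unfolding ph_def norm_power using le1[OF r(2)] by (simp add: power_le_one)
    qed (use C2(1) in \<open>auto simp: B_def\<close>)
    also have "... \<le> B * C2*norm Om/real k^n" proof -
     have "real k^(a + n) \<le> real k^M" using k1 by (intro power_increasing) (auto simp: M_def)
     then have "(B * C2*norm Om)*(real k^a*real k^n) \<le> (B * C2*norm Om)*real k^M"
      unfolding power_add using C2(1) by (intro mult_left_mono) (auto simp: B_def)
     then show ?thesis using k1 by (simp add: field_simps)
    qed
    finally show "norm (P *\<^sub>R sc ph (sc (\<Sum>i<M. G i (coord (y - n0))/of_nat k^i) Om) - P *\<^sub>R sc ph (sc (Gk k (coord (y - n0))) Om)) \<le> B * C2*norm Om/real k^n" .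
   qed
   finally show ?thesis unfolding P_def by (simp add: add_divide_distrib)
  qed
  then show ?thesis by blast
 qed
 have th: "ext_phase x = \<Theta> x" if x: "x \<in> \<Gamma> \<inter> V0" for x proof -
  obtain r y where r: "r \<in> lattice" "y \<in> W0" "x = r + y" using x by (auto elim: V0_cases)
  have y: "y \<in> \<Gamma>" using x r(3) saturated_translate[OF \<Gamma> r(1)] by simp
  have "\<Theta> x = cis (real 1 * omega r y/2)*\<Theta> y" using \<Theta> r(1) y unfolding r(3) is_section_def by blast
  then show ?thesis unfolding r(3) ext_phase_translate[OF r(1,2)] using on[OF r(2) y] by simp
 qed
 have sg: "c 0 x = \<sigma> x" if x: "x \<in> \<Gamma> \<inter> V0" for x proof -
  obtain r y where r: "r \<in> lattice" "y \<in> W0" "x = r + y" using x by (auto elim: V0_cases)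
  have y: "y \<in> \<Gamma>" using x r(3) saturated_translate[OF \<Gamma> r(1)] by simp
  have "\<sigma> x = sc (cis (real 0 * omega r y/2)) (\<sigma> y)" using \<sigma> r(1) y unfolding r(3) is_section_def by blast
  then show ?thesis unfolding c_def r(3) ext_amp_translate[OF r(1,2)] using on[OF r(2) y] by simp
 qed
 have lt: "norm (ext_phase x) < 1" if x: "x \<in> V0 - \<Gamma>" for x proof -
  obtain r y where r: "r \<in> lattice" "y \<in> W0" "x = r + y" using x by (auto elim: V0_cases)
  have y: "y \<notin> \<Gamma>" using x r(3) saturated_translate[OF \<Gamma> r(1)] by simp
  show ?thesis unfolding r(3) ext_phase_translate[OF r(1,2)] norm_mult using off[OF r(2) y] by simp
 qed
 \<comment> \<open>The extended phase is exactly holomorphic on an open set, so every iterated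
   derivative of its \<open>dbar\<close> is 0 there.\<close>
 have van: "vanishes_inf_order (\<Gamma> \<inter> V0) (\<lambda>x. dbar j (*) 1 ext_phase x v)" for v unfolding vanishes_inf_order_def
 proof (intro allI ballI)
  fix vs x assume x: "x \<in> \<Gamma> \<inter> V0"
  have "iter_deriv vs (\<lambda>x. dbar j (*) 1 ext_phase x v) x = iter_deriv vs (\<lambda>x. 0) x"
   by (rule iter_deriv_cong_open[of V0]) (use x dbar_ext_phase open_saturation[OF open_square] in auto)
  also have "iter_deriv vs (\<lambda>x::plane. 0 :: complex) = (\<lambda>x. 0)" by (induction vs) (auto simp: frechet_eq)
  finally show "iter_deriv vs (\<lambda>x. dbar j (*) 1 ext_phase x v) x = 0" .
 qed
 show ?thesis unfolding lag_at_def proof (rule exI[of _ V0], rule exI[of _ ext_phase], rule exI[of _ f], rule exI[of _ c], intro conjI)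
  show "open_M V0" by (rule open_M_saturation[OF open_square])
  show "x0 \<in> V0" by (rule xV)
  show "V0 \<subseteq> U" by (rule saturation_subset[OF U WU])
  show "is_section (*) 1 V0 ext_phase" by (rule section_ext_phase)
  show "smooth_on V0 ext_phase" by (rule smooth_ext_phase)
  show "\<forall>x\<in>\<Gamma> \<inter> V0. ext_phase x = \<Theta> x" using th by blast
  show "\<forall>x\<in>V0 - \<Gamma>. norm (ext_phase x) < 1" using lt by blast
  show "\<forall>v. vanishes_inf_order (\<Gamma> \<inter> V0) (\<lambda>x. dbar j (*) 1 ext_phase x v)" using van by blast
  show "\<forall>k\<ge>1. is_section sc 0 V0 (f k) \<and> smooth_on V0 (f k)" unfolding f_def using section_ext_amp smooth_ext_amp[OF Gk] by blast
  show "\<forall>l. is_section sc 0 V0 (c l) \<and> smooth_on V0 (c l)" unfolding c_def using section_ext_amp smooth_ext_amp[OF G] by blast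
  show "asymp_expansion V0 f c" by (rule exp)
  show "\<forall>x\<in>\<Gamma> \<inter> V0. c 0 x = \<sigma> x" using sg by blast
  show "\<forall>n. \<exists>C. \<forall>k\<ge>1. \<forall>x\<in>V0. norm (\<xi> k x - ((kp k) powr (1/4 + N)) *\<^sub>R sc (ext_phase x^k) (f k x)) \<le> C/real k^n"
   using est by blast
 qed
qed

end

end

section \<open>The curves and their flat section\<close>

lemma A1_iff: "x \<in> A1 \<longleftrightarrow> snd x \<in> \<int>" proof
 assume "x \<in> A1"
 then obtain r p where "r \<in> lattice" "x = r + p *\<^sub>R mu" unfolding A1_def saturation_def by blast
 then show "snd x \<in> \<int>" by (auto simp: lattice_def mu_def)
next
 assume x: "snd x \<in> \<int>"
 have "(0, snd x) + fst x *\<^sub>R mu \<in> A1" unfolding A1_def by (rule saturation_memI) (use x in \<open>auto simp: lattice_def\<close>)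
 then show "x \<in> A1" by (simp add: mu_def)
qed

lemma half_not_Ints: "(1/2 :: real) \<notin> \<int>" proof
 assume "(1/2 :: real) \<in> \<int>"
 then obtain n :: int where "(1/2 :: real) = of_int n" by (elim Ints_cases)
 then have "real_of_int 1 = of_int (2*n)" by simp
 then have "1 = 2*n" by (simp only: of_int_eq_iff)
 then show False by presburger
qed

lemma A2_iff: "x \<in> A2 \<longleftrightarrow> 2 * fst x \<in> \<int>" proof
 assume "x \<in> A2"
 then obtain r q where r: "r \<in> lattice" and x: "x = r + q *\<^sub>R lam \<or> x = r + ((1/2) *\<^sub>R mu + q *\<^sub>R lam)"
  unfolding A2_def saturation_def by blast
 obtain m :: int where m: "fst r = of_int m" using r unfolding lattice_def by (auto elim!: Ints_cases)
 from x have "2 * fst x = of_int (2*m) \<or> 2 * fst x = of_int (2*m + 1)" by (auto simp: m mu_def lam_def)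
 then show "2 * fst x \<in> \<int>" by (metis Ints_of_int)
next
 assume "2 * fst x \<in> \<int>"
 then obtain n :: int where n: "2 * fst x = of_int n" by (elim Ints_cases)
 define m where "m = n div 2"
 have l: "(of_int m, 0) \<in> lattice" by (simp add: lattice_def)
 show "x \<in> A2" proof (cases "even n")
  case True
  then have "n = 2*m" by (simp add: m_def)
  then have "fst x = of_int m" using n by simp
  then have "x = (of_int m, 0) + snd x *\<^sub>R lam" by (simp add: lam_def prod_eq_iff)
  also have "... \<in> A2" unfolding A2_def by (rule saturation_memI[OF l]) blast
  finally show ?thesis .
 next
  case False
  then have "n = 2*m + 1" by (simp add: m_def)
  then have "fst x = of_int m + 1/2" using n by simp
  then have "x = (of_int m, 0) + ((1/2) *\<^sub>R mu + snd x *\<^sub>R lam)" by (simp add: lam_def mu_def prod_eq_iff)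
  also have "... \<in> A2" unfolding A2_def by (rule saturation_memI[OF l]) blast
  finally show ?thesis .
 qed
qed

lemma saturated_A1: "saturated A1" and saturated_A2: "saturated A2" unfolding A1_def A2_def by (rule saturated_saturation)+

lemma saturated_Compl: "saturated S ==> saturated (- S)" using saturated_translate unfolding saturated_def by blast

lemma saturated_Diff: "saturated S ==> saturated T ==> saturated (S - T)" using saturated_translate unfolding saturated_def by blast

lemma open_M_A1: "open_M (- A1)" proof -
 have "closed ((\<lambda>x::plane. snd x) -` \<int>)" by (intro closed_vimage closed_Ints continuous_intros)
 moreover have "A1 = (\<lambda>x::plane. snd x) -` \<int>" using A1_iff by blast
 ultimately show ?thesis unfolding open_M_def using saturated_Compl[OF saturated_A1] by (simp add: open_closed)
qed

lemma open_M_A2: "open_M (- A2)" proof -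
 have "closed ((\<lambda>x::plane. 2 * fst x) -` \<int>)" by (intro closed_vimage closed_Ints continuous_intros)
 moreover have "A2 = (\<lambda>x::plane. 2 * fst x) -` \<int>" using A2_iff by blast
 ultimately show ?thesis unfolding open_M_def using saturated_Compl[OF saturated_A2] by (simp add: open_closed)
qed

lemma Ints_close_eq: "a \<in> \<int> ==> b \<in> \<int> ==> \<bar>a - b\<bar> < 1 ==> a = (b :: real)" by (elim Ints_cases) (simp flip: of_int_diff)

lemma submanifold_1dI:
 assumes l: "bounded_linear (l :: plane => real)" "l v = 1" and G: "\<Gamma> \<subseteq> U" "saturated \<Gamma>"
  and loc: "\<And>x. x \<in> \<Gamma> ==> \<exists>W. open W \<and> x \<in> W \<and> W \<subseteq> U \<and> \<Gamma> \<inter> W = {y \<in> W. l y = l x}"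
 shows "submanifold_1d U \<Gamma>" unfolding submanifold_1d_def proof (intro conjI G ballI)
 fix x assume "x \<in> \<Gamma>"
 then obtain W where W: "open W" "x \<in> W" "W \<subseteq> U" "\<Gamma> \<inter> W = {y \<in> W. l y = l x}" using loc by blast
 define \<rho> where "\<rho> = (\<lambda>y. l y + - l x)"
 have "smooth_on W \<rho>" unfolding \<rho>_def by (intro smooth_on_add smooth_on_const smooth_on_bounded_linear l W)
 moreover have "frechet_derivative \<rho> (at y) v \<noteq> 0" for y proof -
  have "(\<rho> has_derivative (\<lambda>h. l h + 0)) (at y)" unfolding \<rho>_def
   by (intro has_derivative_add bounded_linear.has_derivative[OF l(1)] has_derivative_ident has_derivative_const)
  from frechet_eq[OF this] show ?thesis using l(2) by simp
 qed
 moreover have "\<Gamma> \<inter> W = {y \<in> W. \<rho> y = 0}" unfolding W(4) \<rho>_def by auto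
 ultimately show "\<exists>W (\<rho> :: plane => real). open W \<and> x \<in> W \<and> W \<subseteq> U \<and> smooth_on W \<rho> \<and>
    (\<forall>y\<in>W. \<exists>v. frechet_derivative \<rho> (at y) v \<noteq> 0) \<and> \<Gamma> \<inter> W = {y \<in> W. \<rho> y = 0}"
  using W(1,2,3) by blast
qed

lemma submanifold_A1: "submanifold_1d (- A2) (A1 - A2)" proof (rule submanifold_1dI[OF bounded_linear_snd, of "(0, 1)"])
 fix x assume x: "x \<in> A1 - A2"
 define W where "W = - A2 \<inter> {y. \<bar>snd y - snd x\<bar> < 1}"
 have "open {y::plane. \<bar>snd y - snd x\<bar> < 1}" by (intro open_Collect_less continuous_intros)
 then have "open W" using open_M_A2 unfolding W_def open_M_def by blast
 moreover have "(A1 - A2) \<inter> W = {y \<in> W. snd y = snd x}" using x Ints_close_eq unfolding W_def A1_iff[abs_def] by (auto simp: A1_iff)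
 ultimately show "\<exists>W. open W \<and> x \<in> W \<and> W \<subseteq> - A2 \<and> (A1 - A2) \<inter> W = {y \<in> W. snd y = snd x}"
  using x by (intro exI[of _ W]) (auto simp: W_def)
qed (use saturated_Diff[OF saturated_A1 saturated_A2] in auto)

lemma submanifold_A2: "submanifold_1d (- A1) (A2 - A1)" proof (rule submanifold_1dI[OF bounded_linear_fst, of "(1, 0)"])
 fix x assume x: "x \<in> A2 - A1"
 define W where "W = - A1 \<inter> {y. \<bar>fst y - fst x\<bar> < 1/2}"
 have "open {y::plane. \<bar>fst y - fst x\<bar> < 1/2}" by (intro open_Collect_less continuous_intros)
 then have "open W" using open_M_A1 unfolding W_def open_M_def by blast
 moreover have "(A2 - A1) \<inter> W = {y \<in> W. fst y = fst x}" proof -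
  have "fst y = fst x" if "y \<in> A2" "\<bar>fst y - fst x\<bar> < 1/2" for y proof -
   have "\<bar>2 * fst y - 2 * fst x\<bar> < 1" using that(2) by linarith
   then show ?thesis using Ints_close_eq[of "2 * fst y" "2 * fst x"] that(1) x by (simp add: A2_iff)
  qed
  then show ?thesis using x unfolding W_def by (auto simp: A2_iff)
 qed
 ultimately show "\<exists>W. open W \<and> x \<in> W \<and> W \<subseteq> - A1 \<and> (A2 - A1) \<inter> W = {y \<in> W. fst y = fst x}"
  using x by (intro exI[of _ W]) (auto simp: W_def)
qed (use saturated_Diff[OF saturated_A2 saturated_A1] in auto)

lemma flat_section_subset:
 assumes "flat_section S \<Theta>" "T \<subseteq> S" shows "flat_section T \<Theta>" unfolding flat_section_def proof (intro conjI allI impI)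
 show "is_section (*) 1 T \<Theta>" using assms unfolding flat_section_def is_section_def by blast
 show "continuous_on T \<Theta>" using assms continuous_on_subset unfolding flat_section_def by blast
 fix \<gamma> :: "real => plane" and t v assume a: "eventually (\<lambda>s. \<gamma> s \<in> T) (nhds t) \<and> (\<gamma> has_vector_derivative v) (at t)"
 then have "eventually (\<lambda>s. \<gamma> s \<in> S) (nhds t)" using assms(2) by (auto elim: eventually_mono)
 with a assms(1) show "((\<lambda>s. \<Theta> (\<gamma> s)) has_vector_derivative - (1 / \<i> * of_real (alpha (\<gamma> t) v)*\<Theta> (\<gamma> t))) (at t)"
  unfolding flat_section_def by blast
qed

text \<open>Along a straight line the connection form is constant,
  \<open>alpha (a + t b) b = alpha a b\<close>, so the transport equation integrates to a pure
  exponential.\<close>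

lemma flat_section_line:
 assumes fl: "flat_section S \<Theta>" and line: "\<And>t. a + t *\<^sub>R b \<in> S"
 shows "\<Theta> (a + t *\<^sub>R b) = cis (t * alpha a b)*\<Theta> a" proof -
 define h where "h = (\<lambda>t. exp (of_real t*(- \<i> * of_real (alpha a b)))*\<Theta> (a + t *\<^sub>R b))"
 have "(h has_vector_derivative 0) (at t)" for t proof -
  have "((\<lambda>t. a + t *\<^sub>R b) has_vector_derivative b) (at t)" by (auto intro!: derivative_eq_intros)
  then have "((\<lambda>s. \<Theta> (a + s *\<^sub>R b)) has_vector_derivative - (1 / \<i> * of_real (alpha (a + t *\<^sub>R b) b)*\<Theta> (a + t *\<^sub>R b))) (at t)"
   by (intro fl[unfolded flat_section_def, THEN conjunct2, THEN conjunct2, rule_format, of "\<lambda>s. a + s *\<^sub>R b" t b] conjI) (simp_all add: line)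
  moreover have "alpha (a + t *\<^sub>R b) b = alpha a b" by (simp add: alpha_def omega_def algebra_simps)
  ultimately have 1: "((\<lambda>s. \<Theta> (a + s *\<^sub>R b)) has_vector_derivative (\<i> * of_real (alpha a b)*\<Theta> (a + t *\<^sub>R b))) (at t)" by simp
  have 2: "((\<lambda>t. exp (of_real t*(- \<i> * of_real (alpha a b)))) has_vector_derivative (- \<i> * of_real (alpha a b))*exp (of_real t*(- \<i> * of_real (alpha a b)))) (at t)"
   by (rule has_vector_derivative_real_field) (auto intro!: derivative_eq_intros)
  show ?thesis unfolding h_def using has_vector_derivative_mult[OF 2 1] by (simp add: algebra_simps)
 qed
 then have "h t = h 0" using has_vector_derivative_zero_constant[of UNIV h] by (metis UNIV_I convex_UNIV)
 then have "exp (of_real t*(\<i> * of_real (alpha a b)))*h t = exp (of_real t*(\<i> * of_real (alpha a b)))*\<Theta> a" by (simp add: h_def)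
 moreover have "exp (of_real t*(\<i> * of_real (alpha a b)))*h t = \<Theta> (a + t *\<^sub>R b)"
  unfolding h_def by (simp add: mult.assoc[symmetric] exp_add[symmetric])
 moreover have "exp (of_real t*(\<i> * of_real (alpha a b))) = cis (t * alpha a b)" by (simp add: cis_conv_exp mult_ac)
 ultimately show ?thesis by simp
qed

context
 fixes \<Theta> :: "plane => complex"
 assumes fl: "flat_section (A1 \<union> A2) \<Theta>" and \<Theta>0: "\<Theta> 0 = 1"
begin

lemma Theta_mu: "\<Theta> (p, 0) = 1" proof -
 have "\<Theta> (0 + p *\<^sub>R mu) = cis (p * alpha 0 mu)*\<Theta> 0" by (rule flat_section_line[OF fl]) (simp add: A1_iff mu_def)
 then show ?thesis by (simp add: mu_def alpha_def omega_def \<Theta>0)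
qed

lemma Theta_lam: "\<Theta> (0, q) = 1" proof -
 have "\<Theta> (0 + q *\<^sub>R lam) = cis (q * alpha 0 lam)*\<Theta> 0" by (rule flat_section_line[OF fl]) (simp add: A2_iff lam_def)
 then show ?thesis by (simp add: lam_def alpha_def omega_def \<Theta>0)
qed

text \<open>The line starts at \<open>mu/2\<close>, reached along the first curve with value 1, and
  there \<open>alpha\<close> takes the value \<open>pi\<close> on \<open>lam\<close>.\<close>

lemma Theta_half: "\<Theta> (1/2, q) = cis (pi*q)" proof -
 have "\<Theta> ((1/2, 0) + q *\<^sub>R lam) = cis (q * alpha (1/2, 0) lam)*\<Theta> (1/2, 0)" by (rule flat_section_line[OF fl]) (simp add: A2_iff lam_def)
 then show ?thesis by (simp add: lam_def alpha_def omega_def Theta_mu mult.commute)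
qed

lemma norm_Theta:
 assumes "x \<in> A1 \<union> A2" shows "norm (\<Theta> x) = 1" proof -
 have tr: "norm (\<Theta> (r + y)) = norm (\<Theta> y)" if "r \<in> lattice" "y \<in> A1 \<union> A2" for r y proof -
  have "\<Theta> (r + y) = cis (real 1 * omega r y/2)*\<Theta> y" using fl that unfolding flat_section_def is_section_def by blast
  then show ?thesis by (simp add: norm_mult)
 qed
 show ?thesis proof (cases "x \<in> A1")
  case True
  then obtain r p where r: "r \<in> lattice" "x = r + p *\<^sub>R mu" unfolding A1_def saturation_def by blast
  show ?thesis unfolding r(2) using tr[OF r(1), of "p *\<^sub>R mu"] Theta_mu[of p] by (simp add: A1_iff mu_def)
 next
  case False
  then obtain r q where r: "r \<in> lattice" "x = r + q *\<^sub>R lam \<or> x = r + ((1/2) *\<^sub>R mu + q *\<^sub>R lam)"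
   using assms unfolding A2_def saturation_def by blast
  show ?thesis using r(2) tr[OF r(1), of "q *\<^sub>R lam"] tr[OF r(1), of "(1/2) *\<^sub>R mu + q *\<^sub>R lam"] Theta_lam[of q] Theta_half[of q]
   by (auto simp: A2_iff mu_def lam_def)
 qed
qed

end

context half_form_setup
begin

definition sigma1 :: "nat => plane => 'd" where
 "sigma1 g x = sc (\<i> * of_real (sqrt 2*pi^g * sin (2*pi * fst x) powi (1 - 2*int g))) Om"

text \<open>\<open>frac\<close> makes the symbol periodic in \<open>q\<close>. The leading minus
  sign arises because the expansion is made at \<open>-1 < q < 0\<close> with amplitude
  \<open>P0 (-2q)\<close>, which the antisymmetry of \<open>P0\<close> about 1 turns into
  \<open>- P0 (2 * frac q)\<close>. The sign for non-integer \<open>fst x\<close> belongs to the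
  second component.\<close>

definition sigma2 :: "real poly => plane => 'd" where
 "sigma2 P0 x = sc (- (if fst x \<in> \<int> then 1 else - 1)*(of_real (sqrt (pi/2))/csqrt (- \<i>*modulus)) * of_real (poly P0 (2 * frac (snd x)))) Om"

lemma sigma1_section: "is_section sc 0 S (sigma1 g)" unfolding is_section_def proof (intro ballI)
 fix r y :: plane assume r: "r \<in> lattice"
 obtain m :: int where m: "fst r = of_int m" using r unfolding lattice_def by (auto elim!: Ints_cases)
 have "2*pi * fst (r + y) = 2*pi * fst y + 2*pi * of_int m" by (simp add: m algebra_simps)
 then have "sin (2*pi * fst (r + y)) = sin (2*pi * fst y)" using sin.plus_of_int[of "2*pi * fst y" m] by (simp add: mult_ac)
 then show "sigma1 g (r + y) = sc (cis (real 0 * omega r y/2)) (sigma1 g y)" unfolding sigma1_def by simp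
qed

lemma sigma2_section: "is_section sc 0 S (sigma2 P0)" unfolding is_section_def proof (intro ballI)
 fix r y :: plane assume r: "r \<in> lattice"
 obtain m n :: int where m: "r = (of_int m, of_int n)" using r unfolding lattice_def by (auto elim!: Ints_cases)
 have "of_int m + fst y \<in> \<int> \<longleftrightarrow> fst y \<in> \<int>" by (metis Ints_add Ints_diff Ints_of_int add_diff_cancel_left')
 moreover have "frac (of_int n + snd y) = frac (snd y)" by (simp add: frac_def)
 ultimately show "sigma2 P0 (r + y) = sc (cis (real 0 * omega r y/2)) (sigma2 P0 y)" unfolding sigma2_def m by simp
qed

context
 fixes \<Psi> :: "nat => int => plane => 'd" and g :: nat
 assumes basis: "\<And>k. k \<ge> 1 ==> quantum_basis j sc herm Om k (\<Psi> k)" and g: "g \<ge> 1"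
begin

section \<open>Microsupport and local form of the state\<close>

lemma Z_state_approx:
 assumes C1: "C1 \<ge> 0" "\<forall>k\<ge>1. \<forall>y\<in>S. norm (Z0 g k y - of_real ((kp k) powr a)*(ph y^k * T k y)) \<le> C1*real k^d/real k^M"
 shows "\<exists>C\<ge>0. \<forall>k\<ge>1. \<forall>y\<in>S. norm (Z_state \<Psi> g k y - ((kp k) powr a) *\<^sub>R sc (ph y^k) (sc (T k y) Om)) \<le> C*real k^d/real k^M"
proof -
 obtain C2 where C2: "C2 \<ge> 0" "\<forall>k\<ge>1. \<forall>x. norm (Z_state \<Psi> g k x - sc (Z0 g k x) Om) \<le> C2/real k^M"
  using Z_state_close[of \<Psi> g M, OF basis g] by blast
 have "norm (Z_state \<Psi> g k y - ((kp k) powr a) *\<^sub>R sc (ph y^k) (sc (T k y) Om)) \<le> (C2 + C1*norm Om)*real k^d/real k^M"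
  if k: "k \<ge> 1" and y: "y \<in> S" for k y proof -
  define D where "D = Z0 g k y - of_real ((kp k) powr a)*(ph y^k * T k y)"
  have kd: "1 \<le> real k^d" using k by simp
  have "((kp k) powr a) *\<^sub>R sc (ph y^k) (sc (T k y) Om) = sc (of_real ((kp k) powr a)*(ph y^k * T k y)) Om"
   unfolding sc_sc sc_of_real[symmetric] ..
  then have "Z_state \<Psi> g k y - ((kp k) powr a) *\<^sub>R sc (ph y^k) (sc (T k y) Om) = (Z_state \<Psi> g k y - sc (Z0 g k y) Om) + sc D Om"
   using sc_add_left[of D "of_real ((kp k) powr a)*(ph y^k * T k y)" Om] by (simp add: D_def)
  note eq = this
  have "norm (Z_state \<Psi> g k y - ((kp k) powr a) *\<^sub>R sc (ph y^k) (sc (T k y) Om)) \<le> norm (Z_state \<Psi> g k y - sc (Z0 g k y) Om) + norm D*norm Om"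
   unfolding eq norm_sc[of D Om, symmetric] by (rule norm_triangle_ineq)
  also have "... \<le> C2*real k^d/real k^M + (C1*real k^d/real k^M)*norm Om" proof (rule add_mono)
   have "C2*1 \<le> C2*real k^d" by (rule mult_left_mono[OF kd C2(1)])
   then have "C2/real k^M \<le> C2*real k^d/real k^M" by (simp add: divide_right_mono)
   with C2(2)[rule_format, OF k, of y] show "norm (Z_state \<Psi> g k y - sc (Z0 g k y) Om) \<le> C2*real k^d/real k^M" by (rule order_trans)
   show "norm D*norm Om \<le> (C1*real k^d/real k^M)*norm Om" unfolding D_def by (rule mult_right_mono) (use C1(2) k y in auto)
  qed
  also have "... = (C2 + C1*norm Om)*real k^d/real k^M" by (simp add: add_divide_distrib algebra_simps)
  finally show ?thesis .
 qed
 moreover have "C2 + C1*norm Om \<ge> 0" using C1(1) C2(1) by simp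
 ultimately show ?thesis by blast
qed

text \<open>A point off both curves has \<open>2p\<close> not an integer and a representative with
  \<open>0 < |q| <= 1/2\<close>. There the theta sum of the inverted modulus is already negligible,
  and the norm of a section is invariant under the lattice.\<close>

lemma microsupport_Z_state: "microsupport (Z_state \<Psi> g) \<subseteq> A1 \<union> A2" proof
 fix x assume x: "x \<in> microsupport (Z_state \<Psi> g)"
 show "x \<in> A1 \<union> A2" proof (rule ccontr)
  assume "x \<notin> A1 \<union> A2"
  then have p: "2 * fst x \<notin> \<int>" and q: "snd x \<notin> \<int>" by (auto simp: A1_iff A2_iff)
  define n where "n = \<lfloor>snd x + 1/2\<rfloor>"
  define q1 where "q1 = snd x - of_int n"
  have q1: "\<bar>q1\<bar> \<le> 1/2" unfolding q1_def n_def by linarith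
  have "q1 \<noteq> 0" using q unfolding q1_def by auto
  then have \<delta>: "\<bar>q1\<bar>/2 > 0" by simp
  obtain \<epsilon> where \<epsilon>: "\<epsilon> > 0" "\<forall>N. \<exists>C\<ge>0. \<forall>k\<ge>1. \<forall>p q. \<bar>p - fst x\<bar> \<le> \<epsilon> --> \<bar>q1\<bar>/2 \<le> \<bar>q\<bar> --> \<bar>q\<bar> \<le> 3/4 -->
   norm (Z0 g k (p, q)) \<le> C/real k^N" using region_1_negligible[OF g p \<delta>] by (elim exE conjE) (rule that)
  \<comment> \<open>This size keeps \<open>|q1|/2 <= |q| <= 3/4\<close> on the whole square.\<close>
  define e where "e = min \<epsilon> (min (\<bar>q1\<bar>/2) (1/4))"
  have e: "e > 0" using \<epsilon>(1) \<delta> by (simp add: e_def)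
  define x' where "x' = (fst x, q1)"
  have est: "\<exists>C. \<forall>k\<ge>1. \<forall>y\<in>saturation (square x' e). norm (Z_state \<Psi> g k y) \<le> C/real k^N" for N proof -
   obtain C1 where C1: "C1 \<ge> 0" "\<forall>k\<ge>1. \<forall>p q. \<bar>p - fst x\<bar> \<le> \<epsilon> --> \<bar>q1\<bar>/2 \<le> \<bar>q\<bar> --> \<bar>q\<bar> \<le> 3/4 -->
    norm (Z0 g k (p, q)) \<le> C1/real k^N" using \<epsilon>(2)[THEN spec, of N] by (elim exE conjE) (rule that)
   obtain C2 where C2: "C2 \<ge> 0" "\<forall>k\<ge>1. \<forall>x. norm (Z_state \<Psi> g k x - sc (Z0 g k x) Om) \<le> C2/real k^N"
    using Z_state_close[of \<Psi> g N, OF basis g] by blast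
   have "norm (Z_state \<Psi> g k z) \<le> (C1*norm Om + C2)/real k^N" if k: "k \<ge> 1" and z: "z \<in> saturation (square x' e)" for k z proof -
    obtain r y where r: "r \<in> lattice" "y \<in> square x' e" "z = r + y" using z unfolding saturation_def by blast
    have "Z_state \<Psi> g k z = sc (cis (real k * omega r y/2)) (Z_state \<Psi> g k y)"
     unfolding r(3) using Z_state_section[of \<Psi> k g, OF basis k] r(1) unfolding is_section_def by blast
    then have "norm (Z_state \<Psi> g k z) = norm (Z_state \<Psi> g k y)" by (simp add: norm_sc)
    also have "... \<le> norm (sc (Z0 g k y) Om) + norm (Z_state \<Psi> g k y - sc (Z0 g k y) Om)"
     using norm_triangle_ineq[of "sc (Z0 g k y) Om" "Z_state \<Psi> g k y - sc (Z0 g k y) Om"] by simp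
    also have "... \<le> C1/real k^N*norm Om + C2/real k^N" proof (rule add_mono)
     have "\<bar>fst y - fst x\<bar> \<le> \<epsilon>" "\<bar>q1\<bar>/2 \<le> \<bar>snd y\<bar>" "\<bar>snd y\<bar> \<le> 3/4" proof -
      have "\<bar>fst y - fst x\<bar> < e" "\<bar>snd y - q1\<bar> < e" using r(2) by (auto simp: square_def x'_def)
      moreover have "e \<le> \<epsilon>" "e \<le> \<bar>q1\<bar>/2" "e \<le> 1/4" unfolding e_def by linarith+
      ultimately show "\<bar>fst y - fst x\<bar> \<le> \<epsilon>" "\<bar>q1\<bar>/2 \<le> \<bar>snd y\<bar>" "\<bar>snd y\<bar> \<le> 3/4" using q1 by linarith+
     qed
     then have "norm (Z0 g k (fst y, snd y)) \<le> C1/real k^N" using C1(2) k by blast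
     then show "norm (sc (Z0 g k y) Om) \<le> C1/real k^N*norm Om" unfolding norm_sc by (intro mult_right_mono) auto
    qed (use C2(2) k in blast)
    finally show ?thesis by (simp add: add_divide_distrib)
   qed
   then show ?thesis by blast
  qed
  have "x = (0, of_int n) + x'" by (simp add: x'_def q1_def prod_eq_iff)
  also have "... \<in> saturation (square x' e)" by (rule saturation_memI) (use e in \<open>auto simp: lattice_def square_def\<close>)
  finally have "x \<notin> microsupport (Z_state \<Psi> g)" unfolding microsupport_def using open_M_saturation[OF open_square] est by blast
  with x show False by simp
 qed
qed

context
 fixes \<Theta> :: "plane => complex"
 assumes fl: "flat_section (A1 \<union> A2) \<Theta>" and \<Theta>0: "\<Theta> 0 = 1"
begin

lemma Theta_section: "T \<subseteq> A1 \<union> A2 ==> is_section (*) 1 T \<Theta>"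
 using flat_section_subset[OF fl] unfolding flat_section_def by blast

lemma lagrangian_stateI:
 assumes "open_M U" "submanifold_1d U \<Gamma>" "\<Gamma> \<subseteq> A1 \<union> A2" "(A1 \<union> A2) \<inter> U \<subseteq> \<Gamma>" "is_section sc 0 \<Gamma> \<sigma>"
  and "\<And>x0. x0 \<in> \<Gamma> ==> lag_at U (Z_state \<Psi> g) \<Gamma> \<Theta> \<sigma> N x0"
 shows "lagrangian_state j sc herm U (Z_state \<Psi> g) \<Gamma> \<Theta> \<sigma> N" unfolding lagrangian_state_def unfolding lag_at_def[symmetric]
proof (intro conjI assms(1,2,5) Z_state_admissible basis g ballI)
 show "flat_section \<Gamma> \<Theta>" by (rule flat_section_subset[OF fl assms(3)])
 show "microsupport (Z_state \<Psi> g) \<inter> U \<subseteq> \<Gamma>" using microsupport_Z_state assms(4) by blast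
next
 fix x assume "x \<in> \<Gamma>"
 then show "norm (\<Theta> x) = 1" using norm_Theta[OF fl \<Theta>0] assms(3) by blast
next
 fix x0 assume "x0 \<in> \<Gamma>"
 then show "lag_at U (Z_state \<Psi> g) \<Gamma> \<Theta> \<sigma> N x0" by (rule assms(6))
qed

lemma amp1_holomorphic: "amp1 g i holomorphic_on {z. sin (2 * of_real pi*z) \<noteq> 0}" proof -
 define S where "S = {z. sin (2 * of_real pi*z) \<noteq> (0 :: complex)}"
 have opS: "open S" unfolding S_def by (intro open_Collect_neq continuous_intros)
 define w where "w = (\<lambda>z::complex. sin (2 * of_real pi*z) powi (1 - 2*int g))"
 have "w holomorphic_on S" unfolding w_def by (intro holomorphic_intros) (simp add: S_def)
 then have A: "(deriv ^^ (2*i)) w holomorphic_on S" by (rule holomorphic_higher_deriv[OF _ opS])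
 have B: "uminus holomorphic_on S" by (intro holomorphic_intros)
 have "((deriv ^^ (2*i)) w \<circ> uminus) holomorphic_on S" by (rule holomorphic_on_compose_gen[OF B A]) (auto simp: S_def)
 then have "(\<lambda>z. (deriv ^^ (2*i)) w (- z)) holomorphic_on S" by (simp add: o_def)
 then have "(\<lambda>z. (- \<i> * of_real (sqrt 2*pi^g))*(beta (- 1/modulus) 1^i/fact i*(deriv ^^ (2*i)) w (- z))) holomorphic_on S"
  by (intro holomorphic_intros) auto
 then show ?thesis unfolding amp1_def[abs_def] w_def S_def .
qed

text \<open>A lattice translation puts the point on \<open>q = 0\<close>, where the Gaussian of
  \<open>polarized_mu\<close> equals 1, as the flat section does. The oddness of the sine power
  matches the leading amplitude with \<open>sigma1\<close>.\<close>

lemma lag_at_region_1: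
 assumes x0: "x0 \<in> A1 - A2" shows "lag_at (- A2) (Z_state \<Psi> g) (A1 - A2) \<Theta> (sigma1 g) (real g) x0" proof -
 define p0 where "p0 = fst x0"
 have p0: "2 * p0 \<notin> \<int>" using x0 by (simp add: A2_iff p0_def)
 obtain \<epsilon> where \<epsilon>: "\<epsilon> > 0" "\<forall>M\<ge>1. \<exists>C\<ge>0. \<forall>k\<ge>1. \<forall>p q. \<bar>p - p0\<bar> \<le> \<epsilon> --> \<bar>q\<bar> \<le> \<epsilon> -->
  norm (rem1 g M k p q)
   \<le> C*real k^(g + 2)/real k^M" using region_1_asymptotics[OF g p0] by (elim exE conjE) (rule that)
 have "closed ((\<lambda>p. 2*p) -` (\<int> :: real set))" by (intro closed_vimage closed_Ints continuous_intros)
 then have "open (- ((\<lambda>p. 2*p) -` (\<int> :: real set)))" by (simp add: open_closed)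
 then obtain d where d: "d > 0" "ball p0 d \<subseteq> - ((\<lambda>p. 2*p) -` \<int>)" using p0 unfolding open_contains_ball by blast
 define e where "e = min \<epsilon> (min (1/4) (d/2))"
 have e: "e > 0" "e \<le> 1/4" "e \<le> \<epsilon>" "e < d" using \<epsilon>(1) d(1) by (auto simp: e_def)
 have ni: "2*p \<notin> \<int>" if "\<bar>p - p0\<bar> \<le> e" for p proof -
  have "p \<in> ball p0 d" using that e(4) by (simp add: dist_real_def abs_minus_commute)
  then show ?thesis using d(2) by auto
 qed
 define L where "L = (\<lambda>x::plane. tpi * of_nat 1 * complex_of_real (snd x))"
 have L: "polarized 1 L" unfolding L_def by (rule polarized_mu)
 have ph: "phase0 0 L y = exp (tpi * of_real (snd y)*coord y)" for y unfolding phase0_def L_def by (simp add: alpha_def omega_def)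
 have z1: "snd y = 0" if "y \<in> square (p0, 0) e" "y \<in> A1" for y using that Ints_close_eq[of "snd y" 0] e by (simp add: square_def A1_iff)
 have "lag_at (- A2) (Z_state \<Psi> g) (A1 - A2) \<Theta> (sigma1 g) (real g) (p0, 0)"
 proof (rule lag_atI[of "- A2" "A1 - A2" e "(p0, 0)" "Z_state \<Psi> g" \<Theta> "sigma1 g" L 0 "amp1 g" "{z. sin (2 * of_real pi*z) \<noteq> 0}" "real g" "g + 2"])
  show "saturated (- A2)" by (rule saturated_Compl[OF saturated_A2])
  show "saturated (A1 - A2)" by (rule saturated_Diff[OF saturated_A1 saturated_A2])
  show "square (p0, 0) e \<subseteq> - A2" using ni by (auto simp: square_def A2_iff)
  show "is_section sc k UNIV (Z_state \<Psi> g k)" if "1 \<le> k" for k by (rule Z_state_section[OF basis that])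
  show "is_section (*) 1 (A1 - A2) \<Theta>" by (rule Theta_section) auto
  show "open {z. sin (2 * of_real pi*z) \<noteq> (0::complex)}" by (intro open_Collect_neq continuous_intros)
  show "phase0 0 L y = \<Theta> y \<and> norm (\<Theta> y) = 1 \<and> sc (amp1 g 0 (coord (y - 0))) Om = sigma1 g y"
   if y: "y \<in> square (p0, 0) e" "y \<in> A1 - A2" for y proof -
   have s0: "snd y = 0" using z1 y by blast
   then have yy: "y = (fst y, 0)" by (simp add: prod_eq_iff)
   have T: "\<Theta> y = 1" using Theta_mu[OF fl \<Theta>0, of "fst y"] yy by simp
   have "sin (2 * of_real pi * - coord y) = - complex_of_real (sin (2*pi * fst y))" unfolding coord_eq s0 by (simp flip: sin_of_real)
   then have "amp1 g 0 (coord y) = \<i> * of_real (sqrt 2*pi^g * sin (2*pi * fst y) powi (1 - 2*int g))"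
    unfolding amp1_def by (simp add: power_int_minus_left)
   then show ?thesis using T by (simp add: ph s0 sigma1_def)
  qed
  show "norm (phase0 0 L y) < 1" if y: "y \<in> square (p0, 0) e" "y \<notin> A1 - A2" for y proof -
   have "y \<notin> A2" using y(1) ni by (auto simp: square_def A2_iff)
   then have "snd y \<noteq> 0" using y(2) by (auto simp: A1_iff)
   moreover have "Re (tpi * of_real (snd y)*coord y) = - (2*pi*Im modulus*(snd y)^2)" by (simp add: coord_eq power2_eq_square)
   ultimately show ?thesis unfolding ph norm_exp_eq_Re using modulus_pos by simp
  qed
  show "(\<lambda>y. coord (y - 0)) ` cbox (fst (p0, 0) - e, snd (p0, 0::real) - e) (fst (p0, 0::real) + e, snd (p0, 0) + e) \<subseteq> {z. sin (2 * of_real pi*z) \<noteq> 0}"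
  proof
   fix z assume "z \<in> (\<lambda>y. coord (y - 0)) ` cbox (fst (p0, 0) - e, snd (p0, 0::real) - e) (fst (p0, 0::real) + e, snd (p0, 0) + e)"
   then obtain p q where z: "z = coord (p, q)" "\<bar>p - p0\<bar> \<le> e" by (auto simp: cbox_Pair_eq abs_le_iff)
   \<comment> \<open>The zeros of \<open>sin(2 pi z)\<close> are the real half-integers, and
     \<open>coord (p, q)\<close> is real only for \<open>q = 0\<close> because
     \<open>Im modulus > 0\<close>.\<close>
   show "z \<in> {z. sin (2 * of_real pi*z) \<noteq> 0}" proof (rule CollectI, rule notI)
    assume "sin (2 * of_real pi*z) = 0"
    then obtain n :: int where n: "2 * of_real pi*z = of_real (of_int n*pi)" unfolding sin_eq_0 by blast
    then have "Im (2 * of_real pi*z) = 0" "Re (2 * of_real pi*z) = of_int n*pi" by (simp_all only: Im_complex_of_real Re_complex_of_real)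
    then have "q = 0" "2*p = of_int n" using modulus_pos by (auto simp: z(1) coord_eq)
    then show False using ni[OF z(2)] by simp
   qed
  qed
  show "\<exists>C\<ge>0. \<forall>k\<ge>1. \<forall>y\<in>square (p0, 0) e.
    norm (Z_state \<Psi> g k y - ((kp k) powr (1/4 + real g)) *\<^sub>R sc (phase0 0 L y^k) (sc (\<Sum>i<M. amp1 g i (coord (y - 0))/of_nat k^i) Om)) \<le> C*real k^(g + 2)/real k^M"
   if M: "1 \<le> M" for M proof -
   from \<epsilon>(2)[rule_format, OF M] obtain C1 where C1: "C1 \<ge> 0" "\<forall>k\<ge>1. \<forall>p q. \<bar>p - p0\<bar> \<le> \<epsilon> --> \<bar>q\<bar> \<le> \<epsilon> -->
    norm (rem1 g M k p q)
    \<le> C1*real k^(g + 2)/real k^M" by (elim exE conjE) (rule that)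
   show ?thesis unfolding ph proof (rule Z_state_approx[OF C1(1)], intro allI impI ballI)
    fix k :: nat and y assume k: "1 \<le> k" and y: "y \<in> square (p0, 0) e"
    have "\<bar>fst y - p0\<bar> \<le> \<epsilon>" "\<bar>snd y\<bar> \<le> \<epsilon>" using y e(3) by (auto simp: square_def)
    from C1(2)[rule_format, OF k this]
    show "norm (Z0 g k y - of_real ((kp k) powr (1/4 + real g))*(exp (tpi * of_real (snd y)*coord y)^k*(\<Sum>i<M. amp1 g i (coord (y - 0))/of_nat k^i)))
     \<le> C1*real k^(g + 2)/real k^M" by simp
   qed
  qed
 qed (use e L amp1_holomorphic sigma1_section in auto)
 from lag_at_translate[OF this, of "(0, snd x0)"] show ?thesis using x0 by (simp add: p0_def lattice_def A1_iff)
qed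

context
 fixes P :: "nat => real poly"
 assumes P: "\<And>k l. k \<ge> 1 ==> odd l \<and> 1 \<le> l \<and> l \<le> k - 1 ==>
    N_coeff g k l = (kp k)^(3 * g - 2)*(\<Sum>m<g. poly (P m) (real l/real k)/real k^(2*m))"
begin

lemma amp2_holomorphic: "amp2 g P i holomorphic_on UNIV" proof -
 have "(\<lambda>z. (deriv ^^ n) (\<lambda>z. cpoly (P m) (2*z)) (- z/modulus)) holomorphic_on UNIV" for m n proof -
  have A: "(deriv ^^ n) (\<lambda>z. cpoly (P m) (2*z)) holomorphic_on UNIV" by (rule holomorphic_higher_deriv[OF holomorphic_cpoly open_UNIV])
  have B: "(\<lambda>z. - z/modulus) holomorphic_on UNIV" by (intro holomorphic_intros modulus_neq_0)
  have "((deriv ^^ n) (\<lambda>z. cpoly (P m) (2*z)) \<circ> (\<lambda>z. - z/modulus)) holomorphic_on UNIV"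
   by (rule holomorphic_on_compose_gen[OF B A]) auto
  then show ?thesis by (simp add: o_def)
 qed
 then have "(\<lambda>z. of_real (sqrt (pi/2))/csqrt (- \<i>*modulus)*(\<Sum>m | m < g \<and> 2*m \<le> i.
   beta modulus 1^(i - 2*m)/fact (i - 2*m)*(deriv ^^ (2*(i - 2*m))) (\<lambda>z. cpoly (P m) (2*z)) (- z/modulus))) holomorphic_on UNIV"
  by (intro holomorphic_on_mult holomorphic_on_const holomorphic_on_sum)
 then show ?thesis unfolding amp2_def[abs_def] .
qed

text \<open>The component through \<open>mu/2\<close> is reduced to the one through the origin by
  \<open>Z0_half_shift\<close>. It changes the sign \<open>\<eta>\<close> of the amplitudes and adds
  the phase \<open>exp(2 pi i s q)\<close>, which is the flat section on that component.\<close>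

lemma lag_at_region_2_base:
 assumes s: "s = 0 \<or> s = (1/2 :: real)" and q0: "- 1 < q0" "q0 < 0"
 shows "lag_at (- A1) (Z_state \<Psi> g) (A2 - A1) \<Theta> (sigma2 (P 0)) (3*real g - 3/2) (s, q0)" proof -
 define \<eta> where "\<eta> = (if s = 0 then 1 else - 1 :: complex)"
 have m0: "modulus \<noteq> 0" by (rule modulus_neq_0)
 have R2: "\<exists>\<epsilon>>0. \<forall>M\<ge>1. \<exists>C\<ge>0. \<forall>k\<ge>1. \<forall>p q. \<bar>p\<bar> \<le> \<epsilon> --> \<bar>q - q0\<bar> \<le> \<epsilon> -->
  norm (rem2 g P M k p q)
   \<le> C*real k^(3 * g)/real k^M" by (rule region_2_asymptotics[OF g _ q0]) (rule P)
 obtain \<epsilon> where \<epsilon>: "\<epsilon> > 0" "\<forall>M\<ge>1. \<exists>C\<ge>0. \<forall>k\<ge>1. \<forall>p q. \<bar>p\<bar> \<le> \<epsilon> --> \<bar>q - q0\<bar> \<le> \<epsilon> -->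
  norm (rem2 g P M k p q)
   \<le> C*real k^(3 * g)/real k^M" using R2 by (elim exE conjE) (rule that)
 define e where "e = min \<epsilon> (min (1/4) (min (- q0) (1 + q0)))"
 have e: "e > 0" "e \<le> 1/4" "e \<le> \<epsilon>" "e \<le> - q0" "e \<le> 1 + q0" unfolding e_def using \<epsilon>(1) q0 by linarith+
 define L where "L = (\<lambda>x::plane. - (tpi * of_nat 1/modulus) * complex_of_real (fst x))"
 have L: "polarized 1 L" unfolding L_def by (rule polarized_lam)
 define n0 where "n0 = (s, 0::real)"
 define E where "E = (\<lambda>y. exp (- (tpi/modulus) * of_real (fst y)*coord y))"
 have ph: "phase0 n0 L (n0 + y) = exp (\<i> * of_real (2*pi * s * snd y))*E y" for y
  unfolding phase0_def L_def E_def exp_add[symmetric] by (simp add: alpha_def omega_def n0_def mult.assoc)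
 have s2: "2 * s \<in> \<int>" using s proof
  assume a: "s = 1/2"
  show ?thesis unfolding a by simp
 qed simp
 have sZ: "s \<in> \<int> \<longleftrightarrow> s = 0" using s proof
  assume a: "s = 1/2"
  show ?thesis unfolding a using half_not_Ints by simp
 qed simp
 have sT: "cis (2*pi * s*q) = \<Theta> (s, q)" for q using s proof
  assume a: "s = 1/2"
  show ?thesis unfolding a Theta_half[OF fl \<Theta>0] by simp
 qed (simp add: Theta_lam[OF fl \<Theta>0])
 have sq: "\<bar>fst y - s\<bar> < e" "\<bar>snd y - q0\<bar> < e" "- 1 < snd y" "snd y < 0" if "y \<in> square (s, q0) e" for y
  using that e by (auto simp: square_def)
 have nA1: "y \<notin> A1" if y: "y \<in> square (s, q0) e" for y proof
  assume "y \<in> A1"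
  then obtain n :: int where "snd y = of_int n" unfolding A1_iff by (elim Ints_cases)
  then show False using sq(3,4)[OF y] by simp
 qed
 have fs: "fst y = s" if y: "y \<in> square (s, q0) e" "y \<in> A2" for y proof -
  have "2 * s \<in> \<int>" by (rule s2)
  moreover have "\<bar>2 * fst y - 2 * s\<bar> < 1" using sq(1)[OF y(1)] e(2) by linarith
  ultimately show ?thesis using Ints_close_eq[of "2 * fst y" "2 * s"] y(2) by (simp add: A2_iff)
 qed
 show ?thesis
 proof (rule lag_atI[of "- A1" "A2 - A1" e "(s, q0)" "Z_state \<Psi> g" \<Theta> "sigma2 (P 0)" L n0 "\<lambda>i z. \<eta> * amp2 g P i z" UNIV "3*real g - 3/2" "3 * g"])
  show "saturated (- A1)" by (rule saturated_Compl[OF saturated_A1])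
  show "saturated (A2 - A1)" by (rule saturated_Diff[OF saturated_A2 saturated_A1])
  show "square (s, q0) e \<subseteq> - A1" using nA1 by blast
  show "is_section sc k UNIV (Z_state \<Psi> g k)" if "1 \<le> k" for k by (rule Z_state_section[OF basis that])
  show "is_section (*) 1 (A2 - A1) \<Theta>" by (rule Theta_section) auto
  show "(\<lambda>z. \<eta> * amp2 g P i z) holomorphic_on UNIV" for i by (intro holomorphic_on_mult holomorphic_on_const amp2_holomorphic)
  show "phase0 n0 L y = \<Theta> y \<and> norm (\<Theta> y) = 1 \<and> sc (\<eta> * amp2 g P 0 (coord (y - n0))) Om = sigma2 (P 0) y"
   if y: "y \<in> square (s, q0) e" "y \<in> A2 - A1" for y proof -
   define q where "q = snd y"
   have yy: "y = (s, q)" using fs y by (simp add: q_def prod_eq_iff)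
   have yn: "y = n0 + (0, q)" by (simp add: yy n0_def)
   have "phase0 n0 L y = cis (2*pi * s*q)" unfolding yn ph by (simp add: E_def cis_conv_exp)
   also have "... = \<Theta> y" unfolding yy by (rule sT)
   finally have 1: "phase0 n0 L y = \<Theta> y" .
   have 2: "norm (\<Theta> y) = 1" by (rule norm_Theta[OF fl \<Theta>0]) (use y in auto)
   have q: "- 1 < q" "q < 0" using sq[OF y(1)] by (auto simp: q_def)
   have "\<lfloor>q\<rfloor> = - 1" using q by (simp add: floor_eq_iff)
   \<comment> \<open>On \<open>-1 < q < 0\<close> the fractional part is \<open>q + 1\<close>, so
     \<open>2 * frac q\<close> is the reflection of \<open>-2q\<close> about 1.\<close>
   then have "2 * frac q = 2 - (- 2*q)" by (simp add: frac_def)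
   then have anti: "poly (P 0) (2 * frac q) = - poly (P 0) (- 2*q)" proof -
    have "0 < g" using g by simp
    then have "poly (P 0) (2 - (- 2*q)) = - poly (P 0) (- 2*q)" by (rule leading_polynomials_antisymmetric[OF g, rotated]) (rule P)
    with \<open>2 * frac q = 2 - (- 2*q)\<close> show ?thesis by (simp only:)
   qed
   have A: "2*(- coord (y - n0)/modulus) = of_real (- 2*q)" using m0 by (simp add: yn coord_eq)
   have S: "{m. m < g \<and> 2*m \<le> 0} = {0}" using g by auto
   have "amp2 g P 0 z = of_real (sqrt (pi/2))/csqrt (- \<i>*modulus)*cpoly (P 0) (2*(- z/modulus))" for z unfolding amp2_def S by simp
   then have am: "amp2 g P 0 (coord (y - n0)) = of_real (sqrt (pi/2))/csqrt (- \<i>*modulus) * of_real (poly (P 0) (- 2*q))"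
    by (simp only: A cpoly_of_real)
   have 3: "sc (\<eta> * amp2 g P 0 (coord (y - n0))) Om = sigma2 (P 0) y"
    unfolding am unfolding sigma2_def \<eta>_def yy fst_conv snd_conv anti using sZ by simp
   show ?thesis using 1 2 3 by blast
  qed
  show "norm (phase0 n0 L y) < 1" if y: "y \<in> square (s, q0) e" "y \<notin> A2 - A1" for y proof -
   define p q where "p = fst y - s" and "q = snd y"
   have yn: "y = n0 + (p, q)" by (simp add: p_def q_def n0_def prod_eq_iff)
   have "y \<notin> A2" using y nA1 by blast
   then have p0: "p \<noteq> 0" using s2 unfolding A2_iff p_def by auto
   have "- (tpi/modulus) * of_real p*coord (p, q) = of_real (2*pi*p^2)*(- \<i>/modulus) + of_real (- 2*pi*p*q)*\<i>"
    unfolding coord_eq using m0 by (simp add: field_simps power2_eq_square)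
   then have "Re (- (tpi/modulus) * of_real p*coord (p, q)) = - (2*pi*p^2*(Im modulus/((Re modulus)^2 + (Im modulus)^2)))" by (simp add: Re_divide)
   moreover have "2*pi*p^2*(Im modulus/((Re modulus)^2 + (Im modulus)^2)) > 0"
    using p0 modulus_pos by (intro mult_pos_pos divide_pos_pos add_nonneg_pos) auto
   ultimately have "norm (E (p, q)) < 1" unfolding E_def fst_conv norm_exp_eq_Re by simp
   then show ?thesis unfolding yn ph norm_mult norm_exp_i_times by simp
  qed
  show "\<exists>C\<ge>0. \<forall>k\<ge>1. \<forall>y\<in>square (s, q0) e.
    norm (Z_state \<Psi> g k y - ((kp k) powr (1/4 + (3*real g - 3/2))) *\<^sub>R sc (phase0 n0 L y^k) (sc (\<Sum>i<M. \<eta> * amp2 g P i (coord (y - n0))/of_nat k^i) Om)) \<le> C*real k^(3 * g)/real k^M"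
   if M: "1 \<le> M" for M proof -
   from \<epsilon>(2)[rule_format, OF M] obtain C1 where C1: "C1 \<ge> 0" "\<forall>k\<ge>1. \<forall>p q. \<bar>p\<bar> \<le> \<epsilon> --> \<bar>q - q0\<bar> \<le> \<epsilon> -->
    norm (rem2 g P M k p q)
    \<le> C1*real k^(3 * g)/real k^M" by (elim exE conjE) (rule that)
   show ?thesis proof (rule Z_state_approx[OF C1(1)], intro allI impI ballI)
    fix k :: nat and y assume k: "1 \<le> k" and y: "y \<in> square (s, q0) e"
    define p q where "p = fst y - s" and "q = snd y"
    have yn: "y = n0 + (p, q)" by (simp add: p_def q_def n0_def prod_eq_iff)
    define R where "R = complex_of_real ((kp k) powr (1/4 + (3*real g - 3/2)))"
    define Sg where "Sg = (\<Sum>i<M. amp2 g P i (coord (p, q))/of_nat k^i)"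
    define X where "X = exp (\<i> * of_real (2*pi * s*q))^k"
    have nX: "norm X = 1" unfolding X_def norm_power norm_exp_i_times by simp
    have n\<eta>: "norm \<eta> = 1" by (simp add: \<eta>_def)
    have Z: "Z0 g k y = \<eta>*X * Z0 g k (p, q)" proof (cases "s = 0")
     case True
     then show ?thesis unfolding yn by (simp add: n0_def \<eta>_def X_def)
    next
     case False
     then have s: "s = 1/2" using s by simp
     have "X = exp (\<i> * of_real pi * of_nat k * of_real q)" unfolding X_def s exp_of_nat_mult[symmetric] by (rule arg_cong[where f=exp]) simp
     then show ?thesis using Z0_half_shift[OF k, of g p q] False unfolding yn by (simp add: n0_def \<eta>_def s add.commute)
    qed
    have "(\<Sum>i<M. \<eta> * amp2 g P i (coord (y - n0))/of_nat k^i) = \<eta> * Sg" unfolding Sg_def sum_distrib_left yn by simp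
    moreover have "phase0 n0 L y^k = X*E (p, q)^k" unfolding yn ph X_def snd_conv power_mult_distrib ..
    ultimately have "Z0 g k y - R*(phase0 n0 L y^k*(\<Sum>i<M. \<eta> * amp2 g P i (coord (y - n0))/of_nat k^i))
     = \<eta>*X*(Z0 g k (p, q) - R*(E (p, q)^k * Sg))" unfolding Z by (simp add: algebra_simps)
    then have "norm (Z0 g k y - R*(phase0 n0 L y^k*(\<Sum>i<M. \<eta> * amp2 g P i (coord (y - n0))/of_nat k^i))) = norm (Z0 g k (p, q) - R*(E (p, q)^k * Sg))"
     by (simp add: norm_mult nX n\<eta>)
    moreover have "\<bar>p\<bar> \<le> \<epsilon>" "\<bar>q - q0\<bar> \<le> \<epsilon>" using sq(1,2)[OF y] e(3) by (auto simp: p_def q_def)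
    ultimately show "norm (Z0 g k y - of_real ((kp k) powr (1/4 + (3*real g - 3/2)))*(phase0 n0 L y^k*(\<Sum>i<M. \<eta> * amp2 g P i (coord (y - n0))/of_nat k^i)))
     \<le> C1*real k^(3 * g)/real k^M" using C1(2)[rule_format, OF k] unfolding R_def Sg_def E_def fst_conv by simp
   qed
  qed
 qed (use e L sigma2_section in auto)
qed

lemma lag_at_region_2:
 assumes x0: "x0 \<in> A2 - A1" shows "lag_at (- A1) (Z_state \<Psi> g) (A2 - A1) \<Theta> (sigma2 (P 0)) (3*real g - 3/2) x0" proof -
 have "2 * fst x0 \<in> \<int>" using x0 by (simp add: A2_iff)
 then obtain n :: int where n: "2 * fst x0 = of_int n" by (elim Ints_cases)
 define m where "m = n div 2"
 define s where "s = fst x0 - of_int m"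
 have "n = 2*m \<or> n = 2*m + 1" unfolding m_def by presburger
 then have s: "s = 0 \<or> s = 1/2" using n by (auto simp: s_def)
 define q0 where "q0 = snd x0 - of_int (\<lfloor>snd x0\<rfloor> + 1)"
 have "snd x0 \<noteq> of_int \<lfloor>snd x0\<rfloor>" using x0 by (metis A1_iff DiffD2 Ints_of_int)
 then have q0: "- 1 < q0" "q0 < 0" unfolding q0_def by linarith+
 have "(of_int m, of_int (\<lfloor>snd x0\<rfloor> + 1)) \<in> lattice" by (simp add: lattice_def)
 from lag_at_translate[OF lag_at_region_2_base[OF s q0] this]
 show ?thesis by (simp add: s_def q0_def)
qed

end

end

end

end

theorem theorem4p1:
  fixes g :: nat
    and j :: "plane \<Rightarrow> plane"
    and sc :: "complex \<Rightarrow> 'd::real_normed_vector \<Rightarrow> 'd"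
    and \<phi> :: "'d \<Rightarrow> 'd \<Rightarrow> plane \<Rightarrow> complex"
    and herm :: "'d \<Rightarrow> 'd \<Rightarrow> complex"
    and Om_mu dp_half dq_half :: 'd
    and \<Psi> :: "nat \<Rightarrow> int \<Rightarrow> plane \<Rightarrow> 'd"
    and P0 :: "real poly"
    and \<Theta>A :: "plane \<Rightarrow> complex"
  assumes "g \<ge> 1"
    and "compatible_complex_structure j"
    and "half_form_line j sc \<phi> herm"
    and "\<phi> Om_mu Om_mu mu = 1"
    and "\<And>k. k \<ge> 1 \<Longrightarrow> quantum_basis j sc herm Om_mu k (\<Psi> k)"
    and "is_leading_polynomial g P0"
    and "flat_section (A1 \<union> A2) \<Theta>A" and "\<Theta>A 0 = 1"
    and "sqrt_coordinate_form \<phi> mu dp_half"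
    and "sqrt_coordinate_form \<phi> lam dq_half"
  shows "(\<exists>\<sigma>1. lagrangian_state j sc herm (- A2) (Z_state \<Psi> g) (A1 - A2) \<Theta>A \<sigma>1 (real g) \<and>
            (\<exists>\<epsilon>\<in>{1, -1}. \<forall>p. p *\<^sub>R mu \<in> A1 - A2 \<longrightarrow>
               \<sigma>1 (p *\<^sub>R mu) =
                 sc (\<epsilon> * \<i> * of_real (sqrt 2 * pi ^ g * sin (2 * pi * p) powi (1 - 2 * int g))) dp_half))
       \<and> (\<exists>\<sigma>2. lagrangian_state j sc herm (- A1) (Z_state \<Psi> g) (A2 - A1) \<Theta>A \<sigma>2 (3 * real g - 3 / 2) \<and>
            (\<exists>\<epsilon>\<in>{1, -1}. \<forall>q\<in>{0<..<1}.
               \<sigma>2 (q *\<^sub>R lam) =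
                 sc (\<epsilon> * cis (pi / 4) * of_real (sqrt (pi / 2) * poly P0 (2 * q))) dq_half) \<and>
            (\<forall>q\<in>{0<..<1}. \<sigma>2 (q *\<^sub>R lam + (1 / 2) *\<^sub>R mu) = - \<sigma>2 (q *\<^sub>R lam)))"
proof -
 interpret half_form_setup j sc \<phi> herm Om_mu by unfold_locales (rule assms(2), rule assms(3), rule assms(4))
 obtain P where P0: "P 0 = P0" and P: "\<forall>k\<ge>1. \<forall>l. odd l \<and> 1 \<le> l \<and> l \<le> k - 1 -->
   N_coeff g k l = (kp k)^(3 * g - 2)*(\<Sum>m<g. poly (P m) (real l/real k)/real k^(2*m))"
  using assms(6) unfolding is_leading_polynomial_def by blast
 have lag1: "lagrangian_state j sc herm (- A2) (Z_state \<Psi> g) (A1 - A2) \<Theta>A (sigma1 g) (real g)" proof (rule lagrangian_stateI)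
  show "is_section sc 0 (A1 - A2) (sigma1 g)" by (rule sigma1_section)
  show "lag_at (- A2) (Z_state \<Psi> g) (A1 - A2) \<Theta>A (sigma1 g) (real g) x0" if "x0 \<in> A1 - A2" for x0
   by (rule lag_at_region_1[OF _ assms(1,7,8) that]) (rule assms(5))
 qed (use assms(1,5,7,8) open_M_A2 submanifold_A1 in auto)
 have lag2: "lagrangian_state j sc herm (- A1) (Z_state \<Psi> g) (A2 - A1) \<Theta>A (sigma2 P0) (3*real g - 3/2)" proof (rule lagrangian_stateI)
  show "is_section sc 0 (A2 - A1) (sigma2 P0)" unfolding P0[symmetric] by (rule sigma2_section)
  show "lag_at (- A1) (Z_state \<Psi> g) (A2 - A1) \<Theta>A (sigma2 P0) (3*real g - 3/2) x0" if "x0 \<in> A2 - A1" for x0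
   unfolding P0[symmetric] by (rule lag_at_region_2[OF _ assms(1,7,8) _ that]) (rule assms(5), assumption, rule P[rule_format])
 qed (use assms(1,5,7,8) open_M_A1 submanifold_A2 in auto)
 \<comment> \<open>On the line spanned by \<open>Om_mu\<close> every square is a multiple of
   \<open>coord\<close>. The given half-forms are therefore multiples of \<open>Om_mu\<close> with
   coefficients \<open>s\<close> and \<open>t\<close> such that \<open>s^2 = 1\<close> and
   \<open>t^2 = 1/modulus\<close>.\<close>
 have square: "\<phi> w w x = (\<phi> Om_mu w mu)^2*coord x" for w x proof -
  have "\<phi> w w x = \<phi> (sc (\<phi> Om_mu w mu) Om_mu) (sc (\<phi> Om_mu w mu) Om_mu) x" using eq_sc_Om[of w] by simp
  then show ?thesis unfolding phi_scale_left phi_scale_right coord_def by (simp add: power2_eq_square)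
 qed
 define s where "s = \<phi> Om_mu dp_half mu"
 define t where "t = \<phi> Om_mu dq_half mu"
 have dp: "dp_half = sc s Om_mu" and dq: "dq_half = sc t Om_mu" unfolding s_def t_def by (rule eq_sc_Om)+
 have "coord mu = 1" unfolding coord_def by (rule Om_mu)
 then have s2: "s * s = 1"
  using assms(9)[unfolded sqrt_coordinate_form_def, THEN spec, of 1] square[of dp_half mu] by (simp add: s_def power2_eq_square)
 then have s1: "s \<in> {1, - 1}" using square_eq_1_iff by blast
 have t2: "t^2*modulus = 1"
  using assms(10)[unfolded sqrt_coordinate_form_def, THEN spec, of 1] square[of dq_half lam] by (simp add: t_def modulus_def)
 have sig1: "sigma1 g (p *\<^sub>R mu) = sc (s*\<i> * of_real (sqrt 2*pi^g * sin (2*pi*p) powi (1 - 2*int g))) dp_half" for p proof -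
  have e: "s*\<i>*X * s = \<i>*X" for X proof -
   have "s*\<i>*X * s = (s * s)*(\<i>*X)" by (simp only: mult_ac)
   then show ?thesis by (simp only: s2 mult_1)
  qed
  show ?thesis unfolding sigma1_def dp sc_sc e by (simp add: mu_def)
 qed
 \<comment> \<open>Since \<open>cis (pi/4)\<close> squares to \<open>\<i>\<close>, both
   \<open>cis (pi/4) * t\<close> and \<open>r\<close> are square roots of
   \<open>\<i>/modulus\<close>, hence equal up to sign. That sign, combined with the minus sign of
   \<open>sigma2\<close>, is the \<open>\<epsilon>\<close> obtained below.\<close>
 define r where "r = 1/csqrt (- \<i>*modulus)"
 have "(cis (pi/4)*t)^2 = r^2" proof -
  have "(cis (pi/4))^2 = \<i>" unfolding Complex.DeMoivre by simp
  moreover have "t^2 = 1/modulus" using t2 modulus_neq_0 by (simp add: field_simps)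
  moreover have "r^2 = \<i>/modulus" unfolding r_def power_divide power2_csqrt using modulus_neq_0 by (simp add: field_simps)
  ultimately show ?thesis by (simp add: power_mult_distrib)
 qed
 then have "cis (pi/4)*t = r \<or> cis (pi/4)*t = - r" by (simp add: power2_eq_iff)
 then obtain \<epsilon> where \<epsilon>: "\<epsilon> \<in> {1, - 1}" "\<epsilon>*(cis (pi/4)*t) = - r" proof
  assume "cis (pi/4)*t = r"
  then show thesis using that[of "- 1"] by simp
 next
  assume "cis (pi/4)*t = - r"
  then show thesis using that[of 1] by simp
 qed
 have sig2: "sigma2 P0 (q *\<^sub>R lam) = sc (\<epsilon>*cis (pi/4) * of_real (sqrt (pi/2)*poly P0 (2*q))) dq_half" if "q \<in> {0<..<1}" for q
 proof -
  have "\<epsilon>*cis (pi/4)*X*t = - r*X" for X unfolding \<epsilon>(2)[symmetric] by (simp only: mult_ac)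
  then have "sc (\<epsilon>*cis (pi/4) * of_real (sqrt (pi/2)*poly P0 (2*q))) dq_half = sc (- r * of_real (sqrt (pi/2)*poly P0 (2*q))) Om_mu"
   unfolding dq sc_sc by simp
  moreover have "frac q = q" using that by (simp add: frac_eq)
  ultimately show ?thesis unfolding sigma2_def r_def by (simp add: lam_def)
 qed
 have shift: "sigma2 P0 (q *\<^sub>R lam + (1/2) *\<^sub>R mu) = - sigma2 P0 (q *\<^sub>R lam)" for q proof -
  have "fst (q *\<^sub>R lam + (1/2) *\<^sub>R mu) \<notin> \<int>" using half_not_Ints by (simp add: lam_def mu_def)
  moreover have "fst (q *\<^sub>R lam) \<in> \<int>" by (simp add: lam_def)
  moreover have "snd (q *\<^sub>R lam + (1/2) *\<^sub>R mu) = snd (q *\<^sub>R lam)" by (simp add: mu_def)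
  ultimately show ?thesis unfolding sigma2_def sc_minus_1[symmetric] sc_sc by simp
 qed
 show ?thesis proof (intro conjI)
  show "\<exists>\<sigma>1. lagrangian_state j sc herm (- A2) (Z_state \<Psi> g) (A1 - A2) \<Theta>A \<sigma>1 (real g) \<and>
      (\<exists>\<epsilon>\<in>{1, -1}. \<forall>p. p *\<^sub>R mu \<in> A1 - A2 -->
        \<sigma>1 (p *\<^sub>R mu) =
         sc (\<epsilon>*\<i> * of_real (sqrt 2*pi^g * sin (2*pi*p) powi (1 - 2*int g))) dp_half)"
   by (rule exI[of _ "sigma1 g"], rule conjI, rule lag1, rule bexI[OF _ s1]) (use sig1 in blast)
  show "\<exists>\<sigma>2. lagrangian_state j sc herm (- A1) (Z_state \<Psi> g) (A2 - A1) \<Theta>A \<sigma>2 (3*real g - 3/2) \<and>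
      (\<exists>\<epsilon>\<in>{1, -1}. \<forall>q\<in>{0<..<1}.
        \<sigma>2 (q *\<^sub>R lam) =
         sc (\<epsilon>*cis (pi/4) * of_real (sqrt (pi/2)*poly P0 (2*q))) dq_half) \<and>
      (\<forall>q\<in>{0<..<1}. \<sigma>2 (q *\<^sub>R lam + (1/2) *\<^sub>R mu) = - \<sigma>2 (q *\<^sub>R lam))"
  proof (rule exI[of _ "sigma2 P0"], intro conjI lag2)
   show "\<exists>\<epsilon>\<in>{1, -1}. \<forall>q\<in>{0<..<1}. sigma2 P0 (q *\<^sub>R lam) = sc (\<epsilon>*cis (pi/4) * of_real (sqrt (pi/2)*poly P0 (2*q))) dq_half"
    by (rule bexI[OF _ \<epsilon>(1)]) (use sig2 in blast)
   show "\<forall>q\<in>{0<..<1}. sigma2 P0 (q *\<^sub>R lam + (1/2) *\<^sub>R mu) = - sigma2 P0 (q *\<^sub>R lam)" using shift by blast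
  qed
 qed
qed

end
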